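(* Let $X$ be a nilmanifold of real dimension $6$ endowed with a left-invariant complex structure, and assume $X$ is not a complex torus. Then $X$ always admits a plurisigned hermitian metric. More precisely: - either $X$ belongs to one of the families (Np), (Nii), (Niii), and then any left-invariant hermitian metric on $X$ is pluripositive but not pluriclosed; - or $X$ belongs to (Ni) and, depending on the complex structure, every left-invariant hermitian metric on $X$ is pluriclosed, or every left-invariant hermitian metric on $X$ is pluripositive but not pluriclosed, or else every left-invariant hermitian metric on $X$ is plurinegative but not pluriclosed.
   Context: A nilmanifold is a compact quotient $\Gamma\backslash G$ of a connected simply connected nilpotent (real) Lie group $G$ by a discrete co-compact subgroup $\Gamma$. A left-invariant complex structure (resp. form, hermitian metric) on $\Gamma\backslash G$ is one induced by a complex structure (resp. form, hermitian metric) on $G$ invariant under left translations. A hermitian metric is a smooth positive definite real $(1,1)$-form $\omega$; $dd^c=\sqrt{-1}\,\partial\overline{\partial}$. It is pluripositive if $dd^c\omega\geq0$, plurinegative if $dd^c\omega\leq 0$, pluriclosed if $dd^c\omega=0$, and plurisigned if it is pluripositive or plurinegative. (In complex dimension $3$, a real $(2,2)$-form $\Theta$ is $\geq0$ if $\Theta\wedge\sqrt{-1}\eta\wedge\overline{\eta}\geq0$ for every $(1,0)$-form $\eta$.) Families: $X$ belongs to a family below if it has a coframe of left-invariant $(1,0)$-forms $(\varphi^1,\varphi^2,\varphi^3)$ satisfying the given structure equations, where $\varphi^{12}:=\varphi^1\wedge\varphi^2$, $\varphi^{1\bar2}:=\varphi^1\wedge\overline{\varphi}^2$, etc. (By known classification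 results, every left-invariant complex structure on a six-dimensional nilmanifold is in one of these families.) (Np): $d\varphi^1=d\varphi^2=0$, $d\varphi^3=\rho\,\varphi^{12}$, with $\rho\in\{0,1\}$ ($\rho=0$ corresponds to the complex torus). (Ni): $d\varphi^1=d\varphi^2=0$, $d\varphi^3=\rho\,\varphi^{12}+\varphi^{1\bar1}+\lambda\,\varphi^{1\bar2}+D\,\varphi^{2\bar2}$, with $\rho\in\{0,1\}$, $\lambda\in\mathbb{R}$, $\lambda\geq0$, $D\in\mathbb{C}$ with $\mathrm{Im}\,D\geq0$. (Nii): $d\varphi^1=0$, $d\varphi^2=\varphi^{1\bar1}$, $d\varphi^3=\rho\,\varphi^{12}+B\,\varphi^{1\bar2}+c\,\varphi^{2\bar1}$, with $\rho\in\{0,1\}$, $B\in\mathbb{C}$, $c\in\mathbb{R}$, $c\geq0$, $(\rho,B,c)\neq(0,0,0)$. (Niii): $d\varphi^1=0$, $d\varphi^2=\varphi^{13}+\varphi^{1\bar3}$, $d\varphi^3=\sqrt{-1}\rho\,\varphi^{1\bar1}\pm\sqrt{-1}(\varphi^{1\bar2}-\varphi^{2\bar1})$, with $\rho\in\{0,1\}$. *)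

theory Defs
  imports "HOL-Analysis.Analysis" "HOL-Combinatorics.Permutations"
begin

section \<open>Smooth and holomorphic maps\<close>

primrec higher_diff_on ::
  "nat \<Rightarrow> 'a::real_normed_vector set \<Rightarrow> ('a \<Rightarrow> 'b::real_normed_vector) \<Rightarrow> bool" where
  "higher_diff_on 0 S f \<longleftrightarrow> continuous_on S f"
| "higher_diff_on (Suc n) S f \<longleftrightarrow>
     (\<forall>x\<in>S. f differentiable (at x)) \<and>
     (\<forall>v. higher_diff_on n S (\<lambda>x. frechet_derivative f (at x) v))"

text \<open>Only used on open subsets of finite-dimensional spaces, where it means \<open>C\<^sup>\<infinity>\<close>.\<close>

definition smooth_on :: "'a::real_normed_vector set \<Rightarrow> ('a \<Rightarrow> 'b::real_normed_vector) \<Rightarrow> bool" where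
  "smooth_on S f \<longleftrightarrow> (\<forall>n. higher_diff_on n S f)"

definition holo_on :: "(complex^3) set \<Rightarrow> (complex^3 \<Rightarrow> complex^3) \<Rightarrow> bool" where
  "holo_on S f \<longleftrightarrow>
     (\<forall>x\<in>S. \<exists>D. (f has_derivative D) (at x) \<and> (\<forall>v. D (\<i> *s v) = \<i> *s D v))"


section \<open>Complex manifolds of complex dimension 3\<close>

text \<open>A chart is a pair of its domain and its coordinate map; the values of the coordinate map
  outside the domain are irrelevant.\<close>

type_synonym 'm chart = "'m set \<times> ('m \<Rightarrow> complex^3)"
type_synonym 'm atlas = "'m chart set"

definition loc_map :: "'m chart \<Rightarrow> 'n chart \<Rightarrow> ('m \<Rightarrow> 'n) \<Rightarrow> complex^3 \<Rightarrow> complex^3" where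
  "loc_map C D f = snd D \<circ> f \<circ> inv_into (fst C) (snd C)"

definition loc_dom :: "'m chart \<Rightarrow> 'n chart \<Rightarrow> ('m \<Rightarrow> 'n) \<Rightarrow> (complex^3) set" where
  "loc_dom C D f = snd C ` {m \<in> fst C. f m \<in> fst D}"

definition holomorphic_map :: "'m atlas \<Rightarrow> 'n atlas \<Rightarrow> ('m \<Rightarrow> 'n) \<Rightarrow> bool" where
  "holomorphic_map A B f \<longleftrightarrow> (\<forall>C\<in>A. \<forall>D\<in>B. holo_on (loc_dom C D f) (loc_map C D f))"

text \<open>Holomorphic transition maps are automatically smooth; smoothness is listed because the same
  atlas also provides the underlying real smooth structure.\<close>

definition complex_manifold :: "'m topology \<Rightarrow> 'm atlas \<Rightarrow> bool" where
  "complex_manifold T A \<longleftrightarrow>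
     Hausdorff_space T \<and> second_countable T \<and>
     \<Union>(fst ` A) = topspace T \<and>
     (\<forall>(U, c)\<in>A. openin T U \<and> open (c ` U) \<and>
        homeomorphic_map (subtopology T U) (top_of_set (c ` U)) c) \<and>
     (\<forall>C\<in>A. \<forall>D\<in>A. smooth_on (loc_dom C D id) (loc_map C D id)) \<and>
     holomorphic_map A A id"

definition biholomorphic :: "'m topology \<Rightarrow> 'm atlas \<Rightarrow> 'n topology \<Rightarrow> 'n atlas \<Rightarrow> bool" where
  "biholomorphic T A S B \<longleftrightarrow>
     (\<exists>f g. homeomorphic_maps T S f g \<and> holomorphic_map A B f \<and> holomorphic_map B A g)"


section \<open>Lie groups, discrete cocompact subgroups and their quotients\<close>

text \<open>Groups are written additively, as in the class \<^class>\<open>topological_group_add\<close>, but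
  \<^emph>\<open>not\<close> assumed commutative: left translation by \<open>a\<close> is \<open>\<lambda>x. a + x\<close>.\<close>

definition add_subgroup :: "'g::group_add set \<Rightarrow> bool" where
  "add_subgroup H \<longleftrightarrow> 0 \<in> H \<and> (\<forall>x\<in>H. \<forall>y\<in>H. x + y \<in> H) \<and> (\<forall>x\<in>H. - x \<in> H)"

definition gen_subgroup :: "'g::group_add set \<Rightarrow> 'g set" where
  "gen_subgroup S = \<Inter>{H. add_subgroup H \<and> S \<subseteq> H}"

primrec lower_central :: "nat \<Rightarrow> 'g::group_add set" where
  "lower_central 0 = UNIV"
| "lower_central (Suc n) = gen_subgroup {x + y - x - y | x y. y \<in> lower_central n}"

definition nilpotent_group :: "'g::group_add itself \<Rightarrow> bool" where
  "nilpotent_group _ \<longleftrightarrow> (\<exists>n. lower_central n = {0 :: 'g})"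

definition lie_group :: "'g::topological_group_add atlas \<Rightarrow> bool" where
  "lie_group A \<longleftrightarrow>
     (\<forall>(U, c)\<in>A. \<forall>(V, d)\<in>A. \<forall>(W, e)\<in>A.
        smooth_on {(x, y). x \<in> c ` U \<and> y \<in> d ` V \<and> inv_into U c x + inv_into V d y \<in> W}
          (\<lambda>(x, y). e (inv_into U c x + inv_into V d y))) \<and>
     (\<forall>C\<in>A. \<forall>D\<in>A. smooth_on (loc_dom C D uminus) (loc_map C D uminus))"

text \<open>A connected simply connected nilpotent real Lie group of real dimension 6 (the underlying
  smooth structure of the atlas) with a complex structure invariant under left translations.\<close>

definition nilpotent_lie_group_cs :: "'g::topological_group_add atlas \<Rightarrow> bool" where
  "nilpotent_lie_group_cs A \<longleftrightarrow>
     complex_manifold (euclidean :: 'g topology) A \<and> lie_group A \<and>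
     connected (UNIV :: 'g set) \<and> simply_connected (UNIV :: 'g set) \<and>
     nilpotent_group TYPE('g) \<and>
     (\<forall>a. holomorphic_map A A (\<lambda>x. a + x))"

definition coset :: "'g::group_add set \<Rightarrow> 'g \<Rightarrow> 'g set" where
  "coset \<Gamma> x = (\<lambda>\<gamma>. \<gamma> + x) ` \<Gamma>"

definition quot_top :: "'g::{group_add, topological_space} set \<Rightarrow> 'g set topology" where
  "quot_top \<Gamma> = topology (\<lambda>S. S \<subseteq> range (coset \<Gamma>) \<and> open (coset \<Gamma> -` S))"

lemma openin_quot_top:
  "openin (quot_top \<Gamma>) S \<longleftrightarrow> S \<subseteq> range (coset \<Gamma>) \<and> open (coset \<Gamma> -` S)"
proof -
  have "istopology (\<lambda>S. S \<subseteq> range (coset \<Gamma>) \<and> open (coset \<Gamma> -` S))"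
    unfolding istopology_def by (auto simp: vimage_Union)
  then show ?thesis
    by (simp add: quot_top_def)
qed

lemma topspace_quot_top: "topspace (quot_top \<Gamma>) = range (coset \<Gamma>)"
proof -
  have "openin (quot_top \<Gamma>) (range (coset \<Gamma>))"
    by (simp add: openin_quot_top vimage_def)
  then show ?thesis
    unfolding topspace_def using openin_quot_top by blast
qed

lemma quotient_map_coset: "quotient_map euclidean (quot_top \<Gamma>) (coset \<Gamma>)"
  by (auto simp: quotient_map_def topspace_quot_top openin_quot_top vimage_def)

text \<open>The complex structure induced on \<open>\<Gamma>\G\<close>: local inverses of the projection
  followed by restrictions of charts of \<open>G\<close>.\<close>

definition quot_atlas :: "'g::{group_add, topological_space} set \<Rightarrow> 'g atlas \<Rightarrow> 'g set atlas" where
  "quot_atlas \<Gamma> A =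
     {(coset \<Gamma> ` V, c \<circ> inv_into V (coset \<Gamma>)) | U c V.
        (U, c) \<in> A \<and> open V \<and> V \<subseteq> U \<and> inj_on (coset \<Gamma>) V}"

definition cocompact_discrete :: "'g::topological_group_add set \<Rightarrow> bool" where
  "cocompact_discrete \<Gamma> \<longleftrightarrow>
     add_subgroup \<Gamma> \<and> discrete \<Gamma> \<and> compact_space (quot_top \<Gamma>)"

definition nilmanifold_cs :: "'g::topological_group_add atlas \<Rightarrow> 'g set \<Rightarrow> bool" where
  "nilmanifold_cs A \<Gamma> \<longleftrightarrow> nilpotent_lie_group_cs A \<and> cocompact_discrete \<Gamma>"

definition complex_torus :: "'m topology \<Rightarrow> 'm atlas \<Rightarrow> bool" where
  "complex_torus T A \<longleftrightarrow>
     (\<exists>L :: (complex^3) set. cocompact_discrete L \<and>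
        biholomorphic T A (quot_top L) (quot_atlas L {(UNIV, id)}))"


section \<open>Exterior algebra of \<open>\<complex>\<^sup>3\<close> regarded as a real vector space\<close>

text \<open>A complex-valued \<open>k\<close>-form on the real vector space underlying \<open>\<complex>\<^sup>3\<close> is a function on lists
  of vectors that vanishes on lists of length other than \<open>k\<close>.\<close>

type_synonym cform = "(complex^3) list \<Rightarrow> complex"

definition alt_forms :: "nat \<Rightarrow> cform set" where
  "alt_forms k = {\<alpha>.
     (\<forall>vs. length vs \<noteq> k \<longrightarrow> \<alpha> vs = 0) \<and>
     (\<forall>vs i. length vs = k \<longrightarrow> i < k \<longrightarrow> linear (\<lambda>v. \<alpha> (vs[i := v]))) \<and>
     (\<forall>vs i j. length vs = k \<longrightarrow> i < j \<longrightarrow> j < k \<longrightarrow> vs ! i = vs ! j \<longrightarrow> \<alpha> vs = 0)}"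

text \<open>In the sum over \<open>p\<close> only the degree of \<open>\<alpha>\<close> contributes; the normalisation is the one for
  which \<open>(\<alpha> \<and> \<beta>)(v, w) = \<alpha>(v) \<beta>(w) - \<alpha>(w) \<beta>(v)\<close> for one-forms.\<close>

definition wedge :: "cform \<Rightarrow> cform \<Rightarrow> cform" where
  "wedge \<alpha> \<beta> vs = (let n = length vs in
     \<Sum>p\<le>n. \<Sum>\<sigma> | \<sigma> permutes {..<n}.
       of_int (sign \<sigma>) / (fact p * fact (n - p)) *
       \<alpha> (map (\<lambda>i. vs ! \<sigma> i) [0..<p]) * \<beta> (map (\<lambda>i. vs ! \<sigma> i) [p..<n]))"

definition cform_bar :: "cform \<Rightarrow> cform" where
  "cform_bar \<alpha> vs = cnj (\<alpha> vs)"

definition wedges :: "(complex^3 \<Rightarrow> complex) list \<Rightarrow> cform" where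
  "wedges \<theta>s vs = (let n = length \<theta>s in
     if length vs = n
     then \<Sum>\<sigma> | \<sigma> permutes {..<n}. of_int (sign \<sigma>) * (\<Prod>i<n. (\<theta>s ! i) (vs ! \<sigma> i))
     else 0)"

definition dz :: "3 \<Rightarrow> complex^3 \<Rightarrow> complex" where
  "dz i v = v $ i"

definition dzbar :: "3 \<Rightarrow> complex^3 \<Rightarrow> complex" where
  "dzbar i v = cnj (v $ i)"

text \<open>\<open>\<Lambda>\<^sup>p\<^sup>,\<^sup>q\<close>: the linear combinations of
  \<open>dz\<^bsub>i\<^sub>1\<^esub> \<and> \<dots> \<and> dz\<^bsub>i\<^sub>p\<^esub> \<and> dzbar\<^bsub>j\<^sub>1\<^esub> \<and> \<dots> \<and> dzbar\<^bsub>j\<^sub>q\<^esub>\<close>.\<close>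

definition pq_forms :: "nat \<Rightarrow> nat \<Rightarrow> cform set" where
  "pq_forms p q = {\<alpha>. \<exists>a :: 3 list \<Rightarrow> 3 list \<Rightarrow> complex.
     \<alpha> = (\<lambda>vs. \<Sum>I | length I = p. \<Sum>J | length J = q.
              a I J * wedges (map dz I @ map dzbar J) vs)}"

text \<open>The component of type \<open>(p, q)\<close> of a form of degree \<open>p + q\<close>.\<close>

definition pq_part :: "nat \<Rightarrow> nat \<Rightarrow> cform \<Rightarrow> cform" where
  "pq_part p q \<alpha> = (THE \<beta>. \<exists>\<gamma> :: nat \<Rightarrow> cform.
     (\<forall>r\<le>p+q. \<gamma> r \<in> pq_forms r (p + q - r)) \<and>
     \<alpha> = (\<lambda>vs. \<Sum>r\<le>p+q. \<gamma> r vs) \<and> \<beta> = \<gamma> p)"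

text \<open>A real form of top degree is nonnegative with respect to the complex orientation iff it is
  so on the basis \<open>e\<^sub>1, \<i>e\<^sub>1, e\<^sub>2, \<i>e\<^sub>2, e\<^sub>3, \<i>e\<^sub>3\<close>.\<close>

definition top_nonneg :: "cform \<Rightarrow> bool" where
  "top_nonneg \<tau> \<longleftrightarrow>
     \<tau> [axis 1 1, \<i> *s axis 1 1, axis 2 1, \<i> *s axis 2 1, axis 3 1, \<i> *s axis 3 1] \<in> \<real>\<^sub>\<ge>\<^sub>0"

definition nonneg_22 :: "cform \<Rightarrow> bool" where
  "nonneg_22 \<Theta> \<longleftrightarrow>
     (\<forall>\<eta>\<in>pq_forms 1 0. top_nonneg (wedge \<Theta> (wedge (\<lambda>vs. \<i> * \<eta> vs) (cform_bar \<eta>))))"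


section \<open>Differential forms on manifolds\<close>

text \<open>A differential form is given by its local expressions, one for each chart of the atlas. The
  values of the local expression in the chart \<open>(U, c)\<close> outside \<open>c ` U\<close> are irrelevant.\<close>

type_synonym 'm form = "'m chart \<Rightarrow> complex^3 \<Rightarrow> cform"

text \<open>\<open>is_pullback A B f \<beta> \<alpha>\<close> says that the form \<open>\<alpha>\<close> on the source is \<open>f\<^sup>*\<beta>\<close>. For \<open>f = id\<close> and
  \<open>\<alpha> = \<beta>\<close> this is the compatibility of the local expressions of \<open>\<alpha>\<close>.\<close>

definition is_pullback :: "'m atlas \<Rightarrow> 'n atlas \<Rightarrow> ('m \<Rightarrow> 'n) \<Rightarrow> 'n form \<Rightarrow> 'm form \<Rightarrow> bool" where
  "is_pullback A B f \<beta> \<alpha> \<longleftrightarrow>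
     (\<forall>C\<in>A. \<forall>D\<in>B. \<forall>x\<in>loc_dom C D f. \<forall>vs.
        \<alpha> C x vs = \<beta> D (loc_map C D f x) (map (frechet_derivative (loc_map C D f) (at x)) vs))"

definition diff_form :: "'m atlas \<Rightarrow> nat \<Rightarrow> 'm form \<Rightarrow> bool" where
  "diff_form A k \<alpha> \<longleftrightarrow>
     (\<forall>(U, c)\<in>A. (\<forall>x\<in>c ` U. \<alpha> (U, c) x \<in> alt_forms k) \<and>
                  (\<forall>vs. smooth_on (c ` U) (\<lambda>x. \<alpha> (U, c) x vs))) \<and>
     is_pullback A A id \<alpha> \<alpha>"

definition pq_form :: "'m atlas \<Rightarrow> nat \<Rightarrow> nat \<Rightarrow> 'm form \<Rightarrow> bool" where
  "pq_form A p q \<alpha> \<longleftrightarrow>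
     diff_form A (p + q) \<alpha> \<and> (\<forall>(U, c)\<in>A. \<forall>x\<in>c ` U. \<alpha> (U, c) x \<in> pq_forms p q)"

definition form_eq :: "'m atlas \<Rightarrow> 'm form \<Rightarrow> 'm form \<Rightarrow> bool" where
  "form_eq A \<alpha> \<beta> \<longleftrightarrow> (\<forall>(U, c)\<in>A. \<forall>x\<in>c ` U. \<alpha> (U, c) x = \<beta> (U, c) x)"

definition ext_d :: "'m form \<Rightarrow> 'm form" where
  "ext_d \<alpha> C x vs =
     (\<Sum>i<length vs. (-1) ^ i *
        frechet_derivative (\<lambda>y. \<alpha> C y (take i vs @ drop (Suc i) vs)) (at x) (vs ! i))"

text \<open>\<open>\<partial>\<close> and \<open>\<partial>bar\<close> on forms of type \<open>(p, q)\<close>.\<close>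

definition del :: "nat \<Rightarrow> nat \<Rightarrow> 'm form \<Rightarrow> 'm form" where
  "del p q \<alpha> C x = pq_part (Suc p) q (ext_d \<alpha> C x)"

definition delbar :: "nat \<Rightarrow> nat \<Rightarrow> 'm form \<Rightarrow> 'm form" where
  "delbar p q \<alpha> C x = pq_part p (Suc q) (ext_d \<alpha> C x)"

definition wedge_form :: "'m form \<Rightarrow> 'm form \<Rightarrow> 'm form" (infixl "\<and>\<^sub>f" 70) where
  "(\<alpha> \<and>\<^sub>f \<beta>) C x = wedge (\<alpha> C x) (\<beta> C x)"

definition bar_form :: "'m form \<Rightarrow> 'm form" where
  "bar_form \<alpha> C x = cform_bar (\<alpha> C x)"

definition ddc :: "'m form \<Rightarrow> 'm form" where
  "ddc \<omega> C x vs = \<i> * del 1 2 (delbar 1 1 \<omega>) C x vs"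


section \<open>Hermitian metrics\<close>

text \<open>For \<open>\<omega> = \<i> \<Sum> h\<^sub>j\<^sub>k dz\<^sub>j \<and> dzbar\<^sub>k\<close> one has \<open>\<omega>(v, \<i>v) = 2 h(v, v)\<close>.\<close>

definition hermitian_metric :: "'m atlas \<Rightarrow> 'm form \<Rightarrow> bool" where
  "hermitian_metric A \<omega> \<longleftrightarrow>
     pq_form A 1 1 \<omega> \<and>
     (\<forall>(U, c)\<in>A. \<forall>x\<in>c ` U.
        (\<forall>vs. \<omega> (U, c) x vs \<in> \<real>) \<and>
        (\<forall>v. v \<noteq> 0 \<longrightarrow> Re (\<omega> (U, c) x [v, \<i> *s v]) > 0))"

definition pluripositive :: "'m atlas \<Rightarrow> 'm form \<Rightarrow> bool" where
  "pluripositive A \<omega> \<longleftrightarrow> (\<forall>(U, c)\<in>A. \<forall>x\<in>c ` U. nonneg_22 (ddc \<omega> (U, c) x))"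

definition plurinegative :: "'m atlas \<Rightarrow> 'm form \<Rightarrow> bool" where
  "plurinegative A \<omega> \<longleftrightarrow>
     (\<forall>(U, c)\<in>A. \<forall>x\<in>c ` U. nonneg_22 (\<lambda>vs. - ddc \<omega> (U, c) x vs))"

definition pluriclosed :: "'m atlas \<Rightarrow> 'm form \<Rightarrow> bool" where
  "pluriclosed A \<omega> \<longleftrightarrow> form_eq A (ddc \<omega>) (\<lambda>C x vs. 0)"

definition plurisigned :: "'m atlas \<Rightarrow> 'm form \<Rightarrow> bool" where
  "plurisigned A \<omega> \<longleftrightarrow> pluripositive A \<omega> \<or> plurinegative A \<omega>"


section \<open>Left-invariant forms on \<open>\<Gamma>\G\<close> and the families\<close>

text \<open>Below \<open>A\<close> is the complex structure of \<open>G\<close>, and the forms \<open>\<beta>\<close>, \<open>\<omega>\<close>, \<open>\<phi>\<close> live on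
  the quotient \<open>\<Gamma>\G\<close>.\<close>

definition left_invariant :: "'g::topological_group_add atlas \<Rightarrow> 'g set \<Rightarrow> nat \<Rightarrow> 'g set form \<Rightarrow> bool" where
  "left_invariant A \<Gamma> k \<beta> \<longleftrightarrow>
     diff_form (quot_atlas \<Gamma> A) k \<beta> \<and>
     (\<exists>\<alpha>. diff_form A k \<alpha> \<and> (\<forall>a. is_pullback A A (\<lambda>x. a + x) \<alpha> \<alpha>) \<and>
          is_pullback A (quot_atlas \<Gamma> A) (coset \<Gamma>) \<beta> \<alpha>)"

definition inv_hermitian_metric :: "'g::topological_group_add atlas \<Rightarrow> 'g set \<Rightarrow> 'g set form \<Rightarrow> bool" where
  "inv_hermitian_metric A \<Gamma> \<omega> \<longleftrightarrow>
     hermitian_metric (quot_atlas \<Gamma> A) \<omega> \<and> left_invariant A \<Gamma> 2 \<omega>"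

definition inv_coframe ::
  "'g::topological_group_add atlas \<Rightarrow> 'g set \<Rightarrow> 'g set form \<Rightarrow> 'g set form \<Rightarrow> 'g set form \<Rightarrow> bool" where
  "inv_coframe A \<Gamma> \<phi>\<^sub>1 \<phi>\<^sub>2 \<phi>\<^sub>3 \<longleftrightarrow>
     (\<forall>\<phi>\<in>{\<phi>\<^sub>1, \<phi>\<^sub>2, \<phi>\<^sub>3}. left_invariant A \<Gamma> 1 \<phi> \<and> pq_form (quot_atlas \<Gamma> A) 1 0 \<phi>) \<and>
     (\<forall>(U, c)\<in>quot_atlas \<Gamma> A. \<forall>x\<in>c ` U. \<forall>\<eta>\<in>pq_forms 1 0.
        \<exists>!a :: complex^3. \<eta> =
          (\<lambda>vs. a $ 1 * \<phi>\<^sub>1 (U, c) x vs + a $ 2 * \<phi>\<^sub>2 (U, c) x vs + a $ 3 * \<phi>\<^sub>3 (U, c) x vs))"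

definition family_Np :: "'g::topological_group_add atlas \<Rightarrow> 'g set \<Rightarrow> bool" where
  "family_Np A \<Gamma> \<longleftrightarrow>
     (\<exists>\<phi>\<^sub>1 \<phi>\<^sub>2 \<phi>\<^sub>3 \<rho>. inv_coframe A \<Gamma> \<phi>\<^sub>1 \<phi>\<^sub>2 \<phi>\<^sub>3 \<and> \<rho> \<in> {0, 1} \<and>
        form_eq (quot_atlas \<Gamma> A) (ext_d \<phi>\<^sub>1) (\<lambda>C x vs. 0) \<and>
        form_eq (quot_atlas \<Gamma> A) (ext_d \<phi>\<^sub>2) (\<lambda>C x vs. 0) \<and>
        form_eq (quot_atlas \<Gamma> A) (ext_d \<phi>\<^sub>3) (\<lambda>C x vs. \<rho> * (\<phi>\<^sub>1 \<and>\<^sub>f \<phi>\<^sub>2) C x vs))"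

definition family_Ni :: "'g::topological_group_add atlas \<Rightarrow> 'g set \<Rightarrow> bool" where
  "family_Ni A \<Gamma> \<longleftrightarrow>
     (\<exists>\<phi>\<^sub>1 \<phi>\<^sub>2 \<phi>\<^sub>3 \<rho> (l::real) (D::complex). inv_coframe A \<Gamma> \<phi>\<^sub>1 \<phi>\<^sub>2 \<phi>\<^sub>3 \<and>
        \<rho> \<in> {0, 1} \<and> l \<ge> 0 \<and> Im D \<ge> 0 \<and>
        form_eq (quot_atlas \<Gamma> A) (ext_d \<phi>\<^sub>1) (\<lambda>C x vs. 0) \<and>
        form_eq (quot_atlas \<Gamma> A) (ext_d \<phi>\<^sub>2) (\<lambda>C x vs. 0) \<and>
        form_eq (quot_atlas \<Gamma> A) (ext_d \<phi>\<^sub>3) (\<lambda>C x vs.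
          \<rho> * (\<phi>\<^sub>1 \<and>\<^sub>f \<phi>\<^sub>2) C x vs + (\<phi>\<^sub>1 \<and>\<^sub>f bar_form \<phi>\<^sub>1) C x vs
          + of_real l * (\<phi>\<^sub>1 \<and>\<^sub>f bar_form \<phi>\<^sub>2) C x vs + D * (\<phi>\<^sub>2 \<and>\<^sub>f bar_form \<phi>\<^sub>2) C x vs))"

definition family_Nii :: "'g::topological_group_add atlas \<Rightarrow> 'g set \<Rightarrow> bool" where
  "family_Nii A \<Gamma> \<longleftrightarrow>
     (\<exists>\<phi>\<^sub>1 \<phi>\<^sub>2 \<phi>\<^sub>3 \<rho> (B::complex) (c::real). inv_coframe A \<Gamma> \<phi>\<^sub>1 \<phi>\<^sub>2 \<phi>\<^sub>3 \<and>
        \<rho> \<in> {0, 1} \<and> c \<ge> 0 \<and> (\<rho>, B, c) \<noteq> (0, 0, 0) \<and>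
        form_eq (quot_atlas \<Gamma> A) (ext_d \<phi>\<^sub>1) (\<lambda>C x vs. 0) \<and>
        form_eq (quot_atlas \<Gamma> A) (ext_d \<phi>\<^sub>2) (\<phi>\<^sub>1 \<and>\<^sub>f bar_form \<phi>\<^sub>1) \<and>
        form_eq (quot_atlas \<Gamma> A) (ext_d \<phi>\<^sub>3) (\<lambda>C x vs.
          \<rho> * (\<phi>\<^sub>1 \<and>\<^sub>f \<phi>\<^sub>2) C x vs + B * (\<phi>\<^sub>1 \<and>\<^sub>f bar_form \<phi>\<^sub>2) C x vs
          + of_real c * (\<phi>\<^sub>2 \<and>\<^sub>f bar_form \<phi>\<^sub>1) C x vs))"

text \<open>The sign \<open>s\<close> is the one written \<open>\<plusminus>\<close> in the structure equations.\<close>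

definition family_Niii :: "'g::topological_group_add atlas \<Rightarrow> 'g set \<Rightarrow> bool" where
  "family_Niii A \<Gamma> \<longleftrightarrow>
     (\<exists>\<phi>\<^sub>1 \<phi>\<^sub>2 \<phi>\<^sub>3 \<rho> s. inv_coframe A \<Gamma> \<phi>\<^sub>1 \<phi>\<^sub>2 \<phi>\<^sub>3 \<and> \<rho> \<in> {0, 1} \<and> s \<in> {1, -1} \<and>
        form_eq (quot_atlas \<Gamma> A) (ext_d \<phi>\<^sub>1) (\<lambda>C x vs. 0) \<and>
        form_eq (quot_atlas \<Gamma> A) (ext_d \<phi>\<^sub>2) (\<lambda>C x vs.
          (\<phi>\<^sub>1 \<and>\<^sub>f \<phi>\<^sub>3) C x vs + (\<phi>\<^sub>1 \<and>\<^sub>f bar_form \<phi>\<^sub>3) C x vs) \<and>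
        form_eq (quot_atlas \<Gamma> A) (ext_d \<phi>\<^sub>3) (\<lambda>C x vs.
          \<i> * \<rho> * (\<phi>\<^sub>1 \<and>\<^sub>f bar_form \<phi>\<^sub>1) C x vs
          + s * \<i> * ((\<phi>\<^sub>1 \<and>\<^sub>f bar_form \<phi>\<^sub>2) C x vs - (\<phi>\<^sub>2 \<and>\<^sub>f bar_form \<phi>\<^sub>1) C x vs)))"

end

theory Submission
  imports Defs
begin

text \<open>
  The left Maurer-Cartan form \<open>N\<close> identifies invariant forms on \<open>\<Gamma>\G\<close> with alternating forms on the
  tangent space \<open>\<complex>\<^sup>3\<close> at the identity, and the exterior derivative with the Chevalley-Eilenberg
  differential of the bracket \<open>br\<close>. The bracket splits into a complex bilinear part \<open>P\<close> and a part \<open>Q\<close>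
  that is complex linear in the first and antilinear in the second argument, and the Jacobi identity
  splits by type accordingly. An Engel-type argument yields closed \<open>(1, 0)\<close>-functionals. If some
  nonzero vector is annihilated by both \<open>P\<close> and \<open>Q\<close>, two such functionals complete to a coframe of
  family (Np), (Ni) or (Nii); otherwise there is an abelian complex ideal of codimension one, and the
  three operators by which a transversal vector acts on it are forced into the shape of (Niii).

  In the first case \<open>dd\<^sup>c\<omega>\<close> is, with a factor depending on the metric, a positive multiple of
  \<open>\<bar>\<rho>\<bar>\<^sup>2 + \<bar>y\<bar>\<^sup>2 + \<bar>z\<bar>\<^sup>2 - 2 Re (x cnj w)\<close> times a fixed nonnegative form, where \<open>\<rho>\<close>, \<open>x\<close>, \<open>y\<close>, \<open>z\<close>, \<open>w\<close> are
  the coefficients of \<open>\<phi>\<^sub>1 \<and> \<phi>\<^sub>2\<close>, \<open>\<phi>\<^sub>1 \<and> cnj \<phi>\<^sub>1\<close>, \<open>\<phi>\<^sub>1 \<and> cnj \<phi>\<^sub>2\<close>, \<open>\<phi>\<^sub>2 \<and> cnj \<phi>\<^sub>1\<close>, \<open>\<phi>\<^sub>2 \<and> cnj \<phi>\<^sub>2\<close> in \<open>d\<phi>\<^sub>3\<close>;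
  so its sign does not depend on the metric. In family (Niii) it is a positive combination of two
  nonnegative forms. In (Np) the number above vanishes only if the bracket does. Then \<open>N\<close> is closed,
  its local primitive inverts to a homomorphism from \<open>\<complex>\<^sup>3\<close> onto \<open>G\<close>, and the quotient is a complex torus.
\<close>

section \<open>Smooth maps\<close>

text \<open>The obstacle is that left translations are holomorphic while right translations and the
  group law itself need not be: every \<open>N C x\<close> is complex linear, but \<open>br\<close>
  is only real bilinear. So the derived algebra, though proper by nilpotency, is merely a real
  subspace, and its complex span could a priori be everything; a closed complex linear functional
  has to vanish on that span. Testing a functional on \<open>br u v\<close> and on
  \<open>br (\<i> *s u) v\<close> separates the types, and the separated pieces are again complex
  linear functionals to which an induction on the length of iterated brackets applies. Integrability
  is present as the complex linearity of the derivative of \<open>N\<close> in its second argument,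
  of which the bracket is the antisymmetrisation. Nilpotency is given for the group: differentiating
  iterated commutators yields products of \<open>Ad x - 1\<close>, and differentiating these at the
  identity yields iterated brackets. The dichotomy asks for a vector \<open>c\<close> such that
  \<open>c\<close> and \<open>\<i> *s c\<close> are both central, because only then does dividing by
  a complex line leave a two-dimensional problem.\<close>

lemma frechet_derivative_eqI: "(f has_derivative f') (at x) \<Longrightarrow> frechet_derivative f (at x) = f'"
  using frechet_derivative_at by metis

lemma frechet_derivative_cong_open:
  assumes "open S" "x \<in> S" "\<And>y. y \<in> S \<Longrightarrow> f y = g y"
  shows "frechet_derivative f (at x) = frechet_derivative g (at x)"
proof -
  have "(f has_derivative D) (at x) \<longleftrightarrow> (g has_derivative D) (at x)" for D
    using has_derivative_transform_within_open[OF _ assms(1,2)] assms(3) by metis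
  then show ?thesis by (simp add: frechet_derivative_def)
qed

lemma differentiable_cong_open:
  assumes "open S" "x \<in> S" "\<And>y. y \<in> S \<Longrightarrow> f y = g y"
  shows "f differentiable (at x) \<longleftrightarrow> g differentiable (at x)"
  unfolding differentiable_def
  using has_derivative_transform_within_open[OF _ assms(1,2)] assms(3) by metis

lemma higher_diff_on_cong:
  assumes "open S" "\<And>y. y \<in> S \<Longrightarrow> f y = g y"
  shows "higher_diff_on n S f \<longleftrightarrow> higher_diff_on n S g"
  using assms(2)
proof (induction n arbitrary: f g)
  case 0
  then show ?case by (simp cong: continuous_on_cong)
next
  case (Suc n)
  have "higher_diff_on n S (\<lambda>x. frechet_derivative f (at x) v) =
        higher_diff_on n S (\<lambda>x. frechet_derivative g (at x) v)" for v
    by (rule Suc.IH) (use frechet_derivative_cong_open[OF assms(1)] Suc.prems in metis)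
  moreover have "f differentiable (at x) \<longleftrightarrow> g differentiable (at x)" if "x \<in> S" for x
    using differentiable_cong_open[OF assms(1) that] Suc.prems by metis
  ultimately show ?case by simp
qed

lemma higher_diff_on_mono: "higher_diff_on n S f \<Longrightarrow> T \<subseteq> S \<Longrightarrow> higher_diff_on n T f"
  by (induction n arbitrary: f) (auto intro: continuous_on_subset)

lemma higher_diff_on_Suc_imp: "higher_diff_on (Suc n) S f \<Longrightarrow> higher_diff_on n S f"
proof (induction n arbitrary: f)
  case 0
  then have "f differentiable (at x)" if "x \<in> S" for x using that by simp
  then show ?case
    by (simp add: continuous_at_imp_continuous_on differentiable_imp_continuous_within)
next
  case (Suc n)
  have "higher_diff_on n S (\<lambda>x. frechet_derivative f (at x) v)" for v
    using Suc by auto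
  then show ?case using Suc.prems by auto
qed

lemma higher_diff_on_const: "higher_diff_on n S (\<lambda>x. c)"
  by (induction n arbitrary: c) (auto simp: frechet_derivative_const)

lemma higher_diff_on_bounded_linear:
  assumes "bounded_linear f" shows "higher_diff_on n S f"
proof (cases n)
  case 0
  then show ?thesis using assms linear_continuous_on by auto
next
  case (Suc m)
  have "(f has_derivative f) (at x)" for x
    using assms bounded_linear_imp_has_derivative by auto
  note D = this
  show ?thesis
    unfolding Suc higher_diff_on.simps frechet_derivative_eqI[OF D] using D
    by (auto simp: higher_diff_on_const differentiable_def)
qed

lemma higher_diff_on_linear_comp:
  assumes L: "bounded_linear L" and "open S"
  shows "higher_diff_on n S f \<Longrightarrow> higher_diff_on n S (\<lambda>x. L (f x))"
proof (induction n arbitrary: f)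
  case 0
  then show ?case using L by (auto intro: bounded_linear.continuous_on)
next
  case (Suc n)
  have D: "((\<lambda>x. L (f x)) has_derivative (\<lambda>v. L (frechet_derivative f (at x) v))) (at x)" if "x \<in> S" for x
    using Suc.prems that by (auto intro!: bounded_linear.has_derivative[OF L] simp: frechet_derivative_works)
  have "higher_diff_on n S (\<lambda>x. frechet_derivative (\<lambda>x. L (f x)) (at x) v)" for v
    by (subst higher_diff_on_cong[OF assms(2), where g = "\<lambda>x. L (frechet_derivative f (at x) v)"])
      (use frechet_derivative_eqI[OF D] Suc in auto)
  then show ?case using D by (auto simp: differentiable_def)
qed

lemma higher_diff_on_add:
  assumes "open S"
  shows "higher_diff_on n S f \<Longrightarrow> higher_diff_on n S g \<Longrightarrow> higher_diff_on n S (\<lambda>x. f x + g x)"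
proof (induction n arbitrary: f g)
  case 0
  then show ?case by (auto intro: continuous_on_add)
next
  case (Suc n)
  have D: "((\<lambda>x. f x + g x) has_derivative
      (\<lambda>v. frechet_derivative f (at x) v + frechet_derivative g (at x) v)) (at x)" if "x \<in> S" for x
    using Suc.prems that by (auto intro!: has_derivative_add simp: frechet_derivative_works)
  have "higher_diff_on n S (\<lambda>x. frechet_derivative (\<lambda>x. f x + g x) (at x) v)" for v
    by (subst higher_diff_on_cong[OF assms(1),
          where g = "\<lambda>x. frechet_derivative f (at x) v + frechet_derivative g (at x) v"])
      (use frechet_derivative_eqI[OF D] Suc in auto)
  then show ?case using D by (auto simp: differentiable_def)
qed

lemma higher_diff_on_sum:
  assumes "open S" "\<And>i. i \<in> I \<Longrightarrow> higher_diff_on n S (f i)"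
  shows "higher_diff_on n S (\<lambda>x. \<Sum>i\<in>I. f i x)"
  using assms(2)
  by (induction I rule: infinite_finite_induct)
    (auto intro: higher_diff_on_const higher_diff_on_add[OF assms(1)])

lemma higher_diff_on_bilinear:
  assumes B: "bounded_bilinear B" and S: "open S"
  shows "higher_diff_on n S f \<Longrightarrow> higher_diff_on n S g \<Longrightarrow> higher_diff_on n S (\<lambda>x. B (f x) (g x))"
proof (induction n arbitrary: f g)
  case 0
  then show ?case using B by (auto intro: bounded_bilinear.continuous_on)
next
  case (Suc n)
  have D: "((\<lambda>x. B (f x) (g x)) has_derivative
      (\<lambda>v. B (f x) (frechet_derivative g (at x) v) + B (frechet_derivative f (at x) v) (g x))) (at x)"
    if "x \<in> S" for x
    using Suc.prems that by (auto intro!: bounded_bilinear.FDERIV[OF B] simp: frechet_derivative_works)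
  have "higher_diff_on n S (\<lambda>x. frechet_derivative (\<lambda>x. B (f x) (g x)) (at x) v)" for v
  proof -
    have "higher_diff_on n S (\<lambda>x. B (f x) (frechet_derivative g (at x) v) + B (frechet_derivative f (at x) v) (g x))"
      by (intro higher_diff_on_add[OF S] Suc.IH higher_diff_on_Suc_imp[OF Suc.prems(1)]
          higher_diff_on_Suc_imp[OF Suc.prems(2)]) (use Suc.prems in simp_all)
    then show ?thesis
      by (subst higher_diff_on_cong[OF S,
          where g = "\<lambda>x. B (f x) (frechet_derivative g (at x) v) + B (frechet_derivative f (at x) v) (g x)"])
        (simp_all add: frechet_derivative_eqI[OF D])
  qed
  then show ?case using D by (auto simp: differentiable_def)
qed

text \<open>\<open>higher_diff_on\<close> speaks of derivatives along a fixed direction, whereas the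
  chain rule feeds the moving vector \<open>frechet_derivative f (at x) v\<close> into the
  derivative of \<open>g\<close>. Expanding this vector in \<open>Basis\<close> leaves a sum of
  products of functions to which the induction hypothesis applies; hence the euclidean middle
  space.\<close>

lemma higher_diff_on_compose:
  fixes f :: "'a::real_normed_vector \<Rightarrow> 'b::euclidean_space"
  assumes S: "open S" and T: "open T" and fS: "f ` S \<subseteq> T"
  shows "higher_diff_on n S f \<Longrightarrow> higher_diff_on n T g \<Longrightarrow> higher_diff_on n S (\<lambda>x. g (f x))"
  using fS
proof (induction n arbitrary: g)
  case 0
  then show ?case by (auto intro: continuous_on_compose2)
next
  case (Suc n)
  let ?h = "\<lambda>v x. \<Sum>b\<in>Basis. (frechet_derivative f (at x) v \<bullet> b) *\<^sub>R frechet_derivative g (at (f x)) b"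
  have D: "((\<lambda>x. g (f x)) has_derivative (\<lambda>v. ?h v x)) (at x)" if "x \<in> S" for x
  proof -
    have g: "(g has_derivative frechet_derivative g (at (f x))) (at (f x))"
      using Suc.prems that by (auto simp: frechet_derivative_works[symmetric])
    have "((\<lambda>x. g (f x)) has_derivative
        (\<lambda>v. frechet_derivative g (at (f x)) (frechet_derivative f (at x) v))) (at x)"
      using Suc.prems that
      by (intro has_derivative_compose[where f = f and g = g, OF _ g]) (auto simp: frechet_derivative_works[symmetric])
    also have "(\<lambda>v. frechet_derivative g (at (f x)) (frechet_derivative f (at x) v)) = (\<lambda>v. ?h v x)"
    proof
      fix v
      interpret linear "frechet_derivative g (at (f x))"
        using g has_derivative_linear by blast
      have "frechet_derivative g (at (f x)) (frechet_derivative f (at x) v) =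
        frechet_derivative g (at (f x)) (\<Sum>b\<in>Basis. (frechet_derivative f (at x) v \<bullet> b) *\<^sub>R b)"
        by (simp only: euclidean_representation)
      also have "\<dots> = ?h v x" by (simp add: sum scaleR)
      finally show "frechet_derivative g (at (f x)) (frechet_derivative f (at x) v) = ?h v x" .
    qed
    finally show ?thesis .
  qed
  have "higher_diff_on n S (?h v)" for v
  proof (intro higher_diff_on_sum[OF S] higher_diff_on_bilinear[OF bounded_bilinear_scaleR S])
    fix b :: 'b
    show "higher_diff_on n S (\<lambda>x. frechet_derivative f (at x) v \<bullet> b)"
      by (rule higher_diff_on_linear_comp[OF bounded_linear_inner_left S]) (use Suc.prems in auto)
    show "higher_diff_on n S (\<lambda>x. frechet_derivative g (at (f x)) b)"
      by (rule Suc.IH) (use Suc.prems higher_diff_on_Suc_imp[OF Suc.prems(1)] in auto)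
  qed
  then have "higher_diff_on n S (\<lambda>x. frechet_derivative (\<lambda>x. g (f x)) (at x) v)" for v
    by (subst higher_diff_on_cong[OF S, where g = "?h v"]) (use frechet_derivative_eqI[OF D] in auto)
  then show ?case using D by (auto simp: differentiable_def)
qed

text \<open>Differentiability is checked near each point, so that every point may use its own
  intermediate chart.\<close>

lemma higher_diff_on_local:
  assumes "\<And>x. x \<in> S \<Longrightarrow> \<exists>T. open T \<and> x \<in> T \<and> higher_diff_on n T f"
  shows "higher_diff_on n S f"
  using assms
proof (induction n arbitrary: f)
  case 0
  then have "continuous (at x) f" if "x \<in> S" for x
    using that continuous_on_eq_continuous_at by (metis higher_diff_on.simps(1))
  then show ?case by (simp add: continuous_at_imp_continuous_on)
next
  case (Suc n)
  have "higher_diff_on n S (\<lambda>x. frechet_derivative f (at x) v)" for v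
  proof (rule Suc.IH)
    fix x assume "x \<in> S"
    then obtain T where "open T" "x \<in> T" "higher_diff_on (Suc n) T f" using Suc.prems by blast
    then show "\<exists>T. open T \<and> x \<in> T \<and> higher_diff_on n T (\<lambda>x. frechet_derivative f (at x) v)"
      by auto
  qed
  moreover have "f differentiable (at x)" if "x \<in> S" for x
  proof -
    obtain T where "x \<in> T" "higher_diff_on (Suc n) T f" using Suc.prems \<open>x \<in> S\<close> by blast
    then show ?thesis by simp
  qed
  ultimately show ?case by simp
qed

lemma smooth_on_cong: "open S \<Longrightarrow> (\<And>y. y \<in> S \<Longrightarrow> f y = g y) \<Longrightarrow> smooth_on S f \<longleftrightarrow> smooth_on S g"
  unfolding smooth_on_def by (simp only: higher_diff_on_cong[of S f g])

lemma smooth_on_mono: "smooth_on S f \<Longrightarrow> T \<subseteq> S \<Longrightarrow> smooth_on T f"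
  unfolding smooth_on_def by (blast intro: higher_diff_on_mono)

lemma smooth_on_const: "smooth_on S (\<lambda>x. c)"
  by (simp add: smooth_on_def higher_diff_on_const)

lemma smooth_on_bounded_linear: "bounded_linear f \<Longrightarrow> smooth_on S f"
  by (simp add: smooth_on_def higher_diff_on_bounded_linear)

lemma smooth_on_ident: "smooth_on S (\<lambda>x. x)"
  by (intro smooth_on_bounded_linear bounded_linear_ident)

lemma smooth_on_linear_comp: "bounded_linear L \<Longrightarrow> open S \<Longrightarrow> smooth_on S f \<Longrightarrow> smooth_on S (\<lambda>x. L (f x))"
  unfolding smooth_on_def by (rule allI, rule higher_diff_on_linear_comp) blast+

lemma smooth_on_add: "open S \<Longrightarrow> smooth_on S f \<Longrightarrow> smooth_on S g \<Longrightarrow> smooth_on S (\<lambda>x. f x + g x)"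
  unfolding smooth_on_def by (rule allI, rule higher_diff_on_add) blast+

lemma smooth_on_sum:
  "open S \<Longrightarrow> (\<And>i. i \<in> I \<Longrightarrow> smooth_on S (f i)) \<Longrightarrow> smooth_on S (\<lambda>x. \<Sum>i\<in>I. f i x)"
  unfolding smooth_on_def by (rule allI, rule higher_diff_on_sum) blast+

lemma smooth_on_bilinear:
  "bounded_bilinear B \<Longrightarrow> open S \<Longrightarrow> smooth_on S f \<Longrightarrow> smooth_on S g \<Longrightarrow> smooth_on S (\<lambda>x. B (f x) (g x))"
  unfolding smooth_on_def by (rule allI, rule higher_diff_on_bilinear) blast+

lemma smooth_on_compose:
  fixes f :: "'a::real_normed_vector \<Rightarrow> 'b::euclidean_space"
  assumes "open S" "open T" "f ` S \<subseteq> T" "smooth_on S f" "smooth_on T g"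
  shows "smooth_on S (\<lambda>x. g (f x))"
  using assms(4,5) unfolding smooth_on_def by (blast intro: higher_diff_on_compose[OF assms(1-3)])

lemma smooth_on_Pair:
  assumes "open S" "smooth_on S f" "smooth_on S g"
  shows "smooth_on S (\<lambda>x. (f x, g x))"
proof -
  have "smooth_on S (\<lambda>x. (f x, 0) + (0, g x))"
    by (intro smooth_on_add smooth_on_linear_comp[of "\<lambda>a. (a, 0)"] smooth_on_linear_comp[of "\<lambda>a. (0, a)"]
        bounded_linear_Pair bounded_linear_ident bounded_linear_zero assms)
  then show ?thesis by simp
qed

lemma smooth_on_local:
  assumes "\<And>x. x \<in> S \<Longrightarrow> \<exists>T. open T \<and> x \<in> T \<and> smooth_on T f"
  shows "smooth_on S f"
  unfolding smooth_on_def
proof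
  fix n show "higher_diff_on n S f"
    by (rule higher_diff_on_local) (use assms in \<open>unfold smooth_on_def, blast\<close>)
qed

lemma smooth_on_imp_has_derivative:
  "smooth_on S f \<Longrightarrow> x \<in> S \<Longrightarrow> (f has_derivative frechet_derivative f (at x)) (at x)"
  unfolding smooth_on_def frechet_derivative_works[symmetric] by (drule spec[of _ "Suc 0"]) simp

lemma smooth_on_frechet_derivative: "smooth_on S f \<Longrightarrow> smooth_on S (\<lambda>x. frechet_derivative f (at x) v)"
  unfolding smooth_on_def
proof
  fix n assume "\<forall>n. higher_diff_on n S f"
  then have "higher_diff_on (Suc n) S f" ..
  then show "higher_diff_on n S (\<lambda>x. frechet_derivative f (at x) v)" by simp
qed

lemma smooth_on_imp_continuous_on: "smooth_on S f \<Longrightarrow> continuous_on S f"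
  unfolding smooth_on_def by (drule spec[of _ 0]) simp

section \<open>Symmetry of second derivatives\<close>

text \<open>The mean value theorem is used twice: along \<open>u\<close> for the increment of
  \<open>f\<close> in direction \<open>v\<close>, then along \<open>v\<close> for the derivative in
  direction \<open>u\<close>. The second difference on the left is symmetric in \<open>u\<close> and
  \<open>v\<close>.\<close>

lemma mixed_difference_mvt:
  fixes f :: "'a::euclidean_space \<Rightarrow> real"
  assumes S: "smooth_on S f" and h: "h > 0"
    and seg: "\<And>s t. 0 \<le> s \<Longrightarrow> s \<le> h \<Longrightarrow> 0 \<le> t \<Longrightarrow> t \<le> h \<Longrightarrow> x + s *\<^sub>R u + t *\<^sub>R v \<in> S"
  shows "\<exists>s t. 0 < s \<and> s < h \<and> 0 < t \<and> t < h \<and>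
    f (x + h *\<^sub>R u + h *\<^sub>R v) - f (x + h *\<^sub>R u) - f (x + h *\<^sub>R v) + f x =
    h * (h * frechet_derivative (\<lambda>y. frechet_derivative f (at y) u) (at (x + s *\<^sub>R u + t *\<^sub>R v)) v)"
proof -
  let ?Df = "\<lambda>y. frechet_derivative f (at y)"
  let ?Du = "\<lambda>y. frechet_derivative f (at y) u"
  have lin: "linear (frechet_derivative f (at y))" if "y \<in> S" for y
    using smooth_on_imp_has_derivative[OF S that] has_derivative_linear by blast
  have lin2: "linear (frechet_derivative ?Du (at y))" if "y \<in> S" for y
    using smooth_on_imp_has_derivative[OF smooth_on_frechet_derivative[OF S] that] has_derivative_linear by blast
  have d1: "((\<lambda>s. f (x + s *\<^sub>R u + t *\<^sub>R v)) has_real_derivative ?Du (x + s *\<^sub>R u + t *\<^sub>R v)) (at s)"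
    if "0 \<le> s" "s \<le> h" "0 \<le> t" "t \<le> h" for s t
  proof -
    have "((\<lambda>s. x + s *\<^sub>R u + t *\<^sub>R v) has_derivative (\<lambda>a. a *\<^sub>R u)) (at s)"
      by (auto intro!: derivative_eq_intros)
    from has_derivative_compose[OF this smooth_on_imp_has_derivative[OF S seg[OF that]]]
    show ?thesis
      by (simp add: has_field_derivative_def linear_scale[OF lin[OF seg[OF that]]] mult_commute_abs)
  qed
  have d2: "((\<lambda>t. ?Du (x + s *\<^sub>R u + t *\<^sub>R v)) has_real_derivative
      frechet_derivative ?Du (at (x + s *\<^sub>R u + t *\<^sub>R v)) v) (at t)"
    if "0 \<le> s" "s \<le> h" "0 \<le> t" "t \<le> h" for s t
  proof -
    have "((\<lambda>t. x + s *\<^sub>R u + t *\<^sub>R v) has_derivative (\<lambda>a. a *\<^sub>R v)) (at t)"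
      by (auto intro!: derivative_eq_intros)
    from has_derivative_compose[OF this smooth_on_imp_has_derivative[OF smooth_on_frechet_derivative[OF S, of u] seg[OF that]]]
    show ?thesis
      by (simp add: has_field_derivative_def linear_scale[OF lin2[OF seg[OF that]]] mult_commute_abs)
  qed
  let ?g = "\<lambda>s. f (x + s *\<^sub>R u + h *\<^sub>R v) - f (x + s *\<^sub>R u + 0 *\<^sub>R v)"
  have "\<exists>s. 0 < s \<and> s < h \<and> ?g h - ?g 0 = (h - 0) * (?Du (x + s *\<^sub>R u + h *\<^sub>R v) - ?Du (x + s *\<^sub>R u + 0 *\<^sub>R v))"
    by (rule MVT2[OF h]) (use h in \<open>auto intro!: DERIV_diff d1 simp del: scaleR_zero_left\<close>)
  then obtain s where s: "0 < s" "s < h"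
    and 1: "?g h - ?g 0 = h * (?Du (x + s *\<^sub>R u + h *\<^sub>R v) - ?Du (x + s *\<^sub>R u + 0 *\<^sub>R v))"
    by auto
  have "\<exists>t. 0 < t \<and> t < h \<and> ?Du (x + s *\<^sub>R u + h *\<^sub>R v) - ?Du (x + s *\<^sub>R u + 0 *\<^sub>R v)
      = (h - 0) * frechet_derivative ?Du (at (x + s *\<^sub>R u + t *\<^sub>R v)) v"
    by (rule MVT2[OF h]) (use s in \<open>auto intro!: d2\<close>)
  then obtain t where t: "0 < t" "t < h"
    and 2: "?Du (x + s *\<^sub>R u + h *\<^sub>R v) - ?Du (x + s *\<^sub>R u + 0 *\<^sub>R v)
      = h * frechet_derivative ?Du (at (x + s *\<^sub>R u + t *\<^sub>R v)) v"
    by auto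
  show ?thesis
    by (rule exI[of _ s], rule exI[of _ t]) (use s t 1 2 in auto)
qed

text \<open>Evaluating the second difference in both orders makes the two mixed derivatives agree at
  points \<open>p n\<close> and \<open>q n\<close> at distance at most \<open>h n * k\<close> from
  \<open>x\<close>. Both sequences tend to \<open>x\<close>, and the mixed derivatives are
  continuous.\<close>

lemma symmetric_second_derivative_real:
  fixes f :: "'a::euclidean_space \<Rightarrow> real"
  assumes S: "smooth_on S f" "open S" "x \<in> S"
  shows "frechet_derivative (\<lambda>y. frechet_derivative f (at y) u) (at x) v =
    frechet_derivative (\<lambda>y. frechet_derivative f (at y) v) (at x) u"
proof -
  let ?F = "\<lambda>y. frechet_derivative (\<lambda>y. frechet_derivative f (at y) u) (at y) v"
  let ?G = "\<lambda>y. frechet_derivative (\<lambda>y. frechet_derivative f (at y) v) (at y) u"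
  obtain r where r: "r > 0" "ball x r \<subseteq> S" using S(2,3) openE by blast
  define k where "k = norm u + norm v + 1"
  have k: "k > 0" by (simp add: k_def add_nonneg_pos)
  \<comment> \<open>The summand 2 keeps \<open>h n * k = r / (n + 2)\<close> strictly below
    \<open>r\<close> already for \<open>n = 0\<close>, so the whole parallelogram stays in
    \<open>S\<close>.\<close>
  define h where "h n = r / (k * (real n + 2))" for n :: nat
  have h: "h n > 0" for n using r k by (simp add: h_def)
  have hk: "h n * k < r" for n
    using r(1) k by (simp add: h_def divide_simps) 
  have small: "norm (s *\<^sub>R u + t *\<^sub>R v) \<le> h n * k" if "0 \<le> s" "s \<le> h n" "0 \<le> t" "t \<le> h n" for s t n
  proof -
    have "norm (s *\<^sub>R u + t *\<^sub>R v) \<le> s * norm u + t * norm v"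
      using that norm_triangle_ineq[of "s *\<^sub>R u" "t *\<^sub>R v"] by simp
    also have "\<dots> \<le> h n * norm u + h n * norm v"
      using that by (intro add_mono mult_right_mono) auto
    also have "\<dots> \<le> h n * k" using h[of n] by (simp add: k_def distrib_left)
    finally show ?thesis .
  qed
  have inS: "x + s *\<^sub>R u + t *\<^sub>R v \<in> S" if "0 \<le> s" "s \<le> h n" "0 \<le> t" "t \<le> h n" for s t n
    using small[OF that] hk[of n] r(2) by (auto simp: dist_norm norm_minus_commute add.assoc subset_iff)
  have inS': "x + s *\<^sub>R v + t *\<^sub>R u \<in> S" if "0 \<le> s" "s \<le> h n" "0 \<le> t" "t \<le> h n" for s t n
    using inS[OF that(3,4,1,2)] by (simp add: algebra_simps)
  have "\<exists>p q. norm (p - x) \<le> h n * k \<and> norm (q - x) \<le> h n * k \<and> ?F p = ?G q" for n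
  proof -
    obtain s t where 1: "0 < s" "s < h n" "0 < t" "t < h n"
      "f (x + h n *\<^sub>R u + h n *\<^sub>R v) - f (x + h n *\<^sub>R u) - f (x + h n *\<^sub>R v) + f x = h n * (h n * ?F (x + s *\<^sub>R u + t *\<^sub>R v))"
      using mixed_difference_mvt[where x = x and u = u and v = v, OF S(1) h[of n]] inS by blast
    obtain s' t' where 2: "0 < s'" "s' < h n" "0 < t'" "t' < h n"
      "f (x + h n *\<^sub>R v + h n *\<^sub>R u) - f (x + h n *\<^sub>R v) - f (x + h n *\<^sub>R u) + f x = h n * (h n * ?G (x + s' *\<^sub>R v + t' *\<^sub>R u))"
      using mixed_difference_mvt[where x = x and u = v and v = u, OF S(1) h[of n]] inS' by blast
    have "h n * (h n * ?F (x + s *\<^sub>R u + t *\<^sub>R v)) = h n * (h n * ?G (x + s' *\<^sub>R v + t' *\<^sub>R u))"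
      using 1(5) 2(5) by (simp add: algebra_simps)
    then have "?F (x + s *\<^sub>R u + t *\<^sub>R v) = ?G (x + s' *\<^sub>R v + t' *\<^sub>R u)"
      using h[of n] by (metis mult_left_cancel less_irrefl)
    moreover have "norm ((x + s *\<^sub>R u + t *\<^sub>R v) - x) \<le> h n * k" "norm ((x + s' *\<^sub>R v + t' *\<^sub>R u) - x) \<le> h n * k"
      using small[of s n t] small[of t' n s'] 1 2 by (simp_all add: algebra_simps)
    ultimately show ?thesis by blast
  qed
  then obtain p q where pq: "\<And>n. norm (p n - x) \<le> h n * k" "\<And>n. norm (q n - x) \<le> h n * k" "\<And>n. ?F (p n) = ?G (q n)"
    by metis
  have h0: "(\<lambda>n. h n * k) \<longlonglongrightarrow> 0"
  proof -
    have "(\<lambda>n. r * inverse (real n + 2)) \<longlonglongrightarrow> r * 0"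
      by (intro tendsto_mult tendsto_const tendsto_inverse_0_at_top
          filterlim_tendsto_add_at_top[OF tendsto_const[of 2], simplified add.commute] filterlim_real_sequentially)
    moreover have "h n * k = r * inverse (real n + 2)" for n
    proof -
      have "r / (k * a) * k = r * inverse a" for a using k by (simp add: divide_inverse)
      then show ?thesis by (simp add: h_def)
    qed
    ultimately show ?thesis by simp
  qed
  have p: "p \<longlonglongrightarrow> x"
    by (rule LIM_zero_cancel, rule Lim_null_comparison[OF _ h0]) (simp add: pq(1))
  have q: "q \<longlonglongrightarrow> x"
    by (rule LIM_zero_cancel, rule Lim_null_comparison[OF _ h0]) (simp add: pq(2))
  have "continuous_on S ?F" "continuous_on S ?G"
    by (rule smooth_on_imp_continuous_on[OF smooth_on_frechet_derivative[OF smooth_on_frechet_derivative[OF S(1)]]])+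
  then have cont: "isCont ?F x" "isCont ?G x"
    using continuous_on_eq_continuous_at[OF S(2)] S(3) by blast+
  have "(\<lambda>n. ?F (p n)) \<longlonglongrightarrow> ?F x"
    by (rule isCont_tendsto_compose[OF cont(1) p])
  moreover have "(\<lambda>n. ?F (p n)) \<longlonglongrightarrow> ?G x"
    unfolding pq(3) by (rule isCont_tendsto_compose[OF cont(2) q])
  ultimately show ?thesis by (rule LIMSEQ_unique)
qed

lemma symmetric_second_derivative:
  fixes f :: "'a::euclidean_space \<Rightarrow> 'b::euclidean_space"
  assumes S: "smooth_on S f" "open S" "x \<in> S"
  shows "frechet_derivative (\<lambda>y. frechet_derivative f (at y) u) (at x) v =
    frechet_derivative (\<lambda>y. frechet_derivative f (at y) v) (at x) u"
proof (rule euclidean_eqI)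
  fix b :: 'b
  have *: "frechet_derivative (\<lambda>y. g y \<bullet> b) (at y) w = frechet_derivative g (at y) w \<bullet> b"
    if "smooth_on S g" "y \<in> S" for g :: "'a \<Rightarrow> 'b" and y w
    by (rule fun_cong[OF frechet_derivative_eqI])
      (rule has_derivative_inner_left, rule smooth_on_imp_has_derivative[OF that])
  have "frechet_derivative (\<lambda>y. frechet_derivative f (at y) u) (at x) v \<bullet> b
     = frechet_derivative (\<lambda>y. frechet_derivative (\<lambda>z. f z \<bullet> b) (at y) u) (at x) v" for u v
  proof -
    have "frechet_derivative (\<lambda>y. frechet_derivative (\<lambda>z. f z \<bullet> b) (at y) u) (at x)
       = frechet_derivative (\<lambda>y. frechet_derivative f (at y) u \<bullet> b) (at x)"
      by (rule frechet_derivative_cong_open[OF S(2,3)]) (simp add: *[OF S(1)])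
    then show ?thesis using *[OF smooth_on_frechet_derivative[OF S(1)] S(3)] by simp
  qed
  then show "frechet_derivative (\<lambda>y. frechet_derivative f (at y) u) (at x) v \<bullet> b =
    frechet_derivative (\<lambda>y. frechet_derivative f (at y) v) (at x) u \<bullet> b"
    using symmetric_second_derivative_real[OF smooth_on_linear_comp[OF bounded_linear_inner_left S(2,1)] S(2,3)]
    by simp
qed

section \<open>The left Maurer-Cartan form\<close>

text \<open>Product rule for a family of linear maps that is known to be differentiable only on each
  fixed argument. The expansion in a basis reduces it to products of a scalar and a vector;
  \<open>rep'\<close> shows that the derivatives \<open>F' b\<close> inherit linearity in
  \<open>b\<close>.\<close>

lemma has_derivative_apply:
  fixes f :: "'a::real_normed_vector \<Rightarrow> 'b::euclidean_space"
    and F :: "'a \<Rightarrow> 'b \<Rightarrow> 'c::real_normed_vector"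
  assumes S: "open S" "x \<in> S" and lin: "\<And>y. y \<in> S \<Longrightarrow> linear (F y)"
    and F': "\<And>b. ((\<lambda>y. F y b) has_derivative F' b) (at x)"
    and f': "(f has_derivative f') (at x)"
  shows "((\<lambda>y. F y (f y)) has_derivative (\<lambda>u. F' (f x) u + F x (f' u))) (at x)"
proof -
  have rep: "F y w = (\<Sum>b\<in>Basis. (w \<bullet> b) *\<^sub>R F y b)" if "y \<in> S" for y w
  proof -
    interpret linear "F y" by (rule lin[OF that])
    have "F y w = F y (\<Sum>b\<in>Basis. (w \<bullet> b) *\<^sub>R b)" by (simp only: euclidean_representation)
    then show ?thesis by (simp add: sum scaleR)
  qed
  have rep': "F' w u = (\<Sum>b\<in>Basis. (w \<bullet> b) *\<^sub>R F' b u)" for w u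
  proof -
    have "((\<lambda>y. \<Sum>b\<in>Basis. (w \<bullet> b) *\<^sub>R F y b) has_derivative (\<lambda>u. \<Sum>b\<in>Basis. (w \<bullet> b) *\<^sub>R F' b u)) (at x)"
      by (intro has_derivative_sum has_derivative_scaleR_right F')
    then have "((\<lambda>y. F y w) has_derivative (\<lambda>u. \<Sum>b\<in>Basis. (w \<bullet> b) *\<^sub>R F' b u)) (at x)"
      by (rule has_derivative_transform_within_open[OF _ S]) (rule rep[symmetric])
    then show ?thesis using has_derivative_unique[OF F'] by metis
  qed
  have "((\<lambda>y. \<Sum>b\<in>Basis. (f y \<bullet> b) *\<^sub>R F y b) has_derivative
      (\<lambda>u. \<Sum>b\<in>Basis. (f x \<bullet> b) *\<^sub>R F' b u + (f' u \<bullet> b) *\<^sub>R F x b)) (at x)"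
    by (intro has_derivative_sum has_derivative_scaleR F' has_derivative_inner_left f')
  moreover have "(\<lambda>u. \<Sum>b\<in>Basis. (f x \<bullet> b) *\<^sub>R F' b u + (f' u \<bullet> b) *\<^sub>R F x b) = (\<lambda>u. F' (f x) u + F x (f' u))"
  proof
    fix u
    show "(\<Sum>b\<in>Basis. (f x \<bullet> b) *\<^sub>R F' b u + (f' u \<bullet> b) *\<^sub>R F x b) = F' (f x) u + F x (f' u)"
      by (simp add: rep'[of "f x" u] rep[OF S(2), of "f' u"] sum.distrib)
  qed
  ultimately have "((\<lambda>y. \<Sum>b\<in>Basis. (f y \<bullet> b) *\<^sub>R F y b) has_derivative (\<lambda>u. F' (f x) u + F x (f' u))) (at x)"
    by simp
  then show ?thesis by (rule has_derivative_transform_within_open[OF _ S]) (rule rep[symmetric])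
qed

section \<open>Charts of the group and smoothness of its operations\<close>

abbreviation cdom :: "'m chart \<Rightarrow> (complex^3) set" where "cdom C \<equiv> snd C ` fst C"
abbreviation cinv :: "'m chart \<Rightarrow> complex^3 \<Rightarrow> 'm" where "cinv C \<equiv> inv_into (fst C) (snd C)"

lemma cinv_mem: "x \<in> cdom C \<Longrightarrow> cinv C x \<in> fst C" by (rule inv_into_into)
lemma cinv_right [simp]: "x \<in> cdom C \<Longrightarrow> snd C (cinv C x) = x" by (rule f_inv_into_f)

lemma loc_map_eq: "loc_map C D f x = snd D (f (cinv C x))" by (simp add: loc_map_def)

locale lie_group_cs =
  fixes A :: "'g::topological_group_add atlas"
  assumes nilp_cs: "nilpotent_lie_group_cs A"
begin

lemma cmf: "complex_manifold (euclidean :: 'g topology) A" and lg: "lie_group A"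
  and holo_left: "holomorphic_map A A (\<lambda>x. a + x)"
  using nilp_cs by (auto simp: nilpotent_lie_group_cs_def)

lemma charts_cover: "\<exists>C\<in>A. g \<in> fst C"
  using cmf unfolding complex_manifold_def by auto

context
  fixes C assumes C: "C \<in> A"
begin

lemma chart_open: "open (fst C)" and chart_dom_open: "open (cdom C)"
  and chart_homeo: "homeomorphic_map (subtopology euclidean (fst C)) (top_of_set (cdom C)) (snd C)"
  using cmf C unfolding complex_manifold_def by (auto simp: case_prod_beta)

lemma chart_inj: "inj_on (snd C) (fst C)"
  using homeomorphic_imp_injective_map[OF chart_homeo] by simp

lemma cinv_left [simp]: "g \<in> fst C \<Longrightarrow> cinv C (snd C g) = g"
  by (rule inv_into_f_f[OF chart_inj])

lemma chart_cont: "continuous_on (fst C) (snd C)"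
  using homeomorphic_imp_continuous_map[OF chart_homeo] by (simp add: continuous_map_in_subtopology)

lemma cinv_cont: "continuous_on (cdom C) (cinv C)"
proof -
  obtain g where g: "homeomorphic_maps (subtopology euclidean (fst C)) (top_of_set (cdom C)) (snd C) g"
    using chart_homeo homeomorphic_map_maps by blast
  then have c: "continuous_on (cdom C) g" and "\<forall>x\<in>fst C. g (snd C x) = x"
    by (auto simp: homeomorphic_maps_def continuous_map_in_subtopology)
  then have "g x = cinv C x" if "x \<in> cdom C" for x using that by auto
  then show ?thesis using c by (simp cong: continuous_on_cong)
qed

lemma open_cinv_preimage:
  assumes "continuous_on UNIV f" "open V"
  shows "open {x \<in> cdom C. f (cinv C x) \<in> V}"
proof -
  have "continuous_on (cdom C) (\<lambda>x. f (cinv C x))"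
    by (rule continuous_on_compose2[OF assms(1) cinv_cont]) auto
  then have "open (cdom C \<inter> (\<lambda>x. f (cinv C x)) -` V)"
    by (rule continuous_open_preimage[OF _ chart_dom_open assms(2)])
  then show ?thesis by (simp add: vimage_def Int_def)
qed

lemma loc_dom_eq: "loc_dom C D f = {x \<in> cdom C. f (cinv C x) \<in> fst D}"
  unfolding loc_dom_def by auto

end

lemma loc_dom_open: "C \<in> A \<Longrightarrow> D \<in> A \<Longrightarrow> continuous_on UNIV f \<Longrightarrow> open (loc_dom C D f)"
  by (simp add: loc_dom_eq open_cinv_preimage chart_open)

lemma loc_dom_left_open: "C \<in> A \<Longrightarrow> D \<in> A \<Longrightarrow> open (loc_dom C D ((+) a))"
  by (rule loc_dom_open) (auto intro: continuous_intros)

lemma loc_dom_right_open: "C \<in> A \<Longrightarrow> D \<in> A \<Longrightarrow> open (loc_dom C D (\<lambda>g. g + a))"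
  by (rule loc_dom_open) (auto intro: continuous_intros)

lemma open_cinv_preimage2:
  assumes C: "C \<in> A" and D: "D \<in> A"
    and f: "continuous_on UNIV (\<lambda>(g, h). f g h)" and V: "open V"
  shows "open {(x, y). x \<in> cdom C \<and> y \<in> cdom D \<and> f (cinv C x) (cinv D y) \<in> V}"
proof -
  have "continuous_on (cdom C \<times> cdom D) (\<lambda>z. (cinv C (fst z), cinv D (snd z)))"
    by (intro continuous_on_Pair continuous_on_compose2[OF cinv_cont[OF C] continuous_on_fst]
        continuous_on_compose2[OF cinv_cont[OF D] continuous_on_snd] continuous_on_id) auto
  then have "continuous_on (cdom C \<times> cdom D) (\<lambda>z. (\<lambda>(g, h). f g h) (cinv C (fst z), cinv D (snd z)))"
    by (rule continuous_on_compose2[OF f]) auto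
  then have "open ((cdom C \<times> cdom D) \<inter> (\<lambda>z. f (cinv C (fst z)) (cinv D (snd z))) -` V)"
    using V by (intro continuous_open_preimage open_Times chart_dom_open C D) auto
  also have "(cdom C \<times> cdom D) \<inter> (\<lambda>z. f (cinv C (fst z)) (cinv D (snd z))) -` V
    = {(x, y). x \<in> cdom C \<and> y \<in> cdom D \<and> f (cinv C x) (cinv D y) \<in> V}" by auto
  finally show ?thesis .
qed

lemma smooth_mult:
  assumes "C \<in> A" "D \<in> A" "E \<in> A"
  shows "smooth_on {(x, y). x \<in> cdom C \<and> y \<in> cdom D \<and> cinv C x + cinv D y \<in> fst E}
    (\<lambda>(x, y). snd E (cinv C x + cinv D y))"
  using lg assms unfolding lie_group_def by (auto simp: case_prod_beta)

lemma open_mult_dom: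
  assumes "C \<in> A" "D \<in> A" "E \<in> A"
  shows "open {(x, y). x \<in> cdom C \<and> y \<in> cdom D \<and> cinv C x + cinv D y \<in> fst E}"
  by (intro open_cinv_preimage2 assms chart_open) (auto simp: case_prod_beta intro!: continuous_intros)

lemma smooth_uminus: "C \<in> A \<Longrightarrow> D \<in> A \<Longrightarrow> smooth_on (loc_dom C D uminus) (loc_map C D uminus)"
  using lg unfolding lie_group_def by auto

lemma loc_dom_uminus_open: "C \<in> A \<Longrightarrow> D \<in> A \<Longrightarrow> open (loc_dom C D uminus)"
  by (rule loc_dom_open) (auto intro: continuous_intros)

lemma smooth_left:
  assumes C: "C \<in> A" and D: "D \<in> A"
  shows "smooth_on (loc_dom C D ((+) a)) (loc_map C D ((+) a))"
proof -
  obtain B where B: "B \<in> A" "a \<in> fst B" using charts_cover by blast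
  let ?S = "{(x, y). x \<in> cdom B \<and> y \<in> cdom C \<and> cinv B x + cinv C y \<in> fst D}"
  have "smooth_on (loc_dom C D ((+) a)) (\<lambda>x. (\<lambda>(x, y). snd D (cinv B x + cinv C y)) (snd B a, x))"
    by (rule smooth_on_compose[OF loc_dom_left_open[OF C D] open_mult_dom[OF B(1) C D] _ _ smooth_mult[OF B(1) C D]])
      (use B in \<open>simp add: loc_dom_eq[OF C] image_subset_iff\<close>, intro smooth_on_Pair smooth_on_const smooth_on_ident loc_dom_left_open C D)
  then show ?thesis
    by (subst smooth_on_cong[OF loc_dom_left_open[OF C D]]) (simp_all add: loc_map_eq B)
qed

lemma smooth_right:
  assumes C: "C \<in> A" and D: "D \<in> A"
  shows "smooth_on (loc_dom C D (\<lambda>g. g + a)) (loc_map C D (\<lambda>g. g + a))"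
proof -
  obtain B where B: "B \<in> A" "a \<in> fst B" using charts_cover by blast
  have "smooth_on (loc_dom C D (\<lambda>g. g + a)) (\<lambda>x. (\<lambda>(x, y). snd D (cinv C x + cinv B y)) (x, snd B a))"
    by (rule smooth_on_compose[OF loc_dom_right_open[OF C D] open_mult_dom[OF C B(1) D] _ _ smooth_mult[OF C B(1) D]])
      (use B in \<open>simp add: loc_dom_eq[OF C] image_subset_iff\<close>, intro smooth_on_Pair smooth_on_const smooth_on_ident loc_dom_right_open C D)
  then show ?thesis
    by (subst smooth_on_cong[OF loc_dom_right_open[OF C D]]) (simp_all add: loc_map_eq B)
qed

lemma open_diff_dom:
  assumes "C \<in> A" "D \<in> A" "E \<in> A"
  shows "open {(x, y). x \<in> cdom C \<and> y \<in> cdom D \<and> - cinv C x + cinv D y \<in> fst E}"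
  by (intro open_cinv_preimage2 assms chart_open) (auto simp: case_prod_beta intro!: continuous_intros)

text \<open>The inverse may land in any chart, so smoothness is shown near one point at a time, with
  a chart \<open>B\<close> around the inverse of that point as intermediate step.\<close>

lemma smooth_diff:
  assumes C: "C \<in> A" and D: "D \<in> A" and E: "E \<in> A"
  shows "smooth_on {(x, y). x \<in> cdom C \<and> y \<in> cdom D \<and> - cinv C x + cinv D y \<in> fst E}
    (\<lambda>(x, y). snd E (- cinv C x + cinv D y))" (is "smooth_on ?S ?f")
proof (rule smooth_on_local)
  fix z assume z: "z \<in> ?S"
  obtain B where B: "B \<in> A" "- cinv C (fst z) \<in> fst B" using charts_cover by blast
  let ?T = "?S \<inter> fst -` loc_dom C B uminus"
  have oT: "open ?T"
    by (intro open_Int open_diff_dom assms open_vimage_fst loc_dom_uminus_open B(1))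
  have zT: "z \<in> ?T" using z B by (auto simp: loc_dom_eq[OF C])
  let ?g = "\<lambda>(x, y). snd E (cinv B x + cinv D y)"
  have 1: "smooth_on ?T (\<lambda>w. loc_map C B uminus (fst w))"
    by (rule smooth_on_compose[OF oT loc_dom_uminus_open[OF C B(1)] _ _ smooth_uminus[OF C B(1)]])
      (auto intro: smooth_on_bounded_linear bounded_linear_fst)
  have "smooth_on ?T (\<lambda>w. ?g (loc_map C B uminus (fst w), snd w))"
    by (rule smooth_on_compose[OF oT open_mult_dom[OF B(1) D E] _ smooth_on_Pair[OF oT 1 smooth_on_bounded_linear[OF bounded_linear_snd]] smooth_mult[OF B(1) D E]])
      (auto simp: loc_dom_eq[OF C] loc_map_eq B)
  then have "smooth_on ?T ?f"
    by (subst smooth_on_cong[OF oT]) (auto simp: loc_dom_eq[OF C] loc_map_eq B)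
  then show "\<exists>T. open T \<and> z \<in> T \<and> smooth_on T ?f" using oT zT by blast
qed

text \<open>A chart at the identity fixed once and for all. It identifies the tangent space there
  with \<open>complex^3\<close>, and all invariant data are read off at its point
  \<open>p0\<close>.\<close>

definition C0 where "C0 = (SOME C. C \<in> A \<and> 0 \<in> fst C)"
definition p0 where "p0 = snd C0 0"

lemma C0: "C0 \<in> A" "0 \<in> fst C0"
proof -
  have "\<exists>C. C \<in> A \<and> 0 \<in> fst C" using charts_cover by blast
  from someI_ex[OF this] show "C0 \<in> A" "0 \<in> fst C0" by (auto simp: C0_def)
qed

lemma p0 [simp]: "p0 \<in> cdom C0" "cinv C0 p0 = 0" using C0 by (auto simp: p0_def)

section \<open>The Maurer-Cartan form, its structure equation and the bracket\<close>

text \<open>The differential at \<open>x\<close> of the left translation that moves the point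
  \<open>cinv C x\<close> to the identity, read in the charts \<open>C\<close> and
  \<open>C0\<close>.\<close>

definition N where "N C x = frechet_derivative (loc_map C C0 ((+) (- cinv C x))) (at x)"

lemma left_has_derivative:
  assumes "C \<in> A" "D \<in> A" "x \<in> loc_dom C D ((+) a)"
  shows "(loc_map C D ((+) a) has_derivative frechet_derivative (loc_map C D ((+) a)) (at x)) (at x)"
  by (rule smooth_on_imp_has_derivative[OF smooth_left[OF assms(1,2)] assms(3)])

lemma left_deriv_clinear:
  assumes "C \<in> A" "D \<in> A" "x \<in> loc_dom C D ((+) a)"
  shows "frechet_derivative (loc_map C D ((+) a)) (at x) (\<i> *s v)
    = \<i> *s frechet_derivative (loc_map C D ((+) a)) (at x) v"
proof -
  have "holo_on (loc_dom C D ((+) a)) (loc_map C D ((+) a))"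
    using holo_left assms(1,2) unfolding holomorphic_map_def by auto
  then obtain D' where D': "(loc_map C D ((+) a) has_derivative D') (at x)" "\<forall>v. D' (\<i> *s v) = \<i> *s D' v"
    using assms(3) unfolding holo_on_def by blast
  then show ?thesis using frechet_derivative_eqI by metis
qed

lemma self_in_loc_dom: "C \<in> A \<Longrightarrow> x \<in> cdom C \<Longrightarrow> x \<in> loc_dom C C0 ((+) (- cinv C x))"
  by (simp add: loc_dom_eq C0)

lemma N_has_derivative:
  "C \<in> A \<Longrightarrow> x \<in> cdom C \<Longrightarrow> (loc_map C C0 ((+) (- cinv C x)) has_derivative N C x) (at x)"
  unfolding N_def by (intro left_has_derivative C0 self_in_loc_dom)

lemma N_linear: "C \<in> A \<Longrightarrow> x \<in> cdom C \<Longrightarrow> linear (N C x)"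
  using N_has_derivative has_derivative_linear by blast

lemma N_clinear: "C \<in> A \<Longrightarrow> x \<in> cdom C \<Longrightarrow> N C x (\<i> *s v) = \<i> *s N C x v"
  unfolding N_def by (intro left_deriv_clinear C0 self_in_loc_dom)

text \<open>Translating by \<open>a\<close> and then to the identity is the same as translating to
  the identity at once. With \<open>a = 0\<close> this is the compatibility of \<open>N\<close>
  under a change of chart.\<close>

lemma N_trans:
  assumes C: "C \<in> A" and D: "D \<in> A" and x: "x \<in> loc_dom C D ((+) a)"
  shows "N C x v = N D (loc_map C D ((+) a) x) (frechet_derivative (loc_map C D ((+) a)) (at x) v)"
proof -
  let ?t = "loc_map C D ((+) a)"
  have x': "x \<in> cdom C" "a + cinv C x \<in> fst D" using x by (auto simp: loc_dom_eq[OF C])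
  have tx: "?t x \<in> cdom D" using x' by (auto simp: loc_map_eq)
  have inv: "cinv D (?t y) = a + cinv C y" if "y \<in> loc_dom C D ((+) a)" for y
    using that by (auto simp: loc_map_eq loc_dom_eq[OF C] cinv_left[OF D])
  have "((\<lambda>y. loc_map D C0 ((+) (- cinv D (?t x))) (?t y)) has_derivative
      (\<lambda>v. N D (?t x) (frechet_derivative ?t (at x) v))) (at x)"
    by (rule has_derivative_compose[OF left_has_derivative[OF C D x] N_has_derivative[OF D tx]])
  then have "(loc_map C C0 ((+) (- cinv C x)) has_derivative
      (\<lambda>v. N D (?t x) (frechet_derivative ?t (at x) v))) (at x)"
    by (rule has_derivative_transform_within_open[OF _ loc_dom_left_open[OF C D] x])
      (simp only: loc_map_eq[of D C0] loc_map_eq[of C C0] inv x minus_add add.assoc minus_add_cancel)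
  then show ?thesis unfolding N_def[of C] by (simp add: frechet_derivative_eqI)
qed

lemma N_p0: "N C0 p0 v = v"
proof -
  have "((\<lambda>y. y) has_derivative (\<lambda>v. v)) (at p0)" by (rule has_derivative_ident)
  then have "(loc_map C0 C0 ((+) (- cinv C0 p0)) has_derivative (\<lambda>v. v)) (at p0)"
    by (rule has_derivative_transform_within_open[OF _ chart_dom_open[OF C0(1)] p0(1)])
      (simp add: loc_map_eq)
  then show ?thesis unfolding N_def by (simp add: frechet_derivative_eqI)
qed

text \<open>The translation back from the identity gives a left inverse, and the dimensions
  agree.\<close>

lemma N_bij: assumes C: "C \<in> A" and x: "x \<in> cdom C" shows "bij (N C x)"
proof -
  let ?t = "loc_map C C0 ((+) (- cinv C x))" and ?s = "loc_map C0 C ((+) (cinv C x))"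
  have tx: "?t x = p0" using C0 by (simp add: loc_map_eq p0_def)
  have p: "p0 \<in> loc_dom C0 C ((+) (cinv C x))"
    using cinv_mem[OF x] by (simp add: loc_dom_eq C0)
  have "((\<lambda>y. ?s (?t y)) has_derivative
      (\<lambda>v. frechet_derivative ?s (at p0) (N C x v))) (at x)"
    by (rule has_derivative_compose[OF N_has_derivative[OF C x]])
      (unfold tx, rule left_has_derivative[OF C0(1) C p])
  then have "((\<lambda>y. y) has_derivative (\<lambda>v. frechet_derivative ?s (at p0) (N C x v))) (at x)"
    by (rule has_derivative_transform_within_open[OF _ loc_dom_left_open[OF C C0(1)] self_in_loc_dom[OF C x]])
      (auto simp: loc_dom_eq[OF C] loc_map_eq cinv_left[OF C0(1)])
  then have "(\<lambda>v. frechet_derivative ?s (at p0) (N C x v)) = (\<lambda>v. v)"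
    using has_derivative_unique has_derivative_ident by blast
  then have "inj (N C x)" by (metis injI)
  then show ?thesis
    using N_linear[OF C x] by (simp add: bij_def linear_injective_imp_surjective)
qed

text \<open>The translation differentiated in \<open>N C x\<close> varies with \<open>x\<close>.
  Hence \<open>N C x v\<close> is written as the partial derivative in the second variable of the
  smooth map taking \<open>(x, y)\<close> to the quotient of the two points, restricted to the
  diagonal.\<close>

lemma N_smooth: assumes C: "C \<in> A" shows "smooth_on (cdom C) (\<lambda>x. N C x v)"
proof -
  let ?S = "{(x, y). x \<in> cdom C \<and> y \<in> cdom C \<and> - cinv C x + cinv C y \<in> fst C0}"
  let ?F = "\<lambda>(x, y). snd C0 (- cinv C x + cinv C y)"
  have S: "smooth_on ?S ?F" and o: "open ?S"
    using smooth_diff[OF C C C0(1)] open_diff_dom[OF C C C0(1)] by auto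
  have diag: "(x, x) \<in> ?S" if "x \<in> cdom C" for x using that C0 by auto
  have eq: "N C x v = frechet_derivative ?F (at (x, x)) (0, v)" if "x \<in> cdom C" for x
  proof -
    have "((\<lambda>y. (x, y)) has_derivative (\<lambda>v. (0, v))) (at x)"
      by (auto intro!: derivative_eq_intros)
    from has_derivative_compose[OF this smooth_on_imp_has_derivative[OF S diag[OF that]]]
    have "(loc_map C C0 ((+) (- cinv C x)) has_derivative (\<lambda>v. frechet_derivative ?F (at (x, x)) (0, v))) (at x)"
      by (simp add: loc_map_def o_def)
    then show ?thesis unfolding N_def by (simp add: frechet_derivative_eqI)
  qed
  have "smooth_on (cdom C) (\<lambda>x. frechet_derivative ?F (at (x, x)) (0, v))"
    by (rule smooth_on_compose[OF chart_dom_open[OF C] o _ _ smooth_on_frechet_derivative[OF S]])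
      (rule image_subsetI, erule diag, intro smooth_on_Pair smooth_on_ident chart_dom_open[OF C])
  then show ?thesis
    by (subst smooth_on_cong[OF chart_dom_open[OF C]]) (auto simp: eq)
qed

text \<open>The first vector is the direction of differentiation, the second the argument of the
  form.\<close>

definition dN where "dN C x u v = frechet_derivative (\<lambda>y. N C y v) (at x) u"

lemma dN_has_derivative:
  "C \<in> A \<Longrightarrow> x \<in> cdom C \<Longrightarrow> ((\<lambda>y. N C y v) has_derivative (\<lambda>u. dN C x u v)) (at x)"
  unfolding dN_def by (rule smooth_on_imp_has_derivative[OF N_smooth])

lemma dN_apply:
  fixes f :: "'a::real_normed_vector \<Rightarrow> complex^3"
  assumes "C \<in> A" "open S" "x \<in> S" "\<And>y. y \<in> S \<Longrightarrow> \<tau> y \<in> cdom C"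
    "(\<tau> has_derivative \<tau>') (at x)" "(f has_derivative f') (at x)"
  shows "((\<lambda>y. N C (\<tau> y) (f y)) has_derivative (\<lambda>u. dN C (\<tau> x) (\<tau>' u) (f x) + N C (\<tau> x) (f' u))) (at x)"
proof -
  have "((\<lambda>y. (\<lambda>y. N C (\<tau> y)) y (f y)) has_derivative (\<lambda>u. (\<lambda>b u. dN C (\<tau> x) (\<tau>' u) b) (f x) u + (\<lambda>y. N C (\<tau> y)) x (f' u))) (at x)"
    by (rule has_derivative_apply[OF assms(2,3) N_linear[OF assms(1) assms(4)]
          has_derivative_compose[OF assms(5) dN_has_derivative[OF assms(1) assms(4)[OF assms(3)]]] assms(6)])
  then show ?thesis by simp
qed

lemma dN_linear1: "C \<in> A \<Longrightarrow> x \<in> cdom C \<Longrightarrow> linear (\<lambda>u. dN C x u v)"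
  using dN_has_derivative has_derivative_linear by blast

lemma dN_linear2: assumes C: "C \<in> A" "x \<in> cdom C" shows "linear (dN C x u)"
proof (rule linearI)
  note o = chart_dom_open[OF C(1)]
  fix v w and r :: real
  have "((\<lambda>y. N C y v + N C y w) has_derivative (\<lambda>u. dN C x u v + dN C x u w)) (at x)"
    by (intro has_derivative_add dN_has_derivative C)
  then have "((\<lambda>y. N C y (v + w)) has_derivative (\<lambda>u. dN C x u v + dN C x u w)) (at x)"
    by (rule has_derivative_transform_within_open[OF _ o C(2)]) (simp add: linear_add[OF N_linear[OF C(1)]])
  then show "dN C x u (v + w) = dN C x u v + dN C x u w" by (simp add: dN_def[of _ _ _ "v + w"] frechet_derivative_eqI)
  have "((\<lambda>y. r *\<^sub>R N C y v) has_derivative (\<lambda>u. r *\<^sub>R dN C x u v)) (at x)"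
    by (intro has_derivative_scaleR_right dN_has_derivative C)
  then have "((\<lambda>y. N C y (r *\<^sub>R v)) has_derivative (\<lambda>u. r *\<^sub>R dN C x u v)) (at x)"
    by (rule has_derivative_transform_within_open[OF _ o C(2)]) (simp add: linear_scale[OF N_linear[OF C(1)]])
  then show "dN C x u (r *\<^sub>R v) = r *\<^sub>R dN C x u v" by (simp add: dN_def[of _ _ _ "r *\<^sub>R v"] frechet_derivative_eqI)
qed

lemma bounded_linear_vector_smult: "bounded_linear (\<lambda>v :: complex^3. c *s v)"
proof -
  have "linear (\<lambda>v :: complex^3. c *s v)"
    by (rule linearI) (simp_all add: vec_eq_iff algebra_simps scaleR_conv_of_real)
  then show ?thesis by (rule linear_conv_bounded_linear[THEN iffD1])
qed

lemma dN_clinear: assumes C: "C \<in> A" "x \<in> cdom C" shows "dN C x u (\<i> *s v) = \<i> *s dN C x u v"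
proof -
  have "((\<lambda>y. \<i> *s N C y v) has_derivative (\<lambda>u. \<i> *s dN C x u v)) (at x)"
    by (intro bounded_linear.has_derivative[OF bounded_linear_vector_smult] dN_has_derivative C)
  then have "((\<lambda>y. N C y (\<i> *s v)) has_derivative (\<lambda>u. \<i> *s dN C x u v)) (at x)"
    by (rule has_derivative_transform_within_open[OF _ chart_dom_open[OF C(1)] C(2)]) (simp add: N_clinear C)
  then show ?thesis by (simp add: dN_def[of _ _ _ "\<i> *s v"] frechet_derivative_eqI)
qed

text \<open>The exterior derivative of \<open>N\<close> at the identity is
  \<open>dN C0 p0 u v - dN C0 p0 v u\<close>; the bracket is its negative. That it is also the
  derivative of the adjoint representation is shown in \<open>Ad_deriv\<close>.\<close>

definition br where "br u v = dN C0 p0 v u - dN C0 p0 u v"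

text \<open>\<open>N\<close> is the pullback of its germ at the identity under a left translation,
  and exterior derivatives commute with pullback.\<close>

lemma Maurer_Cartan:
  assumes C: "C \<in> A" "x \<in> cdom C"
  shows "dN C x u v - dN C x v u = - br (N C x u) (N C x v)"
proof -
  let ?S = "loc_dom C C0 ((+) (- cinv C x))" and ?t = "loc_map C C0 ((+) (- cinv C x))"
  let ?Dt = "\<lambda>y. frechet_derivative ?t (at y)"
  have o: "open ?S" and x: "x \<in> ?S"
    using loc_dom_left_open[OF C(1) C0(1)] self_in_loc_dom[OF C] by auto
  have tx: "?t x = p0" using C0 C by (simp add: loc_map_eq p0_def)
  have tS: "?t y \<in> cdom C0" if "y \<in> ?S" for y using that by (auto simp: loc_map_eq loc_dom_eq[OF C(1)])
  have sm: "smooth_on ?S ?t" by (rule smooth_left[OF C(1) C0(1)])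
  \<comment> \<open>Product rule for the transformation law of \<open>N\<close>. The second
    derivative of the translation is symmetric in \<open>u\<close> and \<open>v\<close> and drops
    out of the difference.\<close>
  have key: "dN C x u v = dN C0 p0 (N C x u) (N C x v) + frechet_derivative (\<lambda>y. ?Dt y v) (at x) u" for u v
  proof -
    have "((\<lambda>y. N C0 (?t y) (?Dt y v)) has_derivative
        (\<lambda>u. dN C0 (?t x) (N C x u) (?Dt x v) + N C0 (?t x) (frechet_derivative (\<lambda>y. ?Dt y v) (at x) u))) (at x)"
      by (rule dN_apply[OF C0(1) o x tS N_has_derivative[OF C]
            smooth_on_imp_has_derivative[OF smooth_on_frechet_derivative[OF sm] x]])
    then have "((\<lambda>y. N C y v) has_derivative
        (\<lambda>u. dN C0 (?t x) (N C x u) (?Dt x v) + N C0 (?t x) (frechet_derivative (\<lambda>y. ?Dt y v) (at x) u))) (at x)"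
      by (rule has_derivative_transform_within_open[OF _ o x]) (rule N_trans[OF C(1) C0(1), symmetric])
    then have "dN C x u v = dN C0 (?t x) (N C x u) (?Dt x v) + N C0 (?t x) (frechet_derivative (\<lambda>y. ?Dt y v) (at x) u)"
      unfolding dN_def[of C] by (simp add: frechet_derivative_eqI)
    then show ?thesis by (simp add: tx N_p0 N_def[symmetric])
  qed
  show ?thesis
    using symmetric_second_derivative[OF sm o x, of u v] by (simp add: key br_def)
qed

lemma br_bilinear: "bilinear br"
  unfolding bilinear_def br_def
  by (intro conjI allI linear_compose_sub dN_linear1 dN_linear2 C0 p0)

lemma br_skew: "br u v = - br v u" by (simp add: br_def)

text \<open>This is the vanishing of the twofold exterior derivative of \<open>N\<close> at the
  identity: the structure equation is differentiated once more and summed cyclically.\<close>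

lemma Jacobi: "br u (br v w) + br v (br w u) + br w (br u v) = 0"
proof -
  interpret B: bounded_bilinear br
    using br_bilinear bilinear_conv_bounded_bilinear by blast
  note o = chart_dom_open[OF C0(1)]
  define n where "n = dN C0 p0"
  define n2 where "n2 w u v = frechet_derivative (\<lambda>y. dN C0 y u v) (at p0) w" for w u v
  have n: "((\<lambda>y. N C0 y v) has_derivative (\<lambda>u. n u v)) (at p0)" for v
    unfolding n_def by (intro dN_has_derivative C0 p0)
  have n2: "((\<lambda>y. dN C0 y u v) has_derivative (\<lambda>w. n2 w u v)) (at p0)" for u v
    unfolding n2_def dN_def
    by (rule smooth_on_imp_has_derivative[OF smooth_on_frechet_derivative[OF N_smooth[OF C0(1)]] p0(1)])
  have sym: "n2 w u v = n2 u w v" for u v w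
    unfolding n2_def dN_def by (rule symmetric_second_derivative[OF N_smooth[OF C0(1)] o p0(1)])
  \<comment> \<open>The structure equation differentiated in direction \<open>w\<close>.\<close>
  have eq: "n2 w u v - n2 w v u = - (br u (n w v) + br (n w u) v)" for u v w
  proof -
    have 1: "((\<lambda>y. dN C0 y u v - dN C0 y v u) has_derivative (\<lambda>w. n2 w u v - n2 w v u)) (at p0)"
      by (intro has_derivative_diff n2)
    have "((\<lambda>y. - br (N C0 y u) (N C0 y v)) has_derivative
        (\<lambda>w. - (br (N C0 p0 u) (n w v) + br (n w u) (N C0 p0 v)))) (at p0)"
      by (intro has_derivative_minus B.FDERIV n)
    then have "((\<lambda>y. dN C0 y u v - dN C0 y v u) has_derivative
        (\<lambda>w. - (br (N C0 p0 u) (n w v) + br (n w u) (N C0 p0 v)))) (at p0)"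
      by (rule has_derivative_transform_within_open[OF _ o p0(1)]) (simp add: Maurer_Cartan C0)
    from has_derivative_unique[OF 1 this] show ?thesis by (metis N_p0)
  qed
  have brn: "br u v = n v u - n u v" for u v by (simp add: br_def n_def)
  \<comment> \<open>In the cyclic sum the second derivatives of \<open>N\<close> cancel in pairs by
    \<open>sym\<close>.\<close>
  have e: "(br u (n w v) + br (n w u) v) + (br v (n u w) + br (n u v) w) + (br w (n v u) + br (n v w) u) = 0"
  proof -
    have "br u (n w v) + br (n w u) v = n2 w v u - n2 w u v" for u v w
      using eq[of w u v] by (metis minus_diff_eq minus_minus)
    then show ?thesis using sym[of w u v] sym[of u v w] sym[of v w u] by simp
  qed
  have a: "br u (br v w) = br u (n w v) - br u (n v w)" "br v (br w u) = br v (n u w) - br v (n w u)"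
    "br w (br u v) = br w (n v u) - br w (n u v)"
    by (simp_all add: brn[of v w] brn[of w u] brn[of u v] B.diff_right)
  show ?thesis
    unfolding a using e unfolding br_skew[of "n w u" v] br_skew[of "n u v" w] br_skew[of "n v w" u]
    by (simp add: algebra_simps)
qed

end

section \<open>Nilpotency of the Lie algebra\<close>

lemma gen_subgroup_superset: "x \<in> S \<Longrightarrow> x \<in> gen_subgroup S"
  by (auto simp: gen_subgroup_def)

lemma iterated_commutator_lower_central:
  "foldr (\<lambda>x g. x + g - x - g) xs g \<in> lower_central (length xs)"
  by (induction xs) (auto intro!: gen_subgroup_superset)

lemma iterated_commutator_zero: "foldr (\<lambda>x g. x + g - x - g) xs (0::'g::group_add) = 0"
  by (induction xs) auto

context lie_group_cs
begin

section \<open>The group law near the identity and the adjoint representation\<close>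

definition mul where "mul = (\<lambda>(x, y). snd C0 (cinv C0 x + cinv C0 y))"
definition mul_dom where
  "mul_dom = {(x, y). x \<in> cdom C0 \<and> y \<in> cdom C0 \<and> cinv C0 x + cinv C0 y \<in> fst C0}"

lemma mul_smooth: "smooth_on mul_dom mul" and mul_dom_open: "open mul_dom"
  unfolding mul_def mul_dom_def by (intro smooth_mult open_mult_dom C0)+

lemma p0_mul_dom: "p \<in> cdom C0 \<Longrightarrow> (p, p0) \<in> mul_dom" "p \<in> cdom C0 \<Longrightarrow> (p0, p) \<in> mul_dom"
  using C0 cinv_mem by (auto simp: mul_dom_def)

lemma mul_has_derivative:
  "z \<in> mul_dom \<Longrightarrow> (mul has_derivative frechet_derivative mul (at z)) (at z)"
  by (rule smooth_on_imp_has_derivative[OF mul_smooth])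

lemma mul_deriv_Pair1:
  assumes "z \<in> mul_dom"
  shows "((\<lambda>p. mul (p, snd z)) has_derivative (\<lambda>u. frechet_derivative mul (at z) (u, 0))) (at (fst z))"
proof -
  have "((\<lambda>p. (p, snd z)) has_derivative (\<lambda>u. (u, 0))) (at (fst z))" by (auto intro!: derivative_eq_intros)
  from has_derivative_compose[OF this, of mul] mul_has_derivative[OF assms] show ?thesis by simp
qed

lemma mul_deriv_Pair2:
  assumes "z \<in> mul_dom"
  shows "((\<lambda>p. mul (fst z, p)) has_derivative (\<lambda>u. frechet_derivative mul (at z) (0, u))) (at (snd z))"
proof -
  have "((\<lambda>p. (fst z, p)) has_derivative (\<lambda>u. (0, u))) (at (snd z))" by (auto intro!: derivative_eq_intros)
  from has_derivative_compose[OF this, of mul] mul_has_derivative[OF assms] show ?thesis by simp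
qed

lemma mul_deriv_p0: "frechet_derivative mul (at (p0, p0)) (u, v) = u + v"
proof -
  let ?D = "frechet_derivative mul (at (p0, p0))"
  note o = chart_dom_open[OF C0(1)]
  have "((\<lambda>p. p) has_derivative (\<lambda>u. ?D (u, 0))) (at p0)"
    using mul_deriv_Pair1[OF p0_mul_dom(1)[OF p0(1)], unfolded fst_conv snd_conv]
    by (rule has_derivative_transform_within_open[OF _ o]) (auto simp: mul_def simp del: cinv_left[OF C0(1)])
  then have 1: "?D (u, 0) = u" using has_derivative_unique[OF has_derivative_ident] by metis
  have "((\<lambda>p. p) has_derivative (\<lambda>u. ?D (0, u))) (at p0)"
    using mul_deriv_Pair2[OF p0_mul_dom(1)[OF p0(1)], unfolded fst_conv snd_conv]
    by (rule has_derivative_transform_within_open[OF _ o]) (auto simp: mul_def simp del: cinv_left[OF C0(1)])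
  then have 2: "?D (0, v) = v" using has_derivative_unique[OF has_derivative_ident] by metis
  have "linear ?D" using mul_has_derivative[OF p0_mul_dom(1)[OF p0(1)]] has_derivative_linear by blast
  from linear_add[OF this, of "(u, 0)" "(0, v)"] show ?thesis by (simp add: 1 2)
qed

lemma mul_has_derivative_p0: "(mul has_derivative (\<lambda>z. fst z + snd z)) (at (p0, p0))"
proof -
  have "frechet_derivative mul (at (p0, p0)) = (\<lambda>z. fst z + snd z)"
    by (rule ext) (metis mul_deriv_p0 prod.collapse)
  then show ?thesis using mul_has_derivative[OF p0_mul_dom(1)[OF p0(1)]] by simp
qed

text \<open>Differentiate the product of \<open>y\<close> with its inverse, which is constant, using
  that the derivative of the group law at the identity is addition.\<close>

lemma uminus_deriv_p0:
  "(loc_map C0 C0 uminus has_derivative (\<lambda>v. - v)) (at p0)"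
proof -
  let ?i = "loc_map C0 C0 uminus" and ?S = "loc_dom C0 C0 uminus"
  have p: "p0 \<in> ?S" using C0 by (simp add: loc_dom_eq)
  have i: "(?i has_derivative frechet_derivative ?i (at p0)) (at p0)"
    by (rule smooth_on_imp_has_derivative[OF smooth_uminus p]) (rule C0)+
  have ip: "?i p0 = p0" by (simp add: loc_map_eq p0_def[symmetric])
  have "((\<lambda>y. (y, ?i y)) has_derivative (\<lambda>v. (v, frechet_derivative ?i (at p0) v))) (at p0)"
    by (intro has_derivative_Pair has_derivative_ident i)
  from has_derivative_compose[OF this, of mul "\<lambda>z. fst z + snd z"] mul_has_derivative_p0
  have "((\<lambda>y. mul (y, ?i y)) has_derivative (\<lambda>v. v + frechet_derivative ?i (at p0) v)) (at p0)"
    by (simp add: ip)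
  then have "((\<lambda>y. p0) has_derivative (\<lambda>v. v + frechet_derivative ?i (at p0) v)) (at p0)"
    by (rule has_derivative_transform_within_open[OF _ loc_dom_uminus_open p])
      (auto simp: C0 loc_dom_eq loc_map_eq mul_def p0_def cinv_left[OF C0(1)])
  from fun_cong[OF has_derivative_unique[OF has_derivative_const this]]
  have "v + frechet_derivative ?i (at p0) v = 0" for v by simp
  then have "frechet_derivative ?i (at p0) = (\<lambda>v. - v)" by (metis add.commute eq_neg_iff_add_eq_0 ext)
  then show ?thesis using i by simp
qed

definition Ad where "Ad x = frechet_derivative (\<lambda>y. snd C0 (x + cinv C0 y - x)) (at p0)"

lemma Ad_has_derivative: "((\<lambda>y. snd C0 (x + cinv C0 y - x)) has_derivative Ad x) (at p0)"
proof -
  obtain B where B: "B \<in> A" "x \<in> fst B" using charts_cover by blast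
  let ?l = "loc_map C0 B ((+) x)" and ?r = "loc_map B C0 (\<lambda>g. g + - x)"
  have p: "p0 \<in> loc_dom C0 B ((+) x)" using B by (simp add: loc_dom_eq C0)
  have lp: "?l p0 = snd B x" by (simp add: loc_map_eq)
  have q: "snd B x \<in> loc_dom B C0 (\<lambda>g. g + - x)" using B C0 by (simp add: loc_dom_eq)
  obtain D E where D: "(?l has_derivative D) (at p0)" and E: "(?r has_derivative E) (at (?l p0))"
    using smooth_on_imp_has_derivative[OF smooth_left[OF C0(1) B(1)] p]
      smooth_on_imp_has_derivative[OF smooth_right[OF B(1) C0(1)] q] unfolding lp by blast
  have "((\<lambda>y. ?r (?l y)) has_derivative (\<lambda>v. E (D v))) (at p0)"
    by (rule has_derivative_compose[OF D E])
  then have "((\<lambda>y. snd C0 (x + cinv C0 y - x)) has_derivative (\<lambda>v. E (D v))) (at p0)"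
    by (rule has_derivative_transform_within_open[OF _ loc_dom_left_open[OF C0(1) B(1)] p])
      (auto simp: loc_map_eq loc_dom_eq C0 B)
  then show ?thesis unfolding Ad_def using frechet_derivative_eqI by metis
qed

lemma Ad_linear: "linear (Ad x)" using Ad_has_derivative has_derivative_linear by blast

text \<open>The commutator is the product of a conjugate of \<open>y\<close> with the inverse of
  \<open>y\<close>, both equal to the identity at \<open>p0\<close>, so the derivatives add.\<close>

lemma commutator_has_derivative:
  "((\<lambda>y. snd C0 (x + cinv C0 y - x - cinv C0 y)) has_derivative (\<lambda>w. Ad x w - w)) (at p0)"
proof -
  let ?S = "{y \<in> cdom C0. x + cinv C0 y - x \<in> fst C0} \<inter> loc_dom C0 C0 uminus"
  have o: "open ?S"
    by (intro open_Int open_cinv_preimage C0 chart_open loc_dom_uminus_open)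
      (auto intro!: continuous_intros)
  have p: "p0 \<in> ?S" using C0 by (simp add: loc_dom_eq)
  have "((\<lambda>y. (snd C0 (x + cinv C0 y - x), loc_map C0 C0 uminus y)) has_derivative (\<lambda>v. (Ad x v, - v))) (at p0)"
    by (intro has_derivative_Pair Ad_has_derivative uminus_deriv_p0)
  from has_derivative_compose[OF this, of mul "\<lambda>z. fst z + snd z"] mul_has_derivative_p0
  have "((\<lambda>y. mul (snd C0 (x + cinv C0 y - x), loc_map C0 C0 uminus y)) has_derivative (\<lambda>w. Ad x w - w)) (at p0)"
    by (simp add: loc_map_eq p0_def[symmetric])
  then show ?thesis
    by (rule has_derivative_transform_within_open[OF _ o p])
      (auto simp: mul_def loc_map_eq loc_dom_eq C0)
qed

text \<open>Every commutator map fixes the identity, hence the chain rule can be iterated at the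
  single point \<open>p0\<close>.\<close>

lemma iterated_commutator_has_derivative:
  "((\<lambda>y. snd C0 (foldr (\<lambda>x g. x + g - x - g) xs (cinv C0 y))) has_derivative
    foldr (\<lambda>x w. Ad x w - w) xs) (at p0)"
proof (induction xs)
  case Nil
  have "((\<lambda>y. y) has_derivative (\<lambda>v. v)) (at p0)" by (rule has_derivative_ident)
  then have "((\<lambda>y. snd C0 (cinv C0 y)) has_derivative (\<lambda>v. v)) (at p0)"
    by (rule has_derivative_transform_within_open[OF _ chart_dom_open[OF C0(1)] p0(1)]) simp
  then show ?case by (simp add: id_def)
next
  case (Cons x xs)
  let ?f = "\<lambda>g. foldr (\<lambda>x g. x + g - x - g) xs g"
  have cont: "continuous_on UNIV ?f"
    by (induction xs) (auto intro!: continuous_intros)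
  let ?S = "{y \<in> cdom C0. ?f (cinv C0 y) \<in> fst C0}"
  have o: "open ?S" by (intro open_cinv_preimage C0 chart_open cont)
  have p: "p0 \<in> ?S" using C0 by (simp add: iterated_commutator_zero)
  have q: "snd C0 (?f (cinv C0 p0)) = p0" by (simp add: iterated_commutator_zero p0_def[symmetric])
  have "((\<lambda>y. (\<lambda>y. snd C0 (x + cinv C0 y - x - cinv C0 y)) (snd C0 (?f (cinv C0 y)))) has_derivative
      (\<lambda>v. Ad x (foldr (\<lambda>x w. Ad x w - w) xs v) - foldr (\<lambda>x w. Ad x w - w) xs v)) (at p0)"
    by (rule has_derivative_compose[OF Cons.IH]) (unfold q, rule commutator_has_derivative)
  then have "((\<lambda>y. snd C0 (x + ?f (cinv C0 y) - x - ?f (cinv C0 y))) has_derivative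
      (\<lambda>v. Ad x (foldr (\<lambda>x w. Ad x w - w) xs v) - foldr (\<lambda>x w. Ad x w - w) xs v)) (at p0)"
    by (rule has_derivative_transform_within_open[OF _ o p]) (auto simp: C0)
  then show ?case by (simp add: o_def)
qed

text \<open>A commutator nested as deep as the nilpotency class is constant, so its derivative
  vanishes.\<close>

lemma Ad_nilpotent: "\<exists>n. \<forall>xs w. length xs = n \<longrightarrow> foldr (\<lambda>x w. Ad x w - w) xs w = 0"
proof -
  obtain n where n: "lower_central n = {0 :: 'g}"
    using nilp_cs by (auto simp: nilpotent_lie_group_cs_def nilpotent_group_def)
  have "foldr (\<lambda>x w. Ad x w - w) xs w = 0" if "length xs = n" for xs w
  proof -
    have z: "foldr (\<lambda>x g. x + g - x - g) xs g = 0" for g :: 'g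
      using iterated_commutator_lower_central[of xs g] n that by auto
    have "((\<lambda>y. snd C0 0) has_derivative foldr (\<lambda>x w. Ad x w - w) xs) (at p0)"
      using iterated_commutator_has_derivative[of xs] unfolding z .
    from fun_cong[OF has_derivative_unique[OF has_derivative_const this], of w] show ?thesis by simp
  qed
  then show ?thesis by blast
qed

text \<open>The conditions keep the product, the conjugate and the inverse inside the chart
  \<open>C0\<close>, so that conjugation can be written with \<open>mul\<close> and the inversion in
  this one chart.\<close>

definition conj_dom where "conj_dom = {(p, y). p \<in> cdom C0 \<and> y \<in> cdom C0 \<and> cinv C0 p + cinv C0 y \<in> fst C0} \<inter>
   {(p, y). p \<in> cdom C0 \<and> y \<in> cdom C0 \<and> cinv C0 p + cinv C0 y - cinv C0 p \<in> fst C0} \<inter>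
   {(p, y). p \<in> cdom C0 \<and> y \<in> cdom C0 \<and> - cinv C0 p \<in> fst C0}"

lemma conj_dom_open: "open conj_dom"
  unfolding conj_dom_def
  by (intro open_Int open_cinv_preimage2[where f = "\<lambda>g h. g + h"] open_cinv_preimage2[where f = "\<lambda>g h. g + h - g"]
      open_cinv_preimage2[where f = "\<lambda>g h. - g"] C0 chart_open)
    (auto simp: case_prod_beta intro!: continuous_intros)

lemma p0_conj_dom: "(p0, p0) \<in> conj_dom" using C0 by (simp add: conj_dom_def)

lemma conj_smooth: "smooth_on conj_dom (\<lambda>(p, y). snd C0 (cinv C0 p + cinv C0 y - cinv C0 p))"
proof -
  have 1: "smooth_on conj_dom mul"
    by (rule smooth_on_mono[OF mul_smooth]) (auto simp: conj_dom_def mul_dom_def)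
  have 2: "smooth_on conj_dom (\<lambda>z. loc_map C0 C0 uminus (fst z))"
    by (rule smooth_on_compose[OF conj_dom_open loc_dom_uminus_open _ _ smooth_uminus])
      (auto simp: C0 loc_dom_eq conj_dom_def intro: smooth_on_bounded_linear bounded_linear_fst)
  have "smooth_on conj_dom (\<lambda>z. mul (mul z, loc_map C0 C0 uminus (fst z)))"
    by (rule smooth_on_compose[OF conj_dom_open mul_dom_open _ smooth_on_Pair[OF conj_dom_open 1 2] mul_smooth])
      (auto simp: conj_dom_def mul_dom_def mul_def loc_map_eq C0)
  then show ?thesis
    by (subst smooth_on_cong[OF conj_dom_open]) (auto simp: conj_dom_def mul_def loc_map_eq C0)
qed

text \<open>Both sides are expressed through the second derivative \<open>M\<close> of the group law
  at the identity. The bracket was defined through \<open>N\<close>, not through \<open>Ad\<close>,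
  so the two computations are independent and meet in the antisymmetrisation of
  \<open>M\<close>.\<close>

lemma Ad_deriv: "((\<lambda>p. Ad (cinv C0 p) w) has_derivative (\<lambda>u. br u w)) (at p0)"
proof -
  define H where "H = (\<lambda>(p, y). snd C0 (cinv C0 p + cinv C0 y - cinv C0 p))"
  define W where "W = {p. (p, p0) \<in> conj_dom}"
  note o0 = chart_dom_open[OF C0(1)]
  have oW: "open W"
  proof -
    have "W = (\<lambda>p. (p, p0)) -` conj_dom" by (auto simp: W_def)
    then show ?thesis using conj_dom_open by (auto intro!: open_vimage continuous_intros)
  qed
  have pW: "p0 \<in> W" using p0_conj_dom by (simp add: W_def)
  have Wdom: "p \<in> cdom C0" if "p \<in> W" for p using that by (auto simp: W_def conj_dom_def)
  have HS: "smooth_on conj_dom H" using conj_smooth by (simp add: H_def)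
  have AdH: "Ad (cinv C0 p) w = frechet_derivative H (at (p, p0)) (0, w)" if "p \<in> W" for p w
  proof -
    have "((\<lambda>y. (p, y)) has_derivative (\<lambda>u. (0, u))) (at p0)" by (auto intro!: derivative_eq_intros)
    from has_derivative_compose[OF this, of H] smooth_on_imp_has_derivative[OF HS, of "(p, p0)"] that
    have "((\<lambda>y. H (p, y)) has_derivative (\<lambda>u. frechet_derivative H (at (p, p0)) (0, u))) (at p0)"
      by (simp add: W_def)
    then show ?thesis unfolding Ad_def by (simp add: H_def frechet_derivative_eqI)
  qed
  have "smooth_on W (\<lambda>p. frechet_derivative H (at (p, p0)) (0, w))"
    by (rule smooth_on_compose[OF oW conj_dom_open _ _ smooth_on_frechet_derivative[OF HS], where f = "\<lambda>p. (p, p0)"])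
      (auto simp: W_def intro!: smooth_on_Pair oW[unfolded W_def] smooth_on_ident smooth_on_const)
  then have sm: "smooth_on W (\<lambda>p. Ad (cinv C0 p) w)"
    by (subst smooth_on_cong[OF oW]) (auto simp: AdH)
  define f where "f p = Ad (cinv C0 p) w" for p
  define f' where "f' = frechet_derivative f (at p0)"
  have f': "(f has_derivative f') (at p0)"
    unfolding f'_def by (rule smooth_on_imp_has_derivative[OF _ pW]) (use sm in \<open>simp add: f_def[abs_def]\<close>)
  have f0: "f p0 = w"
  proof -
    have "((\<lambda>y. snd C0 (0 + cinv C0 y - 0)) has_derivative (\<lambda>v. v)) (at p0)"
      by (rule has_derivative_transform_within_open[OF has_derivative_ident o0 p0(1)]) simp
    then show ?thesis by (simp add: f_def Ad_def frechet_derivative_eqI)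
  qed
  define M where "M a b = frechet_derivative (\<lambda>z. frechet_derivative mul (at z) b) (at (p0, p0)) a" for a b
  have M: "((\<lambda>z. frechet_derivative mul (at z) b) has_derivative (\<lambda>a. M a b)) (at (p0, p0))" for b
    unfolding M_def by (rule smooth_on_imp_has_derivative[OF smooth_on_frechet_derivative[OF mul_smooth] p0_mul_dom(1)[OF p0(1)]])
  have Msym: "M a b = M b a" for a b
    unfolding M_def by (rule symmetric_second_derivative[OF mul_smooth mul_dom_open p0_mul_dom(1)[OF p0(1)]])
  \<comment> \<open>The group identity \<open>p + y = (p + y - p) + p\<close>, differentiated in
    \<open>y\<close> at the identity. Differentiating the result in \<open>p\<close> gives the
    derivative of \<open>Ad\<close>.\<close>
  have id: "frechet_derivative mul (at (p, p0)) (0, w) = frechet_derivative mul (at (p0, p)) (f p, 0)"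
    if p: "p \<in> W" for p
  proof -
    let ?S = "{y. (p, y) \<in> conj_dom}"
    have oS: "open ?S"
    proof -
      have "?S = (\<lambda>y. (p, y)) -` conj_dom" by auto
      then show ?thesis using conj_dom_open by (auto intro!: open_vimage continuous_intros)
    qed
    have pS: "p0 \<in> ?S" using p by (simp add: W_def)
    have 1: "((\<lambda>y. mul (p, y)) has_derivative (\<lambda>w. frechet_derivative mul (at (p, p0)) (0, w))) (at p0)"
      using mul_deriv_Pair2[OF p0_mul_dom(1)[OF Wdom[OF p]]] by simp
    have k0: "snd C0 (cinv C0 p + cinv C0 p0 - cinv C0 p) = p0" by (simp add: p0_def[symmetric])
    have "((\<lambda>q. mul (q, p)) has_derivative (\<lambda>u. frechet_derivative mul (at (p0, p)) (u, 0))) (at p0)"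
      using mul_deriv_Pair1[OF p0_mul_dom(2)[OF Wdom[OF p]]] by simp
    then have "((\<lambda>y. mul (snd C0 (cinv C0 p + cinv C0 y - cinv C0 p), p)) has_derivative
        (\<lambda>w. frechet_derivative mul (at (p0, p)) (Ad (cinv C0 p) w, 0))) (at p0)"
      by (intro has_derivative_compose[OF Ad_has_derivative]) (simp only: k0)
    then have "((\<lambda>y. mul (p, y)) has_derivative
        (\<lambda>w. frechet_derivative mul (at (p0, p)) (Ad (cinv C0 p) w, 0))) (at p0)"
      by (rule has_derivative_transform_within_open[OF _ oS pS])
        (auto simp: conj_dom_def mul_def C0 diff_add_cancel)
    from fun_cong[OF has_derivative_unique[OF 1 this], of w] show ?thesis by (simp add: f_def)
  qed
  have 1: "((\<lambda>p. frechet_derivative mul (at (p, p0)) (0, w)) has_derivative (\<lambda>u. M (u, 0) (0, w))) (at p0)"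
    by (rule has_derivative_compose[where f = "\<lambda>p. (p, p0)", OF _ M]) (auto intro!: derivative_eq_intros)
  have "((\<lambda>p. (\<lambda>p z. frechet_derivative mul (at (p0, p)) (z, 0)) p (f p)) has_derivative
      (\<lambda>u. (\<lambda>z u. M (0, u) (z, 0)) (f p0) u + (\<lambda>p z. frechet_derivative mul (at (p0, p)) (z, 0)) p0 (f' u))) (at p0)"
  proof (rule has_derivative_apply[OF o0 p0(1) _ _ f'])
    fix p assume "p \<in> cdom C0"
    from mul_deriv_Pair1[OF p0_mul_dom(2)[OF this]]
    show "linear (\<lambda>z. frechet_derivative mul (at (p0, p)) (z, 0))" using has_derivative_linear by auto
  next
    fix b
    show "((\<lambda>p. frechet_derivative mul (at (p0, p)) (b, 0)) has_derivative (\<lambda>u. M (0, u) (b, 0))) (at p0)"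
      by (rule has_derivative_compose[where f = "\<lambda>p. (p0, p)", OF _ M]) (auto intro!: derivative_eq_intros)
  qed
  then have 2: "((\<lambda>p. frechet_derivative mul (at (p0, p)) (f p, 0)) has_derivative (\<lambda>u. M (0, u) (w, 0) + f' u)) (at p0)"
    by (simp add: f0 mul_deriv_p0)
  have "((\<lambda>p. frechet_derivative mul (at (p, p0)) (0, w)) has_derivative (\<lambda>u. M (0, u) (w, 0) + f' u)) (at p0)"
    by (rule has_derivative_transform_within_open[OF 2 oW pW]) (simp add: id)
  from fun_cong[OF has_derivative_unique[OF 1 this]]
  have f'M: "f' u = M (u, 0) (0, w) - M (w, 0) (0, u)" for u
    by (simp add: Msym[of "(0, u)"] algebra_simps)
  \<comment> \<open>\<open>N C0 p\<close> inverts the differential of the left translation by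
    \<open>p\<close>; at the identity the derivative of the inverse is minus the derivative.\<close>
  have NM: "dN C0 p0 u v = - M (u, 0) (0, v)" for u v
  proof -
    have Nm: "N C0 p (frechet_derivative mul (at (p, p0)) (0, v)) = v" if p: "p \<in> cdom C0" for p
    proof -
      let ?t = "loc_map C0 C0 ((+) (cinv C0 p))"
      have "p0 \<in> loc_dom C0 C0 ((+) (cinv C0 p))" using p cinv_mem C0 by (auto simp: loc_dom_eq)
      from N_trans[OF C0(1) C0(1) this, of v]
      have "v = N C0 p (frechet_derivative ?t (at p0) v)" using p by (simp add: N_p0 loc_map_eq)
      moreover have "(?t has_derivative (\<lambda>w. frechet_derivative mul (at (p, p0)) (0, w))) (at p0)"
        using mul_deriv_Pair2[OF p0_mul_dom(1)[OF p]] by (simp add: mul_def loc_map_def o_def)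
      ultimately show ?thesis by (simp add: frechet_derivative_eqI)
    qed
    have d: "((\<lambda>p. frechet_derivative mul (at (p, p0)) (0, v)) has_derivative (\<lambda>u. M (u, 0) (0, v))) (at p0)"
      by (rule has_derivative_compose[where f = "\<lambda>p. (p, p0)", OF _ M]) (auto intro!: derivative_eq_intros)
    from dN_apply[OF C0(1) o0 p0(1) _ has_derivative_ident d]
    have "((\<lambda>p. N C0 p (frechet_derivative mul (at (p, p0)) (0, v))) has_derivative
       (\<lambda>u. dN C0 p0 u v + M (u, 0) (0, v))) (at p0)"
      by (simp add: N_p0 mul_deriv_p0)
    then have "((\<lambda>p. v) has_derivative (\<lambda>u. dN C0 p0 u v + M (u, 0) (0, v))) (at p0)"
      by (rule has_derivative_transform_within_open[OF _ o0 p0(1)]) (rule Nm)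
    from fun_cong[OF has_derivative_unique[OF has_derivative_const this], of u] show ?thesis
      by (simp add: eq_neg_iff_add_eq_0)
  qed
  have "f' = (\<lambda>u. br u w)" by (rule ext) (simp add: f'M br_def NM)
  then show ?thesis using f' by (simp add: f_def[abs_def])
qed

text \<open>The factors \<open>Ad x - 1\<close> are turned into brackets one at a time, starting
  from the outermost. The linear map \<open>L\<close> is a parameter of the induction because it
  absorbs the factors that are still in group form.\<close>

lemma br_nilpotent: "\<exists>n. \<forall>Xs w. length Xs = n \<longrightarrow> foldr br Xs w = 0"
proof -
  \<comment> \<open>A function of \<open>x\<close> that vanishes identically has zero derivative at
    the identity, and the derivative of \<open>Ad\<close> there is the bracket.\<close>
  have step: "L (br X z) = 0" if L: "linear L" and z: "\<And>x. L (Ad x z - z) = 0"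
    for L :: "complex^3 \<Rightarrow> complex^3" and X z
  proof -
    have "((\<lambda>p. L (Ad (cinv C0 p) z - z)) has_derivative (\<lambda>u. L (br u z - 0))) (at p0)"
      by (intro bounded_linear.has_derivative[OF L[unfolded linear_conv_bounded_linear]]
          has_derivative_diff Ad_deriv has_derivative_const)
    then have "((\<lambda>p. 0) has_derivative (\<lambda>u. L (br u z))) (at p0)" by (simp add: z)
    from fun_cong[OF has_derivative_unique[OF this has_derivative_const], of X] show ?thesis by simp
  qed
  have main: "L (foldr br Xs w) = 0"
    if "linear L" and "\<And>xs w. length xs = n \<Longrightarrow> L (foldr (\<lambda>x w. Ad x w - w) xs w) = 0" and "length Xs = n"
    for n and L :: "complex^3 \<Rightarrow> complex^3" and Xs w
    using that
  proof (induction n arbitrary: L Xs w)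
    case 0
    then show ?case using "0.prems"(2)[of "[]"] by simp
  next
    case (Suc n)
    obtain X Ys where Xs: "Xs = X # Ys" "length Ys = n" using Suc.prems(3) by (cases Xs) auto
    \<comment> \<open>The induction hypothesis is applied to \<open>L\<close> composed with
      \<open>Ad x - 1\<close>; only then is \<open>x\<close> differentiated away.\<close>
    have "L (Ad x (foldr br Ys w) - foldr br Ys w) = 0" for x
    proof (rule Suc.IH[where L = "\<lambda>z. L (Ad x z - z)"])
      show "linear (\<lambda>z. L (Ad x z - z))"
        by (intro linear_compose[OF _ Suc.prems(1), unfolded o_def] linear_compose_sub Ad_linear linear_ident)
      show "L (Ad x (foldr (\<lambda>x w. Ad x w - w) xs w) - foldr (\<lambda>x w. Ad x w - w) xs w) = 0"
        if "length xs = n" for xs w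
        using Suc.prems(2)[of "x # xs" w] that by simp
    qed (rule Xs)
    then show ?case using step[OF Suc.prems(1)] by (simp add: Xs)
  qed
  obtain n where "\<And>xs w. length xs = n \<Longrightarrow> foldr (\<lambda>x w. Ad x w - w) xs w = 0" using Ad_nilpotent by blast
  then show ?thesis using main[of "\<lambda>x. x" n] linear_ident by blast
qed

end

section \<open>Invariant forms on the quotient\<close>

lemma alt_forms_linear:
  "t \<in> alt_forms k \<Longrightarrow> length vs = k \<Longrightarrow> i < k \<Longrightarrow> linear (\<lambda>v. t (vs[i := v]))"
  by (auto simp: alt_forms_def)

lemma alt_forms_length: "t \<in> alt_forms k \<Longrightarrow> length vs \<noteq> k \<Longrightarrow> t vs = 0"
  by (auto simp: alt_forms_def)

lemma alt_forms_comp: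
  assumes t: "t \<in> alt_forms k" and L: "linear L"
  shows "(\<lambda>vs. t (map L vs)) \<in> alt_forms k"
  unfolding alt_forms_def
proof (intro CollectI conjI allI impI)
  fix vs :: "(complex^3) list" and i assume "length vs = k" "i < k"
  then have "linear (\<lambda>v. t ((map L vs)[i := v]))" using alt_forms_linear[OF t] by simp
  from linear_compose[OF L this] show "linear (\<lambda>v. t (map L (vs[i := v])))"
    by (simp add: o_def map_update)
next
  fix vs :: "(complex^3) list" and i j assume "length vs = k" "i < j" "j < k" "vs ! i = vs ! j"
  then show "t (map L vs) = 0" using t by (auto simp: alt_forms_def)
qed (use t in \<open>auto simp: alt_forms_def\<close>)

text \<open>Induction on the number \<open>j\<close> of leading arguments that may vary: argument
  \<open>j\<close> is expanded in the basis, which makes it constant.\<close>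

lemma multilinear_smooth:
  fixes t :: cform and fs :: "('a::real_normed_vector \<Rightarrow> complex^3) list"
  assumes t: "t \<in> alt_forms k" and S: "open S"
    and "length fs = k" "\<And>i. i < k \<Longrightarrow> smooth_on S (fs ! i)"
  shows "smooth_on S (\<lambda>x. t (map (\<lambda>f. f x) fs))"
proof -
  have main: "j \<le> k \<Longrightarrow> length fs = k \<Longrightarrow> (\<And>i. i < k \<Longrightarrow> smooth_on S (fs ! i)) \<Longrightarrow>
      (\<And>i. j \<le> i \<Longrightarrow> i < k \<Longrightarrow> \<exists>c. fs ! i = (\<lambda>x. c)) \<Longrightarrow> smooth_on S (\<lambda>x. t (map (\<lambda>f. f x) fs))"
    for j and fs :: "('a \<Rightarrow> complex^3) list"
  proof (induction j arbitrary: fs)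
    case 0
    have "map (\<lambda>f. f x) fs = map (\<lambda>f. f undefined) fs" for x
    proof (rule nth_equalityI)
      fix i assume "i < length (map (\<lambda>f. f x) fs)"
      then obtain c where "fs ! i = (\<lambda>x. c)" using 0(2) 0(4)[of i] by auto
      then show "map (\<lambda>f. f x) fs ! i = map (\<lambda>f. f undefined) fs ! i"
        using \<open>i < _\<close> by simp
    qed simp
    then have "(\<lambda>x. t (map (\<lambda>f. f x) fs)) = (\<lambda>x. t (map (\<lambda>f. f undefined) fs))" by metis
    then show ?case by (simp add: smooth_on_const)
  next
    case (Suc j)
    let ?f = "fs ! j"
    have "t (map (\<lambda>f. f x) fs) = (\<Sum>b\<in>Basis. (?f x \<bullet> b) *\<^sub>R t (map (\<lambda>f. f x) (fs[j := \<lambda>_. b])))" for x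
    proof -
      let ?vs = "map (\<lambda>f. f x) fs"
      interpret linear "\<lambda>v. t (?vs[j := v])"
        by (rule alt_forms_linear[OF t]) (use Suc.prems in auto)
      have "t ?vs = t (?vs[j := ?f x])" using Suc.prems(1,2) list_update_id[of ?vs j] by simp
      also have "\<dots> = t (?vs[j := \<Sum>b\<in>Basis. (?f x \<bullet> b) *\<^sub>R b])" by (simp only: euclidean_representation)
      also have "\<dots> = (\<Sum>b\<in>Basis. (?f x \<bullet> b) *\<^sub>R t (?vs[j := b]))" by (simp add: sum scaleR)
      finally show ?thesis by (simp add: map_update)
    qed
    moreover have "smooth_on S (\<lambda>x. \<Sum>b\<in>Basis. (?f x \<bullet> b) *\<^sub>R t (map (\<lambda>f. f x) (fs[j := \<lambda>_. b])))"
    proof (rule smooth_on_sum[OF S], rule smooth_on_bilinear[OF bounded_bilinear_scaleR S])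
      fix b :: "complex^3"
      show "smooth_on S (\<lambda>x. ?f x \<bullet> b)"
        by (rule smooth_on_linear_comp[OF bounded_linear_inner_left S]) (use Suc.prems in auto)
      show "smooth_on S (\<lambda>x. t (map (\<lambda>f. f x) (fs[j := \<lambda>_. b])))"
      proof (rule Suc.IH)
        show "smooth_on S (fs[j := \<lambda>_. b] ! i)" if "i < k" for i
          using Suc.prems that by (cases "i = j") (auto simp: smooth_on_const)
        show "\<exists>c. fs[j := \<lambda>_. b] ! i = (\<lambda>x. c)" if "j \<le> i" "i < k" for i
          using Suc.prems that by (cases "i = j") auto
      qed (use Suc.prems in auto)
    qed
    ultimately show ?case by simp
  qed
  show ?thesis by (rule main[of k]) (use assms in auto)
qed

text \<open>The same induction on the number of varying arguments, with
  \<open>has_derivative_apply\<close> releasing argument \<open>j\<close>.\<close>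

lemma multilinear_has_derivative:
  fixes t :: cform and fs :: "('a::real_normed_vector \<Rightarrow> complex^3) list"
  assumes t: "t \<in> alt_forms k"
    and "length fs = k" "\<And>i. i < k \<Longrightarrow> (fs ! i has_derivative fs' i) (at x)"
  shows "((\<lambda>y. t (map (\<lambda>f. f y) fs)) has_derivative
    (\<lambda>u. \<Sum>i<k. t ((map (\<lambda>f. f x) fs)[i := fs' i u]))) (at x)"
proof -
  have main: "j \<le> k \<Longrightarrow> length fs = k \<Longrightarrow> (\<And>i. i < j \<Longrightarrow> (fs ! i has_derivative fs' i) (at x)) \<Longrightarrow>
      (\<And>i. j \<le> i \<Longrightarrow> i < k \<Longrightarrow> \<exists>c. fs ! i = (\<lambda>x. c)) \<Longrightarrow>
      ((\<lambda>y. t (map (\<lambda>f. f y) fs)) has_derivative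
        (\<lambda>u. \<Sum>i<j. t ((map (\<lambda>f. f x) fs)[i := fs' i u]))) (at x)"
    for j and fs :: "('a \<Rightarrow> complex^3) list"
  proof (induction j arbitrary: fs)
    case 0
    have "map (\<lambda>f. f x) fs = map (\<lambda>f. f undefined) fs" for x
    proof (rule nth_equalityI)
      fix i assume "i < length (map (\<lambda>f. f x) fs)"
      then obtain c where "fs ! i = (\<lambda>x. c)" using 0(2) 0(4)[of i] by auto
      then show "map (\<lambda>f. f x) fs ! i = map (\<lambda>f. f undefined) fs ! i"
        using \<open>i < _\<close> by simp
    qed simp
    then have "(\<lambda>x. t (map (\<lambda>f. f x) fs)) = (\<lambda>x. t (map (\<lambda>f. f undefined) fs))" by metis
    then show ?case by simp
  next
    case (Suc j)
    let ?F = "\<lambda>y w. t (map (\<lambda>f. f y) (fs[j := \<lambda>_. w]))"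
    have eq: "map (\<lambda>f. f y) (fs[j := \<lambda>_. w]) = (map (\<lambda>f. f y) fs)[j := w]" for y w
      by (simp add: map_update)
    have lin: "linear (?F y)" for y
      unfolding eq by (rule alt_forms_linear[OF t]) (use Suc.prems in auto)
    have "((\<lambda>y. ?F y ((fs ! j) y)) has_derivative
        (\<lambda>u. (\<lambda>w u. \<Sum>i<j. t ((map (\<lambda>f. f x) (fs[j := \<lambda>_. w]))[i := fs' i u])) ((fs ! j) x) u + ?F x (fs' j u))) (at x)"
    proof (rule has_derivative_apply[OF open_UNIV UNIV_I lin])
      show "(fs ! j has_derivative fs' j) (at x)" by (rule Suc.prems(3)) simp
      fix w
      show "((\<lambda>y. ?F y w) has_derivative (\<lambda>u. \<Sum>i<j. t ((map (\<lambda>f. f x) (fs[j := \<lambda>_. w]))[i := fs' i u]))) (at x)"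
      proof (rule Suc.IH)
        show "(fs[j := \<lambda>_. w] ! i has_derivative fs' i) (at x)" if "i < j" for i
          using Suc.prems(3)[of i] that by simp
        show "\<exists>c. fs[j := \<lambda>_. w] ! i = (\<lambda>x. c)" if "j \<le> i" "i < k" for i
          using Suc.prems that by (cases "i = j") auto
      qed (use Suc.prems in auto)
    qed
    moreover have "(map (\<lambda>f. f y) fs)[j := (fs ! j) y] = map (\<lambda>f. f y) fs" for y
      using Suc.prems(1,2) list_update_id[of "map (\<lambda>f. f y) fs" j] by simp
    ultimately show ?case by (simp add: eq)
  qed
  show ?thesis by (rule main[of k]) (use assms in auto)
qed

lemma ext_d_cong:
  assumes "open S" "x \<in> S" "\<And>y vs. y \<in> S \<Longrightarrow> \<alpha> C y vs = \<beta> D y vs"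
  shows "ext_d \<alpha> C x vs = ext_d \<beta> D x vs"
  unfolding ext_d_def
  by (intro sum.cong refl arg_cong2[where f = times] fun_cong[OF frechet_derivative_cong_open[OF assms(1,2)]] assms(3))

lemma alt_forms_swap:
  assumes t: "t \<in> alt_forms k" and vs: "length vs = k" "i < j" "j < k"
  shows "t (vs[i := vs ! j, j := vs ! i]) = - t vs"
proof -
  let ?f = "\<lambda>u v. t (vs[i := u, j := v])"
  let ?a = "vs ! i" and ?b = "vs ! j"
  have l1: "linear (\<lambda>u. ?f u v)" for v
    using alt_forms_linear[OF t, of "vs[j := v]" i] vs by (simp add: list_update_swap)
  have l2: "linear (\<lambda>v. ?f u v)" for u
    using alt_forms_linear[OF t, of "vs[i := u]" j] vs by simp
  have z: "?f u u = 0" for u using t vs by (auto simp: alt_forms_def)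
  have "?f (?a + ?b) (?a + ?b) = ?f ?a ?a + ?f ?a ?b + ?f ?b ?a + ?f ?b ?b"
    by (simp add: linear_add[OF l1] linear_add[OF l2])
  then have "?f ?b ?a = - ?f ?a ?b" unfolding z by (simp add: eq_neg_iff_add_eq_0 add.commute)
  then show ?thesis by simp
qed

lemma alt2: assumes "t \<in> alt_forms 2" shows "t [b, a] = - t [a, b]"
  using alt_forms_swap[OF assms, of "[a, b]" 0 1] by simp

lemma alt3: assumes "t \<in> alt_forms 3" shows "t [b, a, c] = - t [a, b, c]" "t [a, c, b] = - t [a, b, c]"
  using alt_forms_swap[OF assms, of "[a, b, c]" 0 1] alt_forms_swap[OF assms, of "[a, b, c]" 1 2]
  by (simp_all add: numeral_2_eq_2)

section \<open>Charts of the quotient and descent of invariant forms\<close>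

lemma coset_eq_iff:
  assumes "add_subgroup \<Gamma>"
  shows "coset \<Gamma> x = coset \<Gamma> y \<longleftrightarrow> (\<exists>\<gamma>\<in>\<Gamma>. y = \<gamma> + x)"
proof
  assume "coset \<Gamma> x = coset \<Gamma> y"
  moreover have "y \<in> coset \<Gamma> y" using assms by (force simp: coset_def add_subgroup_def)
  ultimately show "\<exists>\<gamma>\<in>\<Gamma>. y = \<gamma> + x" by (auto simp: coset_def)
next
  assume "\<exists>\<gamma>\<in>\<Gamma>. y = \<gamma> + x"
  then obtain \<gamma> where g: "\<gamma> \<in> \<Gamma>" "y = \<gamma> + x" by blast
  have "\<delta> + x \<in> coset \<Gamma> y" if "\<delta> \<in> \<Gamma>" for \<delta>
  proof -
    have "\<delta> + - \<gamma> \<in> \<Gamma>" using assms g that unfolding add_subgroup_def by blast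
    moreover have "\<delta> + x = (\<delta> + - \<gamma>) + y" by (simp add: g(2) add.assoc minus_add_cancel del: add_uminus_conv_diff)
    ultimately show ?thesis by (auto simp: coset_def)
  qed
  moreover have "\<delta> + y \<in> coset \<Gamma> x" if "\<delta> \<in> \<Gamma>" for \<delta>
  proof -
    have "\<delta> + \<gamma> \<in> \<Gamma>" using assms g that by (auto simp: add_subgroup_def)
    moreover have "\<delta> + y = (\<delta> + \<gamma>) + x" by (simp add: g(2) add.assoc)
    ultimately show ?thesis by (auto simp: coset_def)
  qed
  ultimately show "coset \<Gamma> x = coset \<Gamma> y" by (auto simp: coset_def[of \<Gamma> x] coset_def[of \<Gamma> y])
qed

locale nilmanifold = lie_group_cs A for A :: "'g::topological_group_add atlas" +
  fixes \<Gamma> :: "'g set"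
  assumes cocompact: "cocompact_discrete \<Gamma>"
begin

lemma subgroup: "add_subgroup \<Gamma>" using cocompact by (simp add: cocompact_discrete_def)

abbreviation X where "X \<equiv> quot_atlas \<Gamma> A"

text \<open>\<open>D\<close> is the chart of the quotient obtained from the chart \<open>C\<close>
  of the group on an open set \<open>V\<close> that the projection maps injectively.\<close>

definition qrep where "qrep D C V \<longleftrightarrow>
  C \<in> A \<and> open V \<and> V \<subseteq> fst C \<and> inj_on (coset \<Gamma>) V \<and> D = (coset \<Gamma> ` V, snd C \<circ> inv_into V (coset \<Gamma>))"

lemma qrep_in_X: "qrep D C V \<Longrightarrow> D \<in> X"
  unfolding qrep_def quot_atlas_def by (cases C) auto

lemma X_qrep: "D \<in> X \<Longrightarrow> \<exists>C V. qrep D C V"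
  unfolding qrep_def quot_atlas_def by auto

context
  fixes D C V assumes q: "qrep D C V"
begin

lemma qrep_A: "C \<in> A" and qrep_open: "open V" and qrep_sub: "V \<subseteq> fst C" and qrep_inj: "inj_on (coset \<Gamma>) V"
  and qrep_D: "D = (coset \<Gamma> ` V, snd C \<circ> inv_into V (coset \<Gamma>))"
  using q by (auto simp: qrep_def)

lemma qrep_fst: "fst D = coset \<Gamma> ` V" by (simp add: qrep_D)

lemma qrep_snd: "g \<in> V \<Longrightarrow> snd D (coset \<Gamma> g) = snd C g"
  using qrep_inj by (simp add: qrep_D)

lemma qrep_cdom: "cdom D = snd C ` V"
  unfolding qrep_fst image_image by (rule image_cong) (auto simp: qrep_snd)

lemma qrep_cdom_sub: "x \<in> cdom D \<Longrightarrow> x \<in> cdom C" using qrep_cdom qrep_sub by auto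

lemma qrep_cinv_mem: "x \<in> cdom D \<Longrightarrow> cinv C x \<in> V"
  using qrep_sub by (auto simp: qrep_cdom cinv_left[OF qrep_A] subset_iff)

lemma qrep_cinv: assumes "x \<in> cdom D" shows "cinv D x = coset \<Gamma> (cinv C x)"
proof -
  have "inj_on (snd D) (fst D)"
    unfolding qrep_fst using qrep_sub inj_on_subset[OF chart_inj[OF qrep_A]]
    by (auto simp: inj_on_def qrep_snd)
  moreover have "snd D (coset \<Gamma> (cinv C x)) = x" "coset \<Gamma> (cinv C x) \<in> fst D"
    using qrep_cinv_mem[OF assms] qrep_cdom_sub[OF assms] by (auto simp: qrep_snd qrep_fst)
  ultimately show ?thesis by (metis inv_into_f_f)
qed

lemma qrep_cdom_open: "open (cdom D)"
proof -
  have "cdom D = {x \<in> cdom C. cinv C x \<in> V}"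
  proof (intro set_eqI iffI)
    fix x assume "x \<in> {x \<in> cdom C. cinv C x \<in> V}"
    then show "x \<in> cdom D" unfolding qrep_cdom by (metis (mono_tags, lifting) cinv_right image_eqI mem_Collect_eq)
  qed (simp add: qrep_cdom_sub qrep_cinv_mem)
  then show ?thesis using open_cinv_preimage[OF qrep_A continuous_on_id qrep_open] by simp
qed

end

text \<open>The cosets are orbits of left translations by \<Gamma>. So the projection, read in
  charts, is locally a left translation by an element of \<Gamma>; this is why left-invariant
  objects descend.\<close>

lemma loc_map_coset_eq:
  assumes C: "C \<in> A" and q: "qrep D C' V" and x: "x \<in> loc_dom C D (coset \<Gamma>)"
  obtains \<gamma> S where "\<gamma> \<in> \<Gamma>" "open S" "x \<in> S" "S \<subseteq> loc_dom C C' ((+) \<gamma>)" "S \<subseteq> loc_dom C D (coset \<Gamma>)"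
    "\<And>y. y \<in> S \<Longrightarrow> \<gamma> + cinv C y \<in> V"
    "\<And>y. y \<in> S \<Longrightarrow> loc_map C D (coset \<Gamma>) y = loc_map C C' ((+) \<gamma>) y"
proof -
  from x have x': "x \<in> cdom C" "coset \<Gamma> (cinv C x) \<in> coset \<Gamma> ` V"
    by (auto simp: loc_dom_eq[OF C] qrep_fst[OF q])
  then obtain g where g: "g \<in> V" "coset \<Gamma> (cinv C x) = coset \<Gamma> g" by blast
  then obtain \<gamma> where gam: "\<gamma> \<in> \<Gamma>" "g = \<gamma> + cinv C x" using coset_eq_iff[OF subgroup] by blast
  let ?S = "{y \<in> cdom C. \<gamma> + cinv C y \<in> V}"
  have cos: "coset \<Gamma> (cinv C y) = coset \<Gamma> (\<gamma> + cinv C y)" for y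
    using coset_eq_iff[OF subgroup] gam(1) by blast
  show thesis
  proof
    show "open ?S" by (intro open_cinv_preimage C qrep_open[OF q]) (auto intro!: continuous_intros)
    show "x \<in> ?S" using x' g gam by auto
    show "?S \<subseteq> loc_dom C C' ((+) \<gamma>)" using qrep_sub[OF q] by (auto simp: loc_dom_eq[OF C])
    show "?S \<subseteq> loc_dom C D (coset \<Gamma>)"
      by (auto simp: loc_dom_eq[OF C] qrep_fst[OF q] cos)
    show "loc_map C D (coset \<Gamma>) y = loc_map C C' ((+) \<gamma>) y" if "y \<in> ?S" for y
      using that by (simp add: loc_map_eq cos[of y] qrep_snd[OF q])
  qed (use gam in auto)
qed

lemma coset_trans:
  assumes C: "C \<in> A" and q: "qrep D C' V" and x: "x \<in> loc_dom C D (coset \<Gamma>)"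
  shows "N C x v = N C' (loc_map C D (coset \<Gamma>) x) (frechet_derivative (loc_map C D (coset \<Gamma>)) (at x) v)"
    and "loc_map C D (coset \<Gamma>) x \<in> cdom D"
proof -
  obtain \<gamma> S where S: "\<gamma> \<in> \<Gamma>" "open S" "x \<in> S" "S \<subseteq> loc_dom C C' ((+) \<gamma>)"
    "\<And>y. y \<in> S \<Longrightarrow> loc_map C D (coset \<Gamma>) y = loc_map C C' ((+) \<gamma>) y"
    using loc_map_coset_eq[OF assms] by metis
  have "frechet_derivative (loc_map C D (coset \<Gamma>)) (at x) = frechet_derivative (loc_map C C' ((+) \<gamma>)) (at x)"
    by (rule frechet_derivative_cong_open[OF S(2,3,5)])
  then show "N C x v = N C' (loc_map C D (coset \<Gamma>) x) (frechet_derivative (loc_map C D (coset \<Gamma>)) (at x) v)"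
    using N_trans[OF C qrep_A[OF q], of x \<gamma> v] S by auto
  show "loc_map C D (coset \<Gamma>) x \<in> cdom D"
    using x by (auto simp: loc_dom_eq[OF C] loc_map_eq)
qed

lemma loc_map_id_coset:
  assumes q: "qrep D C V" and x: "x \<in> loc_dom D D' id"
  shows "x \<in> loc_dom C D' (coset \<Gamma>)" "x \<in> cdom D"
    "loc_map D D' id x = loc_map C D' (coset \<Gamma>) x"
    "frechet_derivative (loc_map D D' id) (at x) = frechet_derivative (loc_map C D' (coset \<Gamma>)) (at x)"
proof -
  have inj: "inj_on (snd D) (fst D)"
    unfolding qrep_fst[OF q] using qrep_sub[OF q] inj_on_subset[OF chart_inj[OF qrep_A[OF q]]]
    by (auto simp: inj_on_def qrep_snd[OF q])
  show xD: "x \<in> cdom D" using x by (auto simp: loc_dom_def)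
  have eq: "loc_map D D' id y = loc_map C D' (coset \<Gamma>) y" if "y \<in> cdom D" for y
    by (simp add: loc_map_eq qrep_cinv[OF q that])
  then show "loc_map D D' id x = loc_map C D' (coset \<Gamma>) x" using xD by blast
  have "cinv D x \<in> fst D'" using x inj by (auto simp: loc_dom_def)
  then show "x \<in> loc_dom C D' (coset \<Gamma>)"
    using qrep_cdom_sub[OF q xD] by (simp add: loc_dom_eq[OF qrep_A[OF q]] qrep_cinv[OF q xD])
  show "frechet_derivative (loc_map D D' id) (at x) = frechet_derivative (loc_map C D' (coset \<Gamma>)) (at x)"
    by (rule frechet_derivative_cong_open[OF qrep_cdom_open[OF q] xD eq])
qed

text \<open>A quotient chart does not remember the chart of the group from which it arose; one such
  chart is chosen so that \<open>N\<close> can be evaluated on it.\<close>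

definition pick where "pick D = (SOME C. \<exists>V. qrep D C V)"

lemma pick: "D \<in> X \<Longrightarrow> \<exists>V. qrep D (pick D) V"
  unfolding pick_def using someI_ex[OF X_qrep] .

text \<open>The left-invariant form with value \<open>t\<close> at the identity, on the group and on
  the quotient.\<close>

definition gform :: "cform \<Rightarrow> 'g form" where "gform t C x vs = t (map (N C x) vs)"
definition qform :: "cform \<Rightarrow> 'g set form" where "qform t D x vs = t (map (N (pick D) x) vs)"

lemma smooth_N_form:
  assumes t: "t \<in> alt_forms k" and C: "C \<in> A" and S: "open S" "S \<subseteq> cdom C"
  shows "smooth_on S (\<lambda>x. t (map (N C x) vs))"
proof (cases "length vs = k")
  case True
  have "smooth_on S (\<lambda>x. t (map (\<lambda>f. f x) (map (\<lambda>v x. N C x v) vs)))"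
    by (rule multilinear_smooth[OF t S(1)])
      (use True smooth_on_mono[OF N_smooth[OF C] S(2)] in auto)
  then show ?thesis by (simp add: o_def)
next
  case False
  then show ?thesis using t by (simp add: alt_forms_length smooth_on_const)
qed

lemma gform_pullback_left: "is_pullback A A ((+) a) (gform t) (gform t)"
  unfolding is_pullback_def gform_def by (auto simp: o_def N_trans[symmetric])

lemma loc_map_id: "loc_map C D (id :: 'g \<Rightarrow> 'g) = loc_map C D ((+) 0)"
  "loc_dom C D (id :: 'g \<Rightarrow> 'g) = loc_dom C D ((+) 0)"
  by (auto simp: loc_map_def loc_dom_def)

lemma diff_form_gform: "t \<in> alt_forms k \<Longrightarrow> diff_form A k (gform t)"
  unfolding diff_form_def
proof (intro conjI ballI)
  fix C assume t: "t \<in> alt_forms k" and C: "C \<in> A"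
  show "case C of (U, c) \<Rightarrow> (\<forall>x\<in>c ` U. gform t (U, c) x \<in> alt_forms k) \<and>
     (\<forall>vs. smooth_on (c ` U) (\<lambda>x. gform t (U, c) x vs))"
    using alt_forms_comp[OF t N_linear[OF C]] smooth_N_form[OF t C chart_dom_open[OF C]] C
    by (cases C) (auto simp: gform_def[abs_def])
next
  show "is_pullback A A id (gform t) (gform t)"
    using gform_pullback_left[of 0 t] by (simp add: is_pullback_def loc_map_id)
qed

lemma qform_pullback_coset: "is_pullback A X (coset \<Gamma>) (qform t) (gform t)"
  unfolding is_pullback_def
proof (intro ballI allI)
  fix C D x vs assume C: "C \<in> A" and D: "D \<in> X" and x: "x \<in> loc_dom C D (coset \<Gamma>)"
  obtain V where V: "qrep D (pick D) V" using pick[OF D] by blast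
  show "gform t C x vs = qform t D (loc_map C D (coset \<Gamma>) x)
      (map (frechet_derivative (loc_map C D (coset \<Gamma>)) (at x)) vs)"
    by (simp add: gform_def qform_def o_def coset_trans(1)[OF C V x, symmetric])
qed

lemma qform_pullback_id: "is_pullback X X id (qform t) (qform t)"
  unfolding is_pullback_def
proof (intro ballI allI)
  fix D D' x vs assume D: "D \<in> X" "D' \<in> X" and x: "x \<in> loc_dom D D' id"
  obtain V V' where V: "qrep D (pick D) V" "qrep D' (pick D') V'" using pick D by blast
  note i = loc_map_id_coset[OF V(1) x]
  show "qform t D x vs = qform t D' (loc_map D D' id x) (map (frechet_derivative (loc_map D D' id) (at x)) vs)"
    by (simp add: i(3,4) qform_def o_def coset_trans(1)[OF qrep_A[OF V(1)] V(2) i(1), symmetric])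
qed

lemma diff_form_qform: assumes t: "t \<in> alt_forms k" shows "diff_form X k (qform t)"
  unfolding diff_form_def
proof (intro conjI ballI qform_pullback_id)
  fix D assume D: "D \<in> X"
  obtain V where V: "qrep D (pick D) V" using pick[OF D] by blast
  have "qform t D x \<in> alt_forms k" if "x \<in> cdom D" for x
    using alt_forms_comp[OF t N_linear[OF qrep_A[OF V] qrep_cdom_sub[OF V that]]]
    by (simp add: qform_def[abs_def])
  moreover have "smooth_on (cdom D) (\<lambda>x. qform t D x vs)" for vs
    unfolding qform_def using qrep_cdom_sub[OF V]
    by (intro smooth_N_form[OF t qrep_A[OF V] qrep_cdom_open[OF V]]) auto
  ultimately show "case D of (U, c) \<Rightarrow> (\<forall>x\<in>c ` U. qform t (U, c) x \<in> alt_forms k) \<and>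
     (\<forall>vs. smooth_on (c ` U) (\<lambda>x. qform t (U, c) x vs))"
    by (cases D) auto
qed

lemma left_invariant_qform: "t \<in> alt_forms k \<Longrightarrow> left_invariant A \<Gamma> k (qform t)"
  unfolding left_invariant_def
  using diff_form_qform diff_form_gform gform_pullback_left qform_pullback_coset by blast

text \<open>The witness is the value at the identity of the invariant form on the group; left
  translation spreads it over the group, and the projection is a local isomorphism.\<close>

lemma left_invariant_imp_qform:
  assumes "left_invariant A \<Gamma> k \<beta>"
  shows "\<exists>t\<in>alt_forms k. \<forall>D\<in>X. \<forall>x\<in>cdom D. \<beta> D x = qform t D x"
proof -
  obtain \<alpha> where \<alpha>: "diff_form A k \<alpha>" "\<And>a. is_pullback A A (\<lambda>x. a + x) \<alpha> \<alpha>"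
    "is_pullback A X (coset \<Gamma>) \<beta> \<alpha>"
    using assms unfolding left_invariant_def by blast
  let ?t = "\<alpha> C0 p0"
  have t: "?t \<in> alt_forms k"
    using \<alpha>(1) C0(1) p0(1) unfolding diff_form_def by (cases C0) auto
  have \<alpha>C: "\<alpha> C x vs = ?t (map (N C x) vs)" if "C \<in> A" "x \<in> cdom C" for C x vs
  proof -
    have "loc_map C C0 ((+) (- cinv C x)) x = p0" by (simp add: loc_map_eq p0_def)
    then show ?thesis
      using \<alpha>(2)[of "- cinv C x"] that(1) C0(1) self_in_loc_dom[OF that]
      unfolding is_pullback_def N_def by metis
  qed
  have "\<beta> D x vs = qform ?t D x vs" if D: "D \<in> X" and x: "x \<in> cdom D" for D x vs
  proof -
    obtain V where V: "qrep D (pick D) V" using pick[OF D] by blast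
    note C = qrep_A[OF V]
    \<comment> \<open>Read between \<open>pick D\<close> and \<open>D\<close>, the projection is the
      identity map, so no Jacobian appears when comparing the two forms.\<close>
    have xl: "y \<in> loc_dom (pick D) D (coset \<Gamma>)" and ml: "loc_map (pick D) D (coset \<Gamma>) y = y" if "y \<in> cdom D" for y
      using qrep_cdom_sub[OF V that] qrep_cinv_mem[OF V that]
      by (auto simp: loc_dom_eq[OF C] loc_map_eq qrep_fst[OF V] qrep_snd[OF V])
    have "frechet_derivative (loc_map (pick D) D (coset \<Gamma>)) (at x) = frechet_derivative (\<lambda>y. y) (at x)"
      by (rule frechet_derivative_cong_open[OF qrep_cdom_open[OF V] x ml])
    also have "\<dots> = (\<lambda>v. v)" by (simp add: frechet_derivative_eqI[OF has_derivative_ident])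
    finally have "\<alpha> (pick D) x vs = \<beta> D x vs"
      using \<alpha>(3) C D xl[OF x] ml[OF x] unfolding is_pullback_def by (metis list.map_ident)
    then show ?thesis using \<alpha>C[OF C qrep_cdom_sub[OF V x]] by (simp add: qform_def)
  qed
  then show ?thesis using t by blast
qed

section \<open>The Chevalley-Eilenberg differential\<close>

text \<open>The degree is read off the number of arguments. Degrees one to three suffice, since the
  route from a two-form to its \<open>ddc\<close> passes through three-forms.\<close>

definition ce :: "cform \<Rightarrow> cform" where
  "ce t vs = (case vs of [u, v] \<Rightarrow> - t [br u v]
    | [u, v, w] \<Rightarrow> - t [br u v, w] + t [br u w, v] - t [br v w, u]
    | [a, b, c, d] \<Rightarrow> - t [br a b, c, d] + t [br a c, b, d] - t [br a d, b, c]
        - t [br b c, a, d] + t [br b d, a, c] - t [br c d, a, b]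
    | _ \<Rightarrow> 0)"

lemma N_form_has_derivative:
  assumes t: "t \<in> alt_forms k" and C: "C \<in> A" "x \<in> cdom C" and k: "length vs = k"
  shows "((\<lambda>y. t (map (N C y) vs)) has_derivative
    (\<lambda>u. \<Sum>i<k. t ((map (N C x) vs)[i := dN C x u (vs ! i)]))) (at x)"
  using multilinear_has_derivative[OF t, of "map (\<lambda>v y. N C y v) vs" "\<lambda>i u. dN C x u (vs ! i)" x] k
  by (simp add: dN_has_derivative[OF C] o_def)

text \<open>Each derivative hits one factor \<open>N C y v\<close>. After alternating signs these
  terms pair up to differences \<open>dN C x u v - dN C x v u\<close>, which the structure equation
  replaces by brackets.\<close>

lemma ext_d_invariant:
  assumes t: "t \<in> alt_forms k" and k: "k = 1 \<or> k = 2 \<or> k = 3" and C: "C \<in> A" "x \<in> cdom C"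
  shows "ext_d (\<lambda>C y vs. t (map (N C y) vs)) C x vs = ce t (map (N C x) vs)"
proof -
  let ?n = "N C x" and ?d = "dN C x"
  have mc: "?d u v = ?d v u - br (?n u) (?n v)" for u v using Maurer_Cartan[OF C, of u v] by (simp add: algebra_simps)
  have fd: "frechet_derivative (\<lambda>y. t (map (N C y) ws)) (at x) u = (\<Sum>i<k. t ((map ?n ws)[i := ?d u (ws ! i)]))"
    if "length ws = k" for u ws
    using N_form_has_derivative[OF t C that] by (simp add: frechet_derivative_eqI)
  have lin: "linear (\<lambda>v. t (ws[i := v]))" if "length ws = k" "i < k" for ws i
    by (rule alt_forms_linear[OF t that])
  show ?thesis
  proof (cases "length vs = Suc k")
    case False
    have "(\<lambda>y. t (map (N C y) (take i vs @ drop (Suc i) vs))) = (\<lambda>y. 0)" if "i < length vs" for i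
      using that False by (intro ext alt_forms_length[OF t]) auto
    then have "ext_d (\<lambda>C y vs. t (map (N C y) vs)) C x vs = 0"
      unfolding ext_d_def by (simp add: frechet_derivative_const)
    moreover have "ce t (map ?n vs) = 0"
      using False k by (auto simp: ce_def alt_forms_length[OF t] split: list.splits)
    ultimately show ?thesis by simp
  next
    case True
    from k show ?thesis
    proof (elim disjE)
      assume k1: "k = 1"
      then obtain u v where vs: "vs = [u, v]" using True by (auto simp: length_Suc_conv)
      have l: "t [a - b] = t [a] - t [b]" for a b
        using linear_diff[OF lin[of "[0]" 0], of a b] k1 by simp
      have "frechet_derivative (\<lambda>y. t [N C y w]) (at x) z = t [?d z w]" for z w
        using fd[of "[w]" z] k1 by simp
      then show ?thesis unfolding ext_d_def vs
        by (simp add: lessThan_Suc ce_def mc[of u v] l)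
    next
      assume k2: "k = 2"
      then obtain u v w where vs: "vs = [u, v, w]" using True by (auto simp: length_Suc_conv numeral_2_eq_2)
      have l: "t [a - b, c] = t [a, c] - t [b, c]" for a b c
        using linear_diff[OF lin[of "[0, c]" 0], of a b] k2 by simp
      note sw = alt2[OF t[unfolded k2]]
      have "frechet_derivative (\<lambda>y. t [N C y a, N C y b]) (at x) z = t [?d z a, ?n b] + t [?n a, ?d z b]" for z a b
        using fd[of "[a, b]" z] k2 by (simp add: numeral_2_eq_2 lessThan_Suc add.commute)
      then show ?thesis unfolding ext_d_def vs
        by (simp add: lessThan_Suc ce_def mc[of u v] mc[of u w] mc[of v w]
            sw[of "?n _" "?d _ _"] l)
    next
      assume k3: "k = 3"
      then obtain a b c d where vs: "vs = [a, b, c, d]" using True by (auto simp: length_Suc_conv numeral_3_eq_3)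
      have l: "t [a - b, c, d] = t [a, c, d] - t [b, c, d]" for a b c d
        using linear_diff[OF lin[of "[0, c, d]" 0], of a b] k3 by simp
      note sw = alt3[OF t[unfolded k3]]
      have sw1: "t [x, ?d y z, w] = - t [?d y z, x, w]" "t [x, w, ?d y z] = t [?d y z, x, w]" for x y z w
        using sw by metis+
      have sw2: "t [?d y z, ?n c, ?n b] = - t [?d y z, ?n b, ?n c]" for y z b c by (rule sw(2))
      have "frechet_derivative (\<lambda>y. t [N C y a, N C y b, N C y c]) (at x) z
          = t [?d z a, ?n b, ?n c] + t [?n a, ?d z b, ?n c] + t [?n a, ?n b, ?d z c]" for z a b c
        using fd[of "[a, b, c]" z] k3 by (simp add: numeral_3_eq_3 lessThan_Suc add_ac)
      then show ?thesis unfolding ext_d_def vs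
        by (simp add: lessThan_Suc ce_def mc[of a b] mc[of a c] mc[of a d] mc[of b c] mc[of b d] mc[of c d]
            sw1 l)
    qed
  qed
qed

lemma ext_d_qform:
  assumes t: "t \<in> alt_forms k" "k = 1 \<or> k = 2 \<or> k = 3" and D: "D \<in> X" "x \<in> cdom D"
    and eq: "\<And>y. y \<in> cdom D \<Longrightarrow> \<beta> D y = qform t D y"
  shows "ext_d \<beta> D x = qform (ce t) D x"
proof
  fix vs
  obtain V where V: "qrep D (pick D) V" using pick[OF D(1)] by blast
  have "ext_d \<beta> D x vs = ext_d (\<lambda>C y vs. t (map (N C y) vs)) (pick D) x vs"
    by (rule ext_d_cong[OF qrep_cdom_open[OF V] D(2)]) (simp add: eq qform_def)
  then show "ext_d \<beta> D x vs = qform (ce t) D x vs"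
    using ext_d_invariant[OF t qrep_A[OF V] qrep_cdom_sub[OF V D(2)]] by (simp add: qform_def)
qed

lemma qN_bij: assumes "D \<in> X" "x \<in> cdom D" shows "bij (N (pick D) x)"
proof -
  obtain V where V: "qrep D (pick D) V" using pick[OF assms(1)] by blast
  show ?thesis by (rule N_bij[OF qrep_A[OF V] qrep_cdom_sub[OF V assms(2)]])
qed

lemma qN_linear: assumes "D \<in> X" "x \<in> cdom D" shows "linear (N (pick D) x)"
  "N (pick D) x (\<i> *s v) = \<i> *s N (pick D) x v"
proof -
  obtain V where V: "qrep D (pick D) V" using pick[OF assms(1)] by blast
  show "linear (N (pick D) x)" by (rule N_linear[OF qrep_A[OF V] qrep_cdom_sub[OF V assms(2)]])
  show "N (pick D) x (\<i> *s v) = \<i> *s N (pick D) x v" by (rule N_clinear[OF qrep_A[OF V] qrep_cdom_sub[OF V assms(2)]])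
qed

text \<open>Identities on the quotient are conditions over all its charts; to read them off at the
  identity some chart must exist. Discreteness of \<Gamma> provides a set on which the projection is
  injective.\<close>

lemma X_nonempty: "\<exists>D\<in>X. cdom D \<noteq> {}"
proof -
  obtain T where T: "open T" "T \<inter> \<Gamma> = {0}"
  proof -
    have "0 \<in> \<Gamma>" using subgroup by (simp add: add_subgroup_def)
    then have "0 isolated_in \<Gamma>" using cocompact by (simp add: cocompact_discrete_def discrete_def)
    then show ?thesis using that unfolding isolated_in_def by blast
  qed
  \<comment> \<open>Continuity of the difference gives neighbourhoods whose differences meet
    \<Gamma> only in 0, hence contain at most one point of each coset.\<close>
  let ?f = "\<lambda>z::'g \<times> 'g. fst z + - snd z"
  have "open (?f -` T)" by (rule open_vimage[OF T(1)]) (auto intro!: continuous_intros)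
  moreover have "(0, 0) \<in> ?f -` T" using T by auto
  ultimately obtain P Q where PQ: "open P" "open Q" "(0, 0) \<in> P \<times> Q" "P \<times> Q \<subseteq> ?f -` T"
    by (rule open_prod_elim)
  let ?V = "P \<inter> Q \<inter> fst C0"
  have inj: "inj_on (coset \<Gamma>) ?V"
  proof (rule inj_onI)
    fix x y assume xy: "x \<in> ?V" "y \<in> ?V" "coset \<Gamma> x = coset \<Gamma> y"
    then obtain \<gamma> where g: "\<gamma> \<in> \<Gamma>" "y = \<gamma> + x" using coset_eq_iff[OF subgroup] by blast
    have "y + - x \<in> T" using xy PQ(4) by auto
    moreover have "y + - x = \<gamma>" by (simp add: g(2) add.assoc del: add_uminus_conv_diff)
    ultimately have "\<gamma> = 0" using g T by auto
    then show "x = y" using g by simp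
  qed
  let ?D = "(coset \<Gamma> ` ?V, snd C0 \<circ> inv_into ?V (coset \<Gamma>))"
  have "qrep ?D C0 ?V" using inj PQ C0 chart_open[OF C0(1)] by (auto simp: qrep_def)
  moreover have "0 \<in> ?V" using PQ C0 by auto
  ultimately show ?thesis using qrep_in_X qrep_cdom by blast
qed

end

section \<open>Forms of type \<open>(p, q)\<close>\<close>

text \<open>Here \<open>C j i\<close> is the value of the \<open>i\<close>-th form on the
  \<open>j\<close>-th vector, so \<open>C(j := x)\<close> exchanges a whole vector. Natural number
  indices allow the recursion \<open>detn_Suc\<close>, by which determinants of small size are
  evaluated.\<close>

definition detn :: "nat \<Rightarrow> (nat \<Rightarrow> nat \<Rightarrow> complex) \<Rightarrow> complex" where
  "detn n C = (\<Sum>\<sigma> | \<sigma> permutes {..<n}. of_int (sign \<sigma>) * (\<Prod>i<n. C (\<sigma> i) i))"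

lemma wedges_detn:
  "wedges \<theta>s vs = (if length vs = length \<theta>s then detn (length \<theta>s) (\<lambda>j i. (\<theta>s ! i) (vs ! j)) else 0)"
  by (simp add: wedges_def detn_def Let_def)

lemma detn_cong: "(\<And>i j. i < n \<Longrightarrow> j < n \<Longrightarrow> C j i = D j i) \<Longrightarrow> detn n C = detn n D"
  unfolding detn_def by (intro sum.cong refl arg_cong2[where f = times] prod.cong)
    (auto dest: permutes_in_image)

lemma detn_0 [simp]: "detn 0 C = 1"
  by (simp add: detn_def sign_id)

text \<open>Permutations are sorted by the image \<open>j\<close> of the last index: vector
  \<open>j\<close> goes into the last form and vector \<open>n\<close> takes its place, at the cost
  of a sign unless \<open>j = n\<close>.\<close>

lemma detn_Suc:
  "detn (Suc n) C = detn n C * C n n - (\<Sum>j<n. detn n (C(j := C n)) * C j n)"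
proof -
  let ?f = "\<lambda>\<sigma>. of_int (sign \<sigma>) * (\<Prod>i<Suc n. C (\<sigma> i) i)"
  have q: "(\<Sum>q | q permutes {..<n}. ?f (Transposition.transpose n b \<circ> q)) =
      (if b = n then detn n C * C n n else - (detn n (C(b := C n)) * C b n))" if b: "b \<in> insert n {..<n}" for b
  proof -
    have "?f (Transposition.transpose n b \<circ> q) = (if b = n then of_int (sign q) * (\<Prod>i<n. C (q i) i) * C n n
        else - (of_int (sign q) * (\<Prod>i<n. (C(b := C n)) (q i) i) * C b n))"
      if "q permutes {..<n}" for q
    proof -
      have pq: "permutation q" using that permutes_imp_permutation by blast
      have qn: "q n = n" using that by (simp add: permutes_def)
      have qi: "q i < n" if "i < n" for i using permutes_in_image[OF \<open>q permutes _\<close>] that by simp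
      have "sign (Transposition.transpose n b \<circ> q) = sign (Transposition.transpose n b) * sign q"
        by (rule sign_compose[OF permutation_swap_id pq])
      moreover have "(\<Prod>i<n. C (Transposition.transpose n b (q i)) i) = (\<Prod>i<n. (C(b := C n)) (q i) i)" if "b \<noteq> n"
        using qi that by (intro prod.cong refl) (auto simp: Transposition.transpose_def dest: less_imp_neq)
      ultimately show ?thesis by (auto simp: qn sign_swap_id)
    qed
    then have "(\<Sum>q | q permutes {..<n}. ?f (Transposition.transpose n b \<circ> q)) = (\<Sum>q | q permutes {..<n}.
        (if b = n then of_int (sign q) * (\<Prod>i<n. C (q i) i) * C n n
        else - (of_int (sign q) * (\<Prod>i<n. (C(b := C n)) (q i) i) * C b n)))"
      by (intro sum.cong) auto
    then show ?thesis by (simp add: detn_def sum_distrib_right sum_negf)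
  qed
  have "detn (Suc n) C = (\<Sum>b\<in>insert n {..<n}. \<Sum>q | q permutes {..<n}. ?f (Transposition.transpose n b \<circ> q))"
    unfolding detn_def lessThan_Suc[of n]
    by (subst sum_over_permutations_insert) (auto simp: lessThan_Suc)
  also have "\<dots> = (\<Sum>b\<in>insert n {..<n}. if b = n then detn n C * C n n else - (detn n (C(b := C n)) * C b n))"
    by (rule sum.cong[OF refl q])
  also have "\<dots> = detn n C * C n n + (\<Sum>b<n. - (detn n (C(b := C n)) * C b n))"
    by (subst sum.insert) (auto intro!: sum.cong)
  finally show ?thesis by (simp add: sum_negf)
qed

lemma detn_col_linear:
  assumes j: "j < n"
  shows "detn n (C(j := \<lambda>i. a * x i + b * y i)) = a * detn n (C(j := x)) + b * detn n (C(j := y))"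
proof -
  have "(\<Prod>i<n. (C(j := \<lambda>i. a * x i + b * y i)) (\<sigma> i) i) =
      a * (\<Prod>i<n. (C(j := x)) (\<sigma> i) i) + b * (\<Prod>i<n. (C(j := y)) (\<sigma> i) i)"
    if s: "\<sigma> permutes {..<n}" for \<sigma>
  proof -
    obtain k where k: "k < n" "\<sigma> k = j" using permutes_image[OF s] j by (metis imageE lessThan_iff)
    have ne: "\<sigma> i \<noteq> j" if "i \<noteq> k" for i using permutes_inj[OF s] k that by (metis injD)
    have "(\<Prod>i<n. (C(j := z)) (\<sigma> i) i) = z k * (\<Prod>i\<in>{..<n} - {k}. C (\<sigma> i) i)" for z
    proof -
      have "(\<Prod>i\<in>{..<n} - {k}. (C(j := z)) (\<sigma> i) i) = (\<Prod>i\<in>{..<n} - {k}. C (\<sigma> i) i)"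
        by (rule prod.cong) (auto simp: ne)
      then show ?thesis using k by (subst prod.remove[of _ k]) auto
    qed
    then show ?thesis by (simp add: algebra_simps)
  qed
  then have "detn n (C(j := \<lambda>i. a * x i + b * y i)) = (\<Sum>\<sigma> | \<sigma> permutes {..<n}. of_int (sign \<sigma>) *
    (a * (\<Prod>i<n. (C(j := x)) (\<sigma> i) i) + b * (\<Prod>i<n. (C(j := y)) (\<sigma> i) i)))"
    unfolding detn_def by (intro sum.cong) auto
  then show ?thesis by (simp add: detn_def sum_distrib_left sum.distrib algebra_simps)
qed

lemma detn_alternating:
  assumes ij: "i < n" "j < n" "i \<noteq> j" and C: "C i = C j"
  shows "detn n C = 0"
proof -
  let ?t = "Transposition.transpose i j"
  have tp: "?t permutes {..<n}" using ij by (intro permutes_swap_id) auto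
  have "detn n C = (\<Sum>\<sigma> | \<sigma> permutes {..<n}. of_int (sign (?t \<circ> \<sigma>)) * (\<Prod>k<n. C ((?t \<circ> \<sigma>) k) k))"
    unfolding detn_def
  proof (rule sum.reindex_bij_betw[symmetric], rule bij_betw_byWitness[where f' = "\<lambda>\<sigma>. ?t \<circ> \<sigma>"])
    show "(\<lambda>\<sigma>. ?t \<circ> \<sigma>) ` {\<sigma>. \<sigma> permutes {..<n}} \<subseteq> {\<sigma>. \<sigma> permutes {..<n}}"
      using permutes_compose[OF _ tp] by auto
    then show "(\<lambda>\<sigma>. ?t \<circ> \<sigma>) ` {\<sigma>. \<sigma> permutes {..<n}} \<subseteq> {\<sigma>. \<sigma> permutes {..<n}}" .
  qed (simp_all add: o_assoc[symmetric] comp_assoc[symmetric])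
  also have "\<dots> = (\<Sum>\<sigma> | \<sigma> permutes {..<n}. - (of_int (sign \<sigma>) * (\<Prod>k<n. C (\<sigma> k) k)))"
  proof (rule sum.cong[OF refl])
    fix \<sigma> assume "\<sigma> \<in> {\<sigma>. \<sigma> permutes {..<n}}"
    then have "permutation \<sigma>" using permutes_imp_permutation by blast
    then have "sign (?t \<circ> \<sigma>) = - sign \<sigma>"
      using ij by (simp add: sign_compose permutation_swap_id sign_swap_id)
    moreover have "C ((?t \<circ> \<sigma>) k) = C (\<sigma> k)" for k using C by (auto simp: Transposition.transpose_def)
    ultimately show "of_int (sign (?t \<circ> \<sigma>)) * (\<Prod>k<n. C ((?t \<circ> \<sigma>) k) k) = - (of_int (sign \<sigma>) * (\<Prod>k<n. C (\<sigma> k) k))"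
      by simp
  qed
  also have "\<dots> = - detn n C" by (simp add: detn_def sum_negf)
  finally show ?thesis by simp
qed

text \<open>On \<open>v\<close> and \<open>\<i> *s v\<close> a collection of complex linear and
  antilinear forms takes the values \<open>P + Q\<close> and \<open>\<i> * P - \<i> * Q\<close>,
  where \<open>P\<close> and \<open>Q\<close> belong to the linear and the antilinear forms.
  Expanding leaves two equal cross terms.\<close>

lemma detn_pair:
  assumes ab: "a < n" "b < n" "a \<noteq> b"
  shows "detn n (C(a := \<lambda>r. P r + Q r, b := \<lambda>r. \<i> * P r - \<i> * Q r)) = - 2 * \<i> * detn n (C(a := P, b := Q))"
proof -
  let ?D = "\<lambda>x y. detn n (C(a := x, b := y))"
  have l1: "?D (\<lambda>r. p * x r + q * y r) z = p * ?D x z + q * ?D y z" for p q x y z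
    using detn_col_linear[OF ab(1), of "C(b := z)" p x q y] ab(3) by (simp add: fun_upd_twist)
  have l2: "?D z (\<lambda>r. p * x r + q * y r) = p * ?D z x + q * ?D z y" for p q x y z
    by (rule detn_col_linear[OF ab(2)])
  have z: "?D x x = 0" for x using detn_alternating[OF ab, of "C(a := x, b := x)"] ab(3) by simp
  have "?D (\<lambda>r. 1 * P r + 1 * Q r) (\<lambda>r. 1 * P r + 1 * Q r) = ?D P Q + ?D Q P"
    unfolding l1 l2 z by simp
  then have s: "?D Q P = - ?D P Q" unfolding z by (simp add: eq_neg_iff_add_eq_0 add.commute)
  have "?D (\<lambda>r. P r + Q r) (\<lambda>r. \<i> * P r - \<i> * Q r) = ?D (\<lambda>r. 1 * P r + 1 * Q r) (\<lambda>r. \<i> * P r + (- \<i>) * Q r)"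
    by simp
  also have "\<dots> = - 2 * \<i> * ?D P Q" unfolding l1 l2 z s by (simp add: algebra_simps)
  finally show ?thesis .
qed

lemma wedges_alt_forms:
  assumes "\<forall>\<theta>\<in>set \<theta>s. linear \<theta>"
  shows "wedges \<theta>s \<in> alt_forms (length \<theta>s)"
proof -
  have "linear (\<lambda>v. wedges \<theta>s (vs[j := v]))" if l: "length vs = length \<theta>s" and j: "j < length \<theta>s" for vs j
  proof -
    let ?n = "length \<theta>s"
    let ?C = "\<lambda>j i. (\<theta>s ! i) (vs ! j)"
    have eq: "wedges \<theta>s (vs[j := v]) = detn ?n (?C(j := \<lambda>i. (\<theta>s ! i) v))" for v
      using l j by (auto simp: wedges_detn intro!: detn_cong)
    have lin: "linear (\<theta>s ! i)" if "i < ?n" for i using assms that by simp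
    show ?thesis
    proof (rule linearI)
      fix v w and r :: real
      have "detn ?n (?C(j := \<lambda>i. (\<theta>s ! i) (v + w))) = detn ?n (?C(j := \<lambda>i. 1 * (\<theta>s ! i) v + 1 * (\<theta>s ! i) w))"
        by (rule detn_cong) (simp add: linear_add[OF lin])
      then show "wedges \<theta>s (vs[j := v + w]) = wedges \<theta>s (vs[j := v]) + wedges \<theta>s (vs[j := w])"
        unfolding eq detn_col_linear[OF j] by simp
      have "detn ?n (?C(j := \<lambda>i. (\<theta>s ! i) (r *\<^sub>R v))) = detn ?n (?C(j := \<lambda>i. of_real r * (\<theta>s ! i) v + 0 * 0))"
        by (rule detn_cong) (simp add: linear_scale[OF lin] scaleR_conv_of_real[where 'a=complex])
      then show "wedges \<theta>s (vs[j := r *\<^sub>R v]) = r *\<^sub>R wedges \<theta>s (vs[j := v])"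
        unfolding eq detn_col_linear[OF j] by (simp add: scaleR_conv_of_real)
    qed
  qed
  moreover have "wedges \<theta>s vs = 0"
    if "length vs = length \<theta>s" "i < j" "j < length \<theta>s" "vs ! i = vs ! j" for vs i j
    using that by (auto simp: wedges_detn intro!: detn_alternating[of i _ j])
  ultimately show ?thesis by (simp add: alt_forms_def wedges_def)
qed

section \<open>Complex linear functionals and decomposition by type\<close>

definition clin :: "(complex^3 \<Rightarrow> complex) \<Rightarrow> bool" where
  "clin \<theta> \<longleftrightarrow> (\<forall>u v. \<theta> (u + v) = \<theta> u + \<theta> v) \<and> (\<forall>c v. \<theta> (c *s v) = c * \<theta> v)"

lemma clin_rep: assumes "clin \<theta>" shows "\<theta> = (\<lambda>v. \<Sum>i\<in>UNIV. \<theta> (axis i 1) * dz i v)"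
proof
  fix v :: "complex^3"
  have "v = v $ 1 *s axis 1 1 + v $ 2 *s axis 2 1 + v $ 3 *s axis 3 1"
    by (simp add: vec_eq_iff axis_def forall_3)
  then have "\<theta> v = \<theta> (v $ 1 *s axis 1 1 + v $ 2 *s axis 2 1 + v $ 3 *s axis 3 1)" by simp
  also have "\<dots> = (\<Sum>i\<in>UNIV. \<theta> (axis i 1) * dz i v)"
    using assms by (simp add: clin_def sum_3 dz_def algebra_simps)
  finally show "\<theta> v = (\<Sum>i\<in>UNIV. \<theta> (axis i 1) * dz i v)" .
qed

lemma clin_linear: "clin \<theta> \<Longrightarrow> linear \<theta>"
proof (rule linearI)
  fix r :: real and v assume "clin \<theta>"
  then have "\<theta> (complex_of_real r *s v) = complex_of_real r * \<theta> v" by (simp add: clin_def)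
  moreover have "complex_of_real r *s v = r *\<^sub>R v" by (simp add: vec_eq_iff scaleR_conv_of_real[where 'a=complex])
  ultimately show "\<theta> (r *\<^sub>R v) = r *\<^sub>R \<theta> v" by (simp add: scaleR_conv_of_real)
qed (simp add: clin_def)

lemma clin_cnj_linear: "clin \<theta> \<Longrightarrow> linear (\<lambda>v. cnj (\<theta> v))"
  using linear_compose[OF clin_linear, of \<theta> cnj] by (simp add: o_def linear_iff scaleR_conv_of_real)

lemma clin_dz: "clin (dz i)" by (simp add: clin_def dz_def)

lemma pq_forms_0: "(\<lambda>vs. 0) \<in> pq_forms p q"
  unfolding pq_forms_def by (rule CollectI, rule exI[of _ "\<lambda>_ _. 0"]) simp

lemma pq_forms_add:
  assumes "\<alpha> \<in> pq_forms p q" "\<beta> \<in> pq_forms p q" shows "(\<lambda>vs. \<alpha> vs + \<beta> vs) \<in> pq_forms p q"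
proof -
  obtain a b where "\<alpha> = (\<lambda>vs. \<Sum>I | length I = p. \<Sum>J | length J = q. a I J * wedges (map dz I @ map dzbar J) vs)"
    "\<beta> = (\<lambda>vs. \<Sum>I | length I = p. \<Sum>J | length J = q. b I J * wedges (map dz I @ map dzbar J) vs)"
    using assms unfolding pq_forms_def by blast
  then show ?thesis unfolding pq_forms_def
    by (intro CollectI exI[of _ "\<lambda>I J. a I J + b I J"]) (simp add: sum.distrib algebra_simps)
qed

lemma pq_forms_scale:
  assumes "\<alpha> \<in> pq_forms p q" shows "(\<lambda>vs. c * \<alpha> vs) \<in> pq_forms p q"
proof -
  obtain a where "\<alpha> = (\<lambda>vs. \<Sum>I | length I = p. \<Sum>J | length J = q. a I J * wedges (map dz I @ map dzbar J) vs)"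
    using assms unfolding pq_forms_def by blast
  then show ?thesis unfolding pq_forms_def
    by (intro CollectI exI[of _ "\<lambda>I J. c * a I J"]) (simp add: sum_distrib_left mult.assoc)
qed

lemma pq_forms_sum:
  "(\<And>i. i \<in> S \<Longrightarrow> \<alpha> i \<in> pq_forms p q) \<Longrightarrow> (\<lambda>vs. \<Sum>i\<in>S. \<alpha> i vs) \<in> pq_forms p q"
  by (induction S rule: infinite_finite_induct) (auto intro: pq_forms_0 pq_forms_add)

lemma finite_lists_length_3: "finite {I :: 3 list. length I = p}"
  using finite_lists_length_eq[of "UNIV :: 3 set" p] by simp

lemma pq_forms_basis:
  assumes "length I = p" "length J = q" shows "wedges (map dz I @ map dzbar J) \<in> pq_forms p q"
  unfolding pq_forms_def
proof (intro CollectI exI[of _ "\<lambda>I' J'. of_bool (I' = I \<and> J' = J)"] ext)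
  fix vs
  let ?w = "\<lambda>I J. wedges (map dz I @ map dzbar J) vs"
  have "(\<Sum>I' | length I' = p. \<Sum>J' | length J' = q. of_bool (I' = I \<and> J' = J) * ?w I' J')
    = (\<Sum>I' | length I' = p. if I' = I then \<Sum>J' | length J' = q. if J' = J then ?w I J else 0 else 0)"
    by (auto intro!: sum.cong)
  also have "\<dots> = ?w I J" using assms by (simp add: finite_lists_length_3)
  finally show "?w I J = (\<Sum>I' | length I' = p. \<Sum>J' | length J' = q. of_bool (I' = I \<and> J' = J) * ?w I' J')" by simp
qed

lemma wedges_row_sum:
  assumes k: "k < length \<theta>s"
  shows "wedges (\<theta>s[k := \<lambda>v. \<Sum>i\<in>S. c i * f i v]) vs = (\<Sum>i\<in>S. c i * wedges (\<theta>s[k := f i]) vs)"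
proof (cases "length vs = length \<theta>s")
  case True
  let ?n = "length \<theta>s"
  have p: "(\<Prod>i<?n. (\<theta>s[k := g] ! i) (vs ! \<sigma> i)) = g (vs ! \<sigma> k) * (\<Prod>i\<in>{..<?n} - {k}. (\<theta>s ! i) (vs ! \<sigma> i))"
    for g \<sigma>
  proof -
    have "(\<Prod>i\<in>{..<?n} - {k}. (\<theta>s[k := g] ! i) (vs ! \<sigma> i)) = (\<Prod>i\<in>{..<?n} - {k}. (\<theta>s ! i) (vs ! \<sigma> i))"
      by (rule prod.cong) auto
    then show ?thesis using k by (subst prod.remove[of _ k]) auto
  qed
  show ?thesis
    using True by (simp add: wedges_def Let_def p sum_distrib_left sum_distrib_right mult_ac)
      (rule sum.swap)
qed (simp add: wedges_def Let_def)

text \<open>\<open>pq_forms\<close> is defined through the standard coordinates only. The factors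
  are expanded one at a time in these coordinates, \<open>j\<close> counting those not yet
  expanded.\<close>

lemma wedges_pq_forms:
  assumes "length as = p" "length bs = q" "\<forall>a\<in>set as. clin a" "\<forall>b\<in>set bs. clin b"
  shows "wedges (as @ map (\<lambda>b v. cnj (b v)) bs) \<in> pq_forms p q"
proof -
  have main: "j \<le> p + q \<Longrightarrow> length \<theta>s = p + q \<Longrightarrow> (\<And>i. i < p \<Longrightarrow> clin (\<theta>s ! i)) \<Longrightarrow>
     (\<And>i. p \<le> i \<Longrightarrow> i < p + q \<Longrightarrow> \<exists>b. clin b \<and> \<theta>s ! i = (\<lambda>v. cnj (b v))) \<Longrightarrow>
     (\<And>i. j \<le> i \<Longrightarrow> i < p \<Longrightarrow> \<theta>s ! i \<in> range dz) \<Longrightarrow>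
     (\<And>i. j \<le> i \<Longrightarrow> p \<le> i \<Longrightarrow> i < p + q \<Longrightarrow> \<theta>s ! i \<in> range dzbar) \<Longrightarrow> wedges \<theta>s \<in> pq_forms p q" for j \<theta>s
  proof (induction j arbitrary: \<theta>s)
    case 0
    have "\<forall>i<p. \<exists>k. \<theta>s ! i = dz k" using 0(5) by auto
    then obtain f where f: "\<And>i. i < p \<Longrightarrow> \<theta>s ! i = dz (f i)" by metis
    have "\<exists>k. \<theta>s ! (p + i) = dzbar k" if "i < q" for i
    proof -
      have "\<theta>s ! (p + i) \<in> range dzbar" by (rule 0(6)) (use that in auto)
      then show ?thesis by blast
    qed
    then obtain g where g: "\<And>i. i < q \<Longrightarrow> \<theta>s ! (p + i) = dzbar (g i)" by metis
    have "\<theta>s = map dz (map f [0..<p]) @ map dzbar (map g [0..<q])"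
    proof (rule nth_equalityI)
      fix i assume "i < length \<theta>s"
      then show "\<theta>s ! i = (map dz (map f [0..<p]) @ map dzbar (map g [0..<q])) ! i"
        using f[of i] g[of "i - p"] 0(2) by (auto simp: nth_append)
    qed (use 0(2) in simp)
    then show ?case using pq_forms_basis[of "map f [0..<p]" p "map g [0..<q]" q] by simp
  next
    case (Suc j)
    have jl: "j < length \<theta>s" using Suc.prems(1,2) by simp
    show ?case
    proof (cases "j < p")
      case True
      then have "\<theta>s ! j = (\<lambda>v. \<Sum>i\<in>UNIV. (\<theta>s ! j) (axis i 1) * dz i v)" using Suc.prems(3) clin_rep by blast
      then have e: "\<theta>s[j := \<lambda>v. \<Sum>i\<in>UNIV. (\<theta>s ! j) (axis i 1) * dz i v] = \<theta>s" by (rule subst) simp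
      have eq: "wedges \<theta>s = (\<lambda>vs. \<Sum>i\<in>UNIV. (\<theta>s ! j) (axis i 1) * wedges (\<theta>s[j := dz i]) vs)"
        by (rule ext) (rule wedges_row_sum[OF jl, where S = UNIV and c = "\<lambda>i. (\<theta>s ! j) (axis i 1)" and f = dz, unfolded e])
      have "wedges (\<theta>s[j := dz i]) \<in> pq_forms p q" for i
      proof (rule Suc.IH)
        show "clin (\<theta>s[j := dz i] ! k)" if "k < p" for k
          using Suc.prems(3)[OF that] jl clin_dz by (cases "k = j") auto
        show "\<theta>s[j := dz i] ! k \<in> range dz" if "j \<le> k" "k < p" for k
          using Suc.prems(5)[of k] that jl by (cases "k = j") auto
      qed (use Suc.prems True in auto)
      then show ?thesis unfolding eq by (intro pq_forms_sum pq_forms_scale)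
    next
      case False
      then obtain b where b: "clin b" "\<theta>s ! j = (\<lambda>v. cnj (b v))" using Suc.prems(1,2) Suc.prems(4)[of j] by auto
      have "\<theta>s ! j = (\<lambda>v. \<Sum>i\<in>UNIV. cnj (b (axis i 1)) * dzbar i v)"
        unfolding b(2) by (subst clin_rep[OF b(1)]) (simp add: dz_def dzbar_def)
      then have e: "\<theta>s[j := \<lambda>v. \<Sum>i\<in>UNIV. cnj (b (axis i 1)) * dzbar i v] = \<theta>s" by (rule subst) simp
      have eq: "wedges \<theta>s = (\<lambda>vs. \<Sum>i\<in>UNIV. cnj (b (axis i 1)) * wedges (\<theta>s[j := dzbar i]) vs)"
        by (rule ext) (rule wedges_row_sum[OF jl, where S = UNIV and c = "\<lambda>i. cnj (b (axis i 1))" and f = dzbar, unfolded e])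
      have "wedges (\<theta>s[j := dzbar i]) \<in> pq_forms p q" for i
      proof (rule Suc.IH)
        show "\<exists>b. clin b \<and> \<theta>s[j := dzbar i] ! k = (\<lambda>v. cnj (b v))" if "p \<le> k" "k < p + q" for k
        proof (cases "k = j")
          case True
          then show ?thesis using jl by (intro exI[of _ "dz i"]) (auto simp: clin_dz dz_def dzbar_def)
        qed (use Suc.prems(4) that in auto)
        show "\<theta>s[j := dzbar i] ! k \<in> range dzbar" if "j \<le> k" "p \<le> k" "k < p + q" for k
          using Suc.prems(6)[of k] that jl by (cases "k = j") auto
      qed (use Suc.prems False in auto)
      then show ?thesis unfolding eq by (intro pq_forms_sum pq_forms_scale)
    qed
  qed
  show ?thesis
    by (rule main[of "p + q"]) (use assms in \<open>auto simp: nth_append intro!: exI\<close>)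
qed

text \<open>The type is the weight under multiplication of all arguments by a scalar; this is what
  separates the types below.\<close>

lemma wedges_homogeneous:
  "wedges (map dz I @ map dzbar J) (map (\<lambda>v. \<zeta> *s v) vs) =
    \<zeta> ^ length I * cnj \<zeta> ^ length J * wedges (map dz I @ map dzbar J) vs"
proof (cases "length vs = length I + length J")
  case True
  let ?\<theta>s = "map dz I @ map dzbar J" and ?n = "length I + length J"
  have "(\<Prod>i<?n. (?\<theta>s ! i) (map (\<lambda>v. \<zeta> *s v) vs ! \<sigma> i)) =
      \<zeta> ^ length I * cnj \<zeta> ^ length J * (\<Prod>i<?n. (?\<theta>s ! i) (vs ! \<sigma> i))" if s: "\<sigma> permutes {..<?n}" for \<sigma>
  proof -
    have si: "\<sigma> i < length vs" if "i < ?n" for i using permutes_in_image[OF s, of i] that True by simp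
    have "(\<Prod>i<?n. (?\<theta>s ! i) (map (\<lambda>v. \<zeta> *s v) vs ! \<sigma> i)) =
        (\<Prod>i<?n. (if i < length I then \<zeta> else cnj \<zeta>) * (?\<theta>s ! i) (vs ! \<sigma> i))"
      by (rule prod.cong) (auto simp: si nth_append dz_def dzbar_def)
    also have "\<dots> = (\<Prod>i<?n. if i < length I then \<zeta> else cnj \<zeta>) * (\<Prod>i<?n. (?\<theta>s ! i) (vs ! \<sigma> i))"
      by (rule prod.distrib)
    also have "(\<Prod>i<?n. if i < length I then \<zeta> else cnj \<zeta>) = \<zeta> ^ length I * cnj \<zeta> ^ length J"
    proof -
      have "{..<?n} \<inter> {i. i < length I} = {..<length I}" "{..<?n} \<inter> - {i. i < length I} = {length I..<?n}" by auto
      then show ?thesis by (simp add: prod.If_cases)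
    qed
    finally show ?thesis .
  qed
  then have "(\<Sum>\<sigma> | \<sigma> permutes {..<?n}. of_int (sign \<sigma>) * (\<Prod>i<?n. (?\<theta>s ! i) (map (\<lambda>v. \<zeta> *s v) vs ! \<sigma> i)))
    = (\<Sum>\<sigma> | \<sigma> permutes {..<?n}. of_int (sign \<sigma>) * (\<zeta> ^ length I * cnj \<zeta> ^ length J * (\<Prod>i<?n. (?\<theta>s ! i) (vs ! \<sigma> i))))"
    by (intro sum.cong) auto
  then show ?thesis using True by (simp add: wedges_def Let_def sum_distrib_left mult_ac)
qed (auto simp: wedges_def Let_def)

lemma pq_forms_homogeneous:
  assumes "\<alpha> \<in> pq_forms p q" shows "\<alpha> (map (\<lambda>v. \<zeta> *s v) vs) = \<zeta> ^ p * cnj \<zeta> ^ q * \<alpha> vs"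
proof -
  obtain a where a: "\<alpha> = (\<lambda>vs. \<Sum>I | length I = p. \<Sum>J | length J = q. a I J * wedges (map dz I @ map dzbar J) vs)"
    using assms unfolding pq_forms_def by blast
  show ?thesis unfolding a
    by (auto simp: wedges_homogeneous sum_distrib_left mult_ac intro!: sum.cong)
qed

text \<open>For a unit \<zeta> the component of type \<open>(r, n - r)\<close> has weight
  \<open>\<zeta> ^ r * cnj \<zeta> ^ (n - r)\<close>. Multiplied by \<open>\<zeta> ^ n\<close> this
  is a power of the square of \<zeta>, so the components are the coefficients of a polynomial with
  infinitely many roots.\<close>

lemma pq_forms_independent:
  assumes g: "\<And>r. r \<le> n \<Longrightarrow> \<gamma> r \<in> pq_forms r (n - r)" and z: "\<And>vs. (\<Sum>r\<le>n. \<gamma> r vs) = 0" and r: "r \<le> n"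
  shows "\<gamma> r vs = 0"
proof -
  have "(\<Sum>r\<le>n. \<gamma> r vs * (\<zeta>\<^sup>2) ^ r) = 0" if "norm \<zeta> = 1" for \<zeta> :: complex
  proof -
    have c: "\<zeta> * cnj \<zeta> = 1" using that by (simp add: complex_norm_square[symmetric])
    have e: "\<zeta> ^ n * (\<zeta> ^ r * cnj \<zeta> ^ (n - r)) = (\<zeta>\<^sup>2) ^ r" if "r \<le> n" for r
    proof -
      have "\<zeta> ^ n = \<zeta> ^ r * \<zeta> ^ (n - r)" using that by (simp add: power_add[symmetric])
      then have "\<zeta> ^ n * (\<zeta> ^ r * cnj \<zeta> ^ (n - r)) = (\<zeta> * \<zeta>) ^ r * (\<zeta> * cnj \<zeta>) ^ (n - r)"
        by (simp add: power_mult_distrib mult_ac)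
      then show ?thesis by (simp add: c power2_eq_square)
    qed
    have "0 = \<zeta> ^ n * (\<Sum>r\<le>n. \<gamma> r (map (\<lambda>v. \<zeta> *s v) vs))" by (simp add: z)
    also have "\<dots> = (\<Sum>r\<le>n. \<zeta> ^ n * (\<zeta> ^ r * cnj \<zeta> ^ (n - r)) * \<gamma> r vs)"
      by (simp add: sum_distrib_left mult.assoc pq_forms_homogeneous[OF g])
    also have "\<dots> = (\<Sum>r\<le>n. \<gamma> r vs * (\<zeta>\<^sup>2) ^ r)"
      by (rule sum.cong) (auto simp: e)
    finally show ?thesis by simp
  qed
  note root = this
  have "\<forall>i\<le>n. \<gamma> i vs = 0"
  proof (rule ccontr)
    assume "\<not> (\<forall>i\<le>n. \<gamma> i vs = 0)"
    then obtain k where "k \<le> n" "\<gamma> k vs \<noteq> 0" by blast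
    then have "finite {z. (\<Sum>i\<le>n. \<gamma> i vs * z ^ i) = 0}"
      using polyfun_finite_roots[of "\<lambda>i. \<gamma> i vs" n] by blast
    moreover have "sphere (0::complex) 1 \<subseteq> {z. (\<Sum>i\<le>n. \<gamma> i vs * z ^ i) = 0}"
    proof
      fix z :: complex assume "z \<in> sphere 0 1"
      \<comment> \<open>The polynomial relation is known for squares of unit numbers, and every unit
        number is such a square.\<close>
      then have "norm (csqrt z) = 1" by (simp add: norm_csqrt) 
      from root[OF this] show "z \<in> {z. (\<Sum>i\<le>n. \<gamma> i vs * z ^ i) = 0}" by simp
    qed
    moreover have "infinite (sphere (0::complex) 1)"
    proof
      assume "finite (sphere (0::complex) 1)"
      moreover have "connected (sphere (0::complex) 1)" by (rule connected_sphere) simp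
      ultimately obtain a where "sphere (0::complex) 1 = {a}"
        using connected_finite_iff_sing[of "sphere (0::complex) 1"] by auto
      moreover have "1 \<in> sphere (0::complex) 1" "- 1 \<in> sphere (0::complex) 1" by auto
      ultimately show False by simp
    qed
    ultimately show False using finite_subset by blast
  qed
  then show ?thesis using r by blast
qed

text \<open>Uniqueness of the decomposition makes the description in \<open>pq_part\<close>
  definite, so any explicit decomposition computes it.\<close>

lemma pq_part_eq:
  assumes g: "\<And>r. r \<le> p + q \<Longrightarrow> \<gamma> r \<in> pq_forms r (p + q - r)" and \<alpha>: "\<alpha> = (\<lambda>vs. \<Sum>r\<le>p + q. \<gamma> r vs)"
  shows "pq_part p q \<alpha> = \<gamma> p"
  unfolding pq_part_def
proof (rule the_equality)
  show "\<exists>\<gamma>'. (\<forall>r\<le>p + q. \<gamma>' r \<in> pq_forms r (p + q - r)) \<and> \<alpha> = (\<lambda>vs. \<Sum>r\<le>p + q. \<gamma>' r vs) \<and> \<gamma> p = \<gamma>' p"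
    using g \<alpha> by blast
next
  fix \<beta> assume "\<exists>\<gamma>'. (\<forall>r\<le>p + q. \<gamma>' r \<in> pq_forms r (p + q - r)) \<and> \<alpha> = (\<lambda>vs. \<Sum>r\<le>p + q. \<gamma>' r vs) \<and> \<beta> = \<gamma>' p"
  then obtain \<gamma>' where g': "\<And>r. r \<le> p + q \<Longrightarrow> \<gamma>' r \<in> pq_forms r (p + q - r)"
    "\<alpha> = (\<lambda>vs. \<Sum>r\<le>p + q. \<gamma>' r vs)" "\<beta> = \<gamma>' p" by blast
  have "(\<lambda>vs. \<gamma> p vs + (- 1) * \<gamma>' p vs) vs = 0" for vs
  proof (rule pq_forms_independent[where \<gamma> = "\<lambda>r vs. \<gamma> r vs + (- 1) * \<gamma>' r vs" and n = "p + q" and r = p])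
    show "(\<lambda>vs. \<gamma> r vs + (- 1) * \<gamma>' r vs) \<in> pq_forms r (p + q - r)" if "r \<le> p + q" for r
      by (intro pq_forms_add pq_forms_scale g g' that)
    show "(\<Sum>r\<le>p + q. \<gamma> r vs + - 1 * \<gamma>' r vs) = 0" for vs
      using fun_cong[OF \<alpha>, of vs] fun_cong[OF g'(2), of vs] by (simp add: sum_subtractf)
  qed simp
  then show "\<beta> = \<gamma> p" using g'(3) by (auto simp: fun_eq_iff)
qed

lemma pq_forms_alt_forms: assumes "\<alpha> \<in> pq_forms p q" shows "\<alpha> \<in> alt_forms (p + q)"
proof -
  obtain a where a: "\<alpha> = (\<lambda>vs. \<Sum>I | length I = p. \<Sum>J | length J = q. a I J * wedges (map dz I @ map dzbar J) vs)"
    using assms unfolding pq_forms_def by blast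
  have w: "wedges (map dz I @ map dzbar J) \<in> alt_forms (p + q)" if "length I = p" "length J = q" for I J
  proof -
    have "\<forall>\<theta>\<in>set (map dz I @ map dzbar J). linear \<theta>"
      using clin_linear[OF clin_dz] clin_cnj_linear[OF clin_dz]
      by (auto simp: dz_def[abs_def] dzbar_def[abs_def])
    from wedges_alt_forms[OF this] show ?thesis using that by simp
  qed
  show ?thesis unfolding alt_forms_def
  proof (intro CollectI conjI allI impI)
    fix vs :: "(complex^3) list" and i assume "length vs = p + q" "i < p + q"
    then show "linear (\<lambda>v. \<alpha> (vs[i := v]))"
    proof -
      have "linear (\<lambda>v. a I J * wedges (map dz I @ map dzbar J) (vs[i := v]))" if "length I = p" "length J = q" for I J
        using alt_forms_linear[OF w[OF that] \<open>length vs = p + q\<close> \<open>i < p + q\<close>]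
        by (simp add: linear_iff distrib_left scaleR_conv_of_real[where 'a=complex])
      then show ?thesis unfolding a by (intro linear_compose_sum ballI) auto
    qed
  qed (use w in \<open>auto simp: a alt_forms_def intro!: sum.neutral\<close>)
qed

lemma pq_forms_comp:
  assumes \<alpha>: "\<alpha> \<in> pq_forms p q" and L: "linear L" "\<And>v. L (\<i> *s v) = \<i> *s L v"
  shows "(\<lambda>vs. \<alpha> (map L vs)) \<in> pq_forms p q"
proof -
  obtain a where a: "\<alpha> = (\<lambda>vs. \<Sum>I | length I = p. \<Sum>J | length J = q. a I J * wedges (map dz I @ map dzbar J) vs)"
    using \<alpha> unfolding pq_forms_def by blast
  have Ls: "L (c *s v) = c *s L v" for c v
  proof -
    have "c *s v = Re c *\<^sub>R v + Im c *\<^sub>R (\<i> *s v)" for v :: "complex^3"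
      by (simp add: vec_eq_iff scaleR_conv_of_real[where 'a=complex] complex_eq_iff algebra_simps)
    then show ?thesis using L by (simp add: linear_add linear_scale)
  qed
  have cl: "clin (\<lambda>v. dz i (L v))" for i using L(1) by (simp add: clin_def dz_def linear_add Ls)
  have "(\<lambda>vs. wedges (map dz I @ map dzbar J) (map L vs)) \<in> pq_forms p q" if IJ: "length I = p" "length J = q" for I J
  proof -
    have "wedges (map dz I @ map dzbar J) (map L vs) =
        wedges (map (\<lambda>i v. dz i (L v)) I @ map (\<lambda>b v. cnj (b v)) (map (\<lambda>i v. dz i (L v)) J)) vs" for vs
      by (auto simp: wedges_detn nth_append dz_def dzbar_def intro!: detn_cong)
    then show ?thesis
      using wedges_pq_forms[of "map (\<lambda>i v. dz i (L v)) I" p "map (\<lambda>i v. dz i (L v)) J" q] IJ cl by simp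
  qed
  then show ?thesis unfolding a by (intro pq_forms_sum pq_forms_scale) auto
qed

section \<open>Wedge products, top degree and positivity\<close>

lemma sum_permutations_compose:
  assumes "q permutes S"
  shows "(\<Sum>\<sigma> | \<sigma> permutes S. f \<sigma>) = (\<Sum>\<sigma> | \<sigma> permutes S. f (\<sigma> \<circ> q))"
  by (rule sum_permutations_compose_right[OF assms])

text \<open>Inserting both determinants gives a triple sum over permutations. For fixed inner
  permutations \<tau> and \<pi> the outer sum is already the full wedge, by reindexing, so the
  factorials in the normalisation count equal summands.\<close>

lemma wedge_wedges: "wedge (wedges as) (wedges bs) = wedges (as @ bs)"
proof
  fix vs :: "(complex^3) list"
  let ?p = "length as" and ?q = "length bs" and ?n = "length vs"
  let ?T = "\<lambda>p. \<Sum>\<sigma> | \<sigma> permutes {..<?n}. of_int (sign \<sigma>) / (fact p * fact (?n - p)) *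
       wedges as (map (\<lambda>i. vs ! \<sigma> i) [0..<p]) * wedges bs (map (\<lambda>i. vs ! \<sigma> i) [p..<?n])"
  have T0: "?T p = 0" if "p \<noteq> ?p \<or> ?n - p \<noteq> ?q" for p
    using that by (intro sum.neutral) (auto simp: wedges_def Let_def)
  show "wedge (wedges as) (wedges bs) vs = wedges (as @ bs) vs"
  proof (cases "?n = ?p + ?q")
    case False
    then have "p \<noteq> ?p \<or> ?n - p \<noteq> ?q" if "p \<le> ?n" for p using that by auto
    then have "(\<Sum>p\<le>?n. ?T p) = 0" using T0 by (intro sum.neutral) auto
    then show ?thesis using False by (simp add: wedge_def Let_def wedges_def[of "as @ bs"])
  next
    case n: True
    define P where "P = (\<lambda>\<sigma>. (\<Prod>i<?n. ((as @ bs) ! i) (vs ! \<sigma> i)))"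
    have shift: "bij_betw ((+) ?p) {..<?q} {?p..<?n}"
      by (rule bij_betwI[where g = "\<lambda>i. i - ?p"]) (auto simp: n)
    have main: "(\<Sum>\<sigma> | \<sigma> permutes {..<?n}. of_int (sign \<sigma> * sign \<tau> * sign \<pi>) *
        ((\<Prod>i<?p. (as ! i) (vs ! \<sigma> (\<tau> i))) * (\<Prod>i<?q. (bs ! i) (vs ! \<sigma> (?p + \<pi> i))))) = wedges (as @ bs) vs"
      if \<tau>: "\<tau> permutes {..<?p}" and \<pi>: "\<pi> permutes {..<?q}" for \<tau> \<pi>
    proof -
      \<comment> \<open>\<pi> is transported to the last block of indices; then \<rho> acts as
        \<tau> on the first block and as \<pi> on the second.\<close>
      define \<pi>' where "\<pi>' = map_permutation {..<?q} ((+) ?p) \<pi>"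
      have \<pi>'p: "\<pi>' permutes {?p..<?n}" unfolding \<pi>'_def by (rule map_permutation_permutes[OF shift \<pi>])
      have \<pi>'s: "sign \<pi>' = sign \<pi>" unfolding \<pi>'_def by (rule sign_map_permutation) (use \<pi> in auto)
      have \<pi>'a: "\<pi>' (?p + i) = ?p + \<pi> i" if "i < ?q" for i
        unfolding \<pi>'_def using that by (subst map_permutation_apply) auto
      define \<rho> where "\<rho> = \<tau> \<circ> \<pi>'"
      have tn: "\<tau> permutes {..<?n}" "\<pi>' permutes {..<?n}"
        by (rule permutes_subset[OF \<tau>], force simp: n) (rule permutes_subset[OF \<pi>'p], force)
      have \<rho>p: "\<rho> permutes {..<?n}" unfolding \<rho>_def by (rule permutes_compose[OF tn(2,1)])
      have \<rho>s: "sign \<rho> = sign \<tau> * sign \<pi>"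
        unfolding \<rho>_def using tn by (subst sign_compose) (auto simp: \<pi>'s intro: permutes_imp_permutation)
      have r1: "\<rho> i = \<tau> i" if "i < ?p" for i
        using \<pi>'p that by (simp add: \<rho>_def permutes_def)
      have r2: "\<rho> (?p + i) = ?p + \<pi> i" if "i < ?q" for i
        using \<tau> that by (simp add: \<rho>_def \<pi>'a permutes_def)
      have split: "(\<Prod>i<?n. f i) = (\<Prod>i<?p. f i) * (\<Prod>i<?q. f (?p + i))" for f :: "nat \<Rightarrow> complex"
      proof -
        have "{..<?n} = {..<?p} \<union> {?p..<?n}" by (auto simp: n)
        then have "(\<Prod>i<?n. f i) = (\<Prod>i<?p. f i) * (\<Prod>i\<in>{?p..<?n}. f i)"
          by (simp add: prod.union_disjoint ivl_disj_int)
        then show ?thesis by (simp add: prod.reindex_bij_betw[OF shift, symmetric])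
      qed
      have "wedges (as @ bs) vs = (\<Sum>\<sigma> | \<sigma> permutes {..<?n}. of_int (sign \<sigma>) * P \<sigma>)"
        by (simp add: wedges_def Let_def P_def n)
      also have "\<dots> = (\<Sum>\<sigma> | \<sigma> permutes {..<?n}. of_int (sign (\<sigma> \<circ> \<rho>)) * P (\<sigma> \<circ> \<rho>))"
        by (rule sum_permutations_compose[OF \<rho>p])
      also have "\<dots> = (\<Sum>\<sigma> | \<sigma> permutes {..<?n}. of_int (sign \<sigma> * sign \<tau> * sign \<pi>) *
        ((\<Prod>i<?p. (as ! i) (vs ! \<sigma> (\<tau> i))) * (\<Prod>i<?q. (bs ! i) (vs ! \<sigma> (?p + \<pi> i)))))"
      proof (rule sum.cong[OF refl])
        fix \<sigma> assume "\<sigma> \<in> {\<sigma>. \<sigma> permutes {..<?n}}"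
        then have "sign (\<sigma> \<circ> \<rho>) = sign \<sigma> * sign \<tau> * sign \<pi>"
          using \<rho>p by (subst sign_compose) (auto simp: \<rho>s intro: permutes_imp_permutation)
        moreover have "P (\<sigma> \<circ> \<rho>) = (\<Prod>i<?p. (as ! i) (vs ! \<sigma> (\<tau> i))) * (\<Prod>i<?q. (bs ! i) (vs ! \<sigma> (?p + \<pi> i)))"
          unfolding P_def split by (simp add: r1 r2 nth_append)
        ultimately show "of_int (sign (\<sigma> \<circ> \<rho>)) * P (\<sigma> \<circ> \<rho>) = of_int (sign \<sigma> * sign \<tau> * sign \<pi>) *
        ((\<Prod>i<?p. (as ! i) (vs ! \<sigma> (\<tau> i))) * (\<Prod>i<?q. (bs ! i) (vs ! \<sigma> (?p + \<pi> i))))" by simp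
      qed
      finally show ?thesis ..
    qed
    have "?T ?p = (\<Sum>\<sigma> | \<sigma> permutes {..<?n}. \<Sum>\<tau> | \<tau> permutes {..<?p}. \<Sum>\<pi> | \<pi> permutes {..<?q}.
        1 / (fact ?p * fact ?q) * (of_int (sign \<sigma> * sign \<tau> * sign \<pi>) *
        ((\<Prod>i<?p. (as ! i) (vs ! \<sigma> (\<tau> i))) * (\<Prod>i<?q. (bs ! i) (vs ! \<sigma> (?p + \<pi> i))))))"
    proof (rule sum.cong[OF refl])
      fix \<sigma>
      have "wedges as (map (\<lambda>i. vs ! \<sigma> i) [0..<?p]) =
          (\<Sum>\<tau> | \<tau> permutes {..<?p}. of_int (sign \<tau>) * (\<Prod>i<?p. (as ! i) (vs ! \<sigma> (\<tau> i))))"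
      proof -
        have "\<tau> i < ?p" if "\<tau> permutes {..<?p}" "i < ?p" for \<tau> i
          using permutes_in_image[OF that(1), of i] that(2) by simp
        then show ?thesis
          unfolding wedges_def Let_def by (auto intro!: sum.cong prod.cong)
      qed
      moreover have "wedges bs (map (\<lambda>i. vs ! \<sigma> i) [?p..<?n]) =
          (\<Sum>\<pi> | \<pi> permutes {..<?q}. of_int (sign \<pi>) * (\<Prod>i<?q. (bs ! i) (vs ! \<sigma> (?p + \<pi> i))))"
      proof -
        have "\<pi> i < ?q" if "\<pi> permutes {..<?q}" "i < ?q" for \<pi> i
          using permutes_in_image[OF that(1), of i] that(2) by simp
        then show ?thesis
          unfolding wedges_def Let_def by (auto intro!: sum.cong prod.cong simp: n)
      qed
      ultimately show "of_int (sign \<sigma>) / (fact ?p * fact (?n - ?p)) *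
           wedges as (map (\<lambda>i. vs ! \<sigma> i) [0..<?p]) * wedges bs (map (\<lambda>i. vs ! \<sigma> i) [?p..<?n]) =
         (\<Sum>\<tau> | \<tau> permutes {..<?p}. \<Sum>\<pi> | \<pi> permutes {..<?q}.
        1 / (fact ?p * fact ?q) * (of_int (sign \<sigma> * sign \<tau> * sign \<pi>) *
        ((\<Prod>i<?p. (as ! i) (vs ! \<sigma> (\<tau> i))) * (\<Prod>i<?q. (bs ! i) (vs ! \<sigma> (?p + \<pi> i))))))"
        by (simp add: n sum_product sum_distrib_left sum_divide_distrib mult_ac)
    qed
    also have "\<dots> = (\<Sum>\<tau> | \<tau> permutes {..<?p}. \<Sum>\<pi> | \<pi> permutes {..<?q}. \<Sum>\<sigma> | \<sigma> permutes {..<?n}.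
        1 / (fact ?p * fact ?q) * (of_int (sign \<sigma> * sign \<tau> * sign \<pi>) *
        ((\<Prod>i<?p. (as ! i) (vs ! \<sigma> (\<tau> i))) * (\<Prod>i<?q. (bs ! i) (vs ! \<sigma> (?p + \<pi> i))))))"
      by (subst sum.swap) (rule sum.cong[OF refl], rule sum.swap)
    also have "\<dots> = (\<Sum>\<tau> | \<tau> permutes {..<?p}. \<Sum>\<pi> | \<pi> permutes {..<?q}.
        1 / (fact ?p * fact ?q) * wedges (as @ bs) vs)"
      unfolding sum_distrib_left[symmetric] using main by (intro sum.cong refl arg_cong2[where f = times]) auto
    \<comment> \<open>The number of pairs of inner permutations cancels the product of
      factorials.\<close>
    also have "\<dots> = wedges (as @ bs) vs"
      by (simp add: card_permutations[of _ ?p] card_permutations[of _ ?q])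
    finally have "?T ?p = wedges (as @ bs) vs" .
    moreover have "(\<Sum>p\<le>?n. ?T p) = ?T ?p"
    proof -
      have "(\<Sum>p\<le>?n. ?T p) = ?T ?p + (\<Sum>p\<in>{..?n} - {?p}. ?T p)"
        by (rule sum.remove) (auto simp: n)
      also have "(\<Sum>p\<in>{..?n} - {?p}. ?T p) = 0" by (rule sum.neutral) (use T0 in auto)
      finally show ?thesis by simp
    qed
    ultimately show ?thesis by (simp add: wedge_def Let_def)
  qed
qed

lemma wedge_scale_left: "wedge (\<lambda>vs. c * \<alpha> vs) \<beta> = (\<lambda>vs. c * wedge \<alpha> \<beta> vs)"
  by (rule ext) (simp add: wedge_def Let_def sum_distrib_left mult_ac)

lemma wedge_scale_right: "wedge \<alpha> (\<lambda>vs. c * \<beta> vs) = (\<lambda>vs. c * wedge \<alpha> \<beta> vs)"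
  by (rule ext) (simp add: wedge_def Let_def sum_distrib_left mult_ac)

lemma wedge_add_left: "wedge (\<lambda>vs. \<alpha> vs + \<alpha>' vs) \<beta> = (\<lambda>vs. wedge \<alpha> \<beta> vs + wedge \<alpha>' \<beta> vs)"
  by (rule ext) (simp add: wedge_def Let_def sum.distrib algebra_simps)

lemma detn_1: "detn (Suc 0) C = C 0 0" by (simp add: detn_Suc)

lemma wedges_1: "wedges [a] vs = (case vs of [u] \<Rightarrow> a u | _ \<Rightarrow> 0)"
  by (auto simp: wedges_detn detn_1 split: list.splits)

lemma wedges_2: "wedges [a, b] [u, v] = a u * b v - a v * b u"
  by (simp add: wedges_detn detn_Suc)

lemma wedges_3: "wedges [a, b, c] [u, v, w] =
  (a u * b v - a v * b u) * c w - (a u * b w - a w * b u) * c v + (a v * b w - a w * b v) * c u"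
  by (simp add: wedges_detn detn_Suc algebra_simps)

lemma wedges_4: "wedges [a, b, c, d] [u, v, w, z] =
   (a u * b v - a v * b u) * (c w * d z - c z * d w)
 - (a u * b w - a w * b u) * (c v * d z - c z * d v)
 + (a u * b z - a z * b u) * (c v * d w - c w * d v)
 + (a v * b w - a w * b v) * (c u * d z - c z * d u)
 - (a v * b z - a z * b v) * (c u * d w - c w * d u)
 + (a w * b z - a z * b w) * (c u * d v - c v * d u)"
  by (simp add: wedges_detn detn_Suc algebra_simps)

text \<open>Every complex line splits off the factor \<open>- 2 \<i>\<close>, after which the rows of the
  \<open>(1, 0)\<close>-forms and those of their conjugates live in complementary columns.\<close>

lemma detn_6_block:
  fixes f g h :: "3 \<Rightarrow> complex"
  defines "P \<equiv> \<lambda>k r. if r = 0 then f k else if r = 1 then g k else if r = 4 then h k else (0::complex)"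
    and "Q \<equiv> \<lambda>k r. if r = 2 then cnj (f k) else if r = 3 then cnj (g k) else if r = (5::nat) then cnj (h k) else 0"
  defines "\<delta> \<equiv> f 1 * (g 2 * h 3 - g 3 * h 2) - f 2 * (g 1 * h 3 - g 3 * h 1) + f 3 * (g 1 * h 2 - g 2 * h 1)"
  shows "detn 6 (\<lambda>j. [P 1, Q 1, P 2, Q 2, P 3, Q 3] ! j) = - \<delta> * cnj \<delta>"
proof -
  have 6: "(6::nat) = Suc (Suc (Suc (Suc (Suc (Suc 0)))))" by simp
  have "detn 6 (\<lambda>j. [P 1, Q 1, P 2, Q 2, P 3, Q 3] ! j) =
    - (f 1 * (g 2 * h 3 - g 3 * h 2) - f 2 * (g 1 * h 3 - g 3 * h 1) + f 3 * (g 1 * h 2 - g 2 * h 1)) *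
    (cnj (f 1) * (cnj (g 2) * cnj (h 3) - cnj (g 3) * cnj (h 2)) - cnj (f 2) * (cnj (g 1) * cnj (h 3) - cnj (g 3) * cnj (h 1)) + cnj (f 3) * (cnj (g 1) * cnj (h 2) - cnj (g 2) * cnj (h 1)))"
    unfolding 6 by (simp add: detn_Suc lessThan_Suc P_def Q_def numeral_eq_Suc) (simp add: algebra_simps)
  then show ?thesis by (simp add: \<delta>_def)
qed

lemma detn_6_pairs:
  "detn 6 (\<lambda>j. [\<lambda>r. P1 r + Q1 r, \<lambda>r. \<i> * P1 r - \<i> * Q1 r, \<lambda>r. P2 r + Q2 r, \<lambda>r. \<i> * P2 r - \<i> * Q2 r,
      \<lambda>r. P3 r + Q3 r, \<lambda>r. \<i> * P3 r - \<i> * Q3 r] ! j)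
   = 8 * \<i> * detn 6 (\<lambda>j. [P1, Q1, P2, Q2, P3, Q3] ! j)"
proof -
  let ?E = "\<lambda>x0 x1 x2 x3 x4 x5. detn 6 (\<lambda>j. [x0, x1, x2, x3, x4, x5] ! j)"
  have c: "j = 0 \<or> j = 1 \<or> j = 2 \<or> j = 3 \<or> j = 4 \<or> j = 5" if "j < 6" for j :: nat using that by auto
  have E: "?E x0 x1 x2 x3 x4 x5 = detn 6 (C(0 := x0, 1 := x1, 2 := x2, 3 := x3, 4 := x4, 5 := x5))" for x0 x1 x2 x3 x4 x5 C
    by (rule detn_cong) (auto dest!: c)
  let ?s = "\<lambda>P Q r. P r + Q r :: complex" and ?d = "\<lambda>P Q r. \<i> * P r - \<i> * Q r"
  have e1: "?E (?s P Q) (?d P Q) x2 x3 x4 x5 = - 2 * \<i> * ?E P Q x2 x3 x4 x5" for P Q x2 x3 x4 x5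
  proof -
    have "?E x0 x1 x2 x3 x4 x5 = detn 6 ((\<lambda>j. [P, Q, x2, x3, x4, x5] ! j)(0 := x0, 1 := x1))" for x0 x1
      by (rule detn_cong) (auto dest!: c)
    then show ?thesis using detn_pair[of 0 6 1 "\<lambda>j. [P, Q, x2, x3, x4, x5] ! j" P Q] by simp
  qed
  have e2: "?E x0 x1 (?s P Q) (?d P Q) x4 x5 = - 2 * \<i> * ?E x0 x1 P Q x4 x5" for P Q x0 x1 x4 x5
  proof -
    have "?E x0 x1 x2 x3 x4 x5 = detn 6 ((\<lambda>j. [x0, x1, P, Q, x4, x5] ! j)(2 := x2, 3 := x3))" for x2 x3
      by (rule detn_cong) (auto dest!: c)
    then show ?thesis using detn_pair[of 2 6 3 "\<lambda>j. [x0, x1, P, Q, x4, x5] ! j" P Q] by simp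
  qed
  have e3: "?E x0 x1 x2 x3 (?s P Q) (?d P Q) = - 2 * \<i> * ?E x0 x1 x2 x3 P Q" for P Q x0 x1 x2 x3
  proof -
    have "?E x0 x1 x2 x3 x4 x5 = detn 6 ((\<lambda>j. [x0, x1, x2, x3, P, Q] ! j)(4 := x4, 5 := x5))" for x4 x5
      by (rule detn_cong) (auto dest!: c)
    then show ?thesis using detn_pair[of 4 6 5 "\<lambda>j. [x0, x1, x2, x3, P, Q] ! j" P Q] by simp
  qed
  show ?thesis unfolding e1 e2 e3 by simp
qed

text \<open>\<delta> is the determinant of the three functionals on the standard basis. The three
  complex lines contribute the cube of \<open>- 2 * \<i>\<close>, that is \<open>8 * \<i>\<close>,
  and regrouping the rows contributes the remaining minus sign.\<close>

lemma wedges_6_basis: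
  assumes "clin f" "clin g" "clin h"
  defines "\<delta> \<equiv> f (axis 1 1) * (g (axis 2 1) * h (axis 3 1) - g (axis 3 1) * h (axis 2 1))
    - f (axis 2 1) * (g (axis 1 1) * h (axis 3 1) - g (axis 3 1) * h (axis 1 1))
    + f (axis 3 1) * (g (axis 1 1) * h (axis 2 1) - g (axis 2 1) * h (axis 1 1))"
  shows "wedges [f, g, \<lambda>v. cnj (f v), \<lambda>v. cnj (g v), h, \<lambda>v. cnj (h v)]
    [axis 1 1, \<i> *s axis 1 1, axis 2 1, \<i> *s axis 2 1, axis 3 1, \<i> *s axis 3 1] = - 8 * \<i> * (\<delta> * cnj \<delta>)"
proof -
  define P where "P = (\<lambda>k::3. \<lambda>r::nat. if r = 0 then f (axis k 1) else if r = 1 then g (axis k 1) else if r = 4 then h (axis k 1) else 0)"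
  define Q where "Q = (\<lambda>k::3. \<lambda>r::nat. if r = 2 then cnj (f (axis k 1)) else if r = 3 then cnj (g (axis k 1)) else if r = 5 then cnj (h (axis k 1)) else 0)"
  have c: "j = 0 \<or> j = 1 \<or> j = 2 \<or> j = 3 \<or> j = 4 \<or> j = 5" if "j < 6" for j :: nat using that by auto
  have s: "\<theta> (\<i> *s v) = \<i> * \<theta> v" if "\<theta> \<in> {f, g, h}" for \<theta> v using that assms by (auto simp: clin_def)
  let ?\<theta>s = "[f, g, \<lambda>v. cnj (f v), \<lambda>v. cnj (g v), h, \<lambda>v. cnj (h v)]"
  let ?B = "[axis 1 1, \<i> *s axis 1 1, axis 2 1, \<i> *s axis 2 1, axis 3 1, \<i> *s axis 3 1] :: (complex^3) list"
  have "wedges ?\<theta>s ?B = detn 6 (\<lambda>j i. (?\<theta>s ! i) (?B ! j))" by (simp add: wedges_detn eval_nat_numeral)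
  also have "\<dots> = detn 6 (\<lambda>j. [\<lambda>r. P 1 r + Q 1 r, \<lambda>r. \<i> * P 1 r - \<i> * Q 1 r, \<lambda>r. P 2 r + Q 2 r, \<lambda>r. \<i> * P 2 r - \<i> * Q 2 r,
      \<lambda>r. P 3 r + Q 3 r, \<lambda>r. \<i> * P 3 r - \<i> * Q 3 r] ! j)"
    by (rule detn_cong, drule c, drule c, elim disjE) (simp_all add: P_def Q_def s)
  also have "\<dots> = 8 * \<i> * detn 6 (\<lambda>j. [P 1, Q 1, P 2, Q 2, P 3, Q 3] ! j)" by (rule detn_6_pairs)
  also have "detn 6 (\<lambda>j. [P 1, Q 1, P 2, Q 2, P 3, Q 3] ! j) = - \<delta> * cnj \<delta>"
    unfolding P_def Q_def \<delta>_def by (rule detn_6_block)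
  finally show ?thesis by simp
qed

lemma pq_forms_1_0_clin:
  assumes "\<eta> \<in> pq_forms 1 0" shows "clin (\<lambda>v. \<eta> [v])" "\<eta> = wedges [\<lambda>v. \<eta> [v]]"
proof -
  have alt: "\<eta> \<in> alt_forms 1" using pq_forms_alt_forms[OF assms] by simp
  have "linear (\<lambda>v. \<eta> ([0][0 := v]))" by (rule alt_forms_linear[OF alt]) auto
  then show "clin (\<lambda>v. \<eta> [v])"
    using pq_forms_homogeneous[OF assms, of _ "[_]"] linear_add[of "\<lambda>v. \<eta> [v]"] by (auto simp: clin_def)
  show "\<eta> = wedges [\<lambda>v. \<eta> [v]]"
    by (rule ext) (auto simp: wedges_1 alt_forms_length[OF alt] split: list.splits)
qed

lemma clin_pq_forms: "clin \<theta> \<Longrightarrow> wedges [\<theta>] \<in> pq_forms 1 0"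
  using wedges_pq_forms[of "[\<theta>]" 1 "[]" 0] by simp

lemma clin_comp: "clin \<theta> \<Longrightarrow> linear L \<Longrightarrow> (\<And>v. L (\<i> *s v) = \<i> *s L v) \<Longrightarrow> clin (\<lambda>v. \<theta> (L v))"
  unfolding clin_def
proof (intro conjI allI)
  fix c v assume \<theta>: "(\<forall>u v. \<theta> (u + v) = \<theta> u + \<theta> v) \<and> (\<forall>c v. \<theta> (c *s v) = c * \<theta> v)"
    and L: "linear L" "\<And>v. L (\<i> *s v) = \<i> *s L v"
  have "c *s v = Re c *\<^sub>R v + Im c *\<^sub>R (\<i> *s v)" for v :: "complex^3"
    by (simp add: vec_eq_iff scaleR_conv_of_real[where 'a=complex] complex_eq_iff algebra_simps)
  then have "L (c *s v) = c *s L v" using L by (simp add: linear_add linear_scale)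
  then show "\<theta> (L (c *s v)) = c * \<theta> (L v)" using \<theta> by simp
qed (simp add: linear_add)

text \<open>Wedging with \<open>\<i> * \<eta>\<close> and its conjugate multiplies the value in
  \<open>wedges_6_basis\<close> by \<open>\<i>\<close>, and \<open>\<i> * (- 8 * \<i>)\<close> is
  positive.\<close>

lemma nonneg_22_wedges:
  assumes "clin f" "clin g" "\<kappa> \<ge> 0"
  shows "nonneg_22 (\<lambda>vs. complex_of_real \<kappa> * wedges [f, g, \<lambda>v. cnj (f v), \<lambda>v. cnj (g v)] vs)"
  unfolding nonneg_22_def
proof
  fix \<eta> assume \<eta>: "\<eta> \<in> pq_forms 1 0"
  define h where "h = (\<lambda>v. \<eta> [v])"
  have h: "clin h" "\<eta> = wedges [h]" unfolding h_def using pq_forms_1_0_clin[OF \<eta>] by auto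
  have bar: "cform_bar \<eta> = wedges [\<lambda>v. cnj (h v)]"
    unfolding h(2) by (rule ext) (auto simp: cform_bar_def wedges_1 split: list.splits)
  obtain \<delta> where \<delta>: "wedges [f, g, \<lambda>v. cnj (f v), \<lambda>v. cnj (g v), h, \<lambda>v. cnj (h v)]
    [axis 1 1, \<i> *s axis 1 1, axis 2 1, \<i> *s axis 2 1, axis 3 1, \<i> *s axis 3 1] = - 8 * \<i> * (\<delta> * cnj \<delta>)"
    using wedges_6_basis[OF assms(1,2) h(1)] by blast
  have e: "\<delta> * cnj \<delta> = complex_of_real ((cmod \<delta>)\<^sup>2)" by (metis complex_norm_square)
  have "8 * \<kappa> * (cmod \<delta>)\<^sup>2 \<ge> 0" using assms by simp
  then have "complex_of_real (8 * \<kappa> * (cmod \<delta>)\<^sup>2) \<in> \<real>\<^sub>\<ge>\<^sub>0" by (simp only: nonneg_Reals_of_real_iff)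
  then show "top_nonneg (wedge (\<lambda>vs. complex_of_real \<kappa> * wedges [f, g, \<lambda>v. cnj (f v), \<lambda>v. cnj (g v)] vs)
      (wedge (\<lambda>vs. \<i> * \<eta> vs) (cform_bar \<eta>)))"
    unfolding top_nonneg_def bar unfolding h(2) wedge_scale_left wedge_scale_right wedge_wedges append.simps \<delta> e
    by (simp add: mult_ac)
qed

lemma nonneg_22_add:
  assumes "nonneg_22 \<alpha>" "nonneg_22 \<beta>" shows "nonneg_22 (\<lambda>vs. \<alpha> vs + \<beta> vs)"
  using assms unfolding nonneg_22_def top_nonneg_def wedge_add_left
  by (auto intro: nonneg_Reals_add_I)

lemma wedges_map: "wedges \<theta>s (map L vs) = wedges (map (\<lambda>\<theta> v. \<theta> (L v)) \<theta>s) vs"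
  by (auto simp: wedges_detn intro!: detn_cong)

context nilmanifold
begin

lemma pq_part_qform:
  assumes D: "D \<in> X" "x \<in> cdom D" and eq: "\<alpha> = (\<lambda>vs. \<Sum>r\<le>p + q. \<gamma> r vs)"
    and g: "\<And>r. r \<le> p + q \<Longrightarrow> \<gamma> r \<in> pq_forms r (p + q - r)"
  shows "pq_part p q (qform \<alpha> D x) = qform (\<gamma> p) D x"
proof -
  have "pq_part p q (qform \<alpha> D x) = (\<lambda>r vs. \<gamma> r (map (N (pick D) x) vs)) p"
    by (rule pq_part_eq) (auto simp: qform_def[abs_def] eq intro!: pq_forms_comp g qN_linear D)
  then show ?thesis by (simp add: qform_def[abs_def])
qed

text \<open>Type projections commute with \<open>qform\<close> because \<open>N\<close> is complex
  linear. Hence \<open>ddc\<close> is computed at the identity: split the differential of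
  \<open>t\<close>, differentiate its \<open>(1, 2)\<close> part and keep the \<open>(2, 2)\<close>
  part.\<close>

lemma ddc_qform:
  assumes t: "t \<in> pq_forms 1 1"
    and 1: "ce t = (\<lambda>vs. g1 vs + g2 vs)" "g1 \<in> pq_forms 1 2" "g2 \<in> pq_forms 2 1"
    and 2: "ce g1 = (\<lambda>vs. d1 vs + d2 vs)" "d1 \<in> pq_forms 1 3" "d2 \<in> pq_forms 2 2"
    and D: "D \<in> X" "x \<in> cdom D" and \<omega>: "\<And>y. y \<in> cdom D \<Longrightarrow> \<omega> D y = qform t D y"
  shows "ddc \<omega> D x = (\<lambda>vs. \<i> * d2 (map (N (pick D) x) vs))"
proof -
  have db: "delbar 1 1 \<omega> D y = qform g1 D y" if y: "y \<in> cdom D" for y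
  proof -
    have "ext_d \<omega> D y = qform (ce t) D y"
      by (rule ext_d_qform[where \<beta> = \<omega> and k = 2, OF _ _ D(1) y \<omega>]) (use pq_forms_alt_forms[OF t] in \<open>auto simp: numeral_2_eq_2\<close>)
    moreover have "pq_part 1 2 (qform (ce t) D y) = qform ((\<lambda>r :: nat. if r = 1 then g1 else if r = 2 then g2 else (\<lambda>vs. 0)) 1) D y"
      by (rule pq_part_qform[where p = 1 and q = 2 and \<gamma> = "\<lambda>r :: nat. if r = 1 then g1 else if r = 2 then g2 else (\<lambda>vs. 0)", OF D(1) y]) (use 1 in \<open>auto simp: numeral_eq_Suc pq_forms_0\<close>)
    ultimately show ?thesis by (simp add: delbar_def numeral_2_eq_2)
  qed
  have "ext_d (delbar 1 1 \<omega>) D x = qform (ce g1) D x"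
    by (rule ext_d_qform[where \<beta> = "delbar 1 1 \<omega>" and k = 3, OF _ _ D db]) (use pq_forms_alt_forms[OF 1(2)] in \<open>auto simp: numeral_3_eq_3\<close>)
  moreover have "pq_part 2 2 (qform (ce g1) D x) = qform ((\<lambda>r :: nat. if r = 1 then d1 else if r = 2 then d2 else (\<lambda>vs. 0)) 2) D x"
    by (rule pq_part_qform[where p = 2 and q = 2 and \<gamma> = "\<lambda>r :: nat. if r = 1 then d1 else if r = 2 then d2 else (\<lambda>vs. 0)", OF D]) (use 2 in \<open>auto simp: numeral_eq_Suc pq_forms_0 atMost_Suc le_Suc_eq\<close>)
  ultimately show ?thesis by (simp add: ddc_def[abs_def] del_def qform_def[abs_def] numeral_2_eq_2)
qed

end

section \<open>Dual bases and the coefficients of a two-form of type (1, 1)\<close>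

definition cobasis :: "(3 \<Rightarrow> complex^3 \<Rightarrow> complex) \<Rightarrow> (3 \<Rightarrow> complex^3) \<Rightarrow> bool" where
  "cobasis f e \<longleftrightarrow> (\<forall>i. clin (f i)) \<and> (\<forall>i j. f i (e j) = of_bool (i = j)) \<and>
     (\<forall>v. v = (\<Sum>i\<in>UNIV. f i v *s e i))"

lemma clin_simps: assumes "clin f" shows "f (u + v) = f u + f v" "f (c *s v) = c * f v" "f 0 = 0" "f (- v) = - f v" "f (u - v) = f u - f v"
proof -
  show a: "f (u + v) = f u + f v" "f (c *s v) = c * f v" using assms by (auto simp: clin_def)
  note l = clin_linear[OF assms]
  show "f 0 = 0" "f (- v) = - f v" "f (u - v) = f u - f v"
    using linear_0[OF l] linear_neg[OF l] linear_diff[OF l] by auto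
qed

text \<open>Joint injectivity makes the coordinate map bijective; the dual vectors are the preimages
  of the standard basis.\<close>

lemma cobasis_exists:
  assumes f: "\<And>i. clin (f i)" and inj: "\<And>v. (\<And>i. f i v = 0) \<Longrightarrow> v = 0"
  shows "\<exists>e. cobasis f e"
proof -
  let ?F = "\<lambda>v. (\<chi> i. f i v) :: complex^3"
  have lin: "linear ?F"
    by (rule linearI) (simp_all add: vec_eq_iff clin_simps[OF f] linear_scale[OF clin_linear[OF f]])
  have "inj ?F"
    using inj unfolding linear_injective_0[OF lin] by (simp add: vec_eq_iff)
  then have "surj ?F" by (rule linear_injective_imp_surjective[OF lin]) simp_all
  then have "\<forall>j. \<exists>v. ?F v = axis j 1" by (metis surjD)
  then obtain e where e: "\<And>j. ?F (e j) = axis j 1" by metis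
  have fe: "f i (e j) = of_bool (i = j)" for i j
  proof -
    have "f i (e j) = ?F (e j) $ i" by simp
    also have "\<dots> = axis j 1 $ i" by (simp only: e)
    finally show ?thesis by (simp add: axis_def)
  qed
  have "v = (\<Sum>i\<in>UNIV. f i v *s e i)" for v
  proof -
    have "v - (\<Sum>i\<in>UNIV. f i v *s e i) = 0"
    proof (rule inj)
      fix i
      have "f i (\<Sum>j\<in>UNIV. f j v *s e j) = (\<Sum>j\<in>UNIV. f j v * f i (e j))"
        by (simp add: linear_sum[OF clin_linear[OF f]] clin_simps[OF f])
      also have "\<dots> = f i v" by (simp add: fe)
      finally show "f i (v - (\<Sum>i\<in>UNIV. f i v *s e i)) = 0" by (simp add: clin_simps[OF f])
    qed
    then show ?thesis by simp
  qed
  then show ?thesis unfolding cobasis_def using f fe by blast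
qed

lemma cobasis_inj: "cobasis f e \<Longrightarrow> (\<And>i. f i v = 0) \<Longrightarrow> v = 0"
  unfolding cobasis_def by (metis (no_types, lifting) sum.neutral vector_smult_lzero)

definition fun3 :: "'a \<Rightarrow> 'a \<Rightarrow> 'a \<Rightarrow> 3 \<Rightarrow> 'a" where
  "fun3 a b c i = (if i = 1 then a else if i = 2 then b else c)"

lemma fun3_simps [simp]: "fun3 a b c 1 = a" "fun3 a b c 2 = b" "fun3 a b c 3 = c"
  by (simp_all add: fun3_def)

text \<open>A form of type \<open>(1, 1)\<close> is invariant under multiplication of both arguments
  by \<open>\<i>\<close> and is therefore the antisymmetrisation of a sesquilinear map
  \<open>S\<close>, whose matrix in the basis \<open>e\<close> is \<open>h\<close>. The second claim
  ties the diagonal of \<open>h\<close> to the positivity of a metric.\<close>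

lemma form_11_expansion:
  assumes t: "t \<in> pq_forms 1 1" and b: "cobasis f e"
  shows "\<exists>h :: 3 \<Rightarrow> 3 \<Rightarrow> complex. (\<forall>u v. t [u, v] = (\<Sum>j\<in>UNIV. \<Sum>k\<in>UNIV. h j k * (f j u * cnj (f k v) - f j v * cnj (f k u))))
    \<and> (\<forall>k. t [e k, \<i> *s e k] = - 2 * \<i> * h k k)"
proof -
  have alt: "t \<in> alt_forms 2" using pq_forms_alt_forms[OF t] by (simp add: numeral_2_eq_2)
  have i2: "t [\<i> *s u, \<i> *s v] = t [u, v]" for u v
    using pq_forms_homogeneous[OF t, of \<i> "[u, v]"] by simp
  have l1: "linear (\<lambda>u. t [u, v])" for v using alt_forms_linear[OF alt, of "[0, v]" 0] by simp
  have l2: "linear (\<lambda>v. t [u, v])" for u using alt_forms_linear[OF alt, of "[u, 0]" 1] by simp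
  have sk: "t [v, u] = - t [u, v]" for u v
    by (rule alt2[OF alt])
  have ii: "\<i> *s (\<i> *s v) = - v" for v :: "complex^3" by (simp add: vec_eq_iff)
  have neg: "t [- u, v] = - t [u, v]" for u v using linear_neg[OF l1[of v], of u] .
  have ui: "t [u, \<i> *s v] = - t [\<i> *s u, v]" for u v
    using i2[of "\<i> *s u" v] by (simp add: ii neg) (metis minus_minus)
  \<comment> \<open>The part of \<open>t\<close> that is complex linear in its first
    argument.\<close>
  define S where "S u v = (t [u, v] - \<i> * t [\<i> *s u, v]) / 2" for u v
  have Si: "S (\<i> *s u) v = \<i> * S u v" for u v
    by (simp add: S_def ii neg field_simps)
  have iS: "S u (\<i> *s v) = - \<i> * S u v" for u v
    by (simp add: S_def ui ii neg field_simps)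
  have tS: "t [u, v] = S u v - S v u" for u v
    using sk[of u v] sk[of "\<i> *s v" u] by (simp add: S_def ui field_simps)
  have add1: "S (u + u') v = S u v + S u' v" for u u' v
    by (simp add: S_def vector_add_ldistrib l1[THEN linear_add] field_simps)
  have add2: "S u (v + v') = S u v + S u v'" for u v v'
    by (simp add: S_def l2[THEN linear_add] field_simps)
  have sc: "(c :: complex) *s v = Re c *\<^sub>R v + Im c *\<^sub>R (\<i> *s v)" for c and v :: "complex^3"
    by (simp add: vec_eq_iff scaleR_conv_of_real[where 'a=complex] complex_eq_iff algebra_simps)
  have isc: "\<i> *s (r *\<^sub>R v) = r *\<^sub>R (\<i> *s v)" for r and v :: "complex^3"
    by (simp add: vec_eq_iff scaleR_conv_of_real[where 'a=complex])
  have r1: "S (r *\<^sub>R u) v = of_real r * S u v" for r u v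
    by (simp add: S_def isc l1[THEN linear_scale] scaleR_conv_of_real[where 'a=complex] field_simps)
  have r2: "S u (r *\<^sub>R v) = of_real r * S u v" for r u v
    by (simp add: S_def l2[THEN linear_scale] scaleR_conv_of_real[where 'a=complex] field_simps)
  have s1: "S (c *s u) v = c * S u v" for c u v
    by (simp only: sc[of c u] add1 r1 Si) (simp add: complex_eq_iff algebra_simps)
  have s2: "S u (c *s v) = cnj c * S u v" for c u v
    by (simp only: sc[of c v] add2 r2 iS) (simp add: complex_eq_iff algebra_simps)
  have S01: "S 0 v = 0" "S v 0 = 0" for v using add1[of 0 0 v] add2[of v 0 0] by auto
  have sum1: "S (\<Sum>i\<in>I. w i) v = (\<Sum>i\<in>I. S (w i) v)" for w and I :: "3 set" and v
    by (induction I rule: infinite_finite_induct) (auto simp: S01 add1)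
  have sum2: "S v (\<Sum>i\<in>I. w i) = (\<Sum>i\<in>I. S v (w i))" for w and I :: "3 set" and v
    by (induction I rule: infinite_finite_induct) (auto simp: S01 add2)
  have SS: "S u v = (\<Sum>j\<in>UNIV. \<Sum>k\<in>UNIV. S (e j) (e k) * (f j u * cnj (f k v)))" for u v
  proof -
    have "S u v = S (\<Sum>i\<in>UNIV. f i u *s e i) (\<Sum>i\<in>UNIV. f i v *s e i)"
      using b unfolding cobasis_def by metis
    then show ?thesis by (simp add: sum1 sum2 s1 s2 sum_distrib_left mult_ac) (rule sum.swap)
  qed
  show ?thesis
  proof (intro exI[of _ "\<lambda>j k. S (e j) (e k)"] conjI allI)
    show "t [u, v] = (\<Sum>j\<in>UNIV. \<Sum>k\<in>UNIV. S (e j) (e k) * (f j u * cnj (f k v) - f j v * cnj (f k u)))" for u v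
      unfolding tS[of u v] SS[of u v] SS[of v u] by (simp add: sum_subtractf right_diff_distrib)
    show "t [e k, \<i> *s e k] = - 2 * \<i> * S (e k) (e k)" for k
      unfolding tS[of "e k"] iS Si by simp
  qed
qed

lemma ball_atlas: "(\<forall>(U, c)\<in>S. P U c) \<Longrightarrow> C \<in> S \<Longrightarrow> P (fst C) (snd C)"
  by (auto simp: case_prod_beta)

section \<open>Invariant coframes and metrics as data at the identity\<close>

context nilmanifold
begin

text \<open>\<open>N\<close> at a point is a complex linear bijection, so the type can be
  transported in both directions.\<close>

lemma qform_pq_forms_iff:
  assumes D: "D \<in> X" "x \<in> cdom D"
  shows "qform t D x \<in> pq_forms p q \<longleftrightarrow> t \<in> pq_forms p q"
proof
  show "t \<in> pq_forms p q \<Longrightarrow> qform t D x \<in> pq_forms p q"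
    unfolding qform_def[abs_def] by (rule pq_forms_comp) (use qN_linear D in auto)
next
  let ?L = "N (pick D) x"
  assume q: "qform t D x \<in> pq_forms p q"
  note bij = qN_bij[OF D]
  have lin: "linear (inv ?L)" using bij qN_linear(1)[OF D]
    by (simp add: bij_def inj_linear_imp_inv_linear)
  have i: "inv ?L (\<i> *s v) = \<i> *s inv ?L v" for v
    by (metis bij bij_inv_eq_iff qN_linear(2)[OF D])
  have "(\<lambda>vs. qform t D x (map (inv ?L) vs)) \<in> pq_forms p q"
    by (rule pq_forms_comp[OF q lin i])
  moreover have "qform t D x (map (inv ?L) vs) = t vs" for vs
    using bij by (simp add: qform_def o_def bij_def surj_f_inv_f)
  ultimately show "t \<in> pq_forms p q" by simp
qed

definition rep :: "'g set form \<Rightarrow> (complex^3 \<Rightarrow> complex) \<Rightarrow> bool" where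
  "rep \<phi> f \<longleftrightarrow> (\<forall>D\<in>X. \<forall>x\<in>cdom D. \<phi> D x = qform (wedges [f]) D x)"

lemma rep_qform: "rep (qform (wedges [f])) f" by (simp add: rep_def)

lemma rep_apply: assumes "rep \<phi> f" "D \<in> X" "x \<in> cdom D" shows "\<phi> D x [w] = f (N (pick D) x w)"
proof -
  have "\<phi> D x = qform (wedges [f]) D x" using assms unfolding rep_def by blast
  then show ?thesis by (simp add: qform_def wedges_1)
qed

lemma rep_bar: "rep \<phi> f \<Longrightarrow> rep (bar_form \<phi>) (\<lambda>v. cnj (f v))"
  unfolding rep_def bar_form_def cform_bar_def qform_def[abs_def]
  by (auto simp: wedges_1 fun_eq_iff split: list.splits)

definition form2 :: "(complex^3 \<Rightarrow> complex^3 \<Rightarrow> complex) \<Rightarrow> cform" where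
  "form2 B vs = (case vs of [u, v] \<Rightarrow> B u v | _ \<Rightarrow> 0)"

lemma rep_wedge:
  assumes "rep \<phi> f" "rep \<psi> g" and D: "D \<in> X" "x \<in> cdom D"
  shows "(\<phi> \<and>\<^sub>f \<psi>) D x vs = qform (form2 (\<lambda>u v. f u * g v - f v * g u)) D x vs"
proof -
  have q: "qform (wedges [h]) D x = wedges [\<lambda>v. h (N (pick D) x v)]" for h
    by (rule ext) (simp add: qform_def wedges_map)
  have w: "(\<phi> \<and>\<^sub>f \<psi>) D x = wedges [\<lambda>v. f (N (pick D) x v), \<lambda>v. g (N (pick D) x v)]"
  proof -
    have "\<phi> D x = qform (wedges [f]) D x" "\<psi> D x = qform (wedges [g]) D x"
      using assms unfolding rep_def by blast+
    then show ?thesis by (simp add: wedge_form_def q wedge_wedges)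
  qed
  show ?thesis
  proof (cases "length vs = 2")
    case True
    then obtain u v where "vs = [u, v]" by (auto simp: numeral_2_eq_2 length_Suc_conv)
    then show ?thesis using w by (simp add: wedges_2 qform_def form2_def)
  qed (auto simp: w wedges_def qform_def form2_def split: list.splits)
qed

text \<open>One point of one chart is enough to recover the algebraic identity, since
  \<open>N\<close> is onto there; conversely the identity spreads to all points by
  \<open>ext_d_qform\<close>.\<close>

lemma rep_ext_d_iff:
  assumes r: "rep \<phi> f" and f: "clin f"
    and R: "\<And>D x vs. D \<in> X \<Longrightarrow> x \<in> cdom D \<Longrightarrow> R D x vs = qform (form2 B) D x vs"
  shows "form_eq X (ext_d \<phi>) R \<longleftrightarrow> (\<forall>u v. - f (br u v) = B u v)"
proof -
  have w: "wedges [f] \<in> alt_forms 1" using wedges_alt_forms[of "[f]"] clin_linear[OF f] by simp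
  have e: "ext_d \<phi> D x vs = qform (form2 (\<lambda>u v. - f (br u v))) D x vs" if D: "D \<in> X" "x \<in> cdom D" for D x vs
  proof -
    have "ext_d \<phi> D x = qform (ce (wedges [f])) D x"
      by (rule ext_d_qform[where k = 1 and \<beta> = \<phi>, OF w _ D]) (use r D in \<open>auto simp: rep_def\<close>)
    moreover have "ce (wedges [f]) ws = form2 (\<lambda>u v. - f (br u v)) ws" for ws
      by (auto simp: ce_def form2_def wedges_1 split: list.splits)
    ultimately show ?thesis by (simp add: qform_def)
  qed
  show ?thesis
  proof
    assume eq: "form_eq X (ext_d \<phi>) R"
    obtain D x where D: "D \<in> X" "x \<in> cdom D" using X_nonempty by blast
    note surj = bij_is_surj[OF qN_bij[OF D]]
    show "\<forall>u v. - f (br u v) = B u v"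
    proof (intro allI)
      fix u v
      obtain u' v' where uv: "N (pick D) x u' = u" "N (pick D) x v' = v" using surj by (metis surjD)
      have "ext_d \<phi> D x [u', v'] = R D x [u', v']" using eq D unfolding form_eq_def by (cases D) auto
      then show "- f (br u v) = B u v" using e[OF D] R[OF D] by (simp add: qform_def form2_def uv)
    qed
  next
    assume "\<forall>u v. - f (br u v) = B u v"
    then have "form2 (\<lambda>u v. - f (br u v)) = form2 B" by (simp add: form2_def fun_eq_iff split: list.splits)
    then show "form_eq X (ext_d \<phi>) R" unfolding form_eq_def using e R by fastforce
  qed
qed

lemma inv_coframe_imp_cobasis:
  assumes "inv_coframe A \<Gamma> \<phi>1 \<phi>2 \<phi>3"
  obtains f e where "cobasis f e" "rep \<phi>1 (f 1)" "rep \<phi>2 (f 2)" "rep \<phi>3 (f 3)"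
proof -
  have ex: "\<exists>f. clin f \<and> rep \<phi> f" if "\<phi> \<in> {\<phi>1, \<phi>2, \<phi>3}" for \<phi>
  proof -
    have li: "left_invariant A \<Gamma> 1 \<phi>" and pq: "pq_form X 1 0 \<phi>"
      using assms that unfolding inv_coframe_def by auto
    obtain t where t: "t \<in> alt_forms 1" "\<forall>D\<in>X. \<forall>x\<in>cdom D. \<phi> D x = qform t D x"
      using left_invariant_imp_qform[OF li] by blast
    obtain D x where D: "D \<in> X" "x \<in> cdom D" using X_nonempty by blast
    have "\<phi> D x \<in> pq_forms 1 0" using pq D unfolding pq_form_def by (cases D) auto
    then have "t \<in> pq_forms 1 0" using t D qform_pq_forms_iff[OF D] by simp
    from pq_forms_1_0_clin[OF this] t show ?thesis unfolding rep_def by metis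
  qed
  obtain f1 where f1: "clin f1" "rep \<phi>1 f1" using ex[of \<phi>1] by blast
  obtain f2 where f2: "clin f2" "rep \<phi>2 f2" using ex[of \<phi>2] by blast
  obtain f3 where f3: "clin f3" "rep \<phi>3 f3" using ex[of \<phi>3] by blast
  let ?f = "fun3 f1 f2 f3"
  have cl: "clin (?f i)" for i using f1 f2 f3 by (simp add: fun3_def)
  have "\<exists>e. cobasis ?f e"
  proof (rule cobasis_exists[OF cl])
    fix v assume v: "\<And>i. ?f i v = 0"
    obtain D x where D: "D \<in> X" "x \<in> cdom D" using X_nonempty by blast
    obtain w where w: "N (pick D) x w = v" using bij_is_surj[OF qN_bij[OF D]] by (metis surjD)
    \<comment> \<open>The coframe vanishes on \<open>w\<close>, because \<open>N\<close> sends
      \<open>w\<close> to \<open>v\<close>; \<open>dz i\<close> is a combination of the coframe at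
      this point, so every coordinate of \<open>w\<close> is zero.\<close>
    have "dz i w = 0" for i
    proof -
      have "wedges [dz i] \<in> pq_forms 1 0" by (rule clin_pq_forms[OF clin_dz])
      then obtain a :: "complex^3" where "wedges [dz i] = (\<lambda>vs. a $ 1 * \<phi>1 D x vs + a $ 2 * \<phi>2 D x vs + a $ 3 * \<phi>3 D x vs)"
      proof -
        have "\<forall>(U, c)\<in>X. \<forall>x\<in>c ` U. \<forall>\<eta>\<in>pq_forms 1 0. \<exists>!a :: complex^3. \<eta> =
          (\<lambda>vs. a $ 1 * \<phi>1 (U, c) x vs + a $ 2 * \<phi>2 (U, c) x vs + a $ 3 * \<phi>3 (U, c) x vs)"
          using assms unfolding inv_coframe_def by (rule conjunct2)
        from bspec[OF ball_atlas[OF this D(1)] D(2)] \<open>wedges [dz i] \<in> _\<close>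
        have "\<exists>!a :: complex^3. wedges [dz i] = (\<lambda>vs. a $ 1 * \<phi>1 D x vs + a $ 2 * \<phi>2 D x vs + a $ 3 * \<phi>3 D x vs)"
          by (simp only: prod.collapse)
        then show ?thesis using that by (elim ex1E)
      qed
      from fun_cong[OF this, of "[w]"] show ?thesis
        using v[of 1] v[of 2] v[of 3]
        by (simp add: wedges_1 w rep_apply[OF f1(2) D] rep_apply[OF f2(2) D] rep_apply[OF f3(2) D])
    qed
    then have "w = 0" by (simp add: vec_eq_iff dz_def)
    then show "v = 0" using w linear_0[OF qN_linear(1)[OF D]] by simp
  qed
  then obtain e where "cobasis ?f e" by blast
  then show thesis using that[of ?f e] f1 f2 f3 by simp
qed

lemma cobasis_imp_inv_coframe:
  assumes b: "cobasis f e"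
  shows "inv_coframe A \<Gamma> (qform (wedges [f 1])) (qform (wedges [f 2])) (qform (wedges [f 3]))"
proof -
  have cl: "clin (f i)" for i using b by (simp add: cobasis_def)
  have 1: "left_invariant A \<Gamma> 1 (qform (wedges [f i])) \<and> pq_form X 1 0 (qform (wedges [f i]))" for i
  proof -
    have w: "wedges [f i] \<in> pq_forms 1 0" by (rule clin_pq_forms[OF cl])
    have alt: "wedges [f i] \<in> alt_forms 1" using pq_forms_alt_forms[OF w] by simp
    have "qform (wedges [f i]) (U, c) x \<in> pq_forms 1 0" if "(U, c) \<in> X" "x \<in> c ` U" for U c x
      using qform_pq_forms_iff[of "(U, c)" x] that w by simp
    then show ?thesis
      using left_invariant_qform[OF alt] diff_form_qform[OF alt] by (auto simp: pq_form_def)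
  qed
  have 2: "\<exists>!a :: complex^3. \<eta> = (\<lambda>vs. a $ 1 * qform (wedges [f 1]) D x vs + a $ 2 * qform (wedges [f 2]) D x vs
      + a $ 3 * qform (wedges [f 3]) D x vs)" if D: "D \<in> X" "x \<in> cdom D" and \<eta>: "\<eta> \<in> pq_forms 1 0" for D x \<eta>
  proof -
    let ?L = "N (pick D) x"
    note bij = qN_bij[OF D]
    have inv: "?L (inv ?L v) = v" "inv ?L (?L v) = v" for v
      using bij by (simp_all add: bij_def surj_f_inv_f)
    have ev: "(a $ 1 * qform (wedges [f 1]) D x vs + a $ 2 * qform (wedges [f 2]) D x vs
      + a $ 3 * qform (wedges [f 3]) D x vs) = (case vs of [u] \<Rightarrow> (\<Sum>i\<in>UNIV. a $ i * f i (?L u)) | _ \<Rightarrow> 0)" for a :: "complex^3" and vs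
      by (auto simp: qform_def wedges_1 sum_3 split: list.splits)
    have \<eta>1: "\<eta> vs = (case vs of [u] \<Rightarrow> \<eta> [u] | _ \<Rightarrow> 0)" for vs
      using fun_cong[OF pq_forms_1_0_clin(2)[OF \<eta>], of vs] by (auto simp: wedges_1 split: list.splits)
    show ?thesis unfolding ev
    \<comment> \<open>The coefficients are the values of \<eta> on the tangent vectors that
      \<open>N\<close> sends to the dual basis.\<close>
    proof (rule ex1I[of _ "\<chi> i. \<eta> [inv ?L (e i)]"])
      have "clin (\<lambda>v. \<eta> [inv ?L v])"
      proof (rule clin_comp[OF pq_forms_1_0_clin(1)[OF \<eta>]])
        show "linear (inv ?L)" using bij qN_linear(1)[OF D] by (simp add: bij_def inj_linear_imp_inv_linear)
        show "inv ?L (\<i> *s v) = \<i> *s inv ?L v" for v by (metis bij bij_inv_eq_iff qN_linear(2)[OF D])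
      qed
      note l = this
      have eu: "\<eta> [u] = (\<Sum>i\<in>UNIV. \<eta> [inv ?L (e i)] * f i (?L u))" for u
      proof -
        have "?L u = (\<Sum>i\<in>UNIV. f i (?L u) *s e i)" using b unfolding cobasis_def by blast
        then have "\<eta> [inv ?L (?L u)] = \<eta> [inv ?L (\<Sum>i\<in>UNIV. f i (?L u) *s e i)]" by simp
        also have "\<dots> = (\<Sum>i\<in>UNIV. f i (?L u) * \<eta> [inv ?L (e i)])"
          using linear_sum[OF clin_linear[OF l], of "\<lambda>i. f i (?L u) *s e i" UNIV] by (simp add: clin_simps[OF l])
        finally show ?thesis by (simp add: inv mult.commute)
      qed
      show "\<eta> = (\<lambda>vs. case vs of [u] \<Rightarrow> (\<Sum>i\<in>UNIV. (\<chi> i. \<eta> [inv ?L (e i)]) $ i * f i (?L u)) | _ \<Rightarrow> 0)"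
      proof (rule ext)
        fix vs
        show "\<eta> vs = (case vs of [u] \<Rightarrow> (\<Sum>i\<in>UNIV. (\<chi> i. \<eta> [inv ?L (e i)]) $ i * f i (?L u)) | _ \<Rightarrow> 0)"
        proof (cases "\<exists>u. vs = [u]")
          case True
          then obtain u where vs: "vs = [u]" by blast
          show ?thesis unfolding vs using eu[of u] by simp
        next
          case False
          then show ?thesis using \<eta>1[of vs] by (auto split: list.splits)
        qed
      qed
    next
      fix a :: "complex^3"
      assume a: "\<eta> = (\<lambda>vs. case vs of [u] \<Rightarrow> (\<Sum>i\<in>UNIV. a $ i * f i (?L u)) | _ \<Rightarrow> 0)"
      have "\<eta> [inv ?L (e j)] = a $ j" for j
      proof -
        have "\<eta> [inv ?L (e j)] = (\<Sum>i\<in>UNIV. a $ i * of_bool (i = j))"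
          using b unfolding a by (simp add: inv cobasis_def)
        then show ?thesis by simp
      qed
      then show "a = (\<chi> i. \<eta> [inv ?L (e i)])" by (simp add: vec_eq_iff)
    qed
  qed
  show ?thesis unfolding inv_coframe_def using 1 2 by fastforce
qed

lemma inv_hermitian_metric_imp_qform:
  assumes "inv_hermitian_metric A \<Gamma> \<omega>"
  obtains t where "t \<in> pq_forms 1 1" "\<And>D x. D \<in> X \<Longrightarrow> x \<in> cdom D \<Longrightarrow> \<omega> D x = qform t D x"
    "\<And>vs. t vs \<in> \<real>" "\<And>v. v \<noteq> 0 \<Longrightarrow> Re (t [v, \<i> *s v]) > 0"
proof -
  have h: "hermitian_metric X \<omega>" and li: "left_invariant A \<Gamma> 2 \<omega>"
    using assms by (auto simp: inv_hermitian_metric_def)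
  obtain t where t: "t \<in> alt_forms 2" "\<forall>D\<in>X. \<forall>x\<in>cdom D. \<omega> D x = qform t D x"
    using left_invariant_imp_qform[OF li] by blast
  obtain D x where D: "D \<in> X" "x \<in> cdom D" using X_nonempty by blast
  let ?L = "N (pick D) x"
  have q: "\<omega> D x = qform t D x" using t D by blast
  have h': "\<omega> D x \<in> pq_forms 1 1" "\<And>vs. \<omega> D x vs \<in> \<real>" "\<And>v. v \<noteq> 0 \<Longrightarrow> Re (\<omega> D x [v, \<i> *s v]) > 0"
  proof -
    have 1: "\<forall>(U, c)\<in>X. \<forall>x\<in>c ` U. \<omega> (U, c) x \<in> pq_forms 1 1"
      using h unfolding hermitian_metric_def pq_form_def by (elim conjE)
    have 2: "\<forall>(U, c)\<in>X. \<forall>x\<in>c ` U. (\<forall>vs. \<omega> (U, c) x vs \<in> \<real>) \<and>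
        (\<forall>v. v \<noteq> 0 \<longrightarrow> Re (\<omega> (U, c) x [v, \<i> *s v]) > 0)"
      using h unfolding hermitian_metric_def pq_form_def by (elim conjE)
    show "\<omega> D x \<in> pq_forms 1 1" using bspec[OF ball_atlas[OF 1 D(1)] D(2)] by simp
    show "\<omega> D x vs \<in> \<real>" "v \<noteq> 0 \<Longrightarrow> Re (\<omega> D x [v, \<i> *s v]) > 0" for v vs
      using bspec[OF ball_atlas[OF 2 D(1)] D(2)] by simp_all
  qed
  show thesis
  proof (rule that[of t])
    show "t \<in> pq_forms 1 1" using h'(1) qform_pq_forms_iff[OF D] q by simp
    show "\<omega> D x = qform t D x" if "D \<in> X" "x \<in> cdom D" for D x using t that by blast
    have inv: "?L (inv ?L v) = v" for v using qN_bij[OF D] by (simp add: bij_def surj_f_inv_f)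
    show "t vs \<in> \<real>" for vs
      using h'(2)[of "map (inv ?L) vs"] by (simp add: q qform_def o_def inv)
    show "Re (t [v, \<i> *s v]) > 0" if "v \<noteq> 0" for v
    proof -
      have "inv ?L v \<noteq> 0" using inv[of v] that linear_0[OF qN_linear(1)[OF D]] by metis
      from h'(3)[OF this] show ?thesis by (simp add: q qform_def inv qN_linear(2)[OF D])
    qed
  qed
qed

text \<open>The standard metric of \<open>complex^3\<close>, placed at the identity and spread by
  left translation.\<close>

lemma hermitian_metric_exists: "\<exists>\<omega>. inv_hermitian_metric A \<Gamma> \<omega>"
proof -
  let ?t = "\<lambda>vs. \<Sum>i\<in>UNIV. \<i> * wedges ([dz i] @ map (\<lambda>b v. cnj (b v)) [dz i]) vs"
  have t: "?t \<in> pq_forms 1 1"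
    by (intro pq_forms_sum pq_forms_scale wedges_pq_forms) (auto simp: clin_dz)
  have alt: "?t \<in> alt_forms 2" using pq_forms_alt_forms[OF t] by (simp add: numeral_2_eq_2)
  have w: "wedges ([dz i] @ map (\<lambda>b v. cnj (b v)) [dz i]) vs = (case vs of [u, v] \<Rightarrow> u $ i * cnj (v $ i) - v $ i * cnj (u $ i) | _ \<Rightarrow> 0)" for i vs
  proof (cases "length vs = 2")
    case True
    then obtain u v where "vs = [u, v]" by (auto simp: numeral_2_eq_2 length_Suc_conv)
    then show ?thesis by (simp add: wedges_2 dz_def)
  qed (auto simp: wedges_def split: list.splits)
  have real: "?t vs \<in> \<real>" for vs
  proof (rule sum_in_Reals)
    fix i :: 3
    show "\<i> * wedges ([dz i] @ map (\<lambda>b v. cnj (b v)) [dz i]) vs \<in> \<real>"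
      unfolding w by (auto simp: complex_is_Real_iff split: list.splits)
  qed
  have pos: "Re (?t [v, \<i> *s v]) > 0" if "v \<noteq> 0" for v
  proof -
    have "Re (?t [v, \<i> *s v]) = (\<Sum>i\<in>UNIV. 2 * (cmod (v $ i))\<^sup>2)"
      unfolding w by (simp add: cmod_power2 add.commute flip: power2_eq_square)
    moreover have "(\<Sum>i\<in>UNIV. 2 * (cmod (v $ i))\<^sup>2) > 0"
    proof -
      obtain j where "v $ j \<noteq> 0" using \<open>v \<noteq> 0\<close> by (auto simp: vec_eq_iff)
      then show ?thesis by (intro sum_pos2[of _ j]) auto
    qed
    ultimately show ?thesis by simp
  qed
  have "hermitian_metric X (qform ?t)"
    unfolding hermitian_metric_def pq_form_def
  proof (intro conjI ballI)
    show "diff_form X (1 + 1) (qform ?t)" using diff_form_qform[OF alt] by (simp add: numeral_2_eq_2)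
    fix D assume D: "D \<in> X"
    show "case D of (U, c) \<Rightarrow> \<forall>x\<in>c ` U. qform ?t (U, c) x \<in> pq_forms 1 1"
      using qform_pq_forms_iff[of D] t D by (cases D) auto
    have "qform ?t D x vs \<in> \<real>" for x vs unfolding qform_def by (rule real)
    moreover have "Re (qform ?t D x [v, \<i> *s v]) > 0" if "x \<in> cdom D" "v \<noteq> 0" for x v
    proof -
      have "N (pick D) x v \<noteq> 0"
        using qN_bij[OF D that(1)] linear_0[OF qN_linear(1)[OF D that(1)]] that(2) by (metis bij_pointE)
      from pos[OF this] show ?thesis unfolding qform_def by (simp only: list.map qN_linear(2)[OF D that(1)])
    qed
    ultimately show "case D of (U, c) \<Rightarrow> \<forall>x\<in>c ` U. (\<forall>vs. qform ?t (U, c) x vs \<in> \<real>) \<and>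
        (\<forall>v. v \<noteq> 0 \<longrightarrow> Re (qform ?t (U, c) x [v, \<i> *s v]) > 0)"
      by (cases D) auto
  qed
  then show ?thesis using left_invariant_qform[OF alt] by (auto simp: inv_hermitian_metric_def)
qed

end

section \<open>Structure equations and \<open>dd\<^sup>c\<close> of invariant metrics\<close>

text \<open>Structure equations are recorded as lists: \<open>(c, j, k)\<close> stands for the two-form
  \<open>c \<phi>\<^sub>j \<and> \<phi>\<^sub>k\<close>, where \<open>\<phi>\<^sub>1, \<phi>\<^sub>2, \<phi>\<^sub>3\<close> is the coframe and \<open>\<phi>\<^sub>4, \<phi>\<^sub>5, \<phi>\<^sub>6\<close> its conjugate.\<close>

definition lsum :: "(nat \<Rightarrow> complex^3 \<Rightarrow> complex) \<Rightarrow> (complex \<times> nat \<times> nat) list \<Rightarrow> complex^3 \<Rightarrow> complex^3 \<Rightarrow> complex" where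
  "lsum \<phi> ts u v = (\<Sum>(c, j, k)\<leftarrow>ts. c * (\<phi> j u * \<phi> k v - \<phi> j v * \<phi> k u))"

lemma lsum_wedges_3:
  "(\<Sum>(c, k, l)\<leftarrow>ts. c * wedges [\<phi> k, \<phi> l, b] [u, v, w]) =
    lsum \<phi> ts u v * b w - lsum \<phi> ts u w * b v + lsum \<phi> ts v w * b u"
  "(\<Sum>(c, k, l)\<leftarrow>ts. c * wedges [a, \<phi> k, \<phi> l] [u, v, w]) =
    a u * lsum \<phi> ts v w - a v * lsum \<phi> ts u w + a w * lsum \<phi> ts u v"
  by (induction ts) (auto simp: lsum_def wedges_3 algebra_simps)

lemma lsum_wedges_4:
  "(\<Sum>(c, k, l)\<leftarrow>ts. c * wedges [\<phi> k, \<phi> l, a, b] [u, v, w, z]) =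
     lsum \<phi> ts u v * (a w * b z - a z * b w) - lsum \<phi> ts u w * (a v * b z - a z * b v)
   + lsum \<phi> ts u z * (a v * b w - a w * b v) + lsum \<phi> ts v w * (a u * b z - a z * b u)
   - lsum \<phi> ts v z * (a u * b w - a w * b u) + lsum \<phi> ts w z * (a u * b v - a v * b u)"
  "(\<Sum>(c, k, l)\<leftarrow>ts. c * wedges [a, \<phi> k, \<phi> l, b] [u, v, w, z]) =
     lsum \<phi> ts u v * (a w * b z - a z * b w) - lsum \<phi> ts u w * (a v * b z - a z * b v)
   + lsum \<phi> ts u z * (a v * b w - a w * b v) + lsum \<phi> ts v w * (a u * b z - a z * b u)
   - lsum \<phi> ts v z * (a u * b w - a w * b u) + lsum \<phi> ts w z * (a u * b v - a v * b u)"
  "(\<Sum>(c, k, l)\<leftarrow>ts. c * wedges [a, b, \<phi> k, \<phi> l] [u, v, w, z]) =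
     lsum \<phi> ts u v * (a w * b z - a z * b w) - lsum \<phi> ts u w * (a v * b z - a z * b v)
   + lsum \<phi> ts u z * (a v * b w - a w * b v) + lsum \<phi> ts v w * (a u * b z - a z * b u)
   - lsum \<phi> ts v z * (a u * b w - a w * b u) + lsum \<phi> ts w z * (a u * b v - a v * b u)"
  by (induction ts) (auto simp: lsum_def wedges_4 algebra_simps)

lemma wedges_4_swap:
  "wedges [b, a, c, d] vs = - wedges [a, b, c, d] vs"
  "wedges [a, c, b, d] vs = - wedges [a, b, c, d] vs"
  "wedges [a, b, d, c] vs = - wedges [a, b, c, d] vs"
proof -
  consider (4) u v w z where "vs = [u, v, w, z]" | (other) "length vs \<noteq> 4"
    by (cases "length vs = 4") (auto simp: length_Suc_conv eval_nat_numeral)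
  then have "wedges [b, a, c, d] vs = - wedges [a, b, c, d] vs \<and>
    wedges [a, c, b, d] vs = - wedges [a, b, c, d] vs \<and> wedges [a, b, d, c] vs = - wedges [a, b, c, d] vs"
  proof cases
    case 4
    show ?thesis unfolding 4 by (simp add: wedges_4 algebra_simps)
  qed (simp add: wedges_def)
  then show "wedges [b, a, c, d] vs = - wedges [a, b, c, d] vs"
    "wedges [a, c, b, d] vs = - wedges [a, b, c, d] vs" "wedges [a, b, d, c] vs = - wedges [a, b, c, d] vs" by auto
qed

text \<open>As rewrite rules these sort the indices of a fourfold wedge and delete repetitions; the
  side condition \<open>j < i\<close> makes the sorting terminate.\<close>

lemma wedges_4_sort:
  fixes \<phi> :: "nat \<Rightarrow> complex^3 \<Rightarrow> complex"
  shows "j < i \<Longrightarrow> wedges [\<phi> i, \<phi> j, c, d] vs = - wedges [\<phi> j, \<phi> i, c, d] vs"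
    "j < i \<Longrightarrow> wedges [a, \<phi> i, \<phi> j, d] vs = - wedges [a, \<phi> j, \<phi> i, d] vs"
    "j < i \<Longrightarrow> wedges [a, b, \<phi> i, \<phi> j] vs = - wedges [a, b, \<phi> j, \<phi> i] vs"
    "wedges [\<phi> i, \<phi> i, c, d] vs = 0" "wedges [a, \<phi> i, \<phi> i, d] vs = 0" "wedges [a, b, \<phi> i, \<phi> i] vs = 0"
  using wedges_4_swap(1)[of "\<phi> i" "\<phi> j" c d vs] wedges_4_swap(2)[of a "\<phi> i" "\<phi> j" d vs]
    wedges_4_swap(3)[of a b "\<phi> i" "\<phi> j" vs]
    wedges_4_swap(1)[of "\<phi> i" "\<phi> i" c d vs] wedges_4_swap(2)[of a "\<phi> i" "\<phi> i" d vs]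
    wedges_4_swap(3)[of a b "\<phi> i" "\<phi> i" vs] by auto

lemma pq_forms_diff: "\<alpha> \<in> pq_forms p q \<Longrightarrow> \<beta> \<in> pq_forms p q \<Longrightarrow> (\<lambda>vs. \<alpha> vs - \<beta> vs) \<in> pq_forms p q"
  using pq_forms_add[OF _ pq_forms_scale[of \<beta> p q "-1"]] by fastforce

lemma pq_forms_sum_list:
  "(\<And>y. y \<in> set ys \<Longrightarrow> F y \<in> pq_forms p q) \<Longrightarrow> (\<lambda>vs. \<Sum>y\<leftarrow>ys. F y vs) \<in> pq_forms p q"
  by (induction ys) (auto intro: pq_forms_0 pq_forms_add)

definition pairs3 :: "(nat \<times> nat) list" where
  "pairs3 = [(1, 1), (1, 2), (1, 3), (2, 1), (2, 2), (2, 3), (3, 1), (3, 2), (3, 3)]"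

text \<open>The Leibniz rule for \<open>\<phi> i \<and> \<phi> j \<and> \<phi> k\<close>. The lists
  \<open>da\<close> and \<open>db\<close> hold the \<open>\<partial>\<close> and the conjugate part
  of the differentials.\<close>

definition dw3 :: "(nat \<Rightarrow> complex^3 \<Rightarrow> complex) \<Rightarrow> (nat \<Rightarrow> (complex \<times> nat \<times> nat) list) \<Rightarrow>
    (nat \<Rightarrow> (complex \<times> nat \<times> nat) list) \<Rightarrow> nat \<Rightarrow> nat \<Rightarrow> nat \<Rightarrow> cform" where
  "dw3 \<phi> da db i j k vs = (\<Sum>(c, l, m)\<leftarrow>da i @ db i. c * wedges [\<phi> l, \<phi> m, \<phi> j, \<phi> k] vs)
    - (\<Sum>(c, l, m)\<leftarrow>da j @ db j. c * wedges [\<phi> i, \<phi> l, \<phi> m, \<phi> k] vs)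
    + (\<Sum>(c, l, m)\<leftarrow>da k @ db k. c * wedges [\<phi> i, \<phi> j, \<phi> l, \<phi> m] vs)"

context nilmanifold
begin

lemma ce_add: "ce (\<lambda>vs. \<alpha> vs + \<beta> vs) vs = ce \<alpha> vs + ce \<beta> vs"
  and ce_diff: "ce (\<lambda>vs. \<alpha> vs - \<beta> vs) vs = ce \<alpha> vs - ce \<beta> vs"
  and ce_scale: "ce (\<lambda>vs. c * \<alpha> vs) vs = c * ce \<alpha> vs"
  and ce_zero: "ce (\<lambda>vs. 0) vs = 0"
  by (auto simp: ce_def algebra_simps split: list.splits)

lemma ce_sum_list: "ce (\<lambda>vs. \<Sum>y\<leftarrow>ys. F y vs) vs = (\<Sum>y\<leftarrow>ys. ce (F y) vs)"
  by (induction ys) (auto simp: ce_add ce_zero)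

context
  fixes \<phi> :: "nat \<Rightarrow> complex^3 \<Rightarrow> complex" and da db :: "nat \<Rightarrow> (complex \<times> nat \<times> nat) list"
  assumes str: "\<And>i u v. i \<in> {1..6} \<Longrightarrow> - \<phi> i (br u v) = lsum \<phi> (da i @ db i) u v"
begin

lemma br_lsum: "i \<in> {1..6} \<Longrightarrow> \<phi> i (br u v) = - lsum \<phi> (da i @ db i) u v"
  using str[of i u v] by (metis minus_minus)

lemma ce_wedges_2:
  assumes "i \<in> {1..6}" "j \<in> {1..6}"
  shows "ce (wedges [\<phi> i, \<phi> j]) vs = (\<Sum>(c, k, l)\<leftarrow>da i @ db i. c * wedges [\<phi> k, \<phi> l, \<phi> j] vs)
    - (\<Sum>(c, k, l)\<leftarrow>da j @ db j. c * wedges [\<phi> i, \<phi> k, \<phi> l] vs)"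
proof (cases "length vs = 3")
  case True
  then obtain u v w where vs: "vs = [u, v, w]" by (auto simp: length_Suc_conv eval_nat_numeral)
  show ?thesis unfolding vs lsum_wedges_3
    by (simp add: ce_def wedges_2 br_lsum[OF assms(1)] br_lsum[OF assms(2)] algebra_simps)
next
  case False
  have "(\<Sum>(c, k, l)\<leftarrow>ts. c * wedges [\<phi> k, \<phi> l, \<phi> j] vs) = 0" "(\<Sum>(c, k, l)\<leftarrow>ts. c * wedges [\<phi> i, \<phi> k, \<phi> l] vs) = 0" for ts
    using False by (induction ts) (auto simp: wedges_def)
  moreover have "ce (wedges [\<phi> i, \<phi> j]) vs = 0"
    using False by (auto simp: ce_def wedges_def split: list.splits)
  ultimately show ?thesis by (simp only: diff_self)
qed

lemma ce_wedges_3: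
  assumes "i \<in> {1..6}" "j \<in> {1..6}" "k \<in> {1..6}"
  shows "ce (wedges [\<phi> i, \<phi> j, \<phi> k]) vs = dw3 \<phi> da db i j k vs"
proof (cases "length vs = 4")
  case True
  then obtain u v w z where vs: "vs = [u, v, w, z]" by (auto simp: length_Suc_conv eval_nat_numeral)
  show ?thesis unfolding vs dw3_def lsum_wedges_4
    by (simp add: ce_def wedges_3 br_lsum[OF assms(1)] br_lsum[OF assms(2)] br_lsum[OF assms(3)] algebra_simps)
next
  case False
  have "(\<Sum>(c, l, m)\<leftarrow>ts. c * wedges [\<phi> l, \<phi> m, \<phi> j, \<phi> k] vs) = 0"
    "(\<Sum>(c, l, m)\<leftarrow>ts. c * wedges [\<phi> i, \<phi> l, \<phi> m, \<phi> k] vs) = 0"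
    "(\<Sum>(c, l, m)\<leftarrow>ts. c * wedges [\<phi> i, \<phi> j, \<phi> l, \<phi> m] vs) = 0" for ts
    using False by (induction ts) (auto simp: wedges_def)
  moreover have "ce (wedges [\<phi> i, \<phi> j, \<phi> k]) vs = 0"
    using False by (auto simp: ce_def wedges_def split: list.splits)
  ultimately show ?thesis unfolding dw3_def by simp
qed

text \<open>The type conditions say that \<open>da\<close> raises the first and \<open>db\<close>
  the second degree. So the conjugate derivative of the metric comes from \<open>db\<close> alone,
  and \<open>ddc\<close> reduces to the finite sum in \<open>eq\<close>, which rewriting can
  evaluate. Since that sum is of pure type \<open>(2, 2)\<close>, the \<open>(1, 3)\<close> part is
  zero.\<close>

lemma ddc_structure:
  assumes cl: "\<And>i. i \<in> {1..3} \<Longrightarrow> clin (\<phi> i)" and cj: "\<And>i. i \<in> {1..3} \<Longrightarrow> \<phi> (i + 3) = (\<lambda>v. cnj (\<phi> i v))"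
    and da1: "\<And>i c l m. i \<in> {1..3} \<Longrightarrow> (c, l, m) \<in> set (da i) \<Longrightarrow> l \<in> {1..3} \<and> m \<in> {1..3}"
    and db1: "\<And>i c l m. i \<in> {1..3} \<Longrightarrow> (c, l, m) \<in> set (db i) \<Longrightarrow> l \<in> {1..3} \<and> m \<in> {4..6}"
    and da2: "\<And>i c l m. i \<in> {4..6} \<Longrightarrow> (c, l, m) \<in> set (da i) \<Longrightarrow> l \<in> {1..3} \<and> m \<in> {4..6}"
    and db2: "\<And>i c l m. i \<in> {4..6} \<Longrightarrow> (c, l, m) \<in> set (db i) \<Longrightarrow> l \<in> {4..6} \<and> m \<in> {4..6}"
    and t: "t \<in> pq_forms 1 1" and tH: "t = (\<lambda>vs. \<Sum>(j, k)\<leftarrow>pairs3. H j k * wedges [\<phi> j, \<phi> (k + 3)] vs)"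
    and d2: "d2 \<in> pq_forms 2 2"
    and eq: "\<And>vs. (\<Sum>(j, k)\<leftarrow>pairs3. H j k * ((\<Sum>(c, l, m)\<leftarrow>db j. c * dw3 \<phi> da db l m (k + 3) vs)
      - (\<Sum>(c, l, m)\<leftarrow>db (k + 3). c * dw3 \<phi> da db j l m vs))) = d2 vs"
    and D: "D \<in> X" "x \<in> cdom D" and \<omega>: "\<And>y. y \<in> cdom D \<Longrightarrow> \<omega> D y = qform t D y"
  shows "ddc \<omega> D x = (\<lambda>vs. \<i> * d2 (map (N (pick D) x) vs))"
proof -
  \<comment> \<open>\<open>?G db\<close> and \<open>?G da\<close> are the parts of types
    \<open>(1, 2)\<close> and \<open>(2, 1)\<close> of the differential of the metric.\<close>
  let ?G = "\<lambda>d vs. \<Sum>(j, k)\<leftarrow>pairs3. H j k * ((\<Sum>(c, l, m)\<leftarrow>d j. c * wedges [\<phi> l, \<phi> m, \<phi> (k + 3)] vs)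
      - (\<Sum>(c, l, m)\<leftarrow>d (k + 3). c * wedges [\<phi> j, \<phi> l, \<phi> m] vs))"
  have p3: "j \<in> {1..3} \<and> k \<in> {1..3}" if "(j, k) \<in> set pairs3" for j k using that by (auto simp: pairs3_def)
  have w12: "wedges [\<phi> i, \<phi> j, \<phi> k] \<in> pq_forms 1 2" if "i \<in> {1..3}" "j \<in> {4..6}" "k \<in> {4..6}" for i j k
  proof -
    have "j - 3 \<in> {1..3}" "k - 3 \<in> {1..3}" using that by auto
    then show ?thesis
      using wedges_pq_forms[of "[\<phi> i]" 1 "[\<phi> (j - 3), \<phi> (k - 3)]" 2] cl cj[of "j - 3"] cj[of "k - 3"] that
      by (simp add: numeral_2_eq_2)
  qed
  have w21: "wedges [\<phi> i, \<phi> j, \<phi> k] \<in> pq_forms 2 1" if "i \<in> {1..3}" "j \<in> {1..3}" "k \<in> {4..6}" for i j k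
  proof -
    have "k - 3 \<in> {1..3}" using that by auto
    then show ?thesis
      using wedges_pq_forms[of "[\<phi> i, \<phi> j]" 2 "[\<phi> (k - 3)]" 1] cl cj[of "k - 3"] that
      by (simp add: numeral_2_eq_2)
  qed
  have b3: "k + 3 \<in> {4..6}" if "k \<in> {1..3}" for k :: nat using that by auto
  have g1: "?G db \<in> pq_forms 1 2"
  proof (intro pq_forms_sum_list, clarify)
    fix j k assume "(j, k) \<in> set pairs3"
    then have jk: "j \<in> {1..3}" "k \<in> {1..3}" "k + 3 \<in> {4..6}" using p3 b3 by auto
    have "(\<lambda>vs. \<Sum>(c, l, m)\<leftarrow>db j. c * wedges [\<phi> l, \<phi> m, \<phi> (k + 3)] vs) \<in> pq_forms 1 2"
      using db1[OF jk(1)] jk(3) by (intro pq_forms_sum_list, clarify, intro pq_forms_scale w12) auto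
    moreover have "(\<lambda>vs. \<Sum>(c, l, m)\<leftarrow>db (k + 3). c * wedges [\<phi> j, \<phi> l, \<phi> m] vs) \<in> pq_forms 1 2"
      using db2[OF jk(3)] jk(1) by (intro pq_forms_sum_list, clarify, intro pq_forms_scale w12) auto
    ultimately show "(\<lambda>vs. H j k * ((\<Sum>(c, l, m)\<leftarrow>db j. c * wedges [\<phi> l, \<phi> m, \<phi> (k + 3)] vs)
      - (\<Sum>(c, l, m)\<leftarrow>db (k + 3). c * wedges [\<phi> j, \<phi> l, \<phi> m] vs))) \<in> pq_forms 1 2"
      by (intro pq_forms_scale pq_forms_diff)
  qed
  have g2: "?G da \<in> pq_forms 2 1"
  proof (intro pq_forms_sum_list, clarify)
    fix j k assume "(j, k) \<in> set pairs3"
    then have jk: "j \<in> {1..3}" "k \<in> {1..3}" "k + 3 \<in> {4..6}" using p3 b3 by auto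
    have "(\<lambda>vs. \<Sum>(c, l, m)\<leftarrow>da j. c * wedges [\<phi> l, \<phi> m, \<phi> (k + 3)] vs) \<in> pq_forms 2 1"
      using da1[OF jk(1)] jk(3) by (intro pq_forms_sum_list, clarify, intro pq_forms_scale w21) auto
    moreover have "(\<lambda>vs. \<Sum>(c, l, m)\<leftarrow>da (k + 3). c * wedges [\<phi> j, \<phi> l, \<phi> m] vs) \<in> pq_forms 2 1"
      using da2[OF jk(3)] jk(1) by (intro pq_forms_sum_list, clarify, intro pq_forms_scale w21) auto
    ultimately show "(\<lambda>vs. H j k * ((\<Sum>(c, l, m)\<leftarrow>da j. c * wedges [\<phi> l, \<phi> m, \<phi> (k + 3)] vs)
      - (\<Sum>(c, l, m)\<leftarrow>da (k + 3). c * wedges [\<phi> j, \<phi> l, \<phi> m] vs))) \<in> pq_forms 2 1"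
      by (intro pq_forms_scale pq_forms_diff)
  qed
  have r16: "i \<in> {1..6}" if "i \<in> {1..3} \<or> i \<in> {4..6}" for i :: nat using that by auto
  have 1: "ce t = (\<lambda>vs. ?G db vs + ?G da vs)"
  proof
    fix vs
    have "ce t vs = (\<Sum>(j, k)\<leftarrow>pairs3. H j k * ce (wedges [\<phi> j, \<phi> (k + 3)]) vs)"
      unfolding tH case_prod_beta ce_sum_list ce_scale ..
    also have "\<dots> = (\<Sum>(j, k)\<leftarrow>pairs3. H j k * ((\<Sum>(c, l, m)\<leftarrow>db j. c * wedges [\<phi> l, \<phi> m, \<phi> (k + 3)] vs)
      - (\<Sum>(c, l, m)\<leftarrow>db (k + 3). c * wedges [\<phi> j, \<phi> l, \<phi> m] vs)) + H j k * ((\<Sum>(c, l, m)\<leftarrow>da j. c * wedges [\<phi> l, \<phi> m, \<phi> (k + 3)] vs)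
      - (\<Sum>(c, l, m)\<leftarrow>da (k + 3). c * wedges [\<phi> j, \<phi> l, \<phi> m] vs)))"
      by (intro arg_cong[where f = sum_list] map_cong refl)
        (auto dest!: p3 simp: ce_wedges_2 algebra_simps)
    also have "\<dots> = ?G db vs + ?G da vs"
      unfolding case_prod_beta by (rule sum_list_addf)
    finally show "ce t vs = ?G db vs + ?G da vs" .
  qed
  have 2: "ce (?G db) = (\<lambda>vs. 0 + d2 vs)"
  proof
    fix vs
    have "ce (?G db) vs = (\<Sum>(j, k)\<leftarrow>pairs3. H j k * ((\<Sum>(c, l, m)\<leftarrow>db j. c * ce (wedges [\<phi> l, \<phi> m, \<phi> (k + 3)]) vs)
      - (\<Sum>(c, l, m)\<leftarrow>db (k + 3). c * ce (wedges [\<phi> j, \<phi> l, \<phi> m]) vs)))"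
      unfolding case_prod_beta ce_sum_list ce_scale ce_diff ..
    also have "\<dots> = (\<Sum>(j, k)\<leftarrow>pairs3. H j k * ((\<Sum>(c, l, m)\<leftarrow>db j. c * dw3 \<phi> da db l m (k + 3) vs)
      - (\<Sum>(c, l, m)\<leftarrow>db (k + 3). c * dw3 \<phi> da db j l m vs)))"
    proof (intro arg_cong[where f = sum_list] map_cong refl, clarify)
      fix j k assume "(j, k) \<in> set pairs3"
      then have jk: "j \<in> {1..3}" "k \<in> {1..3}" "k + 3 \<in> {4..6}" using p3 b3 by auto
      have "(\<Sum>(c, l, m)\<leftarrow>db j. c * ce (wedges [\<phi> l, \<phi> m, \<phi> (k + 3)]) vs) = (\<Sum>(c, l, m)\<leftarrow>db j. c * dw3 \<phi> da db l m (k + 3) vs)"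
        using db1[OF jk(1)] jk by (intro arg_cong[where f = sum_list] map_cong refl) (auto intro!: ce_wedges_3 r16)
      moreover have "(\<Sum>(c, l, m)\<leftarrow>db (k + 3). c * ce (wedges [\<phi> j, \<phi> l, \<phi> m]) vs) = (\<Sum>(c, l, m)\<leftarrow>db (k + 3). c * dw3 \<phi> da db j l m vs)"
        using db2[OF jk(3)] jk by (intro arg_cong[where f = sum_list] map_cong refl) (auto intro!: ce_wedges_3 r16)
      ultimately show "H j k * ((\<Sum>(c, l, m)\<leftarrow>db j. c * ce (wedges [\<phi> l, \<phi> m, \<phi> (k + 3)]) vs)
      - (\<Sum>(c, l, m)\<leftarrow>db (k + 3). c * ce (wedges [\<phi> j, \<phi> l, \<phi> m]) vs)) =
       H j k * ((\<Sum>(c, l, m)\<leftarrow>db j. c * dw3 \<phi> da db l m (k + 3) vs) - (\<Sum>(c, l, m)\<leftarrow>db (k + 3). c * dw3 \<phi> da db j l m vs))" by simp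
    qed
    finally show "ce (?G db) vs = 0 + d2 vs" using eq by simp
  qed
  show ?thesis
    by (rule ddc_qform[where t = t and ?g1.0 = "?G db" and ?g2.0 = "?G da" and ?d1.0 = "\<lambda>vs. 0" and ?d2.0 = d2 and \<omega> = \<omega> and D = D,
          OF t 1 g1 g2 2 pq_forms_0 d2 D \<omega>])
qed

end

definition phi6 :: "(3 \<Rightarrow> complex^3 \<Rightarrow> complex) \<Rightarrow> nat \<Rightarrow> complex^3 \<Rightarrow> complex" where
  "phi6 f n = (if n \<le> 3 then f (of_nat n) else (\<lambda>v. cnj (f (of_nat (n - 3)) v)))"

lemma phi6_simps:
  "phi6 f 1 = f 1" "phi6 f 2 = f 2" "phi6 f 3 = f 3" "phi6 f (Suc 0) = f 1"
  "phi6 f 4 = (\<lambda>v. cnj (f 1 v))" "phi6 f 5 = (\<lambda>v. cnj (f 2 v))" "phi6 f 6 = (\<lambda>v. cnj (f 3 v))"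
  by (simp_all add: phi6_def)

text \<open>Only the two diagonal coefficients that enter the final formulas for \<open>ddc\<close>
  are recorded, as \<open>\<i>\<close> times a positive number.\<close>

definition metric_data where
  "metric_data \<omega> f t H r2 r3 \<longleftrightarrow> t \<in> pq_forms 1 1 \<and>
    t = (\<lambda>vs. \<Sum>(j, k)\<leftarrow>pairs3. H j k * wedges [phi6 f j, phi6 f (k + 3)] vs) \<and>
    (\<forall>D\<in>X. \<forall>x\<in>cdom D. \<omega> D x = qform t D x) \<and>
    H 2 2 = \<i> * complex_of_real r2 \<and> H 3 3 = \<i> * complex_of_real r3 \<and> r2 > 0 \<and> r3 > 0"

lemma metric_data_exists:
  assumes "inv_hermitian_metric A \<Gamma> \<omega>" and b: "cobasis f e"
  shows "\<exists>t H r2 r3. metric_data \<omega> f t H r2 r3"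
proof -
  obtain t where t: "t \<in> pq_forms 1 1" "\<And>D x. D \<in> X \<Longrightarrow> x \<in> cdom D \<Longrightarrow> \<omega> D x = qform t D x"
    "\<And>vs. t vs \<in> \<real>" "\<And>v. v \<noteq> 0 \<Longrightarrow> Re (t [v, \<i> *s v]) > 0"
    using inv_hermitian_metric_imp_qform[OF assms(1)] by blast
  obtain h where h: "\<And>u v. t [u, v] = (\<Sum>j\<in>UNIV. \<Sum>k\<in>UNIV. h j k * (f j u * cnj (f k v) - f j v * cnj (f k u)))"
    and hk: "\<And>k. t [e k, \<i> *s e k] = - 2 * \<i> * h k k"
    using form_11_expansion[OF t(1) b] by blast
  have e0: "e k \<noteq> 0" for k
  proof
    assume "e k = 0"
    then have "f k (e k) = 0" using b clin_simps(3) by (auto simp: cobasis_def)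
    then show False using b by (simp add: cobasis_def)
  qed
  define r where "r k = Re (t [e k, \<i> *s e k]) / 2" for k
  have r: "r k > 0" "h k k = \<i> * complex_of_real (r k)" for k
  proof -
    show "r k > 0" using t(4)[OF e0] by (simp add: r_def)
    have "t [e k, \<i> *s e k] = complex_of_real (2 * r k)"
      using t(3)[of "[e k, \<i> *s e k]"] by (simp add: r_def complex_is_Real_iff complex_eq_iff)
    then have "- 2 * \<i> * h k k = complex_of_real (2 * r k)" using hk by simp
    moreover have "2 * h k k = \<i> * (- 2 * \<i> * h k k)" by simp
    ultimately have "2 * h k k = \<i> * complex_of_real (2 * r k)" by (simp only:)
    then show "h k k = \<i> * complex_of_real (r k)" by simp
  qed
  define H where "H j k = h (of_nat j) (of_nat k)" for j k :: nat
  have alt: "t \<in> alt_forms 2" using pq_forms_alt_forms[OF t(1)] by (simp add: numeral_2_eq_2)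
  have "t vs = (\<Sum>(j, k)\<leftarrow>pairs3. H j k * wedges [phi6 f j, phi6 f (k + 3)] vs)" for vs
  proof (cases "length vs = 2")
    case True
    then obtain u v where "vs = [u, v]" by (auto simp: length_Suc_conv eval_nat_numeral)
    then show ?thesis by (simp add: h pairs3_def wedges_2 phi6_simps sum_3 H_def add_ac)
  qed (auto simp: alt_forms_length[OF alt] pairs3_def wedges_def)
  then have "t = (\<lambda>vs. \<Sum>(j, k)\<leftarrow>pairs3. H j k * wedges [phi6 f j, phi6 f (k + 3)] vs)" by (rule ext)
  then have "metric_data \<omega> f t H (r 2) (r 3)"
    unfolding metric_data_def using t(1,2) r[of 2] r[of 3] by (simp add: H_def)
  then show ?thesis by blast
qed

lemma phi6_clin: "cobasis f e \<Longrightarrow> i \<in> {1..3} \<Longrightarrow> clin (phi6 f i)"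
  by (simp add: phi6_def cobasis_def)

lemma phi6_cnj: "i \<in> {1..3} \<Longrightarrow> phi6 f (i + 3) = (\<lambda>v. cnj (phi6 f i v))"
  by (auto simp: phi6_def)

lemma wedges_22: "cobasis f e \<Longrightarrow> wedges [f i, f j, \<lambda>v. cnj (f k v), \<lambda>v. cnj (f l v)] \<in> pq_forms 2 2"
  using wedges_pq_forms[of "[f i, f j]" 2 "[f k, f l]" 2] by (simp add: cobasis_def numeral_2_eq_2)

abbreviation w22 where "w22 f i j \<equiv> wedges [f i, f j, \<lambda>v. cnj (f i v), \<lambda>v. cnj (f j v)]"

text \<open>A common form of the equations of (Np), (Ni) and (Nii), with \<epsilon> the coefficient
  of \<open>\<phi>\<^sub>1 \<and> cnj \<phi>\<^sub>1\<close> in the differential of the second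
  form.\<close>

definition nil_eqs where
  "nil_eqs f \<epsilon> \<rho> x y z w \<longleftrightarrow> (\<forall>u v. f (1::3) (br u v) = 0) \<and>
     (\<forall>u v. - f 2 (br u v) = \<epsilon> * (f 1 u * cnj (f 1 v) - f 1 v * cnj (f 1 u))) \<and>
     (\<forall>u v. - f 3 (br u v) = \<rho> * (f 1 u * f 2 v - f 1 v * f 2 u)
        + x * (f 1 u * cnj (f 1 v) - f 1 v * cnj (f 1 u)) + y * (f 1 u * cnj (f 2 v) - f 1 v * cnj (f 2 u))
        + z * (f 2 u * cnj (f 1 v) - f 2 v * cnj (f 1 u)) + w * (f 2 u * cnj (f 2 v) - f 2 v * cnj (f 2 u)))"

lemma atLeastAtMost_1_6: "{1..6::nat} = {1, 2, 3, 4, 5, 6}" "{1..3::nat} = {1, 2, 3}" "{4..6::nat} = {4, 5, 6}"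
  by auto

text \<open>Of all coefficients of the metric only \<open>H 3 3\<close> survives: every other
  contribution repeats the first form or its conjugate, or carries the factor
  \<open>\<epsilon> * w\<close> up to conjugation. The number \<open>r\<close> is therefore
  \<open>r3\<close>.\<close>

lemma nil_ddc:
  assumes b: "cobasis f e" and s: "nil_eqs f \<epsilon> \<rho> x y z w" and ew: "\<epsilon> * w = 0"
    and \<omega>: "inv_hermitian_metric A \<Gamma> \<omega>"
  obtains r where "r > 0" "\<And>D p. D \<in> X \<Longrightarrow> p \<in> cdom D \<Longrightarrow> ddc \<omega> D p =
    (\<lambda>vs. complex_of_real (r * ((cmod \<rho>)\<^sup>2 + (cmod y)\<^sup>2 + (cmod z)\<^sup>2 - 2 * Re (x * cnj w))) * w22 f 1 2 (map (N (pick D) p) vs))"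
proof -
  obtain t H r2 r3 where md: "metric_data \<omega> f t H r2 r3"
    using metric_data_exists[OF \<omega> b] by blast
  note t = md[unfolded metric_data_def, THEN conjunct1]
    md[unfolded metric_data_def, THEN conjunct2, THEN conjunct1]
    md[unfolded metric_data_def, THEN conjunct2, THEN conjunct2, THEN conjunct2, THEN conjunct1]
    md[unfolded metric_data_def, THEN conjunct2, THEN conjunct2, THEN conjunct2, THEN conjunct2, THEN conjunct1]
    md[unfolded metric_data_def, THEN conjunct2, THEN conjunct2, THEN conjunct2, THEN conjunct2, THEN conjunct2, THEN conjunct1]
    md[unfolded metric_data_def, THEN conjunct2, THEN conjunct2, THEN conjunct2, THEN conjunct2, THEN conjunct2, THEN conjunct2]
  have t\<omega>: "\<omega> D x = qform t D x" if "D \<in> X" "x \<in> cdom D" for D x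
    using md that unfolding metric_data_def by blast
  \<comment> \<open>Entries 5 and 6 are conjugates of entries 2 and 3. The unconjugated factor is
    moved to the front, which accounts for the minus signs.\<close>
  define da :: "nat \<Rightarrow> (complex \<times> nat \<times> nat) list" where
    "da i = (if i = 3 then [(\<rho>, 1, 2)] else if i = 5 then [(- cnj \<epsilon>, 1, 4)]
      else if i = 6 then [(- cnj x, 1, 4), (- cnj y, 2, 4), (- cnj z, 1, 5), (- cnj w, 2, 5)] else [])" for i
  define db :: "nat \<Rightarrow> (complex \<times> nat \<times> nat) list" where
    "db i = (if i = 2 then [(\<epsilon>, 1, 4)] else if i = 3 then [(x, 1, 4), (y, 1, 5), (z, 2, 4), (w, 2, 5)]
      else if i = 6 then [(cnj \<rho>, 4, 5)] else [])" for i
  note e1 = s[unfolded nil_eqs_def, THEN conjunct1, rule_format]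
    and e2 = s[unfolded nil_eqs_def, THEN conjunct2, THEN conjunct1, rule_format]
    and e3 = s[unfolded nil_eqs_def, THEN conjunct2, THEN conjunct2, rule_format]
  have c2: "- cnj (f 2 (br u v)) = cnj (- f 2 (br u v))" and c3: "- cnj (f 3 (br u v)) = cnj (- f 3 (br u v))" for u v by simp_all
  have str: "- phi6 f i (br u v) = lsum (phi6 f) (da i @ db i) u v" if "i \<in> {1..6}" for i u v
    using that unfolding atLeastAtMost_1_6
    by (elim insertE emptyE; simp only: phi6_simps c2 c3 e1 e2 e3)
      (simp_all add: da_def db_def lsum_def phi6_simps algebra_simps)
  have ew': "\<epsilon> * (w * a) = 0" "w * (\<epsilon> * a) = 0" "cnj \<epsilon> * (cnj w * a) = 0" "cnj w * (cnj \<epsilon> * a) = 0"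
    "\<epsilon> * (cnj w * a) = 0" "w * (cnj \<epsilon> * a) = 0" for a
    using ew by auto
  let ?W = "wedges [phi6 f 1, phi6 f 2, phi6 f 4, phi6 f 5]"
  let ?\<kappa> = "H 3 3 * (x * cnj w + w * cnj x - \<rho> * cnj \<rho> - y * cnj y - z * cnj z)"
  have eq: "(\<Sum>(j, k)\<leftarrow>pairs3. H j k * ((\<Sum>(c, l, m)\<leftarrow>db j. c * dw3 (phi6 f) da db l m (k + 3) vs)
      - (\<Sum>(c, l, m)\<leftarrow>db (k + 3). c * dw3 (phi6 f) da db j l m vs))) = ?\<kappa> * ?W vs" for vs
    by (simp add: pairs3_def db_def da_def dw3_def wedges_4_sort[where \<phi> = "phi6 f"] ew' algebra_simps)
  have W: "(\<lambda>vs. ?\<kappa> * ?W vs) \<in> pq_forms 2 2"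
    unfolding phi6_simps by (intro pq_forms_scale wedges_22[OF b])
  have k: "\<i> * ?\<kappa> = complex_of_real (r3 * ((cmod \<rho>)\<^sup>2 + (cmod y)\<^sup>2 + (cmod z)\<^sup>2 - 2 * Re (x * cnj w)))"
    unfolding t(4) cmod_power2 by (simp add: complex_eq_iff power2_eq_square algebra_simps)
  show thesis
  proof (rule that[OF t(6)])
    fix D p assume D: "D \<in> X" "p \<in> cdom D"
    have "ddc \<omega> D p = (\<lambda>vs. \<i> * (?\<kappa> * ?W (map (N (pick D) p) vs)))"
      by (rule ddc_structure[where \<phi> = "phi6 f" and da = da and db = db and H = H and t = t and \<omega> = \<omega> and D = D and ?d2.0 = "\<lambda>vs. ?\<kappa> * ?W vs",
            OF str phi6_clin[OF b] phi6_cnj _ _ _ _ t(1,2) W eq D t\<omega>[OF D(1)]])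
        (auto simp: da_def db_def split: if_splits)
    then show "ddc \<omega> D p = (\<lambda>vs. complex_of_real (r3 * ((cmod \<rho>)\<^sup>2 + (cmod y)\<^sup>2 + (cmod z)\<^sup>2 - 2 * Re (x * cnj w))) * w22 f 1 2 (map (N (pick D) p) vs))"
      by (simp only: phi6_simps mult.assoc[symmetric] k[unfolded mult.assoc[symmetric]])
  qed
qed

definition niii_eqs where
  "niii_eqs f \<rho> s \<longleftrightarrow> (\<forall>u v. f (1::3) (br u v) = 0) \<and>
     (\<forall>u v. - f 2 (br u v) = (f 1 u * f 3 v - f 1 v * f 3 u) + (f 1 u * cnj (f 3 v) - f 1 v * cnj (f 3 u))) \<and>
     (\<forall>u v. - f 3 (br u v) = \<i> * \<rho> * (f 1 u * cnj (f 1 v) - f 1 v * cnj (f 1 u))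
        + s * \<i> * ((f 1 u * cnj (f 2 v) - f 1 v * cnj (f 2 u)) - (f 2 u * cnj (f 1 v) - f 2 v * cnj (f 1 u))))"

text \<open>The off-diagonal coefficients cancel; \<open>H 2 2\<close> and \<open>H 3 3\<close>
  remain, each with the factor \<open>- 2\<close>, which together with \<open>\<i> * \<i>\<close>
  gives positive coefficients.\<close>

lemma niii_ddc:
  assumes b: "cobasis f e" and s: "niii_eqs f \<rho> s" and \<rho>: "\<rho> \<in> {0, 1}" and s1: "s \<in> {1, - 1}"
    and \<omega>: "inv_hermitian_metric A \<Gamma> \<omega>"
  obtains r2 r3 :: real where "r2 > 0" "r3 > 0" "\<And>D p. D \<in> X \<Longrightarrow> p \<in> cdom D \<Longrightarrow> ddc \<omega> D p =
    (\<lambda>vs. complex_of_real (2 * r2) * w22 f 1 3 (map (N (pick D) p) vs) + complex_of_real (2 * r3) * w22 f 1 2 (map (N (pick D) p) vs))"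
proof -
  obtain t H r2 r3 where md: "metric_data \<omega> f t H r2 r3"
    using metric_data_exists[OF \<omega> b] by blast
  note t = md[unfolded metric_data_def, THEN conjunct1]
    md[unfolded metric_data_def, THEN conjunct2, THEN conjunct1]
    md[unfolded metric_data_def, THEN conjunct2, THEN conjunct2, THEN conjunct2, THEN conjunct1]
    md[unfolded metric_data_def, THEN conjunct2, THEN conjunct2, THEN conjunct2, THEN conjunct2, THEN conjunct1]
    md[unfolded metric_data_def, THEN conjunct2, THEN conjunct2, THEN conjunct2, THEN conjunct2, THEN conjunct2, THEN conjunct1]
    md[unfolded metric_data_def, THEN conjunct2, THEN conjunct2, THEN conjunct2, THEN conjunct2, THEN conjunct2, THEN conjunct2]
  have t\<omega>: "\<omega> D x = qform t D x" if "D \<in> X" "x \<in> cdom D" for D x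
    using md that unfolding metric_data_def by blast
  have cs: "cnj s = s" "s * s = 1" "cnj \<rho> = \<rho>" "s * (s * a) = a" for a using s1 \<rho> by auto
  define da :: "nat \<Rightarrow> (complex \<times> nat \<times> nat) list" where
    "da i = (if i = 2 then [(1, 1, 3)] else if i = 5 then [(- 1, 3, 4)]
      else if i = 6 then [(\<i> * \<rho>, 1, 4), (s * \<i>, 2, 4), (- (s * \<i>), 1, 5)] else [])" for i
  define db :: "nat \<Rightarrow> (complex \<times> nat \<times> nat) list" where
    "db i = (if i = 2 then [(1, 1, 6)] else if i = 3 then [(\<i> * \<rho>, 1, 4), (s * \<i>, 1, 5), (- (s * \<i>), 2, 4)]
      else if i = 5 then [(1, 4, 6)] else [])" for i
  note e1 = s[unfolded niii_eqs_def, THEN conjunct1, rule_format]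
    and e2 = s[unfolded niii_eqs_def, THEN conjunct2, THEN conjunct1, rule_format]
    and e3 = s[unfolded niii_eqs_def, THEN conjunct2, THEN conjunct2, rule_format]
  have c2: "- cnj (f 2 (br u v)) = cnj (- f 2 (br u v))" and c3: "- cnj (f 3 (br u v)) = cnj (- f 3 (br u v))" for u v by simp_all
  have str: "- phi6 f i (br u v) = lsum (phi6 f) (da i @ db i) u v" if "i \<in> {1..6}" for i u v
    using that unfolding atLeastAtMost_1_6
    by (elim insertE emptyE; simp only: phi6_simps c2 c3 e1 e2 e3)
      (simp_all add: da_def db_def lsum_def phi6_simps cs algebra_simps)
  let ?W2 = "wedges [phi6 f 1, phi6 f 2, phi6 f 4, phi6 f 5]" and ?W3 = "wedges [phi6 f 1, phi6 f 3, phi6 f 4, phi6 f 6]"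
  let ?e2 = "\<lambda>vs. (- 2 * H 2 2) * ?W3 vs + (- 2 * H 3 3) * ?W2 vs"
  have eq: "(\<Sum>(j, k)\<leftarrow>pairs3. H j k * ((\<Sum>(c, l, m)\<leftarrow>db j. c * dw3 (phi6 f) da db l m (k + 3) vs)
      - (\<Sum>(c, l, m)\<leftarrow>db (k + 3). c * dw3 (phi6 f) da db j l m vs))) = ?e2 vs" for vs
    by (simp add: pairs3_def db_def da_def dw3_def wedges_4_sort[where \<phi> = "phi6 f"] cs algebra_simps)
  have W: "?e2 \<in> pq_forms 2 2"
    unfolding phi6_simps by (intro pq_forms_add pq_forms_scale wedges_22[OF b])
  show thesis
  proof (rule that[OF t(5,6)])
    fix D p assume D: "D \<in> X" "p \<in> cdom D"
    have "ddc \<omega> D p = (\<lambda>vs. \<i> * ?e2 (map (N (pick D) p) vs))"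
      by (rule ddc_structure[where \<phi> = "phi6 f" and da = da and db = db and H = H and t = t and \<omega> = \<omega> and D = D and ?d2.0 = ?e2,
            OF str phi6_clin[OF b] phi6_cnj _ _ _ _ t(1,2) W eq D t\<omega>[OF D(1)]])
        (auto simp: da_def db_def split: if_splits)
    then show "ddc \<omega> D p = (\<lambda>vs. complex_of_real (2 * r2) * w22 f 1 3 (map (N (pick D) p) vs) + complex_of_real (2 * r3) * w22 f 1 2 (map (N (pick D) p) vs))"
      by (simp add: phi6_simps t(3,4) fun_eq_iff algebra_simps)
  qed
qed

lemma nonneg_w22:
  assumes b: "cobasis f e" and D: "D \<in> X" "p \<in> cdom D" and k: "\<kappa> \<ge> 0"
  shows "nonneg_22 (\<lambda>vs. complex_of_real \<kappa> * w22 f i j (map (N (pick D) p) vs))"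
proof -
  have "clin (\<lambda>v. f i (N (pick D) p v))" for i
    using b by (intro clin_comp[where \<theta> = "f i" and L = "N (pick D) p"] qN_linear[OF D]) (simp add: cobasis_def)
  from nonneg_22_wedges[OF this this k, of i j] show ?thesis by (simp add: wedges_map)
qed

text \<open>A list that detects one of the two forms and not the other, so that a combination of
  both with positive coefficients cannot vanish.\<close>

lemma w22_nonzero:
  assumes b: "cobasis f e" and D: "D \<in> X" "p \<in> cdom D"
  shows "\<exists>vs. w22 f 1 2 (map (N (pick D) p) vs) \<noteq> 0 \<and> w22 f 1 3 (map (N (pick D) p) vs) = 0"
proof -
  let ?L = "N (pick D) p" and ?us = "[e 1, \<i> *s e 1, e 2, \<i> *s e 2]"
  have "?L (inv ?L v) = v" for v using qN_bij[OF D] by (simp add: bij_def surj_f_inv_f)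
  then have m: "map ?L (map (inv ?L) ?us) = ?us" by simp
  have fe: "f i (e j) = of_bool (i = j)" "f i (\<i> *s e j) = \<i> * of_bool (i = j)" for i j
    using b by (simp_all add: cobasis_def clin_simps)
  have "w22 f 1 2 ?us \<noteq> 0 \<and> w22 f 1 3 ?us = 0"
    by (simp add: wedges_4 fe)
  then show ?thesis using m by metis
qed

end

section \<open>The families and the sign of dd^c in terms of the bracket\<close>

context nilmanifold
begin

lemma nil_form_eqs:
  assumes b: "cobasis f e" and r: "rep \<phi>1 (f 1)" "rep \<phi>2 (f 2)" "rep \<phi>3 (f 3)"
  shows "nil_eqs f \<epsilon> \<rho> x y z w \<longleftrightarrow> form_eq X (ext_d \<phi>1) (\<lambda>C p vs. 0) \<and>
    form_eq X (ext_d \<phi>2) (\<lambda>C p vs. \<epsilon> * (\<phi>1 \<and>\<^sub>f bar_form \<phi>1) C p vs) \<and>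
    form_eq X (ext_d \<phi>3) (\<lambda>C p vs. \<rho> * (\<phi>1 \<and>\<^sub>f \<phi>2) C p vs + x * (\<phi>1 \<and>\<^sub>f bar_form \<phi>1) C p vs
      + y * (\<phi>1 \<and>\<^sub>f bar_form \<phi>2) C p vs + z * (\<phi>2 \<and>\<^sub>f bar_form \<phi>1) C p vs + w * (\<phi>2 \<and>\<^sub>f bar_form \<phi>2) C p vs)"
proof -
  have cl: "clin (f i)" for i using b by (simp add: cobasis_def)
  note rb = r[THEN rep_bar]
  note wd = rep_wedge[OF r(1) r(2)] rep_wedge[OF r(1) rb(1)] rep_wedge[OF r(1) rb(2)] rep_wedge[OF r(2) rb(1)] rep_wedge[OF r(2) rb(2)]
  have "form_eq X (ext_d \<phi>1) (\<lambda>C p vs. 0) \<longleftrightarrow> (\<forall>u v. - f 1 (br u v) = 0)"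
    by (rule rep_ext_d_iff[OF r(1) cl]) (simp add: qform_def form2_def split: list.split)
  moreover have "form_eq X (ext_d \<phi>2) (\<lambda>C p vs. \<epsilon> * (\<phi>1 \<and>\<^sub>f bar_form \<phi>1) C p vs) \<longleftrightarrow>
    (\<forall>u v. - f 2 (br u v) = \<epsilon> * (f 1 u * cnj (f 1 v) - f 1 v * cnj (f 1 u)))"
    by (rule rep_ext_d_iff[OF r(2) cl]) (simp add: wd qform_def form2_def split: list.split)
  moreover have "form_eq X (ext_d \<phi>3) (\<lambda>C p vs. \<rho> * (\<phi>1 \<and>\<^sub>f \<phi>2) C p vs + x * (\<phi>1 \<and>\<^sub>f bar_form \<phi>1) C p vs
      + y * (\<phi>1 \<and>\<^sub>f bar_form \<phi>2) C p vs + z * (\<phi>2 \<and>\<^sub>f bar_form \<phi>1) C p vs + w * (\<phi>2 \<and>\<^sub>f bar_form \<phi>2) C p vs) \<longleftrightarrow>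
    (\<forall>u v. - f 3 (br u v) = \<rho> * (f 1 u * f 2 v - f 1 v * f 2 u)
        + x * (f 1 u * cnj (f 1 v) - f 1 v * cnj (f 1 u)) + y * (f 1 u * cnj (f 2 v) - f 1 v * cnj (f 2 u))
        + z * (f 2 u * cnj (f 1 v) - f 2 v * cnj (f 1 u)) + w * (f 2 u * cnj (f 2 v) - f 2 v * cnj (f 2 u)))"
    by (rule rep_ext_d_iff[OF r(3) cl]) (simp add: wd qform_def form2_def split: list.split)
  ultimately show ?thesis unfolding nil_eqs_def by simp
qed

lemma niii_form_eqs:
  assumes b: "cobasis f e" and r: "rep \<phi>1 (f 1)" "rep \<phi>2 (f 2)" "rep \<phi>3 (f 3)"
  shows "niii_eqs f \<rho> s \<longleftrightarrow> form_eq X (ext_d \<phi>1) (\<lambda>C p vs. 0) \<and>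
    form_eq X (ext_d \<phi>2) (\<lambda>C p vs. (\<phi>1 \<and>\<^sub>f \<phi>3) C p vs + (\<phi>1 \<and>\<^sub>f bar_form \<phi>3) C p vs) \<and>
    form_eq X (ext_d \<phi>3) (\<lambda>C p vs. \<i> * \<rho> * (\<phi>1 \<and>\<^sub>f bar_form \<phi>1) C p vs
      + s * \<i> * ((\<phi>1 \<and>\<^sub>f bar_form \<phi>2) C p vs - (\<phi>2 \<and>\<^sub>f bar_form \<phi>1) C p vs))"
proof -
  have cl: "clin (f i)" for i using b by (simp add: cobasis_def)
  note rb = r[THEN rep_bar]
  note wd = rep_wedge[OF r(1) r(3)] rep_wedge[OF r(1) rb(1)] rep_wedge[OF r(1) rb(2)] rep_wedge[OF r(2) rb(1)] rep_wedge[OF r(1) rb(3)]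
  have "form_eq X (ext_d \<phi>1) (\<lambda>C p vs. 0) \<longleftrightarrow> (\<forall>u v. - f 1 (br u v) = 0)"
    by (rule rep_ext_d_iff[OF r(1) cl]) (simp add: qform_def form2_def split: list.split)
  moreover have "form_eq X (ext_d \<phi>2) (\<lambda>C p vs. (\<phi>1 \<and>\<^sub>f \<phi>3) C p vs + (\<phi>1 \<and>\<^sub>f bar_form \<phi>3) C p vs) \<longleftrightarrow>
    (\<forall>u v. - f 2 (br u v) = (f 1 u * f 3 v - f 1 v * f 3 u) + (f 1 u * cnj (f 3 v) - f 1 v * cnj (f 3 u)))"
    by (rule rep_ext_d_iff[OF r(2) cl]) (simp add: wd qform_def form2_def split: list.split)
  moreover have "form_eq X (ext_d \<phi>3) (\<lambda>C p vs. \<i> * \<rho> * (\<phi>1 \<and>\<^sub>f bar_form \<phi>1) C p vs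
      + s * \<i> * ((\<phi>1 \<and>\<^sub>f bar_form \<phi>2) C p vs - (\<phi>2 \<and>\<^sub>f bar_form \<phi>1) C p vs)) \<longleftrightarrow>
    (\<forall>u v. - f 3 (br u v) = \<i> * \<rho> * (f 1 u * cnj (f 1 v) - f 1 v * cnj (f 1 u))
        + s * \<i> * ((f 1 u * cnj (f 2 v) - f 1 v * cnj (f 2 u)) - (f 2 u * cnj (f 1 v) - f 2 v * cnj (f 1 u))))"
    by (rule rep_ext_d_iff[OF r(3) cl]) (simp add: wd qform_def form2_def split: list.split)
  ultimately show ?thesis unfolding niii_eqs_def by simp
qed

lemma family_Np_iff: "family_Np A \<Gamma> \<longleftrightarrow> (\<exists>f e \<rho>. cobasis f e \<and> \<rho> \<in> {0, 1} \<and> nil_eqs f 0 \<rho> 0 0 0 0)"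
proof
  assume "family_Np A \<Gamma>"
  then obtain \<phi>1 \<phi>2 \<phi>3 \<rho> where 1: "inv_coframe A \<Gamma> \<phi>1 \<phi>2 \<phi>3" "\<rho> \<in> {0, 1}" and
    2: "form_eq X (ext_d \<phi>1) (\<lambda>C x vs. 0)" "form_eq X (ext_d \<phi>2) (\<lambda>C x vs. 0)"
    "form_eq X (ext_d \<phi>3) (\<lambda>C x vs. \<rho> * (\<phi>1 \<and>\<^sub>f \<phi>2) C x vs)" unfolding family_Np_def by blast
  obtain f e where b: "cobasis f e" "rep \<phi>1 (f 1)" "rep \<phi>2 (f 2)" "rep \<phi>3 (f 3)"
    by (rule inv_coframe_imp_cobasis[OF 1(1)])
  have "nil_eqs f 0 \<rho> 0 0 0 0" unfolding nil_form_eqs[OF b] using 2 by simp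
  then show "\<exists>f e \<rho>. cobasis f e \<and> \<rho> \<in> {0, 1} \<and> nil_eqs f 0 \<rho> 0 0 0 0" using b(1) 1(2) by blast
next
  assume "\<exists>f e \<rho>. cobasis f e \<and> \<rho> \<in> {0, 1} \<and> nil_eqs f 0 \<rho> 0 0 0 0"
  then obtain f e \<rho> where b: "cobasis f e" "\<rho> \<in> {0, 1}" "nil_eqs f 0 \<rho> 0 0 0 0" by blast
  from b(3)[unfolded nil_form_eqs[OF b(1) rep_qform rep_qform rep_qform]]
  show "family_Np A \<Gamma>" unfolding family_Np_def using cobasis_imp_inv_coframe[OF b(1)] b(2)
    by (intro exI[of _ "qform (wedges [f 1])"] exI[of _ "qform (wedges [f 2])"] exI[of _ "qform (wedges [f 3])"]
        exI[of _ \<rho>]) simp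
qed

lemma family_Ni_iff: "family_Ni A \<Gamma> \<longleftrightarrow>
  (\<exists>f e \<rho> (l::real) D. cobasis f e \<and> \<rho> \<in> {0, 1} \<and> l \<ge> 0 \<and> Im D \<ge> 0 \<and> nil_eqs f 0 \<rho> 1 (of_real l) 0 D)"
proof
  assume "family_Ni A \<Gamma>"
  then obtain \<phi>1 \<phi>2 \<phi>3 \<rho> l D where 1: "inv_coframe A \<Gamma> \<phi>1 \<phi>2 \<phi>3" "\<rho> \<in> {0, 1} \<and> (l::real) \<ge> 0 \<and> Im D \<ge> 0" and
    2: "form_eq X (ext_d \<phi>1) (\<lambda>C x vs. 0)" "form_eq X (ext_d \<phi>2) (\<lambda>C x vs. 0)"
    "form_eq X (ext_d \<phi>3) (\<lambda>C x vs.
          \<rho> * (\<phi>1 \<and>\<^sub>f \<phi>2) C x vs + (\<phi>1 \<and>\<^sub>f bar_form \<phi>1) C x vs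
          + of_real l * (\<phi>1 \<and>\<^sub>f bar_form \<phi>2) C x vs + D * (\<phi>2 \<and>\<^sub>f bar_form \<phi>2) C x vs)" unfolding family_Ni_def by blast
  obtain f e where b: "cobasis f e" "rep \<phi>1 (f 1)" "rep \<phi>2 (f 2)" "rep \<phi>3 (f 3)"
    by (rule inv_coframe_imp_cobasis[OF 1(1)])
  have "nil_eqs f 0 \<rho> 1 (of_real l) 0 D" unfolding nil_form_eqs[OF b] using 2 by simp
  then show "\<exists>f e \<rho> (l::real) D. cobasis f e \<and> \<rho> \<in> {0, 1} \<and> l \<ge> 0 \<and> Im D \<ge> 0 \<and> nil_eqs f 0 \<rho> 1 (of_real l) 0 D"
    using b(1) 1(2) by blast
next
  assume "\<exists>f e \<rho> (l::real) D. cobasis f e \<and> \<rho> \<in> {0, 1} \<and> l \<ge> 0 \<and> Im D \<ge> 0 \<and> nil_eqs f 0 \<rho> 1 (of_real l) 0 D"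
  then obtain f e \<rho> l D where b: "cobasis f e" "\<rho> \<in> {0, 1}" "(l::real) \<ge> 0" "Im D \<ge> 0" "nil_eqs f 0 \<rho> 1 (of_real l) 0 D" by blast
  from b(5)[unfolded nil_form_eqs[OF b(1) rep_qform rep_qform rep_qform]]
  show "family_Ni A \<Gamma>" unfolding family_Ni_def using cobasis_imp_inv_coframe[OF b(1)] b(2-4)
    by (intro exI[of _ "qform (wedges [f 1])"] exI[of _ "qform (wedges [f 2])"] exI[of _ "qform (wedges [f 3])"]
        exI[of _ \<rho>] exI[of _ l] exI[of _ D]) simp
qed

lemma family_Nii_iff: "family_Nii A \<Gamma> \<longleftrightarrow>
  (\<exists>f e \<rho> B (c::real). cobasis f e \<and> \<rho> \<in> {0, 1} \<and> c \<ge> 0 \<and> (\<rho>, B, c) \<noteq> (0, 0, 0) \<and> nil_eqs f 1 \<rho> 0 B (of_real c) 0)"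
proof
  assume "family_Nii A \<Gamma>"
  then obtain \<phi>1 \<phi>2 \<phi>3 \<rho> B c where 1: "inv_coframe A \<Gamma> \<phi>1 \<phi>2 \<phi>3"
    "\<rho> \<in> {0, 1} \<and> (c::real) \<ge> 0 \<and> (\<rho>, B, c) \<noteq> (0, 0, 0)" and
    2: "form_eq X (ext_d \<phi>1) (\<lambda>C x vs. 0)" "form_eq X (ext_d \<phi>2) (\<phi>1 \<and>\<^sub>f bar_form \<phi>1)"
    "form_eq X (ext_d \<phi>3) (\<lambda>C x vs.
          \<rho> * (\<phi>1 \<and>\<^sub>f \<phi>2) C x vs + B * (\<phi>1 \<and>\<^sub>f bar_form \<phi>2) C x vs
          + of_real c * (\<phi>2 \<and>\<^sub>f bar_form \<phi>1) C x vs)" unfolding family_Nii_def by blast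
  obtain f e where b: "cobasis f e" "rep \<phi>1 (f 1)" "rep \<phi>2 (f 2)" "rep \<phi>3 (f 3)"
    by (rule inv_coframe_imp_cobasis[OF 1(1)])
  have "nil_eqs f 1 \<rho> 0 B (of_real c) 0" unfolding nil_form_eqs[OF b] using 2 by simp
  then show "\<exists>f e \<rho> B (c::real). cobasis f e \<and> \<rho> \<in> {0, 1} \<and> c \<ge> 0 \<and> (\<rho>, B, c) \<noteq> (0, 0, 0) \<and> nil_eqs f 1 \<rho> 0 B (of_real c) 0"
    using b(1) 1(2) by blast
next
  assume "\<exists>f e \<rho> B (c::real). cobasis f e \<and> \<rho> \<in> {0, 1} \<and> c \<ge> 0 \<and> (\<rho>, B, c) \<noteq> (0, 0, 0) \<and> nil_eqs f 1 \<rho> 0 B (of_real c) 0"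
  then obtain f e \<rho> B c where b: "cobasis f e" "\<rho> \<in> {0, 1}" "(c::real) \<ge> 0" "(\<rho>, B, c) \<noteq> (0, 0, 0)"
    "nil_eqs f 1 \<rho> 0 B (of_real c) 0" by blast
  from b(5)[unfolded nil_form_eqs[OF b(1) rep_qform rep_qform rep_qform]]
  show "family_Nii A \<Gamma>" unfolding family_Nii_def using cobasis_imp_inv_coframe[OF b(1)] b(2-4)
    by (intro exI[of _ "qform (wedges [f 1])"] exI[of _ "qform (wedges [f 2])"] exI[of _ "qform (wedges [f 3])"]
        exI[of _ \<rho>] exI[of _ B] exI[of _ c]) simp
qed

lemma family_Niii_iff: "family_Niii A \<Gamma> \<longleftrightarrow>
  (\<exists>f e \<rho> s. cobasis f e \<and> \<rho> \<in> {0, 1} \<and> s \<in> {1, - 1} \<and> niii_eqs f \<rho> s)"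
proof
  assume "family_Niii A \<Gamma>"
  then obtain \<phi>1 \<phi>2 \<phi>3 \<rho> s where 1: "inv_coframe A \<Gamma> \<phi>1 \<phi>2 \<phi>3" "\<rho> \<in> {0, 1}" "s \<in> {1, - 1}" and
    2: "form_eq X (ext_d \<phi>1) (\<lambda>C x vs. 0)"
    "form_eq X (ext_d \<phi>2) (\<lambda>C x vs. (\<phi>1 \<and>\<^sub>f \<phi>3) C x vs + (\<phi>1 \<and>\<^sub>f bar_form \<phi>3) C x vs)"
    "form_eq X (ext_d \<phi>3) (\<lambda>C x vs. \<i> * \<rho> * (\<phi>1 \<and>\<^sub>f bar_form \<phi>1) C x vs
          + s * \<i> * ((\<phi>1 \<and>\<^sub>f bar_form \<phi>2) C x vs - (\<phi>2 \<and>\<^sub>f bar_form \<phi>1) C x vs))" unfolding family_Niii_def by blast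
  obtain f e where b: "cobasis f e" "rep \<phi>1 (f 1)" "rep \<phi>2 (f 2)" "rep \<phi>3 (f 3)"
    by (rule inv_coframe_imp_cobasis[OF 1(1)])
  have "niii_eqs f \<rho> s" unfolding niii_form_eqs[OF b] using 2 by simp
  then show "\<exists>f e \<rho> s. cobasis f e \<and> \<rho> \<in> {0, 1} \<and> s \<in> {1, - 1} \<and> niii_eqs f \<rho> s" using b(1) 1(2,3) by blast
next
  assume "\<exists>f e \<rho> s. cobasis f e \<and> \<rho> \<in> {0, 1} \<and> s \<in> {1, - 1} \<and> niii_eqs f \<rho> s"
  then obtain f e \<rho> s where b: "cobasis f e" "\<rho> \<in> {0, 1}" "s \<in> {1, - 1}" "niii_eqs f \<rho> s" by blast
  from b(4)[unfolded niii_form_eqs[OF b(1) rep_qform rep_qform rep_qform]]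
  show "family_Niii A \<Gamma>" unfolding family_Niii_def using cobasis_imp_inv_coframe[OF b(1)] b(2,3)
    by (intro exI[of _ "qform (wedges [f 1])"] exI[of _ "qform (wedges [f 2])"] exI[of _ "qform (wedges [f 3])"]
        exI[of _ \<rho>] exI[of _ s]) simp
qed

text \<open>\<open>K\<close> depends on the structure equations alone; the metric enters
  \<open>ddc\<close> only through the positive factor \<open>r\<close>.\<close>

lemma nil_sign:
  assumes b: "cobasis f e" and s: "nil_eqs f \<epsilon> \<rho> x y z w" and ew: "\<epsilon> * w = 0"
    and \<omega>: "inv_hermitian_metric A \<Gamma> \<omega>"
  defines "K \<equiv> (cmod \<rho>)\<^sup>2 + (cmod y)\<^sup>2 + (cmod z)\<^sup>2 - 2 * Re (x * cnj w)"
  shows "K \<ge> 0 \<Longrightarrow> pluripositive X \<omega>" "K \<le> 0 \<Longrightarrow> plurinegative X \<omega>" "pluriclosed X \<omega> \<longleftrightarrow> K = 0"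
proof -
  obtain r where r: "r > 0" and d: "\<And>D p. D \<in> X \<Longrightarrow> p \<in> cdom D \<Longrightarrow> ddc \<omega> D p =
    (\<lambda>vs. complex_of_real (r * K) * w22 f 1 2 (map (N (pick D) p) vs))"
    using nil_ddc[OF b s ew \<omega>] unfolding K_def by blast
  show "pluripositive X \<omega>" if "K \<ge> 0"
    unfolding pluripositive_def
  proof (clarify)
    fix U c p assume D: "(U, c) \<in> X" "p \<in> U"
    have p: "c p \<in> cdom (U, c)" using D by auto
    show "nonneg_22 (ddc \<omega> (U, c) (c p))"
      unfolding d[OF D(1) p] by (rule nonneg_w22[OF b D(1) p]) (use r that in simp)
  qed
  show "plurinegative X \<omega>" if "K \<le> 0"
    unfolding plurinegative_def
  proof (clarify)
    fix U c p assume D: "(U, c) \<in> X" "p \<in> U"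
    have p: "c p \<in> cdom (U, c)" using D by auto
    have "nonneg_22 (\<lambda>vs. complex_of_real (- (r * K)) * w22 f 1 2 (map (N (pick (U, c)) (c p)) vs))"
      by (rule nonneg_w22[OF b D(1) p]) (use r that in \<open>simp add: mult_le_0_iff\<close>)
    then show "nonneg_22 (\<lambda>vs. - ddc \<omega> (U, c) (c p) vs)"
      unfolding d[OF D(1) p] by simp
  qed
  show "pluriclosed X \<omega> \<longleftrightarrow> K = 0"
  proof
    assume pc: "pluriclosed X \<omega>"
    obtain D p where D: "D \<in> X" "p \<in> cdom D" using X_nonempty by blast
    obtain vs where "w22 f 1 2 (map (N (pick D) p) vs) \<noteq> 0" using w22_nonzero[OF b D] by blast
    moreover have "ddc \<omega> D p = (\<lambda>vs. 0)"
      using bspec[OF ball_atlas[OF pc[unfolded pluriclosed_def form_eq_def] D(1)] D(2)] by simp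
    ultimately show "K = 0" using d[OF D] r by (auto dest: fun_cong[of _ _ vs])
  next
    assume K: "K = 0"
    show "pluriclosed X \<omega>" unfolding pluriclosed_def form_eq_def
    proof (clarify)
      fix U c p assume D: "(U, c) \<in> X" "p \<in> U"
      have p: "c p \<in> cdom (U, c)" using D by auto
      show "ddc \<omega> (U, c) (c p) = (\<lambda>vs. 0)" unfolding d[OF D(1) p] using K by simp
    qed
  qed
qed

lemma niii_sign:
  assumes b: "cobasis f e" and s: "niii_eqs f \<rho> s" "\<rho> \<in> {0, 1}" "s \<in> {1, - 1}"
    and \<omega>: "inv_hermitian_metric A \<Gamma> \<omega>"
  shows "pluripositive X \<omega>" "\<not> pluriclosed X \<omega>"
proof -
  obtain r2 r3 :: real where r: "r2 > 0" "r3 > 0" and d: "\<And>D p. D \<in> X \<Longrightarrow> p \<in> cdom D \<Longrightarrow> ddc \<omega> D p =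
    (\<lambda>vs. complex_of_real (2 * r2) * w22 f 1 3 (map (N (pick D) p) vs) + complex_of_real (2 * r3) * w22 f 1 2 (map (N (pick D) p) vs))"
    using niii_ddc[OF b s \<omega>] by blast
  show "pluripositive X \<omega>"
    unfolding pluripositive_def
  proof (clarify)
    fix U c p assume D: "(U, c) \<in> X" "p \<in> U"
    have p: "c p \<in> cdom (U, c)" using D by auto
    show "nonneg_22 (ddc \<omega> (U, c) (c p))"
      unfolding d[OF D(1) p] by (intro nonneg_22_add nonneg_w22[OF b D(1) p]) (use r in simp_all)
  qed
  show "\<not> pluriclosed X \<omega>"
  proof
    assume pc: "pluriclosed X \<omega>"
    obtain D p where D: "D \<in> X" "p \<in> cdom D" using X_nonempty by blast
    obtain vs where vs: "w22 f 1 2 (map (N (pick D) p) vs) \<noteq> 0" "w22 f 1 3 (map (N (pick D) p) vs) = 0"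
      using w22_nonzero[OF b D] by blast
    have "ddc \<omega> D p = (\<lambda>vs. 0)"
      using bspec[OF ball_atlas[OF pc[unfolded pluriclosed_def form_eq_def] D(1)] D(2)] by simp
    from fun_cong[OF this, of vs] vs r show False unfolding d[OF D] by simp
  qed
qed

end

section \<open>Nilpotent Lie algebras with an integrable complex structure\<close>

lemma real_vector_smult: "(complex_of_real r * c) *s v = r *\<^sub>R (c *s v)" for v :: "complex^3"
  by (simp add: vec_eq_iff scaleR_conv_of_real[where 'a=complex])

lemma cobasis_of_independent:
  assumes ind: "\<And>a b c. a *s e1 + b *s e2 + c *s (e3 :: complex^3) = 0 \<Longrightarrow> a = 0 \<and> b = 0 \<and> c = 0"
  shows "\<exists>f. cobasis f (fun3 e1 e2 e3)"
proof -
  let ?L = "\<lambda>x :: complex^3. x $ 1 *s e1 + x $ 2 *s e2 + x $ 3 *s e3"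
  have lin: "linear ?L"
  proof (rule linearI)
    show "?L (x + y) = ?L x + ?L y" for x y by (simp add: vector_sadd_rdistrib add_ac)
    show "?L (r *\<^sub>R x) = r *\<^sub>R ?L x" for r :: real and x
      by (simp only: vector_scaleR_component scaleR_conv_of_real[where 'a=complex] real_vector_smult scaleR_add_right)
  qed
  have "x = 0" if "?L x = 0" for x using ind[OF that] by (simp add: vec_eq_iff forall_3)
  then have "inj ?L" unfolding linear_injective_0[OF lin] by blast
  then have bij: "bij ?L" using linear_injective_imp_surjective[OF lin] by (simp add: bij_def)
  have Lsc: "?L (c *s x) = c *s ?L x" for c x by (simp add: vec_eq_iff distrib_left mult.assoc)
  have Linv: "?L (inv ?L v) = v" "inv ?L (?L x) = x" for v x
    by (rule surj_f_inv_f[OF bij_is_surj[OF bij]]) (rule inv_f_f[OF bij_is_inj[OF bij]])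
  have add: "inv ?L (u + v) = inv ?L u + inv ?L v" for u v
    using Linv(2)[of "inv ?L u + inv ?L v"] by (simp only: linear_add[OF lin] Linv(1))
  have sc: "inv ?L (c *s v) = c *s inv ?L v" for c v
    using Linv(2)[of "c *s inv ?L v"] by (simp only: Lsc Linv(1))
  define f where "f i v = inv ?L v $ i" for i v
  have e: "fun3 e1 e2 e3 j = ?L (axis j 1)" for j
    using exhaust_3[of j] by (auto simp: axis_def)
  have "cobasis f (fun3 e1 e2 e3)"
    unfolding cobasis_def
  proof (intro conjI allI)
    show "clin (f i)" for i by (simp add: clin_def f_def add sc)
    show "f i (fun3 e1 e2 e3 j) = of_bool (i = j)" for i j
      unfolding f_def e Linv(2) by (simp add: axis_def)
    show "v = (\<Sum>i\<in>UNIV. f i v *s fun3 e1 e2 e3 i)" for v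
      using Linv(1)[of v] by (simp add: sum_3 f_def)
  qed
  then show ?thesis by blast
qed

section \<open>Splitting the bracket and the Jacobi identity by type\<close>

text \<open>\<open>n\<close> stands for the derivative of \<open>N\<close> at the identity. That the
  bracket is the antisymmetrisation of a map complex linear in its second argument forces the
  Nijenhuis tensor to vanish.\<close>

locale lie_cs =
  fixes br n :: "complex^3 \<Rightarrow> complex^3 \<Rightarrow> complex^3"
  assumes n_add1: "n (u + u') v = n u v + n u' v" and n_scale1: "n (r *\<^sub>R u) v = r *\<^sub>R n u v"
    and n_add2: "n u (v + v') = n u v + n u v'" and n_clin: "n u (\<i> *s v) = \<i> *s n u v"
    and n_scale2: "n u (r *\<^sub>R v) = r *\<^sub>R n u v"
    and br_n: "br u v = n v u - n u v"
    and jacobi: "br u (br v w) + br v (br w u) + br w (br u v) = 0"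
    and nilpotent: "\<exists>m. \<forall>Xs w. length Xs = m \<longrightarrow> foldr br Xs w = 0"
begin

lemma ii [simp]: "\<i> *s (\<i> *s v) = - v" for v :: "complex^3" by (simp add: vec_eq_iff)

lemma scalar_split: "c *s v = Re c *\<^sub>R v + Im c *\<^sub>R (\<i> *s v)" for v :: "complex^3"
  by (simp add: vec_eq_iff scaleR_conv_of_real[where 'a=complex] complex_eq_iff algebra_simps)

lemma i_scaleR: "\<i> *s (r *\<^sub>R v) = r *\<^sub>R (\<i> *s v)" for v :: "complex^3"
  by (simp add: vec_eq_iff scaleR_conv_of_real[where 'a=complex])

lemma n_neg: "n (- u) v = - n u v" using n_scale1[of "-1" u v] by simp

text \<open>\<open>R\<close> and \<open>Q\<close> are the parts of \<open>n v u\<close> that are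
  complex linear and antilinear in \<open>v\<close>.\<close>

definition Q where "Q u v = (1/2 :: complex) *s (n v u + \<i> *s n (\<i> *s v) u)"
definition R where "R u v = (1/2 :: complex) *s (n v u - \<i> *s n (\<i> *s v) u)"
definition P where "P u v = R u v - R v u"

lemma n_cscale: "n u (c *s v) = c *s n u v"
  unfolding scalar_split[of c] n_add2 n_scale2 n_clin ..

lemma clinear_of_i:
  fixes F :: "complex^3 \<Rightarrow> complex^3"
  assumes "\<And>u v. F (u + v) = F u + F v" "\<And>r v. F (r *\<^sub>R v) = r *\<^sub>R F v" "\<And>v. F (\<i> *s v) = \<i> *s F v"
  shows "F (c *s v) = c *s F v"
  unfolding scalar_split[of c] assms ..

lemma cantilinear_of_i:
  fixes F :: "complex^3 \<Rightarrow> complex^3"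
  assumes "\<And>u v. F (u + v) = F u + F v" "\<And>r v. F (r *\<^sub>R v) = r *\<^sub>R F v" "\<And>v. F (\<i> *s v) = - (\<i> *s F v)"
  shows "F (c *s v) = cnj c *s F v"
  unfolding scalar_split[of c] scalar_split[of "cnj c"] assms by simp

lemma Q_add [simp]: "Q (u + u') v = Q u v + Q u' v" "Q u (v + v') = Q u v + Q u v'"
  by (simp_all add: Q_def n_add1 n_add2 vector_add_ldistrib)

lemma R_add: "R (u + u') v = R u v + R u' v" "R u (v + v') = R u v + R u v'"
  by (simp_all add: R_def n_add1 n_add2 vector_add_ldistrib vec_eq_iff algebra_simps)

lemma Q_scale [simp]: "Q (c *s u) v = c *s Q u v" "Q u (c *s v) = cnj c *s Q u v"
proof -
  show "Q (c *s u) v = c *s Q u v" by (simp add: Q_def n_cscale vec_eq_iff algebra_simps)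
  show "Q u (c *s v) = cnj c *s Q u v"
    by (rule cantilinear_of_i)
      (simp_all add: Q_def n_add1 n_scale1 i_scaleR n_neg vec_eq_iff vector_add_ldistrib scaleR_conv_of_real[where 'a=complex] algebra_simps)
qed

lemma R_scale: "R (c *s u) v = c *s R u v" "R u (c *s v) = c *s R u v"
proof -
  show "R (c *s u) v = c *s R u v" by (simp add: R_def n_cscale vec_eq_iff algebra_simps)
  show "R u (c *s v) = c *s R u v"
    by (rule clinear_of_i)
      (simp_all add: R_def n_add1 n_scale1 i_scaleR n_neg vec_eq_iff vector_add_ldistrib scaleR_conv_of_real[where 'a=complex] algebra_simps)
qed

lemma P_add [simp]: "P (u + u') v = P u v + P u' v" "P u (v + v') = P u v + P u v'"
  by (simp_all add: P_def R_add)

lemma P_scale [simp]: "P (c *s u) v = c *s P u v" "P u (c *s v) = c *s P u v"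
  by (simp_all add: P_def R_scale vec_eq_iff algebra_simps)

lemma P_skew: "P u v = - P v u" by (simp add: P_def)
lemma P_alt [simp]: "P u u = 0" by (simp add: P_def)

lemma zero [simp]: "Q 0 v = 0" "Q v 0 = 0" "P 0 v = 0" "P v 0 = 0"
  using Q_scale(1)[of 0 0 v] Q_scale(2)[of v 0 0] P_scale(1)[of 0 0 v] P_scale(2)[of v 0 0] by simp_all

lemma neg [simp]: "Q (- u) v = - Q u v" "Q u (- v) = - Q u v" "P (- u) v = - P u v" "P u (- v) = - P u v"
  using Q_scale(1)[of "-1" u v] Q_scale(2)[of u "-1" v] P_scale(1)[of "-1" u v] P_scale(2)[of u "-1" v] by simp_all

lemma diff [simp]: "Q (u - u') v = Q u v - Q u' v" "Q u (v - v') = Q u v - Q u v'"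
  "P (u - u') v = P u v - P u' v" "P u (v - v') = P u v - P u v'"
  using Q_add(1)[of u "- u'" v] Q_add(2)[of u v "- v'"] P_add(1)[of u "- u'" v] P_add(2)[of u v "- v'"] by simp_all

lemma br_PQ: "br u v = P u v + Q u v - Q v u"
  by (simp add: br_n P_def Q_def R_def vec_eq_iff algebra_simps)

text \<open>The parts of the Jacobi sum by behaviour in \<open>u\<close>, \<open>v\<close>,
  \<open>w\<close>: linear in all three, antilinear in the last one, antilinear in the last two.
  Cyclic permutations supply the other patterns.\<close>

definition J30 where "J30 u v w = P (P u v) w + P (P v w) u + P (P w u) v"
definition J21 where "J21 u v w = Q (P u v) w + P (Q v w) u - P (Q u w) v + Q u (Q w v) - Q v (Q w u)"
definition J12 where "J12 u v w = Q (Q u v) w - Q (Q u w) v - Q u (P v w)"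

lemma jacobi_types: "J30 u v w + J21 u v w + J21 v w u + J21 w u v + J12 u v w + J12 v w u + J12 w u v = 0"
proof -
  have "br (br u v) w + br (br v w) u + br (br w u) v = 0"
  proof -
    have sk: "br a b = - br b a" for a b by (simp add: br_n)
    show ?thesis using jacobi[of u v w] sk[of "br u v" w] sk[of "br v w" u] sk[of "br w u" v]
      by (simp add: algebra_simps add_eq_0_iff)
  qed
  then show ?thesis
    using P_skew[of "Q u v" w] P_skew[of "Q v u" w]
    by (simp add: br_PQ J30_def J21_def J12_def algebra_simps)
qed

lemma J_hom:
  "J30 (\<i> *s u) v w = \<i> *s J30 u v w" "J30 u (\<i> *s v) w = \<i> *s J30 u v w" "J30 u v (\<i> *s w) = \<i> *s J30 u v w"
  "J21 (\<i> *s u) v w = \<i> *s J21 u v w" "J21 u (\<i> *s v) w = \<i> *s J21 u v w" "J21 u v (\<i> *s w) = - (\<i> *s J21 u v w)"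
  "J12 (\<i> *s u) v w = \<i> *s J12 u v w" "J12 u (\<i> *s v) w = - (\<i> *s J12 u v w)" "J12 u v (\<i> *s w) = - (\<i> *s J12 u v w)"
  by (simp_all add: J30_def J21_def J12_def vec_eq_iff algebra_simps)

text \<open>Replacing arguments by their multiples with \<open>\<i>\<close> changes the signs of the
  seven components according to their type. The eight resulting linear relations isolate each mixed
  component.\<close>

lemma J_zero: "J21 u v w = 0" "J12 u v w = 0"
proof -
  have "J21 u v w $ i = 0 \<and> J12 u v w $ i = 0" for i
  proof -
    define a b c d e f g where "a = J30 u v w $ i" "b = J21 u v w $ i" "c = J21 v w u $ i" "d = J21 w u v $ i"
      "e = J12 u v w $ i" "f = J12 v w u $ i" "g = J12 w u v $ i"
    note defs = this
    have 0: "a + b + c + d + e + f + g = 0"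
      using jacobi_types[of u v w] unfolding defs by (metis vector_add_component zero_index)
    have i1: "\<i> * (a + b - c + d + e - f - g) = 0"
      using arg_cong[OF jacobi_types[of "\<i> *s u" v w], of "\<lambda>x. x $ i"] unfolding defs J_hom by (simp add: algebra_simps)
    have i2: "\<i> * (a + b + c - d - e + f - g) = 0"
      using arg_cong[OF jacobi_types[of u "\<i> *s v" w], of "\<lambda>x. x $ i"] unfolding defs J_hom by (simp add: algebra_simps)
    have i3: "\<i> * (a - b + c + d - e - f + g) = 0"
      using arg_cong[OF jacobi_types[of u v "\<i> *s w"], of "\<lambda>x. x $ i"] unfolding defs J_hom by (simp add: algebra_simps)
    have i12: "a + b - c - d - e - f + g = 0"
      using arg_cong[OF jacobi_types[of "\<i> *s u" "\<i> *s v" w], of "\<lambda>x. x $ i"] unfolding defs J_hom by (simp add: algebra_simps)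
    have i13: "a - b - c + d - e + f - g = 0"
      using arg_cong[OF jacobi_types[of "\<i> *s u" v "\<i> *s w"], of "\<lambda>x. x $ i"] unfolding defs J_hom by (simp add: algebra_simps)
    have i23: "a - b + c - d + e - f - g = 0"
      using arg_cong[OF jacobi_types[of u "\<i> *s v" "\<i> *s w"], of "\<lambda>x. x $ i"] unfolding defs J_hom by (simp add: algebra_simps)
    have i123: "\<i> * (a - b - c - d + e + f + g) = 0"
      using arg_cong[OF jacobi_types[of "\<i> *s u" "\<i> *s v" "\<i> *s w"], of "\<lambda>x. x $ i"] unfolding defs J_hom by (simp add: algebra_simps)
    have j: "a + b - c + d + e - f - g = 0" "a + b + c - d - e + f - g = 0" "a - b + c + d - e - f + g = 0" "a - b - c - d + e + f + g = 0"
      using i1 i2 i3 i123 by simp_all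
    have "b = 0" "e = 0" using 0 j i12 i13 i23 by algebra+
    then show ?thesis by (simp add: defs)
  qed
  then show "J21 u v w = 0" "J12 u v w = 0" by (simp_all add: vec_eq_iff)
qed

lemma J12: "Q (Q u v) w - Q (Q u w) v = Q u (P v w)"
  using J_zero(2)[of u v w] by (simp add: J12_def)

lemma J21: "Q (P u v) w + P (Q v w) u - P (Q u w) v + Q u (Q w v) - Q v (Q w u) = 0"
  using J_zero(1)[of u v w] by (simp add: J21_def)

text \<open>Passing from \<open>u\<close> to \<open>\<i> *s u\<close> flips the sign of the term
  antilinear in \<open>u\<close> relative to the two linear ones, which separates them.\<close>

lemma closed_types:
  assumes "clin \<theta>" "\<theta> (br u v) = 0" "\<theta> (br (\<i> *s u) v) = 0"
  shows "\<theta> (Q v u) = 0" "\<theta> (P u v) + \<theta> (Q u v) = 0"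
proof -
  have 1: "\<theta> (P u v) + \<theta> (Q u v) - \<theta> (Q v u) = 0" using assms by (simp add: br_PQ clin_simps)
  have "\<i> * (\<theta> (P u v) + \<theta> (Q u v) + \<theta> (Q v u)) = 0"
    using assms(3) by (simp add: br_PQ clin_simps[OF assms(1)] algebra_simps)
  then have 2: "\<theta> (P u v) + \<theta> (Q u v) + \<theta> (Q v u) = 0" by simp
  show "\<theta> (Q v u) = 0" "\<theta> (P u v) + \<theta> (Q u v) = 0" using 1 2 by algebra+
qed

text \<open>An Engel-type statement: the complex span of the derived algebra is proper.\<close>

lemma closed_functional_exists:
  assumes H: "\<And>u c. u \<in> H \<Longrightarrow> c *s u \<in> H" "\<And>u v. u \<in> H \<Longrightarrow> v \<in> H \<Longrightarrow> br u v \<in> H"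
    and U: "\<And>\<theta>. \<theta> \<in> U \<Longrightarrow> clin \<theta>" "\<And>\<theta> u. \<theta> \<in> U \<Longrightarrow> u \<in> H \<Longrightarrow> (\<lambda>v. \<theta> (Q v u)) \<in> U"
      "\<And>\<theta> u. \<theta> \<in> U \<Longrightarrow> u \<in> H \<Longrightarrow> (\<lambda>v. \<theta> (P u v)) \<in> U"
    and ex: "\<theta>0 \<in> U" "x0 \<in> H" "\<theta>0 x0 \<noteq> 0"
  shows "\<exists>\<theta>\<in>U. (\<exists>x\<in>H. \<theta> x \<noteq> 0) \<and> (\<forall>u\<in>H. \<forall>v\<in>H. \<theta> (br u v) = 0)"
proof (rule ccontr)
  assume no: "\<not> ?thesis"
  have base: "\<forall>x\<in>H. \<theta> x = 0" if "\<theta> \<in> U" "\<forall>u\<in>H. \<forall>v\<in>H. \<theta> (br u v) = 0" for \<theta>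
    using no that by blast
  have G: "foldr br Xs w \<in> H" if "set Xs \<subseteq> H" "w \<in> H" for Xs w
    using that by (induction Xs) (auto intro: H)
  \<comment> \<open>A functional in \<open>U\<close> killing all \<open>k\<close>-fold brackets
    vanishes on \<open>H\<close>. If it kills the \<open>(k + 1)\<close>-fold ones, then
    \<open>\<theta> (Q v u)\<close> and \<open>\<theta> (P u v)\<close>, as functionals of
    \<open>v\<close>, kill the \<open>k\<close>-fold ones; this is where \<open>U\<close> must be
    stable. Then \<theta> kills all brackets, and the assumed absence of a closed functional nonzero
    on \<open>H\<close> forces it to vanish there.\<close>
  have main: "\<forall>x\<in>H. \<theta> x = 0" if "\<theta> \<in> U" "\<forall>Xs w. length Xs = k \<longrightarrow> set Xs \<subseteq> H \<longrightarrow> w \<in> H \<longrightarrow> \<theta> (foldr br Xs w) = 0" for k \<theta>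
    using that
  proof (induction k arbitrary: \<theta>)
    case 0
    then show ?case by auto
  next
    case (Suc k)
    have z: "\<theta> (br u b) = 0" if "u \<in> H" "b = foldr br Xs w" "length Xs = k" "set Xs \<subseteq> H" "w \<in> H" for u b Xs w
      using Suc.prems(2)[rule_format, of "u # Xs" w] that by simp
    have 1: "\<theta> (Q b u) = 0" "\<theta> (P u b) + \<theta> (Q u b) = 0"
      if "u \<in> H" "b = foldr br Xs w" "length Xs = k" "set Xs \<subseteq> H" "w \<in> H" for u b Xs w
      using closed_types[OF U(1)[OF Suc.prems(1)] z[OF that] z[OF H(1)[OF that(1)] that(2-5)]] by auto
    have 2: "\<theta> (Q v u) = 0" if "u \<in> H" "v \<in> H" for u v
      using Suc.IH[OF U(2)[OF Suc.prems(1) that(1)]] 1(1)[OF that(1)] that(2) by blast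
    have "\<theta> (P u b) = 0" if "u \<in> H" "b = foldr br Xs w" "length Xs = k" "set Xs \<subseteq> H" "w \<in> H" for u b Xs w
      using 1(2)[OF that] 2[of b u] G[OF that(4,5)] that 2[OF G[OF that(4,5)] that(1)] by simp
    then have 3: "\<theta> (P u v) = 0" if "u \<in> H" "v \<in> H" for u v
      using Suc.IH[OF U(3)[OF Suc.prems(1) that(1)]] that by blast
    show ?case
      by (rule base[OF Suc.prems(1)])
        (simp add: br_PQ clin_simps[OF U(1)[OF Suc.prems(1)]] 2 3)
  qed
  obtain m where "\<And>Xs w. length Xs = m \<Longrightarrow> foldr br Xs w = 0" using nilpotent by blast
  then have "\<forall>x\<in>H. \<theta>0 x = 0"
    by (intro main[OF ex(1), of m]) (simp add: clin_simps[OF U(1)[OF ex(1)]])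
  then show False using ex by blast
qed

lemma clin_Q: "clin \<theta> \<Longrightarrow> clin (\<lambda>v. \<theta> (Q v u))" and clin_P: "clin \<theta> \<Longrightarrow> clin (\<lambda>v. \<theta> (P u v))"
  by (simp_all add: clin_def)

text \<open>Modulo the common kernel of \<open>g1\<close> and \<open>g2\<close> the algebra has
  complex dimension two. A component of the Jacobi identity removes \<open>q12\<close>; then
  \<open>x2\<close> is an eigenvector of the brackets with \<open>x1\<close> and
  \<open>\<i> *s x1\<close>, and nilpotency forces both eigenvalues to vanish.\<close>

lemma two_dimensional:
  assumes H: "\<And>u c. u \<in> H \<Longrightarrow> c *s u \<in> H" "\<And>u v. u \<in> H \<Longrightarrow> v \<in> H \<Longrightarrow> br u v \<in> H"
      "\<And>u v. u \<in> H \<Longrightarrow> v \<in> H \<Longrightarrow> P u v \<in> H" "\<And>u v. u \<in> H \<Longrightarrow> v \<in> H \<Longrightarrow> Q u v \<in> H"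
    and g: "clin g1" "clin g2" and x: "x1 \<in> H" "x2 \<in> H" "g1 x1 = 1" "g2 x1 = 0" "g1 x2 = 0" "g2 x2 = 1"
    and g1: "\<And>u v. u \<in> H \<Longrightarrow> v \<in> H \<Longrightarrow> g1 (P u v) = 0" "\<And>u v. u \<in> H \<Longrightarrow> v \<in> H \<Longrightarrow> g1 (Q u v) = 0"
    and g2P: "\<And>u v. u \<in> H \<Longrightarrow> v \<in> H \<Longrightarrow> g2 (P u v) = p * (g1 u * g2 v - g1 v * g2 u)"
    and g2Q: "\<And>u v. u \<in> H \<Longrightarrow> v \<in> H \<Longrightarrow> g2 (Q u v) = q11 * (g1 u * cnj (g1 v)) + q12 * (g1 u * cnj (g2 v)) + q21 * (g2 u * cnj (g1 v))"
  shows "p = 0" "q12 = 0" "q21 = 0"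
proof -
  \<comment> \<open>The instance of \<open>J21\<close> in which the terms with
    \<open>p * q21\<close> cancel and only the squared modulus of \<open>q12\<close> is
    left.\<close>
  have "g2 (Q (P x1 x2) x1 + P (Q x2 x1) x1 - P (Q x1 x1) x2 + Q x1 (Q x1 x2) - Q x2 (Q x1 x1)) = 0"
    unfolding J21 by (simp add: clin_simps[OF g(2)])
  then have "q12 * cnj q12 = 0"
    by (simp add: clin_simps[OF g(2)] g2P g2Q g1 H x algebra_simps)
  then show q12: "q12 = 0" by simp
  have ad1: "g2 (br x1 v) = (p - q21) * g2 v" "g1 (br x1 v) = 0" if "v \<in> H" "g1 v = 0" for v
    using that x by (simp_all add: br_PQ clin_simps[OF g(1)] clin_simps[OF g(2)] g2P g2Q g1 q12 algebra_simps)
  have ad2: "g2 (br (\<i> *s x1) v) = \<i> * (p + q21) * g2 v" "g1 (br (\<i> *s x1) v) = 0" if "v \<in> H" "g1 v = 0" for v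
    using that x H by (simp_all add: br_PQ clin_simps[OF g(1)] clin_simps[OF g(2)] g2P g2Q g1 q12 algebra_simps)
  obtain m where m: "\<And>Xs w. length Xs = m \<Longrightarrow> foldr br Xs w = 0" using nilpotent by blast
  have pow: "g2 (foldr br (replicate k X) x2) = a ^ k \<and> g1 (foldr br (replicate k X) x2) = 0 \<and> foldr br (replicate k X) x2 \<in> H"
    if "\<And>v. v \<in> H \<Longrightarrow> g1 v = 0 \<Longrightarrow> g2 (br X v) = a * g2 v \<and> g1 (br X v) = 0" "X \<in> H" for k X a
    using that by (induction k) (auto simp: x intro: H)
  have "(p - q21) ^ m = 0" using pow[of x1 "p - q21" m] ad1 m[of "replicate m x1" x2] x by (simp add: clin_simps[OF g(2)])
  moreover have "(\<i> * (p + q21)) ^ m = 0"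
    using pow[of "\<i> *s x1" "\<i> * (p + q21)" m] ad2 m[of "replicate m (\<i> *s x1)" x2] x H by (simp add: clin_simps[OF g(2)])
  ultimately have "p - q21 = 0" "p + q21 = 0" by simp_all
  then show "p = 0" "q21 = 0" by algebra+
qed

end

text \<open>Supplies the phase by which a coframe is rotated so that a structure constant becomes
  real and nonnegative; the square arises when two forms turn together.\<close>

lemma unit_square_root: "\<exists>a :: complex. cmod a = 1 \<and> s * a\<^sup>2 = of_real (cmod s)"
proof (cases "s = 0")
  case True
  then show ?thesis by (intro exI[of _ 1]) simp
next
  case False
  let ?a = "csqrt (cnj s / of_real (cmod s))"
  have "(cmod ?a)\<^sup>2 = 1" unfolding norm_power[symmetric] power2_csqrt using False by (simp add: norm_divide)
  then have "cmod ?a = 1" by (simp add: power2_eq_1_iff)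
  moreover have "s * ?a\<^sup>2 = of_real (cmod s)"
  proof -
    have "s * cnj s = of_real (cmod s) * of_real (cmod s)" using complex_norm_square[of s] by (simp add: power2_eq_square)
    then have "s * (cnj s / of_real (cmod s)) = of_real (cmod s) * of_real (cmod s) / of_real (cmod s)"
      by (simp only: times_divide_eq_right)
    also have "\<dots> = of_real (cmod s)" using False by (intro nonzero_mult_div_cancel_right) simp
    finally show ?thesis by (simp only: power2_csqrt)
  qed
  ultimately show ?thesis by blast
qed

lemma unit_rotation: "\<exists>a :: complex. cmod a = 1 \<and> s * a = of_real (cmod s)"
proof -
  obtain a where "cmod a = 1" "s * a\<^sup>2 = of_real (cmod s)" using unit_square_root by blast
  then show ?thesis by (intro exI[of _ "a\<^sup>2"]) (simp add: norm_power)
qed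

lemma unit_cnj: "cmod a = 1 \<Longrightarrow> a * cnj a = 1"
  by (metis complex_norm_square of_real_1 one_power2)

lemma clin_combination: "clin f \<Longrightarrow> clin g \<Longrightarrow> clin (\<lambda>v. a * f v + b * g v)"
  by (simp add: clin_def algebra_simps)

lemma clin_multiple: "clin f \<Longrightarrow> clin (\<lambda>v. a * f v)"
  by (simp add: clin_def algebra_simps)

section \<open>Normal forms of the structure equations\<close>

context lie_cs
begin

definition nilE where
  "nilE f \<epsilon> \<rho> x y z w \<longleftrightarrow> (\<forall>u v. f (1::3) (br u v) = 0) \<and>
     (\<forall>u v. - f 2 (br u v) = \<epsilon> * (f 1 u * cnj (f 1 v) - f 1 v * cnj (f 1 u))) \<and>
     (\<forall>u v. - f 3 (br u v) = \<rho> * (f 1 u * f 2 v - f 1 v * f 2 u)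
        + x * (f 1 u * cnj (f 1 v) - f 1 v * cnj (f 1 u)) + y * (f 1 u * cnj (f 2 v) - f 1 v * cnj (f 2 u))
        + z * (f 2 u * cnj (f 1 v) - f 2 v * cnj (f 1 u)) + w * (f 2 u * cnj (f 2 v) - f 2 v * cnj (f 2 u)))"

text \<open>Hiding the coframe turns every change of coframe into a rule on tuples of coefficients;
  normalisation is then a calculation with such rules.\<close>

definition Ex where "Ex \<epsilon> \<rho> x y z w \<longleftrightarrow> (\<exists>f e. cobasis f e \<and> nilE f \<epsilon> \<rho> x y z w)"

lemma Ex_functionals:
  assumes "Ex \<epsilon> \<rho> x y z w"
  shows "\<exists>f1 f2 f3. clin f1 \<and> clin f2 \<and> clin f3 \<and> (\<forall>v. f1 v = 0 \<longrightarrow> f2 v = 0 \<longrightarrow> f3 v = 0 \<longrightarrow> v = 0) \<and>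
    nilE (fun3 f1 f2 f3) \<epsilon> \<rho> x y z w"
proof -
  obtain f e where f: "cobasis f e" "nilE f \<epsilon> \<rho> x y z w" using assms by (auto simp: Ex_def)
  have e: "fun3 (f 1) (f 2) (f 3) = f" by (rule ext) (metis exhaust_3 fun3_simps)
  have "v = 0" if "f 1 v = 0" "f 2 v = 0" "f 3 v = 0" for v
    using cobasis_inj[OF f(1), of v] that by (metis exhaust_3)
  then show ?thesis using f e unfolding cobasis_def by metis
qed

lemma ExI:
  assumes "clin f1" "clin f2" "clin f3" "\<And>v. f1 v = 0 \<Longrightarrow> f2 v = 0 \<Longrightarrow> f3 v = 0 \<Longrightarrow> v = 0"
    "nilE (fun3 f1 f2 f3) \<epsilon> \<rho> x y z w"
  shows "Ex \<epsilon> \<rho> x y z w"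
proof -
  have "\<exists>e. cobasis (fun3 f1 f2 f3) e"
  proof (rule cobasis_exists)
    show "clin (fun3 f1 f2 f3 i)" for i using assms(1-3) exhaust_3[of i] by auto
    show "v = 0" if "\<And>i. fun3 f1 f2 f3 i v = 0" for v
      using assms(4) that[of 1] that[of 2] that[of 3] by simp
  qed
  then show ?thesis using assms(5) by (auto simp: Ex_def)
qed

lemma rescale:
  fixes a b k r p q p' q' :: complex
  assumes "a \<noteq> 0" "b \<noteq> 0"
  shows "k * r / (a * b) * (a * p * (b * q) - a * p' * (b * q')) = k * (r * (p * q - p' * q'))"
  using assms by (simp add: field_simps)

lemma Ex_scale:
  assumes "Ex \<epsilon> \<rho> x y z w" and nz: "a \<noteq> 0" "b \<noteq> 0" "k \<noteq> 0"
  shows "Ex (b * \<epsilon> / (a * cnj a)) (k * \<rho> / (a * b)) (k * x / (a * cnj a)) (k * y / (a * cnj b)) (k * z / (b * cnj a)) (k * w / (b * cnj b))"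
proof -
  obtain f1 f2 f3 where f: "clin f1" "clin f2" "clin f3" "\<forall>v. f1 v = 0 \<longrightarrow> f2 v = 0 \<longrightarrow> f3 v = 0 \<longrightarrow> v = 0"
    and n: "nilE (fun3 f1 f2 f3) \<epsilon> \<rho> x y z w" using Ex_functionals[OF assms(1)] by blast
  show ?thesis
  proof (rule ExI)
    show "clin (\<lambda>v. a * f1 v)" "clin (\<lambda>v. b * f2 v)" "clin (\<lambda>v. k * f3 v)" by (intro clin_multiple f)+
    show "v = 0" if "a * f1 v = 0" "b * f2 v = 0" "k * f3 v = 0" for v using f(4) that nz by simp
    note E = n[unfolded nilE_def fun3_simps]
    have 1: "- (b * f2 (br u v)) = b * (- f2 (br u v))" "- (k * f3 (br u v)) = k * (- f3 (br u v))" for u v by simp_all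
    show "nilE (fun3 (\<lambda>v. a * f1 v) (\<lambda>v. b * f2 v) (\<lambda>v. k * f3 v)) (b * \<epsilon> / (a * cnj a)) (k * \<rho> / (a * b)) (k * x / (a * cnj a)) (k * y / (a * cnj b)) (k * z / (b * cnj a)) (k * w / (b * cnj b))"
      unfolding nilE_def fun3_simps 1 E[THEN conjunct2, THEN conjunct1, rule_format] E[THEN conjunct2, THEN conjunct2, rule_format] complex_cnj_mult
      using E nz by (simp add: rescale distrib_left del: times_divide_eq_left)
  qed
qed

lemma Ex_shear3:
  assumes "Ex \<epsilon> \<rho> x y z w" shows "Ex \<epsilon> \<rho> (x + m * \<epsilon>) y z w"
proof -
  obtain f1 f2 f3 where f: "clin f1" "clin f2" "clin f3" "\<forall>v. f1 v = 0 \<longrightarrow> f2 v = 0 \<longrightarrow> f3 v = 0 \<longrightarrow> v = 0"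
    and n: "nilE (fun3 f1 f2 f3) \<epsilon> \<rho> x y z w" using Ex_functionals[OF assms(1)] by blast
  show ?thesis
  proof (rule ExI[OF f(1,2)])
    show "clin (\<lambda>v. 1 * f3 v + m * f2 v)" by (intro clin_combination f)
    show "v = 0" if "f1 v = 0" "f2 v = 0" "1 * f3 v + m * f2 v = 0" for v using f(4) that by simp
    note E = n[unfolded nilE_def fun3_simps]
    have 1: "- (1 * f3 (br u v) + m * f2 (br u v)) = - f3 (br u v) + m * (- f2 (br u v))" for u v by simp
    show "nilE (fun3 f1 f2 (\<lambda>v. 1 * f3 v + m * f2 v)) \<epsilon> \<rho> (x + m * \<epsilon>) y z w"
      unfolding nilE_def fun3_simps 1 E[THEN conjunct2, THEN conjunct1, rule_format] E[THEN conjunct2, THEN conjunct2, rule_format]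
      using E[THEN conjunct1] by (auto simp: algebra_simps)
  qed
qed

text \<open>The first form is replaced by itself plus \<open>s\<close> times the second. With
  \<epsilon> = 0 both are closed, so only the third equation changes.\<close>

lemma Ex_shear1:
  assumes "Ex 0 \<rho> x y z w" shows "Ex 0 \<rho> x (y - x * cnj s) (z - x * s) (w + x * (s * cnj s) - y * s - z * cnj s)"
proof -
  obtain f1 f2 f3 where f: "clin f1" "clin f2" "clin f3" "\<forall>v. f1 v = 0 \<longrightarrow> f2 v = 0 \<longrightarrow> f3 v = 0 \<longrightarrow> v = 0"
    and n: "nilE (fun3 f1 f2 f3) 0 \<rho> x y z w" using Ex_functionals[OF assms(1)] by blast
  show ?thesis
  proof (rule ExI[OF _ f(2,3)])
    show "clin (\<lambda>v. 1 * f1 v + s * f2 v)" by (intro clin_combination f)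
    show "v = 0" if "1 * f1 v + s * f2 v = 0" "f2 v = 0" "f3 v = 0" for v using f(4) that by simp
    note E = n[unfolded nilE_def fun3_simps]
    have E2: "f2 (br u v) = 0" for u v using E[THEN conjunct2, THEN conjunct1, rule_format, of u v] by simp
    show "nilE (fun3 (\<lambda>v. 1 * f1 v + s * f2 v) f2 f3) 0 \<rho> x (y - x * cnj s) (z - x * s) (w + x * (s * cnj s) - y * s - z * cnj s)"
      unfolding nilE_def fun3_simps E2 E[THEN conjunct2, THEN conjunct2, rule_format]
      using E[THEN conjunct1] by (auto simp: algebra_simps)
  qed
qed

lemma Ex_swap: assumes "Ex 0 \<rho> x y z w" shows "Ex 0 (- \<rho>) w z y x"
proof -
  obtain f1 f2 f3 where f: "clin f1" "clin f2" "clin f3" "\<forall>v. f1 v = 0 \<longrightarrow> f2 v = 0 \<longrightarrow> f3 v = 0 \<longrightarrow> v = 0"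
    and n: "nilE (fun3 f1 f2 f3) 0 \<rho> x y z w" using Ex_functionals[OF assms(1)] by blast
  show ?thesis
  proof (rule ExI[OF f(2,1,3)])
    note E = n[unfolded nilE_def fun3_simps]
    have E2: "f2 (br u v) = 0" for u v using E[THEN conjunct2, THEN conjunct1, rule_format, of u v] by simp
    show "nilE (fun3 f2 f1 f3) 0 (- \<rho>) w z y x"
      unfolding nilE_def fun3_simps E2 E[THEN conjunct2, THEN conjunct2, rule_format]
      using E[THEN conjunct1] by (auto simp: algebra_simps)
  qed (use f in blast)
qed

lemma Ex_swap23: assumes "Ex 1 0 0 0 0 0" shows "Ex 0 0 1 0 0 0"
proof -
  obtain f1 f2 f3 where f: "clin f1" "clin f2" "clin f3" "\<forall>v. f1 v = 0 \<longrightarrow> f2 v = 0 \<longrightarrow> f3 v = 0 \<longrightarrow> v = 0"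
    and n: "nilE (fun3 f1 f2 f3) 1 0 0 0 0 0" using Ex_functionals[OF assms(1)] by blast
  show ?thesis
  proof (rule ExI[OF f(1,3,2)])
    show "nilE (fun3 f1 f3 f2) 0 0 1 0 0 0"
      using n unfolding nilE_def fun3_simps by simp
  qed (use f in blast)
qed

definition Np where "Np \<longleftrightarrow> (\<exists>\<rho>\<in>{0, 1}. Ex 0 \<rho> 0 0 0 0)"
definition Ni where "Ni \<longleftrightarrow> (\<exists>\<rho>\<in>{0, 1}. \<exists>(l::real) D. l \<ge> 0 \<and> Im D \<ge> 0 \<and> Ex 0 \<rho> 1 (of_real l) 0 D)"
definition Nii where
  "Nii \<longleftrightarrow> (\<exists>\<rho>\<in>{0, 1}. \<exists>B (c::real). c \<ge> 0 \<and> (\<rho>, B, c) \<noteq> (0, 0, 0) \<and> Ex 1 \<rho> 0 B (of_real c) 0)"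

text \<open>Scaling makes \<open>x = 1\<close>, a shear removes \<open>z\<close>, an exchange of the
  first two forms corrects the sign of \<open>Im w\<close>, and a rotation with scaling makes \<rho>
  zero or one and \<open>y\<close> real.\<close>

lemma normalize_Ni:
  assumes "Ex 0 \<rho> x y z w" "x \<noteq> 0" shows Ni
proof -
  have kill: "Ex 0 \<rho> 1 (y - cnj z) 0 (w - y * z)" if "Ex 0 \<rho> 1 y z w" for \<rho> y z w
    using Ex_shear1[OF that, of z] by (simp add: algebra_simps)
  have "Ex 0 (\<rho> / x) 1 (y / x) (z / x) (w / x)"
    using Ex_scale[OF assms(1), of 1 1 "1 / x"] assms(2) by simp
  from kill[OF this] obtain \<rho> y w where e: "Ex 0 \<rho> 1 y 0 w" by blast
  have "\<exists>\<rho> y w. Ex 0 \<rho> 1 y 0 w \<and> Im w \<ge> 0"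
  proof (cases "Im w \<ge> 0")
    case False
    then have w: "w \<noteq> 0" by auto
    \<comment> \<open>After the exchange \<open>w\<close> stands in the place of \<open>x\<close>.
      Dividing by it inverts the last coefficient, and inversion reverses the sign of the imaginary
      part.\<close>
    have "Ex 0 (- \<rho> / w) 1 0 (y / w) (1 / w)"
      using Ex_scale[OF Ex_swap[OF e], of 1 1 "1 / w"] w by simp
    from kill[OF this] have "Ex 0 (- \<rho> / w) 1 (- cnj (y / w)) 0 (1 / w)" by simp
    moreover have "Im (1 / w) \<ge> 0" using False by (simp add: Im_divide divide_nonpos_nonneg)
    ultimately show ?thesis by blast
  qed (use e in blast)
  then obtain \<rho> y w where e: "Ex 0 \<rho> 1 y 0 w" and w: "Im w \<ge> 0" by blast
  show ?thesis
  proof (cases "\<rho> = 0")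
    case True
    obtain a where a: "cmod a = 1" "y * a = of_real (cmod y)" using unit_rotation by blast
    have aa: "a * cnj a = 1" "cnj a * a = 1" using unit_cnj[OF a(1)] by (simp_all add: mult.commute)
    have a0: "cnj a \<noteq> 0" using a(1) by auto
    have "y / cnj a = y * a" using aa a0 by (simp add: field_simps)
    then have "Ex 0 0 1 (of_real (cmod y)) 0 w"
      using Ex_scale[OF e[unfolded True], of "cnj a" 1 1] aa a0 a(2) by simp
    then show ?thesis unfolding Ni_def using w by (intro bexI[of _ 0] exI[of _ "cmod y"] exI[of _ w]) auto
  next
    case False
    \<comment> \<open>The first two forms are multiplied by \<open>cnj c\<close> and
      \<open>\<rho> * c\<close>, whose product is \<rho>; the coefficient \<open>y\<close> then
      becomes \<open>?s * c\<^sup>2\<close>.\<close>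
    let ?s = "y / cnj \<rho>"
    obtain c where c: "cmod c = 1" "?s * c\<^sup>2 = of_real (cmod ?s)" using unit_square_root by blast
    have cc: "c * cnj c = 1" "cnj c * c = 1" using unit_cnj[OF c(1)] by (simp_all add: mult.commute)
    have c0: "c \<noteq> 0" "cnj c \<noteq> 0" using c(1) by auto
    have nz: "\<rho> * c \<noteq> 0" using False c0 by simp
    have 1: "\<rho> / (cnj c * (\<rho> * c)) = 1" using False c0 cc by (simp add: field_simps)
    have 2: "y / (cnj c * cnj (\<rho> * c)) = of_real (cmod ?s)"
    proof -
      have "y / (cnj c * cnj (\<rho> * c)) = ?s * (1 / cnj c)\<^sup>2" using False c0 by (simp add: field_simps power2_eq_square)
      moreover have "1 / cnj c = c" using cc c0 by (simp add: field_simps)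
      ultimately show ?thesis using c(2) by simp
    qed
    have 3: "w / ((\<rho> * c) * cnj (\<rho> * c)) = w / of_real ((cmod \<rho>)\<^sup>2)"
    proof -
      have "(\<rho> * c) * cnj (\<rho> * c) = (\<rho> * cnj \<rho>) * (c * cnj c)" by simp
      then show ?thesis by (simp only: cc complex_norm_square mult_1_right)
    qed
    have "Ex 0 1 1 (of_real (cmod ?s)) 0 (w / of_real ((cmod \<rho>)\<^sup>2))"
      using Ex_scale[OF e c0(2) nz, of 1] cc unfolding mult_1 1 2 3 by simp
    moreover have "Im (w / of_real ((cmod \<rho>)\<^sup>2)) \<ge> 0" using w by (simp only: Im_divide_of_real) simp
    ultimately show ?thesis unfolding Ni_def
      by (intro bexI[of _ 1] exI[of _ "cmod ?s"] exI[of _ "w / of_real ((cmod \<rho>)\<^sup>2)"]) auto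
  qed
qed

lemma normalize_Nii:
  assumes "Ex 1 \<rho> 0 y z 0" "(\<rho>, y, z) \<noteq> (0, 0, 0)" shows Nii
proof (cases "\<rho> = 0")
  case True
  obtain a where a: "cmod a = 1" "z * a = of_real (cmod z)" using unit_rotation by blast
  have aa: "a * cnj a = 1" "cnj a * a = 1" using unit_cnj[OF a(1)] by (simp_all add: mult.commute)
  have a0: "a \<noteq> 0" "cnj a \<noteq> 0" using a(1) by auto
  have "z / cnj a = z * a" using aa a0 by (simp add: field_simps)
  then have "Ex 1 0 0 (y / a) (of_real (cmod z)) 0"
    using Ex_scale[OF assms(1)[unfolded True], of a 1 1] aa a0 a(2) by simp
  moreover have "(0::complex, y / a, cmod z) \<noteq> (0, 0, 0)" using assms(2) True a0 by auto
  ultimately show ?thesis unfolding Nii_def by (intro bexI[of _ 0] exI[of _ "y / a"] exI[of _ "cmod z"]) auto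
next
  case False
  \<comment> \<open>Multiplying the first form by \<open>a\<close> and the third by
    \<open>a / \<rho>\<close> makes \<rho> equal to one and turns \<open>z\<close> into
    \<open>?s * a\<^sup>2\<close>.\<close>
  let ?s = "z / \<rho>"
  obtain a where a: "cmod a = 1" "?s * a\<^sup>2 = of_real (cmod ?s)" using unit_square_root by blast
  have aa: "a * cnj a = 1" "cnj a * a = 1" using unit_cnj[OF a(1)] by (simp_all add: mult.commute)
  have a0: "a \<noteq> 0" "cnj a \<noteq> 0" using a(1) by auto
  have k0: "a / \<rho> \<noteq> 0" using False a0 by simp
  have 2: "a / \<rho> * z / (1 * cnj a) = of_real (cmod ?s)"
  proof -
    have "1 / cnj a = a" using aa a0 by (simp add: field_simps)
    then have "a / \<rho> * z / (1 * cnj a) = ?s * a\<^sup>2" by (simp add: power2_eq_square divide_inverse mult_ac)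
    then show ?thesis using a(2) by simp
  qed
  have "Ex 1 1 0 (y / \<rho>) (of_real (cmod ?s)) 0"
    using Ex_scale[OF assms(1) a0(1) one_neq_zero k0] aa a0 False unfolding 2 by simp
  then show ?thesis unfolding Nii_def by (intro bexI[of _ 1] exI[of _ "y / \<rho>"] exI[of _ "cmod ?s"]) auto
qed

text \<open>If \<epsilon> is nonzero, a multiple of the second form absorbs \<open>x\<close>; should
  nothing else remain, the third form is closed and changes roles with the second, giving (Ni). If
  \<epsilon> = 0, every nonzero coefficient of a mixed term can be turned into a nonzero
  \<open>x\<close>.\<close>

lemma normalize:
  assumes e: "Ex \<epsilon> \<rho> x y z w" and ew: "\<epsilon> * w = 0" shows "Np \<or> Ni \<or> Nii"
proof (cases "\<epsilon> = 0")
  case False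
  then have w: "w = 0" using ew by simp
  have "Ex 1 (\<rho> * \<epsilon>) x (y * cnj \<epsilon>) (z * \<epsilon>) 0"
    using Ex_scale[OF e, of 1 "1 / \<epsilon>" 1] False w by simp
  from Ex_shear3[OF this, of "- x"] have e1: "Ex 1 (\<rho> * \<epsilon>) 0 (y * cnj \<epsilon>) (z * \<epsilon>) 0" by simp
  show ?thesis
  proof (cases "(\<rho> * \<epsilon>, y * cnj \<epsilon>, z * \<epsilon>) = (0, 0, 0)")
    case True
    then have "\<rho> * \<epsilon> = 0" "y * cnj \<epsilon> = 0" "z * \<epsilon> = 0" by (simp_all only: prod.inject)
    then have "Ex 1 0 0 0 0 0" using e1 by (simp only:)
    then have "Ex 0 0 1 0 0 0" by (rule Ex_swap23)
    then have Ni by (rule normalize_Ni) simp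
    then show ?thesis by blast
  next
    case False
    then show ?thesis using normalize_Nii[OF e1] by blast
  qed
next
  case True
  note e0 = e[unfolded True]
  show ?thesis
  proof (cases "x = 0 \<and> w = 0")
    case False
    then show ?thesis using normalize_Ni[OF e0] normalize_Ni[OF Ex_swap[OF e0]] by blast
  next
    case xw: True
    show ?thesis
    proof (cases "y = 0 \<and> z = 0")
      case True
      have Np
      proof (cases "\<rho> = 0")
        case True
        then show ?thesis using e0 xw \<open>y = 0 \<and> z = 0\<close> by (auto simp: Np_def)
      next
        case False
        then have "Ex 0 1 0 0 0 0"
          using Ex_scale[OF e0, of 1 1 "1 / \<rho>"] xw \<open>y = 0 \<and> z = 0\<close> by simp
        then show ?thesis by (auto simp: Np_def)
      qed
      then show ?thesis by blast
    next
      case False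
      \<comment> \<open>This is the new last coefficient after the shear by \<open>s\<close>; it
        cannot vanish for both \<open>s = 1\<close> and \<open>s = \<i>\<close> unless
        \<open>y = z = 0\<close>.\<close>
      have "\<exists>s. - (z * s) - y * cnj s \<noteq> 0"
      proof (rule ccontr)
        assume "\<not> ?thesis"
        then have 1: "- (z * s) - y * cnj s = 0" for s by blast
        have "\<i> * (y - z) = 0" "z + y = 0" using 1[of \<i>] 1[of 1] by (simp_all add: algebra_simps)
        then have "y = 0" "z = 0" by (simp_all add: complex_eq_iff) 
        then show False using False by simp
      qed
      then obtain s where s: "- (z * s) - y * cnj s \<noteq> 0" by blast
      from Ex_shear1[OF Ex_swap[OF e0], of s] xw have "Ex 0 (- \<rho>) 0 z y (- (z * s) - y * cnj s)" by simp
      from normalize_Ni[OF Ex_swap[OF this] s] show ?thesis by blast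
    qed
  qed
qed

end

lemma linear_coords:
  fixes f :: "3 \<Rightarrow> complex^3 \<Rightarrow> complex"
  assumes "\<And>i. clin (f i)"
  shows "linear (\<lambda>v. (\<chi> i. f i v) :: complex^3)"
  by (rule linearI) (simp_all add: vec_eq_iff clin_simps[OF assms] linear_scale[OF clin_linear[OF assms]])

lemma common_kernel:
  assumes "clin f" "clin g" shows "\<exists>v :: complex^3. v \<noteq> 0 \<and> f v = 0 \<and> g v = 0"
proof (rule ccontr)
  assume no: "\<not> ?thesis"
  let ?h = "fun3 f g (\<lambda>v. 0)"
  have cl: "clin (?h i)" for i using exhaust_3[of i] assms by (auto simp: clin_def)
  note lin = linear_coords[OF cl]
  have "v = 0" if "(\<chi> i. ?h i v) = (0 :: complex^3)" for v
    using that no by (auto simp: vec_eq_iff forall_3)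
  then have "inj (\<lambda>v. (\<chi> i. ?h i v) :: complex^3)" unfolding linear_injective_0[OF lin] by blast
  then have "surj (\<lambda>v. (\<chi> i. ?h i v) :: complex^3)" by (intro linear_injective_imp_surjective[OF lin]) simp_all
  then obtain v where "axis 3 1 = (\<chi> i. ?h i v)" by (auto simp: surj_def)
  from arg_cong[OF this, of "\<lambda>x. x $ 3"] show False by simp
qed

lemma coordinate_clin: "clin (\<lambda>v. v $ i)" by (simp add: clin_def)

lemma nonzero_coordinate: "(v :: complex^3) \<noteq> 0 \<Longrightarrow> \<exists>i. v $ i \<noteq> 0" by (simp add: vec_eq_iff)

text \<open>The coordinate map is triangular on the three vectors, hence onto; \<open>a\<close>,
  \<open>b\<close>, \<open>c\<close> are found by forward substitution.\<close>

lemma flag_cobasis: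
  assumes f: "clin f1" "clin f2" "clin f3"
    and x: "f1 x1 \<noteq> 0" "f1 x2 = 0" "f2 x2 \<noteq> 0" "f1 x3 = 0" "f2 x3 = 0" "f3 x3 \<noteq> 0"
  shows "\<exists>e. cobasis (fun3 f1 f2 f3) e"
proof -
  let ?f = "fun3 f1 f2 f3"
  have cl: "clin (?f i)" for i using exhaust_3[of i] f by auto
  have "surj (\<lambda>v. (\<chi> i. ?f i v) :: complex^3)"
  proof (rule surjI)
    fix y :: "complex^3"
    define a where "a = y $ 1 / f1 x1"
    define b where "b = (y $ 2 - a * f2 x1) / f2 x2"
    define c where "c = (y $ 3 - a * f3 x1 - b * f3 x2) / f3 x3"
    show "(\<chi> i. ?f i (a *s x1 + b *s x2 + c *s x3)) = y"
      using x by (simp add: vec_eq_iff forall_3 clin_simps[OF f(1)] clin_simps[OF f(2)] clin_simps[OF f(3)] c_def) (simp add: b_def a_def)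
  qed
  then have "inj (\<lambda>v. (\<chi> i. ?f i v) :: complex^3)" by (intro linear_surjective_imp_injective[OF linear_coords[OF cl]]) simp_all
  then have inj: "(\<chi> i. ?f i v) = (0 :: complex^3) \<Longrightarrow> v = 0" for v
    unfolding linear_injective_0[OF linear_coords[OF cl]] by blast
  show ?thesis
  proof (rule cobasis_exists[OF cl])
    show "v = 0" if "\<And>i. ?f i v = 0" for v using inj[of v] that by (simp add: vec_eq_iff)
  qed
qed

lemma cobasis_expand: "cobasis f e \<Longrightarrow> v = f 1 v *s e 1 + f 2 v *s e 2 + f 3 v *s e 3"
  unfolding cobasis_def by (metis sum_3)

lemma cobasis_dual: "cobasis f e \<Longrightarrow> f i (e j) = of_bool (i = j)"
  unfolding cobasis_def by blast

section \<open>The case of a central complex line\<close>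

context lie_cs
begin

lemma closed_PQ:
  assumes "clin \<theta>" "\<And>u c. u \<in> H \<Longrightarrow> c *s u \<in> H" "\<forall>u\<in>H. \<forall>v\<in>H. \<theta> (br u v) = 0" "u \<in> H" "v \<in> H"
  shows "\<theta> (P u v) = 0" "\<theta> (Q u v) = 0"
proof -
  have Q: "\<theta> (Q u v) = 0" if "u \<in> H" "v \<in> H" for u v
    using closed_types(1)[OF assms(1), of v u] assms(2,3) that by blast
  then show "\<theta> (Q u v) = 0" using assms(4,5) by blast
  have "\<theta> (P u v) + \<theta> (Q u v) = 0"
    using closed_types(2)[OF assms(1), of u v] assms(2-5) by blast
  then show "\<theta> (P u v) = 0" using Q assms(4,5) by simp
qed

text \<open>Equivalently, both \<open>c\<close> and \<open>\<i> *s c\<close> lie in the centre of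
  the bracket.\<close>

definition central where "central c \<longleftrightarrow> (\<forall>v. P c v = 0 \<and> Q c v = 0 \<and> Q v c = 0)"

text \<open>The third form is dual to \<open>c\<close>, the other two vanish on it, so everything
  happens in the two-dimensional quotient by the line of \<open>c\<close>. There
  \<open>two_dimensional\<close> reduces the second equation to one term, and one Jacobi component
  gives the relation needed by \<open>normalize\<close>.\<close>

lemma central_case:
  assumes c: "central c" "c \<noteq> 0"
  shows "Np \<or> Ni \<or> Nii"
proof -
  have z: "P c v = 0" "P v c = 0" "Q c v = 0" "Q v c = 0" for v
    using c(1) P_skew[of v c] unfolding central_def by auto
  obtain i where i: "c $ i \<noteq> 0" using nonzero_coordinate[OF c(2)] by blast
  \<comment> \<open>Functionals killing \<open>c\<close> are those on the quotient by its line; they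
    are stable because \<open>P\<close> and \<open>Q\<close> vanish on \<open>c\<close>.\<close>
  let ?U = "{\<theta>. clin \<theta> \<and> \<theta> c = 0}"
  have U: "\<And>\<theta>. \<theta> \<in> ?U \<Longrightarrow> clin \<theta>" "\<And>\<theta> u. \<theta> \<in> ?U \<Longrightarrow> (\<lambda>v. \<theta> (Q v u)) \<in> ?U" "\<And>\<theta> u. \<theta> \<in> ?U \<Longrightarrow> (\<lambda>v. \<theta> (P u v)) \<in> ?U"
    by (auto simp: clin_Q clin_P z clin_simps)
  have ex: "\<exists>\<theta> x. \<theta> \<in> ?U \<and> g x = 0 \<and> \<theta> x \<noteq> 0" if "clin g" for g
  proof -
    obtain v where v: "v \<noteq> 0" "g v = 0" "v $ i = 0"
      using common_kernel[OF \<open>clin g\<close> coordinate_clin[of i]] by blast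
    obtain j where "v $ j \<noteq> 0" using nonzero_coordinate[OF v(1)] by blast
    then show ?thesis using i v
      by (intro exI[of _ "\<lambda>w. 1 * w $ j + (- (c $ j / c $ i)) * w $ i"] exI[of _ v])
        (auto simp: clin_def algebra_simps add_divide_distrib)
  qed
  obtain \<theta>0 x0 where 0: "\<theta>0 \<in> ?U" "\<theta>0 x0 \<noteq> 0" using ex[of "\<lambda>v. 0"] by (auto simp: clin_def)
  have "\<exists>\<theta>\<in>?U. (\<exists>x\<in>UNIV. \<theta> x \<noteq> 0) \<and> (\<forall>u\<in>UNIV. \<forall>v\<in>UNIV. \<theta> (br u v) = 0)"
    by (rule closed_functional_exists[where ?\<theta>0.0 = \<theta>0 and ?x0.0 = x0]) (use U 0 UNIV_I in blast)+
  then obtain f1 x1 where f1: "clin f1" "f1 c = 0" "f1 x1 \<noteq> 0" "\<And>u v. f1 (br u v) = 0" by blast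
  have f1z: "f1 (P u v) = 0" "f1 (Q u v) = 0" for u v
    using closed_PQ[of f1 UNIV u v] f1 by auto
  let ?H = "{v. f1 v = 0}"
  have H: "\<And>u c. u \<in> ?H \<Longrightarrow> c *s u \<in> ?H" "\<And>u v. br u v \<in> ?H"
    using f1(4) by (auto simp: clin_simps[OF f1(1)])
  obtain \<theta>1 y1 where 1: "\<theta>1 \<in> ?U" "f1 y1 = 0" "\<theta>1 y1 \<noteq> 0" using ex[OF f1(1)] by blast
  have "\<exists>\<theta>\<in>?U. (\<exists>x\<in>?H. \<theta> x \<noteq> 0) \<and> (\<forall>u\<in>?H. \<forall>v\<in>?H. \<theta> (br u v) = 0)"
    by (rule closed_functional_exists[where ?\<theta>0.0 = \<theta>1 and ?x0.0 = y1]) (use U 1 H in blast)+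
  then obtain f2 x2 where f2: "clin f2" "f2 c = 0" "f1 x2 = 0" "f2 x2 \<noteq> 0" "\<forall>u\<in>?H. \<forall>v\<in>?H. f2 (br u v) = 0" by blast
  define f3 where "f3 v = (1 / c $ i) * v $ i" for v
  have f3: "clin f3" "f3 c = 1" using i by (auto simp: f3_def clin_def algebra_simps add_divide_distrib)
  have "\<exists>e. cobasis (fun3 f1 f2 f3) e"
    by (rule flag_cobasis[where ?x1.0 = x1 and ?x2.0 = x2 and ?x3.0 = c]) (use f1 f2 f3 in auto)
  then obtain e where e: "cobasis (fun3 f1 f2 f3) e" by blast
  define e1 e2 where "e1 = e 1" and "e2 = e 2"
  have d: "f1 e1 = 1" "f1 e2 = 0" "f2 e1 = 0" "f2 e2 = 1" "f3 e1 = 0" "f3 e2 = 0"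
    using cobasis_dual[OF e, of 1 1] cobasis_dual[OF e, of 1 2] cobasis_dual[OF e, of 2 1] cobasis_dual[OF e, of 2 2]
      cobasis_dual[OF e, of 3 1] cobasis_dual[OF e, of 3 2] by (simp_all add: e1_def e2_def)
  have e3: "e 3 = c" using cobasis_expand[OF e, of c] f1 f2 f3 by simp
  have ex: "v = f1 v *s e1 + f2 v *s e2 + f3 v *s c" for v
    using cobasis_expand[OF e, of v] by (simp add: e1_def e2_def e3)
  have Pe: "P u v = (f1 u * f2 v - f1 v * f2 u) *s P e1 e2" for u v
    by (subst ex[of u], subst ex[of v])
      (simp add: z P_skew[of e2 e1] vec_eq_iff algebra_simps)
  have Qe: "Q u v = (f1 u * cnj (f1 v)) *s Q e1 e1 + (f1 u * cnj (f2 v)) *s Q e1 e2 + (f2 u * cnj (f1 v)) *s Q e2 e1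
      + (f2 u * cnj (f2 v)) *s Q e2 e2" for u v
    by (subst ex[of u], subst ex[of v]) (simp add: z, simp add: vec_eq_iff algebra_simps)
  have q22: "f2 (Q e2 e2) = 0"
    by (rule closed_PQ(2)[of f2 ?H]) (use f2 d in \<open>auto simp: clin_simps[OF f1(1)]\<close>)
  have e2P: "f2 (P u v) = f2 (P e1 e2) * (f1 u * f2 v - f1 v * f2 u)" for u v
    by (subst Pe) (simp add: clin_simps[OF f2(1)] algebra_simps)
  have e2Q: "f2 (Q u v) = f2 (Q e1 e1) * (f1 u * cnj (f1 v)) + f2 (Q e1 e2) * (f1 u * cnj (f2 v)) + f2 (Q e2 e1) * (f2 u * cnj (f1 v))" for u v
    by (subst Qe) (simp add: clin_simps[OF f2(1)] q22 algebra_simps)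
  note td = two_dimensional[where H = UNIV and ?g1.0 = f1 and ?g2.0 = f2 and ?x1.0 = e1 and ?x2.0 = e2
      and p = "f2 (P e1 e2)" and ?q11.0 = "f2 (Q e1 e1)" and ?q12.0 = "f2 (Q e1 e2)" and ?q21.0 = "f2 (Q e2 e1)"]
  have 2: "f2 (P e1 e2) = 0" "f2 (Q e1 e2) = 0" "f2 (Q e2 e1) = 0"
  proof -
    show "f2 (P e1 e2) = 0" by (rule td(1)) (use f1 f2 d f1z e2P e2Q UNIV_I in blast)+
    show "f2 (Q e1 e2) = 0" by (rule td(2)) (use f1 f2 d f1z e2P e2Q UNIV_I in blast)+
    show "f2 (Q e2 e1) = 0" by (rule td(3)) (use f1 f2 d f1z e2P e2Q UNIV_I in blast)+
  qed
  have f2P: "f2 (P u v) = 0" for u v by (subst Pe) (simp add: clin_simps[OF f2(1)] 2)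
  have f2Q: "f2 (Q u v) = f2 (Q e1 e1) * (f1 u * cnj (f1 v))" for u v
    by (subst Qe) (simp add: clin_simps[OF f2(1)] 2 q22)
  have in_c: "w = f3 w *s c" if "f1 w = 0" "f2 w = 0" for w using ex[of w] that by simp
  \<comment> \<open>\<open>Q e1 e2\<close> and \<open>P e1 e2\<close> are multiples of
    \<open>c\<close>, so both terms on the right vanish and the left one is the product of the
    coefficients \<epsilon> and \<open>w\<close> up to sign.\<close>
  have "f3 (Q (Q e1 e1) e2) = f3 (Q (Q e1 e2) e1) + f3 (Q e1 (P e1 e2))"
    using J12[of e1 e1 e2] by (simp add: clin_simps[OF f3(1), symmetric] algebra_simps)
  moreover have "Q (Q e1 e2) e1 = 0" "Q e1 (P e1 e2) = 0"
    using in_c[of "Q e1 e2"] in_c[of "P e1 e2"] by (metis 2 f1z Q_scale vector_smult_rzero z)+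
  moreover have "f3 (Q (Q e1 e1) e2) = f2 (Q e1 e1) * f3 (Q e2 e2)"
    by (subst Qe) (simp add: f1z d clin_simps[OF f3(1)])
  ultimately have ew: "f2 (Q e1 e1) * f3 (Q e2 e2) = 0" by (simp add: clin_simps[OF f3(1)])
  have "nilE (fun3 f1 f2 f3) (- f2 (Q e1 e1)) (- f3 (P e1 e2)) (- f3 (Q e1 e1)) (- f3 (Q e1 e2)) (- f3 (Q e2 e1)) (- f3 (Q e2 e2))"
    unfolding nilE_def fun3_simps
  proof (intro conjI allI)
    show "f1 (br u v) = 0" for u v by (rule f1)
    show "- f2 (br u v) = - f2 (Q e1 e1) * (f1 u * cnj (f1 v) - f1 v * cnj (f1 u))" for u v
      unfolding br_PQ clin_simps[OF f2(1)] f2P f2Q[of u v] f2Q[of v u] by (simp add: algebra_simps)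
    have f3P: "f3 (P u v) = (f1 u * f2 v - f1 v * f2 u) * f3 (P e1 e2)" for u v
      by (subst Pe) (simp add: clin_simps[OF f3(1)] algebra_simps)
    have f3Q: "f3 (Q u v) = (f1 u * cnj (f1 v)) * f3 (Q e1 e1) + (f1 u * cnj (f2 v)) * f3 (Q e1 e2) + (f2 u * cnj (f1 v)) * f3 (Q e2 e1)
      + (f2 u * cnj (f2 v)) * f3 (Q e2 e2)" for u v
      by (subst Qe) (simp add: clin_simps[OF f3(1)])
    show "- f3 (br u v) = - f3 (P e1 e2) * (f1 u * f2 v - f1 v * f2 u) + - f3 (Q e1 e1) * (f1 u * cnj (f1 v) - f1 v * cnj (f1 u)) +
          - f3 (Q e1 e2) * (f1 u * cnj (f2 v) - f1 v * cnj (f2 u)) + - f3 (Q e2 e1) * (f2 u * cnj (f1 v) - f2 v * cnj (f1 u)) +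
          - f3 (Q e2 e2) * (f2 u * cnj (f2 v) - f2 v * cnj (f2 u))" for u v
      unfolding br_PQ clin_simps[OF f3(1)] f3P[of u v] f3Q[of u v] f3Q[of v u] by (simp add: algebra_simps)
  qed
  then have "Ex (- f2 (Q e1 e1)) (- f3 (P e1 e2)) (- f3 (Q e1 e1)) (- f3 (Q e1 e2)) (- f3 (Q e2 e1)) (- f3 (Q e2 e2))"
    unfolding Ex_def using e by blast
  then show ?thesis by (rule normalize) (simp add: ew)
qed

definition basis2 :: "(complex^3) set \<Rightarrow> complex^3 \<Rightarrow> complex^3 \<Rightarrow> bool" where
  "basis2 H a t \<longleftrightarrow> a \<in> H \<and> t \<in> H \<and> (\<forall>x y. x *s a + y *s t = 0 \<longrightarrow> x = 0 \<and> y = 0) \<and> (\<forall>h\<in>H. \<exists>x y. h = x *s a + y *s t)"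

text \<open>Three closed functionals on successive kernels give a flag. On the kernel of
  \<open>f1\<close> all of \<open>P\<close> and \<open>Q\<close> vanishes by
  \<open>two_dimensional\<close> except possibly \<open>Q e2 e2 = b *s e3\<close>; if
  \<open>b\<close> were nonzero, the last vector \<open>e3\<close> of the flag would be
  central.\<close>

lemma abelian_ideal:
  assumes nc: "\<And>c. central c \<Longrightarrow> c = 0"
  shows "\<exists>f1 e1 e2 e3. clin f1 \<and> f1 e1 = 1 \<and> (\<forall>u v. f1 (P u v) = 0 \<and> f1 (Q u v) = 0) \<and>
    basis2 {v. f1 v = 0} e2 e3 \<and> (\<forall>u v. f1 u = 0 \<longrightarrow> f1 v = 0 \<longrightarrow> P u v = 0 \<and> Q u v = 0)"
proof -
  have U: "\<And>\<theta> u. clin \<theta> \<Longrightarrow> clin (\<lambda>v. \<theta> (Q v u))" "\<And>\<theta> u. clin \<theta> \<Longrightarrow> clin (\<lambda>v. \<theta> (P u v))"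
    by (auto simp: clin_Q clin_P)
  have "\<exists>\<theta>\<in>Collect clin. (\<exists>x\<in>UNIV. \<theta> x \<noteq> 0) \<and> (\<forall>u\<in>UNIV. \<forall>v\<in>UNIV. \<theta> (br u v) = 0)"
    by (rule closed_functional_exists[where ?\<theta>0.0 = "\<lambda>v. v $ 1" and ?x0.0 = "axis 1 1"]) (use U coordinate_clin in auto)
  then obtain f1 x1 where f1: "clin f1" "f1 x1 \<noteq> 0" "\<And>u v. f1 (br u v) = 0" by blast
  have f1z: "f1 (P u v) = 0" "f1 (Q u v) = 0" for u v
    using closed_PQ[of f1 UNIV u v] f1 by auto
  let ?H = "{v. f1 v = 0}"
  have H: "u \<in> ?H \<Longrightarrow> c *s u \<in> ?H" for u c by (simp add: clin_simps[OF f1(1)])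
  obtain y1 where "y1 \<noteq> 0" "f1 y1 = 0" using common_kernel[OF f1(1) f1(1)] by blast
  moreover obtain i where "y1 $ i \<noteq> 0" using nonzero_coordinate[OF \<open>y1 \<noteq> 0\<close>] by blast
  ultimately have "\<exists>\<theta>\<in>Collect clin. (\<exists>x\<in>?H. \<theta> x \<noteq> 0) \<and> (\<forall>u\<in>?H. \<forall>v\<in>?H. \<theta> (br u v) = 0)"
    by (intro closed_functional_exists[where ?\<theta>0.0 = "\<lambda>v. v $ i" and ?x0.0 = y1])
      (use U f1 H coordinate_clin in auto)
  then obtain f2 x2 where f2: "clin f2" "f1 x2 = 0" "f2 x2 \<noteq> 0" "\<forall>u\<in>?H. \<forall>v\<in>?H. f2 (br u v) = 0" by blast
  have f2z: "f2 (P u v) = 0" "f2 (Q u v) = 0" if "f1 u = 0" "f1 v = 0" for u v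
    using closed_PQ[OF f2(1) H f2(4), of u v] that by auto
  let ?K = "{v. f1 v = 0 \<and> f2 v = 0}"
  have K: "u \<in> ?K \<Longrightarrow> c *s u \<in> ?K" for u c by (simp add: clin_simps[OF f1(1)] clin_simps[OF f2(1)])
  obtain y2 where "y2 \<noteq> 0" "f1 y2 = 0" "f2 y2 = 0" using common_kernel[OF f1(1) f2(1)] by blast
  moreover obtain j where "y2 $ j \<noteq> 0" using nonzero_coordinate[OF \<open>y2 \<noteq> 0\<close>] by blast
  ultimately have "\<exists>\<theta>\<in>Collect clin. (\<exists>x\<in>?K. \<theta> x \<noteq> 0) \<and> (\<forall>u\<in>?K. \<forall>v\<in>?K. \<theta> (br u v) = 0)"
    by (intro closed_functional_exists[where ?\<theta>0.0 = "\<lambda>v. v $ j" and ?x0.0 = y2])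
      (use U f1 f2 K coordinate_clin in auto)
  then obtain f3 x3 where f3: "clin f3" "f1 x3 = 0" "f2 x3 = 0" "f3 x3 \<noteq> 0" "\<forall>u\<in>?K. \<forall>v\<in>?K. f3 (br u v) = 0" by blast
  have "\<exists>e. cobasis (fun3 f1 f2 f3) e"
    by (rule flag_cobasis[where ?x1.0 = x1 and ?x2.0 = x2 and ?x3.0 = x3]) (use f1 f2 f3 in auto)
  then obtain e where e: "cobasis (fun3 f1 f2 f3) e" by blast
  define e1 e2 e3 where "e1 = e 1" and "e2 = e 2" and "e3 = e 3"
  have d: "f1 e1 = 1" "f1 e2 = 0" "f1 e3 = 0" "f2 e1 = 0" "f2 e2 = 1" "f2 e3 = 0" "f3 e1 = 0" "f3 e2 = 0" "f3 e3 = 1"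
    using cobasis_dual[OF e, of 1 1] cobasis_dual[OF e, of 1 2] cobasis_dual[OF e, of 1 3] cobasis_dual[OF e, of 2 1] cobasis_dual[OF e, of 2 2]
      cobasis_dual[OF e, of 2 3] cobasis_dual[OF e, of 3 1] cobasis_dual[OF e, of 3 2] cobasis_dual[OF e, of 3 3] by (simp_all add: e1_def e2_def e3_def)
  have ex: "v = f1 v *s e1 + f2 v *s e2 + f3 v *s e3" for v
    using cobasis_expand[OF e, of v] by (simp add: e1_def e2_def e3_def)
  have v0: "v = 0" if "f1 v = 0" "f2 v = 0" "f3 v = 0" for v using ex[of v] that by simp
  have exH: "v = f2 v *s e2 + f3 v *s e3" if "f1 v = 0" for v using ex[of v] that by simp
  \<comment> \<open>\<open>f3\<close> is closed on the line of \<open>e3\<close>; this is what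
    permits leaving out a coefficient for the second vector in
    \<open>two_dimensional\<close>.\<close>
  have "f3 (Q e3 e3) = 0" by (rule closed_PQ(2)[OF f3(1) K f3(5)]) (use d in auto)
  then have Q33: "Q e3 e3 = 0" by (intro v0 f1z f2z) (use d in auto)
  have Pe: "P u v = (f2 u * f3 v - f2 v * f3 u) *s P e2 e3" if "f1 u = 0" "f1 v = 0" for u v
    by (subst exH[OF that(1)], subst exH[OF that(2)])
      (simp add: P_skew[of e3 e2] vec_eq_iff algebra_simps)
  have Qe: "Q u v = (f2 u * cnj (f2 v)) *s Q e2 e2 + (f2 u * cnj (f3 v)) *s Q e2 e3 + (f3 u * cnj (f2 v)) *s Q e3 e2" if "f1 u = 0" "f1 v = 0" for u v
    by (subst exH[OF that(1)], subst exH[OF that(2)]) (simp add: Q33, simp add: vec_eq_iff algebra_simps)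
  have e2P: "f3 (P u v) = f3 (P e2 e3) * (f2 u * f3 v - f2 v * f3 u)" if "u \<in> ?H" "v \<in> ?H" for u v
      by (subst Pe) (use that in \<open>auto simp: clin_simps[OF f3(1)] algebra_simps\<close>)
  have e2Q: "f3 (Q u v) = f3 (Q e2 e2) * (f2 u * cnj (f2 v)) + f3 (Q e2 e3) * (f2 u * cnj (f3 v)) + f3 (Q e3 e2) * (f3 u * cnj (f2 v))"
      if "u \<in> ?H" "v \<in> ?H" for u v
      by (subst Qe) (use that in \<open>auto simp: clin_simps[OF f3(1)] algebra_simps\<close>)
  have Hc: "\<And>u v. br u v \<in> ?H" "\<And>u v. P u v \<in> ?H" "\<And>u v. Q u v \<in> ?H" "e2 \<in> ?H" "e3 \<in> ?H"
    and f2z': "u \<in> ?H \<Longrightarrow> v \<in> ?H \<Longrightarrow> f2 (P u v) = 0" "u \<in> ?H \<Longrightarrow> v \<in> ?H \<Longrightarrow> f2 (Q u v) = 0" for u v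
    using f1 f1z f2z d by simp_all
  note td = two_dimensional[where H = ?H and ?g1.0 = f2 and ?g2.0 = f3 and ?x1.0 = e2 and ?x2.0 = e3
      and p = "f3 (P e2 e3)" and ?q11.0 = "f3 (Q e2 e2)" and ?q12.0 = "f3 (Q e2 e3)" and ?q21.0 = "f3 (Q e3 e2)"]
  have 2: "f3 (P e2 e3) = 0" "f3 (Q e2 e3) = 0" "f3 (Q e3 e2) = 0"
  proof -
    show "f3 (P e2 e3) = 0" by (rule td(1); (rule f2(1) f3(1) d Hc f2z' H e2P e2Q; assumption?))
    show "f3 (Q e2 e3) = 0" by (rule td(2); (rule f2(1) f3(1) d Hc f2z' H e2P e2Q; assumption?))
    show "f3 (Q e3 e2) = 0" by (rule td(3); (rule f2(1) f3(1) d Hc f2z' H e2P e2Q; assumption?))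
  qed
  have "P e2 e3 = 0" "Q e2 e3 = 0" "Q e3 e2 = 0" by (auto intro!: v0 f1z f2z 2 d)
  then have PH: "P u v = 0" and QH: "Q u v = (f2 u * cnj (f2 v)) *s Q e2 e2" if "f1 u = 0" "f1 v = 0" for u v
    using Pe[OF that] Qe[OF that] by simp_all
  define b where "b = f3 (Q e2 e2)"
  have Q22: "Q e2 e2 = b *s e3" using exH[of "Q e2 e2"] f1z f2z[of e2 e2] d by (simp add: b_def)
  have b0: "b = 0"
  proof (rule ccontr)
    assume b: "b \<noteq> 0"
    have e30: "e3 \<noteq> 0" using d by (auto simp: clin_simps[OF f3(1)])
    have k: "f3 (k *s e3) = k" for k by (simp add: clin_simps[OF f3(1)] d)
    \<comment> \<open>On the kernel of \<open>f1\<close>, \<open>Q\<close> sees only the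
      \<open>f2\<close>-coordinates. So the factor \<open>b\<close> detects the
      \<open>f2\<close>-component of \<open>Q e3 e1\<close>, and the Jacobi component moves
      everything to terms in which \<open>e3\<close> makes \<open>Q\<close> vanish. The next two
      quantities are treated alike.\<close>
    have "f2 (Q e3 e1) * b = f3 (Q (Q e3 e1) e2)"
      by (subst QH) (auto simp: f1z d Q22 k)
    also have "Q (Q e3 e1) e2 = Q (Q e3 e2) e1 + Q e3 (P e1 e2)" using J12[of e3 e1 e2] by (simp add: algebra_simps)
    also have "\<dots> = 0" using QH[of e3 e2] QH[of e3 "P e1 e2"] by (simp add: d f1z)
    finally have \<beta>: "f2 (Q e3 e1) = 0" using b by (simp add: clin_simps[OF f3(1)])
    have "f2 (Q e1 e3) * b = f3 (Q (Q e1 e3) e2)"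
      by (subst QH) (auto simp: f1z d Q22 k)
    also have "Q (Q e1 e3) e2 = Q (Q e1 e2) e3 + Q e1 (P e3 e2)" using J12[of e1 e3 e2] by (simp add: algebra_simps)
    also have "\<dots> = 0" using QH[of "Q e1 e2" e3] PH[of e3 e2] by (simp add: d f1z)
    finally have \<gamma>: "f2 (Q e1 e3) = 0" using b by (simp add: clin_simps[OF f3(1)])
    have "f2 (P e1 e3) * b = f3 (Q (P e1 e3) e2)"
      by (subst QH) (auto simp: f1z d Q22 k)
    also have "Q (P e1 e3) e2 = 0"
      using J21[of e1 e3 e2] QH[of e3 e2] PH[of "Q e1 e2" e3] QH[of e2 e3] QH[of e3 "Q e2 e1"] by (simp add: d f1z)
    finally have \<alpha>: "f2 (P e1 e3) = 0" using b by (simp add: clin_simps[OF f3(1)])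
    define a3 b3 c3 where "a3 = f3 (P e1 e3)" and "b3 = f3 (Q e3 e1)" and "c3 = f3 (Q e1 e3)"
    have eq: "P e1 e3 = a3 *s e3" "Q e3 e1 = b3 *s e3" "Q e1 e3 = c3 *s e3"
      using exH[of "P e1 e3"] exH[of "Q e3 e1"] exH[of "Q e1 e3"] f1z \<alpha> \<beta> \<gamma> by (simp_all add: a3_def b3_def c3_def)
    \<comment> \<open>Now \<open>e3\<close> is an eigenvector of all three operators given by
      \<open>e1\<close>. The antilinear one has eigenvalue zero by the Jacobi identity, the linear
      ones by nilpotency of the brackets with \<open>e1\<close> and
      \<open>\<i> *s e1\<close>.\<close>
    have "(cnj c3 * c3) *s e3 = 0"
      using J21[of e1 e3 e1] PH[of "Q e1 e1" e3] QH[of e3 "Q e1 e1"] P_skew[of e3 e1]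
      by (simp add: eq d f1z mult.commute)
    then have c3: "c3 = 0" using e30 by (simp add: vector_mul_eq_0)
    have eig: "l = 0" if "\<And>k. br x (k *s e3) = (l * k) *s e3" for x l
    proof -
      obtain m where m: "\<And>Xs w. length Xs = m \<Longrightarrow> foldr br Xs w = 0" using nilpotent by blast
      have "foldr br (replicate k x) e3 = (l ^ k) *s e3" for k by (induction k) (simp_all add: that)
      then have "(l ^ m) *s e3 = 0" using m[of "replicate m x" e3] by simp
      then show ?thesis using e30 by (simp add: vector_mul_eq_0)
    qed
    have "a3 - b3 = 0" by (rule eig[of e1]) (simp add: br_PQ eq c3, simp add: vec_eq_iff algebra_simps)
    moreover have "\<i> * (a3 + b3) = 0" by (rule eig[of "\<i> *s e1"]) (simp add: br_PQ eq c3, simp add: vec_eq_iff algebra_simps)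
    ultimately have "a3 - b3 = 0" "a3 + b3 = 0" by simp_all
    then have "a3 = 0" "b3 = 0" by algebra+
    then have z: "P e1 e3 = 0" "Q e3 e1 = 0" "Q e1 e3 = 0" by (simp_all add: eq c3)
    have "central e3" unfolding central_def
    proof (intro allI)
      fix v
      have h: "f1 (f2 v *s e2 + f3 v *s e3) = 0" by (simp add: clin_simps[OF f1(1)] d)
      have v: "v = f1 v *s e1 + (f2 v *s e2 + f3 v *s e3)" using ex[of v] by (simp add: add.assoc)
      show "P e3 v = 0 \<and> Q e3 v = 0 \<and> Q v e3 = 0"
        using PH[of e3 "f2 v *s e2 + f3 v *s e3"] QH[of e3 "f2 v *s e2 + f3 v *s e3"] QH[of "f2 v *s e2 + f3 v *s e3" e3] h P_skew[of e3 e1]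
        by (subst (1 2 3) v) (simp add: z d del: Q_scale P_scale add: P_scale(2) Q_scale)
    qed
    then show False using nc e30 by blast
  qed
  have "basis2 ?H e2 e3"
    unfolding basis2_def
  proof (intro conjI allI ballI impI)
    fix x y assume "x *s e2 + y *s e3 = 0"
    then have "f2 (x *s e2 + y *s e3) = 0" "f3 (x *s e2 + y *s e3) = 0" by (simp_all add: clin_simps[OF f2(1)] clin_simps[OF f3(1)])
    then show "x = 0" "y = 0" by (simp_all add: clin_simps[OF f2(1)] clin_simps[OF f3(1)] d)
  qed (use d exH in auto)
  then show ?thesis using f1(1) f1z d(1) PH QH Q22 b0 by (intro exI[of _ f1] exI[of _ e1] exI[of _ e2] exI[of _ e3]) auto
qed

end

lemma sum_diff_0: "x - y = 0 \<Longrightarrow> x + y = 0 \<Longrightarrow> y = (0 :: complex)"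
  by simp

lemma sum_diff_0': "p + q - r + (a + b - c) = 0 \<Longrightarrow> p + q + r - (a + b + c) = 0 \<Longrightarrow> p + (q - c) = (0 :: complex)"
  by algebra

section \<open>The case without a central complex line\<close>

context lie_cs
begin

definition niiiE where
  "niiiE f \<rho> s \<longleftrightarrow> (\<forall>u v. f (1::3) (br u v) = 0) \<and>
     (\<forall>u v. - f 2 (br u v) = (f 1 u * f 3 v - f 1 v * f 3 u) + (f 1 u * cnj (f 3 v) - f 1 v * cnj (f 3 u))) \<and>
     (\<forall>u v. - f 3 (br u v) = \<i> * \<rho> * (f 1 u * cnj (f 1 v) - f 1 v * cnj (f 1 u))
        + s * \<i> * ((f 1 u * cnj (f 2 v) - f 1 v * cnj (f 2 u)) - (f 2 u * cnj (f 1 v) - f 2 v * cnj (f 1 u))))"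

definition Niii where
  "Niii \<longleftrightarrow> (\<exists>f e \<rho> s. cobasis f e \<and> \<rho> \<in> {0, 1} \<and> s \<in> {1, - 1} \<and> niiiE f \<rho> s)"

text \<open>The multiplication table of the basis dual to a coframe of family (Niii). The signs are
  opposite to those of the structure equations, since the differential of a form is minus the form
  on the bracket.\<close>

lemma niii_of_basis:
  assumes ind: "\<And>a b c. a *s E1 + b *s E2 + c *s E3 = 0 \<Longrightarrow> a = 0 \<and> b = 0 \<and> c = 0"
    and z: "P E1 E2 = 0" "P E2 E3 = 0" "Q E2 E2 = 0" "Q E2 E3 = 0" "Q E3 E2 = 0" "Q E3 E3 = 0" "Q E3 E1 = 0"
    and nz: "P E1 E3 = - E2" "Q E1 E3 = - E2" "Q E1 E2 = - ((s * \<i>) *s E3)" "Q E2 E1 = (s * \<i>) *s E3" "Q E1 E1 = - ((\<i> * \<rho>) *s E3)"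
    and rs: "\<rho> \<in> {0, 1}" "s \<in> {1, - 1}"
  shows Niii
proof -
  have "\<exists>f. cobasis f (fun3 E1 E2 E3)" using ind by (rule cobasis_of_independent)
  then obtain f where e: "cobasis f (fun3 E1 E2 E3)" by blast
  have ex: "v = f 1 v *s E1 + f 2 v *s E2 + f 3 v *s E3" for v
    using cobasis_expand[OF e, of v] by simp
  have cl: "clin (f i)" for i using e unfolding cobasis_def by blast
  have d: "f 1 E2 = 0" "f 1 E3 = 0" "f 2 E2 = 1" "f 2 E3 = 0" "f 3 E2 = 0" "f 3 E3 = 1"
    using cobasis_dual[OF e, of 1 2] cobasis_dual[OF e, of 1 3] cobasis_dual[OF e, of 2 2]
      cobasis_dual[OF e, of 2 3] cobasis_dual[OF e, of 3 2] cobasis_dual[OF e, of 3 3] by simp_all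
  have Pe: "P u v = - (f 1 u * f 3 v - f 1 v * f 3 u) *s E2" for u v
    by (subst ex[of u], subst ex[of v])
      (simp add: z nz P_skew[of E2 E1] P_skew[of E3 E1] P_skew[of E3 E2] vec_eq_iff algebra_simps)
  have Qe: "Q u v = - (f 1 u * cnj (f 3 v)) *s E2 + (s * \<i> * (f 2 u * cnj (f 1 v) - f 1 u * cnj (f 2 v)) - \<i> * \<rho> * (f 1 u * cnj (f 1 v))) *s E3" for u v
    by (subst ex[of u], subst ex[of v]) (simp add: z nz vec_eq_iff algebra_simps)
  have "niiiE f \<rho> s"
    unfolding niiiE_def br_PQ clin_simps[OF cl] Pe Qe d by (auto simp: algebra_simps)
  then show ?thesis unfolding Niii_def using e rs by blast
qed

end

locale plane =
  fixes H :: "(complex^3) set" and e2 e3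
  assumes H_add: "u \<in> H \<Longrightarrow> v \<in> H \<Longrightarrow> u + v \<in> H" and H_scale: "u \<in> H \<Longrightarrow> c *s u \<in> H"
    and indep: "x *s e2 + y *s e3 = 0 \<Longrightarrow> x = 0 \<and> y = 0" and in_H: "e2 \<in> H" "e3 \<in> H"
    and span: "h \<in> H \<Longrightarrow> \<exists>x y. h = x *s e2 + y *s e3"
begin

text \<open>One of the two given basis vectors is replaced by \<open>a\<close>, depending on which
  coordinate of \<open>a\<close> is nonzero.\<close>

lemma extend:
  assumes "a \<in> H" "a \<noteq> 0" shows "\<exists>t. plane H a t"
proof -
  obtain x y where a: "a = x *s e2 + y *s e3" using span[OF assms(1)] by blast
  show ?thesis
  proof (cases "x = 0")
    case False
    have "plane H a e3"
    proof
      fix p q assume "p *s a + q *s e3 = 0"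
      then have "(p * x) *s e2 + (p * y + q) *s e3 = 0" by (simp add: a vec_eq_iff algebra_simps)
      from indep[OF this] show "p = 0 \<and> q = 0" using False by auto
    next
      fix h assume "h \<in> H"
      then obtain p q where "h = p *s e2 + q *s e3" using span by blast
      then have "h = (p / x) *s a + (q - p * y / x) *s e3" using False by (simp add: a vec_eq_iff field_simps)
      then show "\<exists>p q. h = p *s a + q *s e3" by blast
    qed (use H_add H_scale assms in_H in auto)
    then show ?thesis by blast
  next
    case True
    then have a: "a = y *s e3" and y: "y \<noteq> 0" using a assms(2) by auto
    have "plane H a e2"
    proof
      fix p q assume "p *s a + q *s e2 = 0"
      then have "q *s e2 + (p * y) *s e3 = 0" by (simp add: a vec_eq_iff algebra_simps)
      from indep[OF this] show "p = 0 \<and> q = 0" using y by auto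
    next
      fix h assume "h \<in> H"
      then obtain p q where "h = p *s e2 + q *s e3" using span by blast
      then have "h = (q / y) *s a + p *s e2" using y by (simp add: a vec_eq_iff field_simps)
      then show "\<exists>p q. h = p *s a + q *s e2" by blast
    qed (use H_add H_scale assms in_H in auto)
    then show ?thesis by blast
  qed
qed

lemma basis_nz: "e2 \<noteq> 0" "e3 \<noteq> 0"
  using indep[of 1 0] indep[of 0 1] by auto

context
  fixes F m
  assumes F: "\<And>u v. F (u + v) = F u + F v" "\<And>c v. F (c *s v) = c *s F v" "\<And>v. v \<in> H \<Longrightarrow> F v \<in> H"
    and nil: "\<And>v. v \<in> H \<Longrightarrow> (F ^^ m) v = 0"
begin

lemma nil_eigenvalue:
  assumes "x \<in> H" "x \<noteq> 0" "F x = c *s x" shows "c = 0"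
proof -
  have "(F ^^ k) x = (c ^ k) *s x" for k by (induction k) (simp_all add: assms F mult.commute)
  then have "(c ^ m) *s x = 0" using nil[OF assms(1)] by simp
  then show ?thesis using assms(2) by (simp add: vector_mul_eq_0)
qed

text \<open>Some nonzero \<open>a\<close> is in the kernel. In a basis \<open>a\<close>,
  \<open>t\<close> the diagonal coefficient \<open>y\<close> of \<open>F t\<close> must vanish,
  since otherwise \<open>F t\<close> would be an eigenvector with eigenvalue \<open>y\<close>; so
  the image lies in the kernel.\<close>

lemma nil_square:
  assumes "h \<in> H" shows "F (F h) = 0"
proof -
  have "\<exists>a. a \<in> H \<and> a \<noteq> 0 \<and> F a = 0" if "(F ^^ k) w = 0" "w \<noteq> 0" "w \<in> H" for k w
    using that
  proof (induction k arbitrary: w)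
    case (Suc k)
    show ?case
    proof (cases "F w = 0")
      case False
      have "(F ^^ k) (F w) = 0" using Suc.prems(1) by (simp add: funpow_swap1)
      from Suc.IH[OF this False F(3)[OF Suc.prems(3)]] show ?thesis .
    qed (use Suc.prems in blast)
  qed auto
  then obtain a where a: "a \<in> H" "a \<noteq> 0" "F a = 0" using nil in_H basis_nz by blast
  obtain t where "plane H a t" using extend[OF a(1,2)] by blast
  then interpret t: plane H a t .
  obtain x y where xy: "F t = x *s a + y *s t" using t.span[OF F(3)[OF t.in_H(2)]] by blast
  have y: "y = 0"
  proof (rule ccontr)
    assume y: "y \<noteq> 0"
    have "F (x *s a + y *s t) = y *s (x *s a + y *s t)" by (simp add: F a xy)
    moreover have "x *s a + y *s t \<noteq> 0" using t.indep y by blast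
    ultimately show False using nil_eigenvalue[of "x *s a + y *s t" y] y t.in_H t.H_add t.H_scale by blast
  qed
  obtain p q where "h = p *s a + q *s t" using t.span[OF assms] by blast
  then show ?thesis by (simp add: F a xy y)
qed

end

end

context lie_cs
begin

text \<open>Nilpotency is known for the real linear brackets with \<open>e\<close> and
  \<open>\<i> *s e\<close>, but it is wanted for the complex linear operators \<open>P e\<close> and
  \<open>Q v e\<close>. These are combinations of the former, together with the antilinear
  \<open>Q e v\<close>; dual functionals are used to peel off one factor at a time.\<close>

lemma abelian_ideal_nilpotent:
  assumes H: "\<And>u v. u \<in> H \<Longrightarrow> v \<in> H \<Longrightarrow> u + v \<in> H" "\<And>u c. u \<in> H \<Longrightarrow> c *s u \<in> H" "\<And>u v. P u v \<in> H" "\<And>u v. Q u v \<in> H"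
  shows "\<exists>m. \<forall>h\<in>H. ((\<lambda>v. Q v e) ^^ m) h = 0 \<and> (P e ^^ m) h = 0"
proof -
  \<comment> \<open>\<open>F\<close> kills all \<open>k\<close>-fold brackets with \<open>e\<close>
    and \<open>\<i> *s e\<close> that start in \<open>H\<close>.\<close>
  define Z where "Z k F \<longleftrightarrow> (\<forall>Xs w. length Xs = k \<longrightarrow> set Xs \<subseteq> {e, \<i> *s e} \<longrightarrow> w \<in> H \<longrightarrow> F (foldr br Xs w) = (0::complex))" for k F
  have neg: "- u \<in> H" if "u \<in> H" for u using H(2)[OF that, of "-1"] by simp
  have br: "br u v \<in> H" for u v
    using H(1)[OF H(1)[OF H(3)[of u v] H(4)[of u v]] neg[OF H(4)[of v u]]] by (simp add: br_PQ)
  have G: "foldr br Xs w \<in> H" if "w \<in> H" for Xs w using that br by (cases Xs) auto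
  have be: "br e h = P e h + Q e h - Q h e" "br (\<i> *s e) h = \<i> *s (P e h + Q e h + Q h e)" for h
    by (simp_all add: br_PQ vec_eq_iff algebra_simps)
  have Zstep: "F (br e (foldr br Xs w)) = 0 \<and> F (br (\<i> *s e) (foldr br Xs w)) = 0"
    if "Z (Suc k) F" "length Xs = k" "set Xs \<subseteq> {e, \<i> *s e}" "w \<in> H" for k F Xs w
    using that(1)[unfolded Z_def, rule_format, of "e # Xs" w] that(1)[unfolded Z_def, rule_format, of "(\<i> *s e) # Xs" w] that(2-4) by simp
  have T: "\<theta> (((\<lambda>v. Q v e) ^^ k) w) = 0" if "clin \<theta>" "Z k \<theta>" "w \<in> H" for k \<theta> w
    using that
  proof (induction k arbitrary: \<theta>)
    case 0
    then show ?case by (simp add: Z_def)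
  next
    case (Suc k)
    have "Z k (\<lambda>v. \<theta> (Q v e))"
      unfolding Z_def
    proof (intro allI impI)
      fix Xs v assume a: "length Xs = k" "set Xs \<subseteq> {e, \<i> *s e}" "v \<in> H"
      define b where "b = foldr br Xs v"
      have "\<theta> (P e b) + \<theta> (Q e b) - \<theta> (Q b e) = 0" "\<i> * (\<theta> (P e b) + \<theta> (Q e b) + \<theta> (Q b e)) = 0"
        using Zstep[OF Suc.prems(2) a, THEN conjunct1] Zstep[OF Suc.prems(2) a, THEN conjunct2]
        unfolding be b_def[symmetric] clin_simps[OF Suc.prems(1)] .
      then have "\<theta> (P e b) + \<theta> (Q e b) - \<theta> (Q b e) = 0" "\<theta> (P e b) + \<theta> (Q e b) + \<theta> (Q b e) = 0" by (simp_all only: mult_eq_0_iff complex_i_not_zero simp_thms)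
      then show "\<theta> (Q (foldr br Xs v) e) = 0" unfolding b_def[symmetric] by (rule sum_diff_0)
    qed
    from Suc.IH[OF clin_Q[OF Suc.prems(1)] this Suc.prems(3)] show ?case by simp
  qed
  \<comment> \<open>The functional carries an antilinear part \<phi>, because removing one bracket
    from \<theta> produces the antilinear summand \<open>\<theta> (Q e v) - \<phi> (Q v e)\<close>
    next to \<open>\<theta> (P e v)\<close>. At \<open>k = 0\<close> comparing \<open>w\<close> with
    \<open>\<i> *s w\<close> separates the two parts.\<close>
  have A: "\<theta> ((P e ^^ k) w) = 0"
    if "clin \<theta>" "\<And>u v. \<phi> (u + v) = \<phi> u + \<phi> v" "\<And>c v. \<phi> (c *s v) = cnj c * \<phi> v" "Z k (\<lambda>v. \<theta> v + \<phi> v)" "w \<in> H" for k \<theta> \<phi> w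
    using that
  proof (induction k arbitrary: \<theta> \<phi>)
    case 0
    have z: "\<theta> v + \<phi> v = 0" if "v \<in> H" for v using 0(4) that by (simp add: Z_def)
    have "\<theta> w + \<phi> w = 0" using z[OF 0(5)] .
    moreover have "\<i> * (\<theta> w - \<phi> w) = 0"
      using z[OF H(2)[OF 0(5), of \<i>]] by (simp add: clin_simps[OF 0(1)] 0(3) algebra_simps)
    then have "\<theta> w - \<phi> w = 0" by simp
    ultimately have "\<theta> w = 0" by algebra
    then show ?case by simp
  next
    case (Suc k)
    note cs = clin_simps[OF Suc.prems(1)] and \<phi> = Suc.prems(2,3)
    have \<phi>d: "\<phi> (u - v) = \<phi> u - \<phi> v" for u v using \<phi>(1)[of "u - v" v] by simp
    have "Z k (\<lambda>v. \<theta> (P e v) + (\<theta> (Q e v) - \<phi> (Q v e)))"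
      unfolding Z_def
    proof (intro allI impI)
      fix Xs v assume a: "length Xs = k" "set Xs \<subseteq> {e, \<i> *s e}" "v \<in> H"
      define b where "b = foldr br Xs v"
      have "\<theta> (P e b) + \<theta> (Q e b) - \<theta> (Q b e) + (\<phi> (P e b) + \<phi> (Q e b) - \<phi> (Q b e)) = 0"
        "\<i> * (\<theta> (P e b) + \<theta> (Q e b) + \<theta> (Q b e) - (\<phi> (P e b) + \<phi> (Q e b) + \<phi> (Q b e))) = 0"
        using Zstep[OF Suc.prems(4) a] unfolding be b_def[symmetric] cs \<phi> \<phi>d by (simp_all add: algebra_simps)
      then have "\<theta> (P e b) + \<theta> (Q e b) - \<theta> (Q b e) + (\<phi> (P e b) + \<phi> (Q e b) - \<phi> (Q b e)) = 0"
        "\<theta> (P e b) + \<theta> (Q e b) + \<theta> (Q b e) - (\<phi> (P e b) + \<phi> (Q e b) + \<phi> (Q b e)) = 0" by simp_all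
      then show "\<theta> (P e (foldr br Xs v)) + (\<theta> (Q e (foldr br Xs v)) - \<phi> (Q (foldr br Xs v) e)) = 0"
        unfolding b_def[symmetric] by (rule sum_diff_0')
    qed
    moreover have "\<theta> (Q e (u + v)) - \<phi> (Q (u + v) e) = \<theta> (Q e u) - \<phi> (Q u e) + (\<theta> (Q e v) - \<phi> (Q v e))" for u v
      by (simp add: cs \<phi>)
    moreover have "\<theta> (Q e (c *s v)) - \<phi> (Q (c *s v) e) = cnj c * (\<theta> (Q e v) - \<phi> (Q v e))" for c v
      by (simp add: cs \<phi> algebra_simps)
    ultimately have "\<theta> (P e ((P e ^^ k) w)) = 0"
      using Suc.IH[OF clin_P[OF Suc.prems(1)], of "\<lambda>v. \<theta> (Q e v) - \<phi> (Q v e)"] Suc.prems(5) by blast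
    then show ?case by simp
  qed
  obtain m where m: "\<And>Xs w. length Xs = m \<Longrightarrow> foldr br Xs w = 0" using nilpotent by blast
  have "((\<lambda>v. Q v e) ^^ m) h = 0 \<and> (P e ^^ m) h = 0" if "h \<in> H" for h
  proof -
    have "Z m (\<lambda>v. v $ i)" "Z m (\<lambda>v. v $ i + 0)" for i by (simp_all add: Z_def m)
    then show ?thesis using T[OF coordinate_clin _ that, of m] A[OF coordinate_clin _ _ _ that, of "\<lambda>v. 0" m] by (auto simp: vec_eq_iff)
  qed
  then show ?thesis by blast
qed

text \<open>On the abelian ideal \<open>H\<close> the algebra is encoded by \<open>A\<close>,
  \<open>T\<close> (linear) and \<open>S\<close> (antilinear). The Jacobi identity gives
  \<open>- T S = S A\<close> and \<open>S S = A T - T A\<close>, nilpotency gives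
  \<open>A A = T T = 0\<close>, and the absence of central vectors excludes a common kernel. These
  relations fix the operators up to scaling.\<close>

lemma noncentral_case:
  assumes nc: "\<And>c. central c \<Longrightarrow> c = 0"
  shows Niii
proof -
  obtain f1 e1 e2 e3 where f1: "clin f1" "f1 e1 = 1" and f1z: "\<And>u v. f1 (P u v) = 0" "\<And>u v. f1 (Q u v) = 0"
    and b2: "basis2 {v. f1 v = 0} e2 e3" and ab: "\<And>u v. f1 u = 0 \<Longrightarrow> f1 v = 0 \<Longrightarrow> P u v = 0 \<and> Q u v = 0"
    using abelian_ideal[OF nc] by blast
  note cs = clin_simps[OF f1(1)]
  define H where "H = {v. f1 v = 0}"
  have pl: "plane H e2 e3"
    using b2 unfolding H_def basis2_def by unfold_locales (auto simp: cs)
  interpret plane H e2 e3 by (rule pl)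
  define A S T where "A v = P e1 v" and "S v = Q e1 v" and "T v = Q v e1" for v
  have lin: "A (u + v) = A u + A v" "A (c *s v) = c *s A v" "S (u + v) = S u + S v" "S (c *s v) = cnj c *s S v"
    "T (u + v) = T u + T v" "T (c *s v) = c *s T v" "A 0 = 0" "S 0 = 0" "T 0 = 0"
    "A (- v) = - A v" "S (- v) = - S v" "T (- v) = - T v" for u v c
    by (simp_all add: A_def S_def T_def)
  have cl: "A v \<in> H" "S v \<in> H" "T v \<in> H" for v by (simp_all add: A_def S_def T_def H_def f1z)
  have zH: "P u v = 0" "Q u v = 0" if "u \<in> H" "v \<in> H" for u v using ab that by (auto simp: H_def)
  have TS: "- T (S h) = S (A h)" if "h \<in> H" for h
    using J12[of e1 e1 h] zH(2)[OF _ that, of "Q e1 e1"] cl(2)[of e1] by (simp add: A_def S_def T_def)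
  have SS: "S (S h) = A (T h) - T (A h)" if "h \<in> H" for h
    using J21[of e1 h e1] zH(1)[OF _ that, of "Q e1 e1"] zH(2)[OF that, of "Q e1 e1"] cl(2)[of e1] P_skew[of "Q h e1" e1]
    by (simp add: A_def S_def T_def algebra_simps add_eq_0_iff)
  have no_common: "c = 0" if "c \<in> H" "A c = 0" "S c = 0" "T c = 0" for c
  proof (rule nc, unfold central_def, intro allI)
    fix v
    define h where "h = v - f1 v *s e1"
    have h: "h \<in> H" and v: "v = f1 v *s e1 + h" by (simp_all add: h_def H_def cs f1)
    have "P c e1 = 0" "Q c e1 = 0" "Q e1 c = 0" using that P_skew[of c e1] by (simp_all add: A_def S_def T_def)
    then show "P c v = 0 \<and> Q c v = 0 \<and> Q v c = 0"
      using zH[OF that(1) h] zH[OF h that(1)] by (subst (1 2 3) v) simp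
  qed
  obtain m where m: "\<forall>h\<in>H. ((\<lambda>v. Q v e1) ^^ m) h = 0 \<and> (P e1 ^^ m) h = 0"
    using abelian_ideal_nilpotent[of H e1] H_add H_scale by (auto simp: H_def f1z)
  have AT: "A = P e1" "T = (\<lambda>v. Q v e1)" by (auto simp: A_def T_def)
  have A2: "A (A h) = 0" if "h \<in> H" for h
    by (rule nil_square[of A m]) (use m that lin cl in \<open>auto simp: AT(1)[symmetric]\<close>)
  have T2: "T (T h) = 0" if "h \<in> H" for h
    by (rule nil_square[of T m]) (use m that lin cl in \<open>auto simp: AT(2)[symmetric]\<close>)
  have Teig: "c = 0" if "x \<in> H" "x \<noteq> 0" "T x = c *s x" for c x
    using T2[OF that(1)] that by (simp add: lin vector_mul_eq_0)
  have Seig: "S k = 0" if "k \<in> H" "S (S k) = 0" "S k = x *s k" for x k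
    using that by (auto simp: lin vector_mul_eq_0)
  have "\<exists>a\<in>H. a \<noteq> 0 \<and> A a = 0"
    by (cases "A e2 = 0") (use A2 cl in_H basis_nz in blast)+
  then obtain a where a: "a \<in> H" "a \<noteq> 0" "A a = 0" by blast
  \<comment> \<open>Otherwise \<open>A\<close> and \<open>T\<close> both kill \<open>a\<close>. Then
    \<open>S a\<close> is a multiple of \<open>a\<close>, hence zero since
    \<open>S (S a) = 0\<close>, or else both \<open>A\<close> and \<open>T\<close> vanish on
    \<open>H\<close>, where \<open>a\<close> or \<open>S a\<close> is in the kernel of
    \<open>S\<close>. Either way there is a common kernel vector.\<close>
  have Ta: "T a \<noteq> 0"
  proof
    assume Ta: "T a = 0"
    obtain t where "plane H a t" using extend[OF a(1,2)] by blast
    then interpret t: plane H a t .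
    obtain x y where At: "A t = x *s a + y *s t" using t.span[OF cl(1)] by blast
    have "(y * x) *s a + (y * y) *s t = 0" using A2[OF t.in_H(2)] by (simp add: At lin a vec_eq_iff algebra_simps)
    then have "y = 0" using t.indep[of "y * x" "y * y"] by simp
    then have At: "A t = x *s a" using At by simp
    have SSa: "S (S a) = 0" using SS[OF a(1)] by (simp add: a Ta lin)
    show False
    proof (cases "x = 0")
      case False
      obtain p q where St: "S t = p *s a + q *s t" using t.span[OF cl(2)] by blast
      obtain p' q' where Tt: "T t = p' *s a + q' *s t" using t.span[OF cl(3)] by blast
      have "(q' * p') *s a + (q' * q') *s t = 0" using T2[OF t.in_H(2)] by (simp add: Tt lin Ta vec_eq_iff algebra_simps)
      then have "q' = 0" using t.indep[of "q' * p'" "q' * q'"] by simp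
      then have "cnj x *s S a = - (q * p') *s a"
        using TS[OF t.in_H(2)] by (simp add: At St Tt lin Ta)
      then have "(1 / cnj x) *s (cnj x *s S a) = (- q * p' / cnj x) *s a" by simp
      then have "S a = (- q * p' / cnj x) *s a" using False by (simp only: vector_smult_assoc) simp
      from Seig[OF a(1) SSa this] show False using no_common a Ta by blast
    next
      case True
      have A0: "A h = 0" if "h \<in> H" for h using t.span[OF that] At True a by (auto simp: lin)
      have TSz: "T (S h) = 0" "S (S h) = 0" if "h \<in> H" for h
        using TS[OF that] SS[OF that] A0[OF that] A0[OF cl(3)] by (simp_all add: lin)
      show False
      proof (cases "T t = 0")
        case True
        then have T0: "T h = 0" if "h \<in> H" for h using t.span[OF that] Ta by (auto simp: lin)
        show False
          by (cases "S a = 0") (use no_common[of a] no_common[of "S a"] a cl A0 T0 TSz in blast)+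
      next
        case False
        obtain p q where Sa: "S a = p *s a + q *s t" using t.span[OF cl(2)] by blast
        have "q *s T t = 0" using TSz(1)[OF a(1)] by (simp add: Sa lin Ta)
        then have "S a = p *s a" using False Sa by (simp add: vector_mul_eq_0)
        from Seig[OF a(1) SSa this] show False using no_common a Ta by blast
      qed
    qed
  qed
  define t where "t = T a"
  have t: "t \<in> H" "t \<noteq> 0" "T t = 0" using Ta cl T2[OF a(1)] by (simp_all add: t_def)
  have ind: "x = 0 \<and> y = 0" if "x *s a + y *s t = 0" for x y
  proof -
    have "T (x *s a + y *s t) = 0" using that by (simp add: lin)
    then have "x *s t = 0" by (simp add: lin t flip: t_def)
    then have "x = 0" using t by (simp add: vector_mul_eq_0)
    then show ?thesis using that t by (simp add: vector_mul_eq_0)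
  qed
  obtain t' where "plane H a t'" using extend[OF a(1,2)] by blast
  then interpret t': plane H a t' .
  have "plane H a t"
  proof
    fix h assume h: "h \<in> H"
    obtain x y where tt: "t = x *s a + y *s t'" using t'.span[OF t(1)] by blast
    have y: "y \<noteq> 0"
    proof
      assume "y = 0"
      then have "T a = x *s a" using tt by (simp add: t_def)
      then have "x = 0" using Teig a by blast
      then show False using \<open>T a = x *s a\<close> Ta by simp
    qed
    obtain p q where "h = p *s a + q *s t'" using t'.span[OF h] by blast
    then have "h = (p - q * x / y) *s a + (q / y) *s t" using y by (simp add: tt vec_eq_iff field_simps)
    then show "\<exists>x y. h = x *s a + y *s t" by blast
  qed (use a t ind H_add H_scale in auto)
  then interpret t: plane H a t .
  have Tt: "T a = t" by (simp add: t_def)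
  obtain \<alpha>' \<alpha>2 where At': "A t = \<alpha>' *s a + \<alpha>2 *s t" using t.span[OF cl(1)] by blast
  have "(\<alpha>2 * \<alpha>') *s a + (\<alpha>2 * \<alpha>2) *s t = 0" using A2[OF t(1)] by (simp add: At' lin a vec_eq_iff algebra_simps)
  then have "\<alpha>2 = 0" using ind[of "\<alpha>2 * \<alpha>'" "\<alpha>2 * \<alpha>2"] by simp
  \<comment> \<open>In the basis \<open>a\<close>, \<open>t = T a\<close> the remaining operators
    are off-diagonal: the relations leave \<open>A t = \<alpha> *s a\<close>,
    \<open>S a = m *s t\<close> and a multiple \<open>n1\<close> of \<open>a\<close> for
    \<open>S t\<close>.\<close>
  then obtain \<alpha> where At: "A t = \<alpha> *s a" using At' by auto
  obtain m' m where Sa': "S a = m' *s a + m *s t" using t.span[OF cl(2)] by blast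
  have "m' *s t = 0" using TS[OF a(1)] by (simp add: a lin Sa' Tt t)
  then have Sa: "S a = m *s t" using Sa' t by (simp add: vector_mul_eq_0)
  obtain n1 n2 where St': "S t = n1 *s a + n2 *s t" using t.span[OF cl(2)] by blast
  have "(- n1 - cnj \<alpha> * m) *s t = 0" using TS[OF t(1)] by (simp add: At St' Sa lin Tt t vec_eq_iff algebra_simps add_eq_0_iff)
  then have n1: "n1 = - cnj \<alpha> * m" using t(2) unfolding vector_mul_eq_0 by (metis diff_eq_eq add.left_neutral minus_equation_iff mult_minus_left)
  have "(cnj m * n1 - \<alpha>) *s a + (cnj m * n2) *s t = 0"
    using SS[OF a(1)] by (simp add: At St' Sa lin Tt a vec_eq_iff algebra_simps)
  from ind[OF this] have mn: "cnj m * n1 = \<alpha>" "m = 0 \<or> n2 = 0" by auto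
  have \<alpha>0: "\<alpha> \<noteq> 0"
  proof
    assume \<alpha>: "\<alpha> = 0"
    then have St: "S t = n2 *s t" using St' n1 by simp
    have "S (S t) = 0" using SS[OF t(1)] by (simp add: At \<alpha> t lin)
    from Seig[OF t(1) this St] show False using no_common t At \<alpha> by auto
  qed
  then have m0: "m \<noteq> 0" using mn(1) by auto
  then have St: "S t = n1 *s a" using mn St' by simp
  have \<alpha>m: "\<alpha> = - cnj \<alpha> * (m * cnj m)" using mn(1) n1 by (simp add: mult_ac)
  \<comment> \<open>Comparing moduli in \<open>\<alpha>m\<close> gives \<open>cmod m = 1\<close>;
    inserting this back makes \<alpha> purely imaginary.\<close>
  then have "cmod \<alpha> = cmod \<alpha> * (cmod m * cmod m)" by (metis norm_mult norm_minus_cancel complex_mod_cnj)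
  then have "(cmod m)\<^sup>2 = 1" using \<alpha>0 by (simp add: power2_eq_square)
  then have m1: "cmod m = 1" using norm_ge_zero[of m] unfolding power2_eq_1_iff by linarith
  then have "m * cnj m = 1" by (rule unit_cnj)
  then have \<alpha>i: "cnj \<alpha> = - \<alpha>" using \<alpha>m by (metis add.inverse_inverse mult.right_neutral mult_minus_left)
  then have "Re \<alpha> = 0" by (simp add: complex_eq_iff)
  define \<eta> where "\<eta> = Im \<alpha>"
  have \<alpha>: "\<alpha> = \<i> * of_real \<eta>" using \<open>Re \<alpha> = 0\<close> by (simp add: complex_eq_iff \<eta>_def)
  have \<eta>0: "\<eta> \<noteq> 0" using \<alpha> \<alpha>0 by auto
  have St: "S t = (\<alpha> * m) *s a" using St n1 \<alpha>i by simp
  \<comment> \<open>A square root of the phase \<open>m\<close>: with it, \<open>S\<close> acts on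
    real multiples of \<open>y *s a\<close> as multiplication to the same multiple of
    \<open>y *s t\<close>, so \<open>S\<close> and \<open>T\<close> can be compared.\<close>
  define y where "y = csqrt m"
  have y2: "y * y = m" using power2_csqrt[of m] by (simp add: y_def power2_eq_square)
  have "cmod y * cmod y = 1" using m1 y2 by (metis norm_mult)
  then have "cmod y = 1" using norm_ge_zero[of y] unfolding power2_eq_square[symmetric] power2_eq_1_iff by linarith
  then have yy: "y * cnj y = 1" by (rule unit_cnj)
  have ym: "cnj y * m = y" using yy y2 by (metis mult.assoc mult.commute mult.right_neutral)
  have y0: "y \<noteq> 0" using yy by auto
  have m0: "m \<noteq> 0" using y2 y0 by auto
  obtain c2 c3 where x0: "Q e1 e1 = c2 *s a + c3 *s t" using t.span[of "Q e1 e1"] cl(2)[of e1] by (auto simp: S_def)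
  define \<xi> where "\<xi> = c3 / y"
  \<comment> \<open>The transversal vector \<open>e1\<close> may be moved by \<open>h\<close> in
    \<open>H\<close>. The coefficient \<open>q\<close> cancels the \<open>a\<close>-component of
    \<open>Q e1 e1\<close>, and \<open>p\<close> the real part of its \<open>t\<close>-component
    relative to \<open>y\<close>; the imaginary part cannot be reached by a real multiple of
    \<open>y\<close>.\<close>
  define p q where "p = y * of_real (- Re \<xi> / 2)" and "q = cnj (- c2 / (\<alpha> * m))"
  define h where "h = p *s a + q *s t"
  have h: "h \<in> H" using H_add H_scale a t by (simp add: h_def)
  have shift: "Q (e1 + h) (e1 + h) = (\<i> * of_real (Im \<xi>) * y) *s t"
  proof -
    have Qhh: "Q h h = 0" using zH h by blast
    have pm: "cnj p * m + p + c3 = \<i> * of_real (Im \<xi>) * y"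
    proof -
      have "cnj p * m = of_real (- Re \<xi> / 2) * (cnj y * m)" by (simp add: p_def)
      also have "\<dots> = of_real (- Re \<xi> / 2) * y" by (simp only: ym)
      finally have 1: "cnj p * m = of_real (- Re \<xi> / 2) * y" .
      have 2: "p = of_real (- Re \<xi> / 2) * y" by (simp add: p_def)
      have 3: "of_real (- Re \<xi> / 2) + of_real (- Re \<xi> / 2) + \<xi> = \<i> * of_real (Im \<xi>)" by (simp add: complex_eq_iff)
      have "c3 = \<xi> * y" using y0 by (simp add: \<xi>_def)
      then have "cnj p * m + p + c3 = (of_real (- Re \<xi> / 2) + of_real (- Re \<xi> / 2) + \<xi>) * y"
        unfolding 1 by (simp only: 2 distrib_right)
      then show ?thesis by (simp only: 3)
    qed
    have qm: "cnj q * (\<alpha> * m) = - c2" using \<alpha>0 m0 by (simp add: q_def)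
    have "Q (e1 + h) (e1 + h) = Q e1 e1 + S h + T h" by (simp add: Qhh S_def T_def add_ac)
    also have "\<dots> = (cnj q * (\<alpha> * m) + c2) *s a + (cnj p * m + p + c3) *s t"
      by (simp add: x0 h_def lin Sa St Tt t vec_eq_iff algebra_simps)
    finally show ?thesis by (simp add: qm pm)
  qed
  \<comment> \<open>Scaling \<open>E1\<close> by \<open>x\<close> normalises \<eta> to its sign,
    which becomes the sign in the structure equations of (Niii).\<close>
  define x where "x = 1 / sqrt \<bar>\<eta>\<bar>"
  have x0': "x > 0" using \<eta>0 by (simp add: x_def)
  have x2: "x * x * \<eta> = sgn \<eta>" using \<eta>0 by (simp add: x_def real_sqrt_mult_self sgn_if field_simps)
  define \<mu> where "\<mu> = x * x * Im \<xi>"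
  \<comment> \<open>\<open>r\<close> rescales \<open>E3\<close> so that the remaining coefficient
    \<mu> of \<open>Q E1 E1\<close> turns into \<rho>; if \<mu> is zero any scale will do.\<close>
  define r where "r = (if \<mu> = 0 then 1 else - \<mu>)"
  define \<rho> :: complex where "\<rho> = (if \<mu> = 0 then 0 else 1)"
  have r: "r \<noteq> 0" and \<mu>r: "of_real \<mu> = - \<rho> * of_real r" by (simp_all add: r_def \<rho>_def)
  \<comment> \<open>\<open>E2\<close> is dictated by the required equation
    \<open>P E1 E3 = - E2\<close>.\<close>
  define E1 E2 E3 where "E1 = of_real x *s (e1 + h)" and "E2 = (- of_real x * of_real r * y * \<alpha>) *s a" and "E3 = (of_real r * y) *s t"
  have EH: "E2 \<in> H" "E3 \<in> H" unfolding E2_def E3_def by (rule H_scale[OF a(1)], rule H_scale[OF t(1)])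
  have on_H: "P E1 v = of_real x *s A v" "Q E1 v = of_real x *s S v" "Q v E1 = of_real x *s T v" if "v \<in> H" for v
    using zH[OF h that] zH[OF that h] by (simp_all add: E1_def A_def S_def T_def)
  have ymr: "cnj y * (\<alpha> * m) = \<alpha> * y" using ym by (simp add: mult_ac)
  have sg: "of_real (sgn \<eta>) = of_real x * of_real x * (of_real \<eta> :: complex)" using x2 by (metis of_real_mult)
  show Niii
  proof (rule niii_of_basis[of E1 E2 E3 "- of_real (sgn \<eta>)" \<rho>])
    fix u v w assume 0: "u *s E1 + v *s E2 + w *s E3 = 0"
    then have "f1 (u *s E1 + v *s E2 + w *s E3) = 0" by (simp add: cs)
    then have u: "u = 0" using EH h x0' f1 by (simp add: cs H_def E1_def)
    have "(v * (- of_real x * of_real r * y * \<alpha>)) *s a + (w * (of_real r * y)) *s t = 0"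
      using 0 unfolding u E2_def E3_def by (simp add: vector_smult_assoc)
    from ind[OF this] show "u = 0 \<and> v = 0 \<and> w = 0" using u x0' r y0 \<alpha>0 by simp
  next
    show "P E1 E2 = 0" by (simp add: on_H EH) (simp add: E2_def lin a)
    show "P E2 E3 = 0" "Q E2 E2 = 0" "Q E2 E3 = 0" "Q E3 E2 = 0" "Q E3 E3 = 0" using zH EH by blast+
    show "Q E3 E1 = 0" by (simp add: on_H EH) (simp add: E3_def lin t)
    show "P E1 E3 = - E2" by (simp add: on_H EH) (simp add: E3_def E2_def lin At vec_eq_iff mult_ac)
    have "Q E1 E3 = (of_real x * of_real r * (cnj y * (\<alpha> * m))) *s a"
      by (simp add: on_H EH) (simp add: E3_def lin St vec_eq_iff mult_ac)
    then show "Q E1 E3 = - E2" unfolding ymr by (simp add: E2_def vec_eq_iff mult_ac)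
    have "Q E1 E2 = (of_real x * of_real x * of_real r * \<alpha> * (cnj y * m)) *s t"
      by (simp add: on_H EH) (simp add: E2_def lin Sa \<alpha>i vec_eq_iff mult_ac)
    then show "Q E1 E2 = - ((- of_real (sgn \<eta>) * \<i>) *s E3)" unfolding ym sg by (simp add: E3_def \<alpha> vec_eq_iff mult_ac)
    show "Q E2 E1 = (- of_real (sgn \<eta>) * \<i>) *s E3"
      unfolding sg by (simp add: on_H EH) (simp add: E2_def E3_def lin Tt \<alpha> vec_eq_iff mult_ac)
    have "Q E1 E1 = (\<i> * of_real \<mu> * y) *s t"
      unfolding E1_def Q_scale shift by (simp add: \<mu>_def vec_eq_iff mult_ac)
    then show "Q E1 E1 = - ((\<i> * \<rho>) *s E3)" unfolding \<mu>r by (simp add: E3_def vec_eq_iff mult_ac)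
    show "\<rho> \<in> {0, 1}" by (simp add: \<rho>_def)
    show "- of_real (sgn \<eta>) \<in> {1, - 1 :: complex}" using \<eta>0 by (simp add: sgn_if)
  qed
qed

theorem classification: "Np \<or> Ni \<or> Nii \<or> Niii"
  using central_case noncentral_case by blast

end

section \<open>Abelian groups and complex tori\<close>

text \<open>The extension at \<open>v\<close> halves \<open>v\<close> until it is small, applies
  \<open>s\<close> and doubles the value as often. Additivity of \<open>s\<close> near 0 makes the
  result independent of the number of halvings.\<close>

lemma hom_extension:
  fixes s :: "'v::real_normed_vector \<Rightarrow> 'g::topological_group_add"
  assumes \<delta>: "\<delta> > 0" and add: "\<And>v w. norm v < \<delta> \<Longrightarrow> norm w < \<delta> \<Longrightarrow> s (v + w) = s v + s w"
    and cont: "continuous_on (ball 0 \<delta>) s"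
  shows "\<exists>E. (\<forall>v w. E (v + w) = E v + E w) \<and> continuous_on UNIV E \<and> (\<forall>v\<in>ball 0 \<delta>. E v = s v)"
proof -
  define D :: "'g \<Rightarrow> 'g" where "D g = g + g" for g
  define F where "F k v = (D ^^ k) (s ((1 / 2 ^ k) *\<^sub>R v))" for k v
  define E where "E v = F (LEAST k. norm v / 2 ^ k < \<delta>) v" for v
  have small: "norm ((1 / 2 ^ k) *\<^sub>R v) < \<delta>" if "norm v / 2 ^ k < \<delta>" for k v using that by simp
  have step: "F (Suc k) v = F k v" if "norm v / 2 ^ k < \<delta>" for k v
  proof -
    have n: "norm ((1 / 2 ^ Suc k) *\<^sub>R v) < \<delta>"
    proof -
      have "norm v / 2 ^ Suc k \<le> norm v / 2 ^ k" by (intro divide_left_mono) auto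
      then show ?thesis using that by simp
    qed
    have "s ((1 / 2 ^ k) *\<^sub>R v) = D (s ((1 / 2 ^ Suc k) *\<^sub>R v))"
      using add[OF n n] by (simp add: D_def flip: scaleR_left_distrib)
    then show ?thesis by (simp add: F_def funpow_swap1)
  qed
  have mono: "norm v / 2 ^ (k + j) < \<delta>" if "norm v / 2 ^ k < \<delta>" for k j v
  proof -
    have "norm v / 2 ^ (k + j) \<le> norm v / 2 ^ k"
      by (intro divide_left_mono) (auto simp: power_add)
    then show ?thesis using that by simp
  qed
  have indep': "F (k + j) v = F k v" if "norm v / 2 ^ k < \<delta>" for k j v
    by (induction j) (use step[OF mono[OF that]] in simp_all)
  have ex: "\<exists>k. c / 2 ^ k < \<delta>" for c
  proof -
    obtain k where "c / \<delta> < 2 ^ k" using real_arch_pow[of 2 "c / \<delta>"] by auto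
    then show ?thesis using \<delta> by (auto simp: field_simps)
  qed
  have EF: "E v = F k v" if "norm v / 2 ^ k < \<delta>" for k v
  proof -
    let ?l = "LEAST k. norm v / 2 ^ k < \<delta>"
    have "?l \<le> k" using that by (rule Least_le)
    moreover have "norm v / 2 ^ ?l < \<delta>" using that by (rule LeastI)
    ultimately show ?thesis using indep'[of v ?l "k - ?l"] by (simp add: E_def)
  qed
  \<comment> \<open>Doubling is additive on commuting elements only. The values of \<open>s\<close>
    commute because addition of vectors does.\<close>
  have Dadd: "(D ^^ k) (g + h) = (D ^^ k) g + (D ^^ k) h" if "g + h = h + g" for k g h
    using that
  proof (induction k arbitrary: g h)
    case (Suc k)
    have D: "D (g + h) = D g + D h"
      unfolding D_def by (metis Suc.prems add.assoc)
    have "D g + D h = D h + D g"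
      unfolding D_def by (metis Suc.prems add.assoc)
    from Suc.IH[OF this] show ?case by (simp add: funpow_swap1[of D, symmetric] D del: funpow.simps(2)) (simp add: funpow_swap1 D)
  qed simp
  have "E (v + w) = E v + E w" for v w
  proof -
    obtain k where k: "(norm v + norm w) / 2 ^ k < \<delta>" using ex by blast
    have b: "norm v / 2 ^ k < \<delta>" "norm w / 2 ^ k < \<delta>" "norm (v + w) / 2 ^ k < \<delta>"
      by (rule le_less_trans[OF divide_right_mono k]; simp add: norm_triangle_ineq)+
    have "s ((1 / 2 ^ k) *\<^sub>R v) + s ((1 / 2 ^ k) *\<^sub>R w) = s ((1 / 2 ^ k) *\<^sub>R w) + s ((1 / 2 ^ k) *\<^sub>R v)"
      using add[OF small[OF b(1)] small[OF b(2)]] add[OF small[OF b(2)] small[OF b(1)]] by (simp add: add.commute)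
    from Dadd[OF this, of k] show ?thesis
      unfolding EF[OF b(1)] EF[OF b(2)] EF[OF b(3)] F_def scaleR_right_distrib
      by (simp only: add[OF small[OF b(1)] small[OF b(2)]])
  qed
  moreover have "continuous_on UNIV E"
  proof -
    have Dc: "continuous_on UNIV (D ^^ k)" for k
    proof (induction k)
      case (Suc k)
      then show ?case unfolding D_def by (auto simp: o_def intro!: continuous_intros)
    qed (simp add: continuous_on_id id_def)
    have "isCont E v" for v
    proof -
      obtain k where k: "norm v / 2 ^ k < \<delta>" using ex by blast
      let ?S = "ball (0 :: 'v) (\<delta> * 2 ^ k)"
      have "continuous_on ?S (\<lambda>v. (D ^^ k) (s ((1 / 2 ^ k) *\<^sub>R v)))"
        by (rule continuous_on_compose2[OF Dc continuous_on_compose2[OF cont]])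
          (auto intro!: continuous_intros simp: field_simps)
      then have "continuous_on ?S (F k)" unfolding F_def[abs_def] .
      moreover have "F k w = E w" if "w \<in> ?S" for w
        using EF[of w k] that by (simp add: field_simps)
      ultimately have "continuous_on ?S E" by (rule continuous_on_eq)
      moreover have "v \<in> ?S" using k by (simp add: field_simps)
      ultimately show ?thesis using continuous_on_eq_continuous_at[OF open_ball] by blast
    qed
    then show ?thesis by (simp add: continuous_on_eq_continuous_at)
  qed
  moreover have "E v = s v" if "v \<in> ball 0 \<delta>" for v
    using EF[of v 0] that by (simp add: F_def)
  ultimately show ?thesis by blast
qed

section \<open>The logarithm of a group with vanishing bracket\<close>

context lie_group_cs
begin

lemma N_bounded_linear: "C \<in> A \<Longrightarrow> x \<in> cdom C \<Longrightarrow> bounded_linear (N C x)"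
  using N_linear linear_conv_bounded_linear by blast

lemma N_continuous: "C \<in> A \<Longrightarrow> continuous_on (cdom C) (\<lambda>x. N C x v)"
  by (rule smooth_on_imp_continuous_on[OF N_smooth])

lemma dN_continuous: "C \<in> A \<Longrightarrow> continuous_on (cdom C) (\<lambda>x. dN C x u v)"
  unfolding dN_def by (rule smooth_on_imp_continuous_on[OF smooth_on_frechet_derivative[OF N_smooth]])

lemma linear_expand: "linear F \<Longrightarrow> F w = (\<Sum>b\<in>Basis. (w \<bullet> b) *\<^sub>R F b)" for F :: "'v::euclidean_space \<Rightarrow> 'w::real_vector"
  by (subst euclidean_representation[of w, symmetric]) (simp only: linear_sum linear_scale)

text \<open>The Poincare lemma on a ball: \<open>N\<close> is closed when the bracket vanishes, and
  \<open>f\<close> integrates it along the rays from \<open>p0\<close>.\<close>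

lemma flat_primitive:
  assumes flat: "\<And>u v. br u v = 0"
  shows "\<exists>r f. r > 0 \<and> ball p0 r \<subseteq> cdom C0 \<and> f p0 = 0 \<and> (\<forall>x\<in>ball p0 r. (f has_derivative N C0 x) (at x))"
proof -
  obtain r where r: "r > 0" "ball p0 r \<subseteq> cdom C0"
    using chart_dom_open[OF C0(1)] p0(1) unfolding open_contains_ball by blast
  define \<tau> where "\<tau> x t = p0 + t *\<^sub>R (x - p0)" for x and t :: real
  have \<tau>: "\<tau> x t \<in> ball p0 r" if "x \<in> ball p0 r" "t \<in> cbox 0 1" for x t
  proof -
    have "\<bar>t\<bar> * norm (x - p0) \<le> 1 * norm (x - p0)" using that(2) by (intro mult_right_mono) auto
    then show ?thesis using that(1) by (simp add: \<tau>_def dist_norm norm_minus_commute)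
  qed
  have \<tau>C: "\<tau> x t \<in> cdom C0" if "x \<in> ball p0 r" "t \<in> cbox 0 1" for x t using \<tau>[OF that] r by blast
  define f where "f x = integral (cbox 0 1) (\<lambda>t. N C0 (\<tau> x t) (x - p0))" for x
  \<comment> \<open>The derivative of the integrand in \<open>x\<close>, by the product rule for
    \<open>N\<close> at a moving point with a moving argument.\<close>
  define f' where "f' x t h = dN C0 (\<tau> x t) (t *\<^sub>R h) (x - p0) + N C0 (\<tau> x t) h" for x t h
  have sym: "dN C0 x u v = dN C0 x v u" if "x \<in> cdom C0" for x u v
    using Maurer_Cartan[OF C0(1) that, of u v] by (simp add: flat)
  have der: "((\<lambda>x. N C0 (\<tau> x t) (x - p0)) has_derivative f' x t) (at x)"
    if "x \<in> ball p0 r" "t \<in> cbox 0 1" for x t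
    unfolding f'_def
    by (rule dN_apply[OF C0(1) open_ball that(1) \<tau>C[OF _ that(2)]])
      (auto simp: \<tau>_def intro!: derivative_eq_intros)
  then have bl: "bounded_linear (f' x t)" if "x \<in> ball p0 r" "t \<in> cbox 0 1" for x t
    using that has_derivative_bounded_linear by blast
  have \<tau>cont: "continuous_on S (\<lambda>z. \<tau> (fst z) (snd z))" for S unfolding \<tau>_def by (intro continuous_intros)
  have cont: "continuous_on (ball p0 r \<times> cbox 0 1) (\<lambda>z. f' (fst z) (snd z) h)" for h
  proof -
    have "f' x t h = (\<Sum>b\<in>Basis. (t * ((x - p0) \<bullet> b)) *\<^sub>R dN C0 (\<tau> x t) h b) + N C0 (\<tau> x t) h"
      if "x \<in> ball p0 r" "t \<in> cbox 0 1" for x t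
    proof -
      have "dN C0 (\<tau> x t) (t *\<^sub>R h) (x - p0) = t *\<^sub>R dN C0 (\<tau> x t) h (x - p0)"
        using linear_scale[OF dN_linear1[OF C0(1) \<tau>C[OF that]]] by simp
      also have "dN C0 (\<tau> x t) h (x - p0) = (\<Sum>b\<in>Basis. ((x - p0) \<bullet> b) *\<^sub>R dN C0 (\<tau> x t) h b)"
        by (rule linear_expand[OF dN_linear2[OF C0(1) \<tau>C[OF that]]])
      finally show ?thesis by (simp add: f'_def scaleR_sum_right)
    qed
    moreover have "continuous_on (ball p0 r \<times> cbox 0 1)
      (\<lambda>z. (\<Sum>b\<in>Basis. (snd z * ((fst z - p0) \<bullet> b)) *\<^sub>R dN C0 (\<tau> (fst z) (snd z)) h b) + N C0 (\<tau> (fst z) (snd z)) h)"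
      by (intro continuous_intros continuous_on_compose2[OF dN_continuous[OF C0(1)] \<tau>cont]
          continuous_on_compose2[OF N_continuous[OF C0(1)] \<tau>cont]) (use \<tau>C in auto)
    ultimately show ?thesis by (elim continuous_on_eq) auto
  qed
  have blf: "blinfun_apply (Blinfun (f' x t)) = f' x t" if "x \<in> ball p0 r" "t \<in> cbox 0 1" for x t
    by (rule bounded_linear_Blinfun_apply[OF bl[OF that]])
  have contB: "continuous_on (ball p0 r \<times> cbox 0 1) (\<lambda>(x, t). Blinfun (f' x t))"
  proof (rule continuous_on_blinfun_componentwise)
    fix i :: "complex^3"
    have "blinfun_apply (case z of (x, t) \<Rightarrow> Blinfun (f' x t)) i = f' (fst z) (snd z) i" if "z \<in> ball p0 r \<times> cbox 0 1" for z
      using that blf by auto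
    then show "continuous_on (ball p0 r \<times> cbox 0 1) (\<lambda>z. blinfun_apply (case z of (x, t) \<Rightarrow> Blinfun (f' x t)) i)"
      using cont[of i] by (elim continuous_on_eq) simp
  qed
  have main: "(f has_derivative N C0 x) (at x)" if x: "x \<in> ball p0 r" for x
  proof -
    have "((\<lambda>x. integral (cbox 0 1) (\<lambda>t. N C0 (\<tau> x t) (x - p0))) has_derivative
        blinfun_apply (integral (cbox 0 1) (\<lambda>t. Blinfun (f' x t)))) (at x within ball p0 r)"
    proof (rule leibniz_rule[OF _ _ contB x convex_ball])
      show "((\<lambda>x. N C0 (\<tau> x t) (x - p0)) has_derivative blinfun_apply (Blinfun (f' x t))) (at x within ball p0 r)"
        if "x \<in> ball p0 r" "t \<in> cbox 0 1" for x t
        unfolding blf[OF that] by (rule has_derivative_at_withinI[OF der[OF that]])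
      show "(\<lambda>t. N C0 (\<tau> x t) (x - p0)) integrable_on cbox 0 1" if "x \<in> ball p0 r" for x
        by (intro integrable_continuous continuous_on_compose2[OF N_continuous[OF C0(1)], where f = "\<tau> x"])
          (use \<tau>C[OF that] in \<open>auto simp: \<tau>_def intro!: continuous_intros\<close>)
    qed
    then have d: "(f has_derivative blinfun_apply (integral (cbox 0 1) (\<lambda>t. Blinfun (f' x t)))) (at x)"
      using x unfolding f_def[abs_def] by (simp add: at_within_open[OF _ open_ball])
    have "blinfun_apply (integral (cbox 0 1) (\<lambda>t. Blinfun (f' x t))) h = N C0 x h" for h
    proof -
      have c1: "continuous_on (cbox 0 1) (\<lambda>t. Blinfun (f' x t))"
proof -
        have "continuous_on (cbox 0 1) (\<lambda>t :: real. (x, t))" by (intro continuous_on_Pair continuous_on_const continuous_on_id)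
        then have "continuous_on (cbox 0 1) (\<lambda>t. (\<lambda>(x, t). Blinfun (f' x t)) (x, t))"
          by (rule continuous_on_compose2[OF contB]) (use x in auto)
        then show ?thesis by simp
      qed
      have "blinfun_apply (integral (cbox 0 1) (\<lambda>t. Blinfun (f' x t))) h
          = integral (cbox 0 1) (\<lambda>t. blinfun_apply (Blinfun (f' x t)) h)"
        by (rule blinfun_apply_integral[OF integrable_continuous[OF c1]])
      also have "\<dots> = integral (cbox 0 1) (\<lambda>t. f' x t h)"
        by (rule integral_cong) (simp add: blf[OF x])
      \<comment> \<open>By closedness the integrand is the \<open>t\<close>-derivative of
        \<open>t *\<^sub>R N C0 (\<tau> x t) h\<close>.\<close>
      also have "\<dots> = 1 *\<^sub>R N C0 (\<tau> x 1) h - 0 *\<^sub>R N C0 (\<tau> x 0) h"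
      proof (rule integral_unique, unfold cbox_interval, rule fundamental_theorem_of_calculus)
        fix t :: real assume t: "t \<in> {0..1}"
        have tc: "\<tau> x t \<in> cdom C0" using \<tau>C[OF x] t by auto
        have "(\<tau> x has_derivative (\<lambda>k. k *\<^sub>R (x - p0))) (at t within {0..1})"
          unfolding \<tau>_def by (auto intro!: derivative_eq_intros)
        from has_derivative_compose[OF this dN_has_derivative[OF C0(1) tc, of h]]
        have "((\<lambda>t. N C0 (\<tau> x t) h) has_derivative (\<lambda>k. dN C0 (\<tau> x t) (k *\<^sub>R (x - p0)) h)) (at t within {0..1})" .
        then have "((\<lambda>t. N C0 (\<tau> x t) h) has_vector_derivative dN C0 (\<tau> x t) (x - p0) h) (at t within {0..1})"
          unfolding has_vector_derivative_def using linear_scale[OF dN_linear1[OF C0(1) tc]] by simp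
        then have "((\<lambda>t. t *\<^sub>R N C0 (\<tau> x t) h) has_vector_derivative t *\<^sub>R dN C0 (\<tau> x t) (x - p0) h + 1 *\<^sub>R N C0 (\<tau> x t) h) (at t within {0..1})"
          by (intro has_vector_derivative_scaleR DERIV_ident)
        moreover have "t *\<^sub>R dN C0 (\<tau> x t) (x - p0) h = dN C0 (\<tau> x t) (t *\<^sub>R h) (x - p0)"
          unfolding linear_scale[OF dN_linear1[OF C0(1) tc]] by (simp only: sym[OF tc, of h])
        ultimately show "((\<lambda>t. t *\<^sub>R N C0 (\<tau> x t) h) has_vector_derivative f' x t h) (at t within {0..1})"
          by (simp add: f'_def)
      qed simp
      finally show ?thesis by (simp add: \<tau>_def)
    qed
    then show ?thesis using d by (metis (no_types, lifting) ext)
  qed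
  have "f p0 = 0" using linear_0[OF N_linear[OF C0(1) p0(1)]] by (simp add: f_def \<tau>_def)
  then show ?thesis using r main by blast
qed

text \<open>\<open>E\<close> is the exponential map as a homomorphism on \<open>complex^3\<close>,
  \<open>g\<close> is its expression in the chart \<open>C0\<close> near 0, and \<open>l\<close> a
  logarithm in chart coordinates. Derivatives are prescribed only at the base points, as
  translations carry them elsewhere.\<close>

definition exp_chart where
  "exp_chart E l W g V \<longleftrightarrow> (\<forall>v w. E (v + w) = E v + E w) \<and> continuous_on UNIV E \<and>
     open W \<and> p0 \<in> W \<and> W \<subseteq> cdom C0 \<and> (\<forall>x\<in>W. E (l x) = cinv C0 x) \<and> l p0 = 0 \<and> continuous_on W l \<and>
     (l has_derivative (\<lambda>v. v)) (at p0) \<and>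
     open V \<and> 0 \<in> V \<and> g 0 = p0 \<and> g ` V \<subseteq> cdom C0 \<and> inj_on g V \<and> (\<forall>v\<in>V. E v = cinv C0 (g v)) \<and>
     (g has_derivative (\<lambda>v. v)) (at 0)"

text \<open>The primitive \<open>f\<close> of \<open>N\<close> is a local isomorphism by the inverse
  function theorem and additive by left invariance of \<open>N\<close>; its inverse is a local
  homomorphism, which extends to all vectors by repeated doubling.\<close>

lemma exp_chart_exists:
  assumes flat: "\<And>u v. br u v = 0"
  shows "\<exists>E l W g V. exp_chart E l W g V"
proof -
  obtain r f where r: "r > 0" "ball p0 r \<subseteq> cdom C0" and f0: "f p0 = 0"
    and f: "\<And>x. x \<in> ball p0 r \<Longrightarrow> (f has_derivative N C0 x) (at x)" using flat_primitive[OF flat] by blast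
  have NB: "blinfun_apply (Blinfun (N C0 x)) = N C0 x" if "x \<in> ball p0 r" for x
    using r that by (intro bounded_linear_Blinfun_apply N_bounded_linear C0) auto
  have p0r: "p0 \<in> ball p0 r" using r by simp
  have Nid: "N C0 p0 = (\<lambda>v. v)" using N_p0 by blast
  have contN: "continuous_on (ball p0 r) (\<lambda>x. Blinfun (N C0 x))"
  proof (rule continuous_on_blinfun_componentwise)
    fix i :: "complex^3"
    have "continuous_on (ball p0 r) (\<lambda>x. N C0 x i)" by (rule continuous_on_subset[OF N_continuous[OF C0(1)] r(2)])
    then show "continuous_on (ball p0 r) (\<lambda>x. blinfun_apply (Blinfun (N C0 x)) i)" by (rule continuous_on_eq) (simp add: NB)
  qed
  have inv: "id_blinfun o\<^sub>L Blinfun (N C0 p0) = id_blinfun"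
    by (rule blinfun_eqI) (simp only: blinfun_apply_blinfun_compose blinfun_apply_id_blinfun NB[OF p0r] N_p0)
  have "(f has_derivative blinfun_apply (Blinfun (N C0 x))) (at x)" if "x \<in> ball p0 r" for x
    using f[OF that] NB[OF that] by simp
  then obtain U V g g' where U: "open U" "U \<subseteq> ball p0 r" "p0 \<in> U" and V: "open V" "f p0 \<in> V" and h: "homeomorphism U V f g"
    and g': "\<And>y. y \<in> V \<Longrightarrow> (g has_derivative (g' y)) (at y)" "\<And>y. y \<in> V \<Longrightarrow> g' y = inv (blinfun_apply (Blinfun (N C0 (g y))))"
    by (rule inverse_function_theorem[OF open_ball _ contN p0r inv]) blast+
  have fg: "f (g v) = v" "g v \<in> U" if "v \<in> V" for v using h that by (auto simp: homeomorphism_def)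
  have gf: "g (f x) = x" "f x \<in> V" if "x \<in> U" for x using h that by (auto simp: homeomorphism_def)
  have fc: "continuous_on U f" and gc: "continuous_on V g" using h by (auto simp: homeomorphism_def)
  have g0: "g 0 = p0" using gf[OF U(3)] f0 by simp
  have UC: "U \<subseteq> cdom C0" using U r by blast
  let ?G = "fst C0 \<inter> snd C0 -` U"
  have oG: "open ?G" by (rule continuous_open_preimage[OF chart_cont[OF C0(1)] chart_open[OF C0(1)] U(1)])
  let ?S = "{(x, y). x \<in> cdom C0 \<and> y \<in> cdom C0 \<and> cinv C0 x + cinv C0 y \<in> ?G}"
  have "open ?S" by (intro open_cinv_preimage2 C0 oG) (auto simp: case_prod_beta intro!: continuous_intros)
  moreover have "(p0, p0) \<in> ?S" using C0 U(3) by (simp flip: p0_def)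
  ultimately obtain A1 A2 where A12: "open A1" "p0 \<in> A1" "open A2" "p0 \<in> A2" "A1 \<times> A2 \<subseteq> ?S"
    by (rule open_prod_elim) blast
  have "open (A1 \<inter> A2 \<inter> U)" "p0 \<in> A1 \<inter> A2 \<inter> U" using A12 U by auto
  then obtain \<epsilon> where \<epsilon>: "\<epsilon> > 0" "ball p0 \<epsilon> \<subseteq> A1 \<inter> A2 \<inter> U" unfolding open_contains_ball by blast
  have mem: "cinv C0 x + cinv C0 y \<in> ?G" if "x \<in> ball p0 \<epsilon>" "y \<in> ball p0 \<epsilon>" for x y
    using that \<epsilon> A12(5) by blast
  \<comment> \<open>As functions of \<open>y\<close>, \<open>f (?t y)\<close> and \<open>f y\<close>
    have the same derivative because \<open>N\<close> is left invariant, so they differ by a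
    constant; the value at \<open>p0\<close> identifies it as \<open>f x\<close>.\<close>
  have add: "f (snd C0 (cinv C0 x + cinv C0 y)) = f x + f y" if x: "x \<in> ball p0 \<epsilon>" and y: "y \<in> ball p0 \<epsilon>" for x y
  proof -
    let ?t = "loc_map C0 C0 ((+) (cinv C0 x))"
    have xC: "x \<in> cdom C0" using x \<epsilon> UC by blast
    have "((\<lambda>y. f (?t y) - f y) has_derivative (\<lambda>v. 0)) (at y within ball p0 \<epsilon>)" if y: "y \<in> ball p0 \<epsilon>" for y
    proof -
      have yd: "y \<in> loc_dom C0 C0 ((+) (cinv C0 x))" using mem[OF x y] y \<epsilon> UC by (auto simp: loc_dom_eq[OF C0(1)])
      have ty: "?t y \<in> ball p0 r" using mem[OF x y] U(2) by (auto simp: loc_map_eq)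
      have "((\<lambda>y. f (?t y)) has_derivative (\<lambda>v. N C0 (?t y) (frechet_derivative ?t (at y) v))) (at y)"
        by (rule has_derivative_compose[OF left_has_derivative[OF C0(1) C0(1) yd] f[OF ty]])
      then have "((\<lambda>y. f (?t y)) has_derivative N C0 y) (at y)"
        by (simp only: N_trans[OF C0(1) C0(1) yd, symmetric])
      moreover have "y \<in> ball p0 r" using y \<epsilon> U(2) by blast
      ultimately have "((\<lambda>y. f (?t y) - f y) has_derivative (\<lambda>v. 0)) (at y)"
        using has_derivative_diff[OF _ f] by fastforce
      then show ?thesis by (rule has_derivative_at_withinI)
    qed
    then have "\<exists>c. \<forall>y\<in>ball p0 \<epsilon>. f (?t y) - f y = c" by (rule has_derivative_zero_constant[OF convex_ball])
    then obtain c where c: "\<And>y. y \<in> ball p0 \<epsilon> \<Longrightarrow> f (?t y) - f y = c" by blast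
    have "f (?t p0) - f p0 = f x" using xC f0 by (simp add: loc_map_eq)
    then have "c = f x" using c[of p0] \<epsilon> by simp
    then show ?thesis using c[OF y] by (simp add: loc_map_eq algebra_simps)
  qed
  have "open (V \<inter> g -` ball p0 \<epsilon>)" by (rule continuous_open_preimage[OF gc V(1) open_ball])
  moreover have "0 \<in> V \<inter> g -` ball p0 \<epsilon>" using V f0 g0 \<epsilon> by simp
  ultimately obtain \<delta> where \<delta>: "\<delta> > 0" "ball 0 \<delta> \<subseteq> V \<inter> g -` ball p0 \<epsilon>" unfolding open_contains_ball by blast
  have gsub: "ball 0 \<delta> \<subseteq> V" "g ` ball 0 \<delta> \<subseteq> cdom C0" using \<delta>(2) fg UC by blast+
  have "\<exists>E. (\<forall>v w. E (v + w) = E v + E w) \<and> continuous_on UNIV E \<and> (\<forall>v\<in>ball 0 \<delta>. E v = cinv C0 (g v))"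
  proof (rule hom_extension[OF \<delta>(1)])
    fix v w :: "complex^3" assume "norm v < \<delta>" "norm w < \<delta>"
    then have vw: "v \<in> V" "w \<in> V" "g v \<in> ball p0 \<epsilon>" "g w \<in> ball p0 \<epsilon>" using \<delta>(2) by auto
    let ?z = "snd C0 (cinv C0 (g v) + cinv C0 (g w))"
    have z: "?z \<in> U" "cinv C0 ?z = cinv C0 (g v) + cinv C0 (g w)" using mem[OF vw(3,4)] by (auto simp: cinv_left[OF C0(1)])
    have "f ?z = v + w" using add[OF vw(3,4)] fg vw by simp
    then have "g (v + w) = ?z" using gf[OF z(1)] by simp
    then show "cinv C0 (g (v + w)) = cinv C0 (g v) + cinv C0 (g w)" using z(2) by simp
  next
    show "continuous_on (ball 0 \<delta>) (\<lambda>v. cinv C0 (g v))"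
      by (rule continuous_on_compose2[OF cinv_cont[OF C0(1)] continuous_on_subset[OF gc]]) (use gsub in blast)+
  qed
  then obtain E where E: "\<forall>v w. E (v + w) = E v + E w" "continuous_on UNIV E" "\<And>v. v \<in> ball 0 \<delta> \<Longrightarrow> E v = cinv C0 (g v)" by blast
  let ?W = "U \<inter> f -` ball 0 \<delta>"
  have "exp_chart E f ?W g (ball 0 \<delta>)"
    unfolding exp_chart_def
  proof (intro conjI)
    show "open ?W" by (rule continuous_open_preimage[OF fc U(1) open_ball])
    show "\<forall>x\<in>?W. E (f x) = cinv C0 x" using E(3) gf by auto
    show "continuous_on ?W f" by (rule continuous_on_subset[OF fc]) auto
    show "(f has_derivative (\<lambda>v. v)) (at p0)" using f[OF p0r] Nid by simp
    show "g ` ball 0 \<delta> \<subseteq> cdom C0" by (rule gsub)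
    show "inj_on g (ball 0 \<delta>)" using \<delta>(2) fg by (metis (no_types, lifting) Int_iff inj_onI subset_iff)
    have "0 \<in> V" using V f0 by simp
    have "g' 0 = inv (N C0 p0)" unfolding g'(2)[OF \<open>0 \<in> V\<close>] g0 NB[OF p0r] ..
    then have "g' 0 = (\<lambda>v. v)" unfolding Nid inv_id[unfolded id_def] .
    then show "(g has_derivative (\<lambda>v. v)) (at 0)" using g'(1)[OF \<open>0 \<in> V\<close>] by simp
  qed (use E UC U f0 \<delta> g0 in auto)
  then show ?thesis by blast
qed

end

section \<open>The quotient as a complex torus\<close>

context nilmanifold
begin

context
  fixes E l W g V assumes ec: "exp_chart E l W g V"
begin

lemma exp_add: "E (v + w) = E v + E w" and exp_cont: "continuous_on UNIV E"
  and W: "open W" "p0 \<in> W" "W \<subseteq> cdom C0" and exp_l: "x \<in> W \<Longrightarrow> E (l x) = cinv C0 x"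
  and l: "l p0 = 0" "continuous_on W l" "(l has_derivative (\<lambda>v. v)) (at p0)"
  and V: "open V" "0 \<in> V" and g: "g 0 = p0" "g ` V \<subseteq> cdom C0" "inj_on g V" "(g has_derivative (\<lambda>v. v)) (at 0)"
  and exp_g: "v \<in> V \<Longrightarrow> E v = cinv C0 (g v)"
  using ec unfolding exp_chart_def by simp_all

lemma exp_0: "E 0 = 0" using exp_add[of 0 0] by (metis add.right_neutral add_left_cancel)

lemma exp_diff: "E (v - w) = E v + - E w"
  using exp_add[of "v - w" w] by (metis add.assoc add.right_inverse add.right_neutral diff_add_cancel)

lemma exp_minus: "E (- v) = - E v" using exp_diff[of 0 v] by (simp add: exp_0)

text \<open>Near \<open>y = E v\<close> a point \<open>h\<close> is the image of \<open>v\<close>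
  plus the logarithm of \<open>- y + h\<close>.\<close>

lemma exp_open:
  assumes S: "open S" shows "open (E ` S)"
proof (subst open_subopen, intro ballI)
  fix y assume "y \<in> E ` S"
  then obtain v where v: "v \<in> S" "y = E v" by blast
  let ?W = "W \<inter> (\<lambda>x. v + l x) -` S"
  have "open ?W" by (intro continuous_open_preimage W S continuous_intros l)
  then have "open (fst C0 \<inter> snd C0 -` ?W)"
    by (rule continuous_open_preimage[OF chart_cont[OF C0(1)] chart_open[OF C0(1)]])
  then have "open ((\<lambda>h. - y + h) -` (fst C0 \<inter> snd C0 -` ?W))"
    by (rule open_vimage) (intro continuous_intros)
  moreover have "y \<in> (\<lambda>h. - y + h) -` (fst C0 \<inter> snd C0 -` ?W)"
    using C0(2) W(2) v l(1) by (simp flip: p0_def)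
  moreover have "(\<lambda>h. - y + h) -` (fst C0 \<inter> snd C0 -` ?W) \<subseteq> E ` S"
  proof
    fix h assume "h \<in> (\<lambda>h. - y + h) -` (fst C0 \<inter> snd C0 -` ?W)"
    then have h: "- y + h \<in> fst C0" "snd C0 (- y + h) \<in> W" "v + l (snd C0 (- y + h)) \<in> S" by auto
    have "E (v + l (snd C0 (- y + h))) = y + (- y + h)"
      unfolding exp_add exp_l[OF h(2)] cinv_left[OF C0(1) h(1)] v(2)[symmetric] ..
    then have "E (v + l (snd C0 (- y + h))) = h" by (simp only: add_minus_cancel)
    then show "h \<in> E ` S" using h(3) by (metis imageI)
  qed
  ultimately show "\<exists>T. open T \<and> y \<in> T \<and> T \<subseteq> E ` S" by blast
qed

text \<open>The range is an open subgroup, hence closed as its complement is a union of translates,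
  and the group is connected.\<close>

lemma exp_surj: "\<exists>v. E v = h"
proof -
  have o: "open (range E)" by (rule exp_open) simp
  have "open (- range E)"
  proof (subst open_subopen, intro ballI)
    fix h assume h: "h \<in> - range E"
    have "open ((\<lambda>k. - h + k) -` range E)" by (rule open_vimage[OF o]) (intro continuous_intros)
    moreover have "h \<in> (\<lambda>k. - h + k) -` range E" using exp_0 by (metis left_minus rangeI vimageI)
    moreover have "(\<lambda>k. - h + k) -` range E \<subseteq> - range E"
    proof
      fix k assume "k \<in> (\<lambda>k. - h + k) -` range E"
      then obtain v where v: "- h + k = E v" by auto
      show "k \<in> - range E"
      proof
        assume "k \<in> range E"
        then obtain w where "k = E w" by blast
        then have "h = E (w - v)" using v by (metis exp_diff add.assoc add_minus_cancel minus_add minus_minus right_minus add.right_neutral)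
        then show False using h by blast
      qed
    qed
    ultimately show "\<exists>T. open T \<and> h \<in> T \<and> T \<subseteq> - range E" by blast
  qed
  then have "closed (range E)" by (simp add: closed_def)
  moreover have "connected (UNIV :: 'g set)" using nilp_cs by (simp add: nilpotent_lie_group_cs_def)
  ultimately have "range E = {} \<or> range E = UNIV" using o unfolding connected_clopen by (auto dest!: spec[of _ "range E"])
  then show ?thesis by (metis empty_iff rangeI surjD)
qed

text \<open>The lattice of the torus: the preimage of \<Gamma> under the exponential
  homomorphism.\<close>

definition lat where "lat = {v. E v \<in> \<Gamma>}"

lemma lat_subgroup: "add_subgroup lat"
  using subgroup by (simp add: add_subgroup_def lat_def exp_0 exp_add exp_minus)

text \<open>\<open>E\<close> is injective near 0 and \<Gamma> meets a neighbourhood of the identity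
  only there; translations carry this to every lattice point.\<close>

lemma lat_discrete: "discrete lat"
  unfolding discrete_def
proof
  fix v assume v: "v \<in> lat"
  have "E v \<in> \<Gamma>" using v by (simp add: lat_def)
  have "0 isolated_in \<Gamma>" using cocompact subgroup by (simp add: cocompact_discrete_def discrete_def add_subgroup_def)
  then obtain T where T: "open T" "T \<inter> \<Gamma> = {0}" unfolding isolated_in_def by blast
  let ?S = "(\<lambda>w. w - v) -` (V \<inter> E -` T)"
  have "open (V \<inter> E -` T)" by (intro open_Int V open_vimage T exp_cont)
  then have "open ?S" by (rule open_vimage) (intro continuous_intros)
  moreover have "?S \<inter> lat = {v}"
  proof (intro equalityI subsetI)
    fix w assume w: "w \<in> ?S \<inter> lat"
    then have "w - v \<in> lat" using v lat_subgroup unfolding add_subgroup_def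
      by (metis IntD2 add_uminus_conv_diff)
    then have "E (w - v) = 0" using w T(2) by (auto simp: lat_def)
    then have "cinv C0 (g (w - v)) = cinv C0 (g 0)" using w V exp_g[of "w - v"] exp_g[of 0] exp_0 by simp
    then have "g (w - v) = g 0" using w g(2) V(2) by (metis (no_types, lifting) IntD1 cinv_right image_subset_iff vimageD)
    then have "w - v = 0" using w V(2) g(3) by (auto dest: inj_onD)
    then show "w \<in> {v}" by simp
  next
    fix w assume "w \<in> {v}"
    then show "w \<in> ?S \<inter> lat" using v V(2) T(2) exp_0 by auto
  qed
  ultimately show "v isolated_in lat" using v unfolding isolated_in_def by blast
qed

lemma coset_lat: "coset lat v = coset lat w \<longleftrightarrow> coset \<Gamma> (E v) = coset \<Gamma> (E w)"
  unfolding coset_eq_iff[OF lat_subgroup] coset_eq_iff[OF subgroup]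
proof
  assume "\<exists>\<gamma>\<in>\<Gamma>. E w = \<gamma> + E v"
  then obtain \<gamma> where "\<gamma> \<in> \<Gamma>" "E w = \<gamma> + E v" by blast
  then have "E (w - v) = \<gamma>" by (simp add: exp_diff add.assoc del: add_uminus_conv_diff)
  then show "\<exists>\<gamma>\<in>lat. w = \<gamma> + v" using \<open>\<gamma> \<in> \<Gamma>\<close> by (intro bexI[of _ "w - v"]) (auto simp: lat_def)
qed (auto simp: lat_def exp_add)

definition \<psi> where "\<psi> c = coset \<Gamma> (E (SOME v. coset lat v = c))"
definition \<phi> where "\<phi> c = coset lat (SOME v. coset \<Gamma> (E v) = c)"

lemma \<psi>: "\<psi> (coset lat v) = coset \<Gamma> (E v)"
proof -
  have "coset lat (SOME w. coset lat w = coset lat v) = coset lat v" by (rule someI) simp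
  then show ?thesis by (simp add: \<psi>_def coset_lat)
qed

lemma \<phi>: "\<phi> (coset \<Gamma> (E v)) = coset lat v"
proof -
  have "coset \<Gamma> (E (SOME w. coset \<Gamma> (E w) = coset \<Gamma> (E v))) = coset \<Gamma> (E v)" by (rule someI) simp
  then show ?thesis by (simp add: \<phi>_def coset_lat)
qed

text \<open>Continuity of \<open>\<psi>\<close> comes from continuity of \<open>E\<close>,
  continuity of \<open>\<phi>\<close> from \<open>E\<close> being open and onto.\<close>

lemma quotients_homeomorphic: "homeomorphic_maps (quot_top \<Gamma>) (quot_top lat) \<phi> \<psi>"
  unfolding homeomorphic_maps_def topspace_quot_top continuous_map openin_quot_top
proof (intro conjI allI impI ballI)
  show "\<phi> ` range (coset \<Gamma>) \<subseteq> range (coset lat)" "\<psi> ` range (coset lat) \<subseteq> range (coset \<Gamma>)"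
    by (auto simp: \<phi>_def \<psi>)
  fix S :: "(complex^3) set set" assume S: "S \<subseteq> range (coset lat) \<and> open (coset lat -` S)"
  show "{x \<in> range (coset \<Gamma>). \<phi> x \<in> S} \<subseteq> range (coset \<Gamma>)" by blast
  have "coset \<Gamma> -` {x \<in> range (coset \<Gamma>). \<phi> x \<in> S} = E ` (coset lat -` S)"
  proof (intro set_eqI iffI)
    fix h assume "h \<in> coset \<Gamma> -` {x \<in> range (coset \<Gamma>). \<phi> x \<in> S}"
    moreover obtain v where "E v = h" using exp_surj by blast
    ultimately show "h \<in> E ` (coset lat -` S)" using \<phi>[of v] by (intro image_eqI[of _ _ v]) auto
  qed (auto simp: \<phi>)
  then show "open (coset \<Gamma> -` {x \<in> range (coset \<Gamma>). \<phi> x \<in> S})" using exp_open S by simp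
next
  fix S :: "'g set set" assume S: "S \<subseteq> range (coset \<Gamma>) \<and> open (coset \<Gamma> -` S)"
  show "{x \<in> range (coset lat). \<psi> x \<in> S} \<subseteq> range (coset lat)" by blast
  have "coset lat -` {x \<in> range (coset lat). \<psi> x \<in> S} = E -` (coset \<Gamma> -` S)" by (auto simp: \<psi>)
  then show "open (coset lat -` {x \<in> range (coset lat). \<psi> x \<in> S})" using open_vimage[OF _ exp_cont] S by simp
next
  fix c assume "c \<in> range (coset \<Gamma>)"
  then show "\<psi> (\<phi> c) = c" using exp_surj by (metis \<phi> \<psi> imageE)
next
  fix c assume "c \<in> range (coset lat)"
  then show "\<phi> (\<psi> c) = c" by (auto simp: \<phi> \<psi>)
qed

lemma lat_cocompact: "cocompact_discrete lat"
  using lat_subgroup lat_discrete cocompact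
    homeomorphic_compact_space[OF homeomorphic_maps_imp_homeomorphic_space[OF quotients_homeomorphic]]
  by (simp add: cocompact_discrete_def)

abbreviation Y where "Y \<equiv> quot_atlas lat {(UNIV, id)}"

definition yrep where "yrep D' V' \<longleftrightarrow>
  open V' \<and> fst D' = coset lat ` V' \<and> (\<forall>u\<in>V'. snd D' (coset lat u) = u \<and> cinv D' u = coset lat u)"

lemma Y_yrep:
  assumes "D' \<in> Y" shows "\<exists>V'. yrep D' V'"
proof -
  obtain V' where V': "open V'" "inj_on (coset lat) V'" and D': "D' = (coset lat ` V', id \<circ> inv_into V' (coset lat))"
    using assms unfolding quot_atlas_def by auto
  have s: "snd D' (coset lat u) = u" if "u \<in> V'" for u using that V'(2) by (simp add: D')
  have "inj_on (snd D') (fst D')" by (rule inj_onI) (auto simp: D' V'(2))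
  then have c: "cinv D' u = coset lat u" if "u \<in> V'" for u
    using that s by (metis D' fst_conv imageI inv_into_f_f)
  then show ?thesis using V' s unfolding yrep_def by (intro exI[of _ V']) (simp add: D')
qed

text \<open>Recentring at the given point writes \<open>\<phi>\<close> locally as a constant plus
  the logarithm of a left translate. Its derivative there is \<open>N\<close>, which is complex
  linear.\<close>

lemma holomorphic_\<phi>: "holomorphic_map X Y \<phi>"
  unfolding holomorphic_map_def holo_on_def
proof (intro ballI)
  fix D D' x assume D: "D \<in> X" and D': "D' \<in> Y" and x: "x \<in> loc_dom D D' \<phi>"
  obtain C Vq where q: "qrep D C Vq" using X_qrep[OF D] by blast
  obtain V' where Y: "yrep D' V'" using Y_yrep[OF D'] by blast
  have V': "open V'" "fst D' = coset lat ` V'" "\<And>u. u \<in> V' \<Longrightarrow> snd D' (coset lat u) = u" using Y unfolding yrep_def by blast+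
  note C = qrep_A[OF q]
  obtain m where m: "m \<in> fst D" "\<phi> m \<in> fst D'" "x = snd D m" using x by (auto simp: loc_dom_def)
  then have xD: "x \<in> cdom D" by blast
  obtain h where h: "h \<in> Vq" "m = coset \<Gamma> h" using m(1) qrep_fst[OF q] by auto
  have "x = snd C h" using m h qrep_snd[OF q h(1)] by simp
  then have ch: "cinv C x = h" using h(1) qrep_sub[OF q] cinv_left[OF C] by auto
  obtain v where v: "v \<in> V'" "\<phi> (coset \<Gamma> h) = coset lat v" using m(2) h V'(2) by auto
  obtain v0 where "E v0 = h" using exp_surj by blast
  then have "coset \<Gamma> (E v0) = coset \<Gamma> (E v)" using v(2) \<phi>[of v0] coset_lat by simp
  then obtain \<gamma> where \<gamma>: "\<gamma> \<in> \<Gamma>" "E v = \<gamma> + h" using \<open>E v0 = h\<close> coset_eq_iff[OF subgroup] by blast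
  \<comment> \<open>\<open>v\<close> is the chosen lift of the image point. The translation by
    \<open>- h\<close> brings the argument to \<open>p0\<close>, where the derivative of
    \<open>l\<close> is the identity.\<close>
  let ?t = "loc_map C C0 ((+) (- cinv C x))" and ?W = "W \<inter> (\<lambda>z. v + l z) -` V'"
  let ?S = "{y \<in> cdom C. - h + cinv C y \<in> fst C0 \<inter> snd C0 -` ?W} \<inter> cdom D"
  have xC: "x \<in> cdom C" by (rule qrep_cdom_sub[OF q xD])
  have "open ?W" by (intro continuous_open_preimage W V' continuous_intros l)
  then have o1: "open (fst C0 \<inter> snd C0 -` ?W)"
    by (rule continuous_open_preimage[OF chart_cont[OF C0(1)] chart_open[OF C0(1)]])
  have oS: "open ?S"
    by (rule open_Int[OF open_cinv_preimage[OF C _ o1] qrep_cdom_open[OF q]]) (intro continuous_intros)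
  have tx: "?t x = p0" by (simp add: loc_map_eq p0_def)
  have "x \<in> ?S" using xC xD C0(2) W(2) l(1) v(1) by (simp add: ch flip: p0_def)
  moreover have "v + l (?t y) = loc_map D D' \<phi> y" if "y \<in> ?S" for y
  proof -
    have y: "- h + cinv C y \<in> fst C0" "?t y \<in> W" "v + l (?t y) \<in> V'" using that by (auto simp: loc_map_eq ch)
    have "E (v + l (?t y)) = \<gamma> + h + (- h + cinv C y)"
      unfolding exp_add exp_l[OF y(2)] \<gamma>(2) by (simp add: loc_map_eq ch cinv_left[OF C0(1) y(1)] del: add_uminus_conv_diff)
    then have "E (v + l (?t y)) = \<gamma> + cinv C y" by (simp only: add.assoc add_minus_cancel)
    then have "coset \<Gamma> (cinv C y) = coset \<Gamma> (E (v + l (?t y)))" using \<gamma>(1) coset_eq_iff[OF subgroup] by blast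
    then show ?thesis using that by (simp add: loc_map_eq[of D] qrep_cinv[OF q] \<phi> V'(3)[OF y(3)])
  qed
  moreover have "((\<lambda>y. v + l (?t y)) has_derivative N C x) (at x)"
  proof -
    have "(l has_derivative (\<lambda>v. v)) (at (?t x))" unfolding tx by (rule l)
    from has_derivative_compose[OF N_has_derivative[OF C xC] this] have "((\<lambda>y. l (?t y)) has_derivative N C x) (at x)" .
    from has_derivative_add[OF has_derivative_const this] show ?thesis by simp
  qed
  ultimately have "(loc_map D D' \<phi> has_derivative N C x) (at x)"
    using has_derivative_transform_within_open[OF _ oS] by blast
  then show "\<exists>D'a. (loc_map D D' \<phi> has_derivative D'a) (at x) \<and> (\<forall>v. D'a (\<i> *s v) = \<i> *s D'a v)"
    using N_clinear[OF C xC] by blast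
qed

text \<open>Here the recentred map is \<open>g\<close> followed by a left translation of the group;
  since \<open>g\<close> has identity derivative at 0, complex linearity is that of the
  translation.\<close>

lemma holomorphic_\<psi>: "holomorphic_map Y X \<psi>"
  unfolding holomorphic_map_def holo_on_def
proof (intro ballI)
  fix D' D x assume D': "D' \<in> Y" and D: "D \<in> X" and x: "x \<in> loc_dom D' D \<psi>"
  obtain C Vq where q: "qrep D C Vq" using X_qrep[OF D] by blast
  obtain V' where Y: "yrep D' V'" using Y_yrep[OF D'] by blast
  have V': "open V'" "fst D' = coset lat ` V'" "\<And>u. u \<in> V' \<Longrightarrow> snd D' (coset lat u) = u"
    "\<And>u. u \<in> V' \<Longrightarrow> cinv D' u = coset lat u" using Y unfolding yrep_def by blast+
  note C = qrep_A[OF q]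
  have "\<exists>m\<in>fst D'. \<psi> m \<in> fst D \<and> x = snd D' m" using x by (auto simp: loc_dom_def)
  then have xV: "x \<in> V'" "\<psi> (coset lat x) \<in> fst D" using V' by auto
  then obtain h where h: "h \<in> Vq" "coset \<Gamma> (E x) = coset \<Gamma> h" using \<psi> qrep_fst[OF q] by auto
  then obtain \<gamma> where \<gamma>: "\<gamma> \<in> \<Gamma>" "h = \<gamma> + E x" using coset_eq_iff[OF subgroup] by blast
  let ?t = "loc_map C0 C ((+) h)"
  let ?S = "V' \<inter> ((\<lambda>y. y - x) -` V \<inter> (\<lambda>y. \<gamma> + E y) -` Vq)"
  have oS: "open ?S"
    by (intro open_Int V' open_vimage V qrep_open[OF q] continuous_intros exp_cont)
  have "x \<in> ?S" using xV V(2) h \<gamma> by simp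
  moreover have "?t (g (y - x)) = loc_map D' D \<psi> y" if "y \<in> ?S" for y
  proof -
    have y: "y \<in> V'" "y - x \<in> V" "\<gamma> + E y \<in> Vq" using that by auto
    have "E y = E x + cinv C0 (g (y - x))" using exp_add[of x "y - x"] exp_g[OF y(2)] by simp
    then have "\<gamma> + E y = h + cinv C0 (g (y - x))" by (simp add: \<gamma>(2) add.assoc)
    moreover have "coset \<Gamma> (E y) = coset \<Gamma> (\<gamma> + E y)" using coset_eq_iff[OF subgroup] \<gamma>(1) by blast
    ultimately show ?thesis using qrep_snd[OF q y(3)] by (simp add: loc_map_eq V'(4)[OF y(1)] \<psi>)
  qed
  moreover have p: "p0 \<in> loc_dom C0 C ((+) h)" using h qrep_sub[OF q] by (auto simp: loc_dom_eq[OF C0(1)])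
  have "((\<lambda>y. ?t (g (y - x))) has_derivative (\<lambda>v. frechet_derivative ?t (at p0) v)) (at x)"
  proof -
    have "((\<lambda>y. y - x) has_derivative (\<lambda>v. v)) (at x)" by (auto intro!: derivative_eq_intros)
    moreover have "(g has_derivative (\<lambda>v. v)) (at (x - x))" using g(4) by simp
    ultimately have "((\<lambda>y. g (y - x)) has_derivative (\<lambda>v. v)) (at x)" by (rule has_derivative_compose)
    moreover have "(?t has_derivative frechet_derivative ?t (at p0)) (at (g (x - x)))"
      using left_has_derivative[OF C0(1) C p] g(1) by simp
    ultimately show ?thesis by (rule has_derivative_compose)
  qed
  ultimately have "(loc_map D' D \<psi> has_derivative frechet_derivative ?t (at p0)) (at x)"
    using has_derivative_transform_within_open[OF _ oS] by blast
  then show "\<exists>D'a. (loc_map D' D \<psi> has_derivative D'a) (at x) \<and> (\<forall>v. D'a (\<i> *s v) = \<i> *s D'a v)"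
    using left_deriv_clinear[OF C0(1) C p] by blast
qed

lemma exp_chart_torus: "complex_torus (quot_top \<Gamma>) X"
  unfolding complex_torus_def biholomorphic_def
  using lat_cocompact quotients_homeomorphic holomorphic_\<phi> holomorphic_\<psi> by blast

end

lemma flat_torus: "(\<And>u v. br u v = 0) \<Longrightarrow> complex_torus (quot_top \<Gamma>) X"
  using exp_chart_torus exp_chart_exists by blast

section \<open>Conclusions for the four families\<close>

text \<open>The abstract classification is instantiated with the derivative of \<open>N\<close> at
  the identity, whose complex linearity in the second argument comes from holomorphic left
  translations.\<close>

lemma family_cases: "family_Np A \<Gamma> \<or> family_Ni A \<Gamma> \<or> family_Nii A \<Gamma> \<or> family_Niii A \<Gamma>"
proof -
  let ?n = "dN C0 p0"
  note lin = dN_linear1[OF C0(1) p0(1)] dN_linear2[OF C0(1) p0(1)]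
  interpret L: lie_cs br ?n
    by unfold_locales
      (rule linear_add[OF lin(1)] linear_scale[OF lin(1)] linear_add[OF lin(2)] dN_clinear[OF C0(1) p0(1)]
        linear_scale[OF lin(2)] br_def Jacobi br_nilpotent)+
  have nil: "L.nilE f \<epsilon> \<rho> x y z w \<longleftrightarrow> nil_eqs f \<epsilon> \<rho> x y z w" for f \<epsilon> \<rho> x y z w
    unfolding L.nilE_def nil_eqs_def ..
  have niii: "L.niiiE f \<rho> s \<longleftrightarrow> niii_eqs f \<rho> s" for f \<rho> s
    unfolding L.niiiE_def niii_eqs_def ..
  have "L.Np \<Longrightarrow> family_Np A \<Gamma>" unfolding L.Np_def L.Ex_def nil family_Np_iff by blast
  moreover have "L.Ni \<Longrightarrow> family_Ni A \<Gamma>" unfolding L.Ni_def L.Ex_def nil family_Ni_iff by blast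
  moreover have "L.Nii \<Longrightarrow> family_Nii A \<Gamma>" unfolding L.Nii_def L.Ex_def nil family_Nii_iff by blast
  moreover have "L.Niii \<Longrightarrow> family_Niii A \<Gamma>" unfolding L.Niii_def niii family_Niii_iff by blast
  ultimately show ?thesis using L.classification by blast
qed

lemma Np_Nii_Niii_sign:
  assumes "\<not> complex_torus (quot_top \<Gamma>) X" "family_Np A \<Gamma> \<or> family_Nii A \<Gamma> \<or> family_Niii A \<Gamma>"
    and \<omega>: "inv_hermitian_metric A \<Gamma> \<omega>"
  shows "pluripositive X \<omega> \<and> \<not> pluriclosed X \<omega>"
  using assms(2)
proof (elim disjE)
  assume "family_Np A \<Gamma>"
  then obtain f e \<rho> where f: "cobasis f e" "nil_eqs f 0 \<rho> 0 0 0 0" "\<rho> = 0 \<or> \<rho> = 1" unfolding family_Np_iff by blast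
  have "\<rho> \<noteq> 0"
  proof
    assume "\<rho> = 0"
    then have "f i (br u v) = 0" for i u v using f(2) exhaust_3[of i] unfolding nil_eqs_def by auto
    then have "br u v = 0" for u v using cobasis_inj[OF f(1)] by blast
    then show False using flat_torus assms(1) by blast
  qed
  then show ?thesis using f nil_sign[OF f(1,2) _ \<omega>] by auto
next
  assume "family_Nii A \<Gamma>"
  then obtain f e \<rho> B c where f: "cobasis f e" "nil_eqs f 1 \<rho> 0 B (of_real c) 0" "(\<rho>, B, c) \<noteq> (0, 0, 0)" unfolding family_Nii_iff by blast
  \<comment> \<open>In (Nii) both \<open>x\<close> and \<open>w\<close> are zero, so the sign number
    is a sum of squares, positive as the coefficients are not all zero.\<close>
  have "(cmod \<rho>)\<^sup>2 + (cmod B)\<^sup>2 + c\<^sup>2 > 0"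
    using f(3) by (auto simp: add_nonneg_eq_0_iff less_le)
  then show ?thesis using nil_sign[OF f(1,2) _ \<omega>] by simp
next
  assume "family_Niii A \<Gamma>"
  then show ?thesis using niii_sign[OF _ _ _ _ \<omega>] unfolding family_Niii_iff by blast
qed

text \<open>\<open>K\<close> equals
  \<open>\<bar>\<rho>\<bar>\<^sup>2 + l\<^sup>2 - 2 * Re D\<close>. It does not involve the metric,
  so its sign selects the same alternative for all metrics.\<close>

lemma Ni_sign:
  assumes "family_Ni A \<Gamma>"
  shows "(\<forall>\<omega>. inv_hermitian_metric A \<Gamma> \<omega> \<longrightarrow> pluriclosed X \<omega>) \<or>
      (\<forall>\<omega>. inv_hermitian_metric A \<Gamma> \<omega> \<longrightarrow> pluripositive X \<omega> \<and> \<not> pluriclosed X \<omega>) \<or>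
      (\<forall>\<omega>. inv_hermitian_metric A \<Gamma> \<omega> \<longrightarrow> plurinegative X \<omega> \<and> \<not> pluriclosed X \<omega>)"
proof -
  obtain f e \<rho> l D where f: "cobasis f e" "nil_eqs f 0 \<rho> 1 (of_real l) 0 D"
    using assms unfolding family_Ni_iff by (elim exE conjE) (rule that)
  define K where "K = (cmod \<rho>)\<^sup>2 + (cmod (of_real l))\<^sup>2 + (cmod 0)\<^sup>2 - 2 * Re (1 * cnj D)"
  have "K \<ge> 0 \<Longrightarrow> pluripositive X \<omega>" "K \<le> 0 \<Longrightarrow> plurinegative X \<omega>" "pluriclosed X \<omega> \<longleftrightarrow> K = 0"
    if "inv_hermitian_metric A \<Gamma> \<omega>" for \<omega>
    using nil_sign[OF f _ that] unfolding K_def by simp_all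
  then show ?thesis by (cases "K = 0"; cases "K > 0") auto
qed

lemma plurisigned_exists:
  assumes "\<not> complex_torus (quot_top \<Gamma>) X" shows "\<exists>\<omega>. hermitian_metric X \<omega> \<and> plurisigned X \<omega>"
proof -
  obtain \<omega> where \<omega>: "inv_hermitian_metric A \<Gamma> \<omega>" using hermitian_metric_exists by blast
  have "pluriclosed X \<omega> \<Longrightarrow> plurisigned X \<omega>" if Ni: "family_Ni A \<Gamma>"
  proof -
    assume "pluriclosed X \<omega>"
    obtain f e \<rho> l D where f: "cobasis f e" "nil_eqs f 0 \<rho> 1 (of_real l) 0 D"
      using Ni unfolding family_Ni_iff by blast
    show "plurisigned X \<omega>"
      using nil_sign[OF f _ \<omega>] unfolding plurisigned_def by (metis le_cases mult_zero_left)
  qed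
  then have "plurisigned X \<omega>"
    using family_cases Np_Nii_Niii_sign[OF assms _ \<omega>] Ni_sign \<omega> unfolding plurisigned_def by blast
  then show ?thesis using \<omega> unfolding inv_hermitian_metric_def by blast
qed

end

theorem theorem4p4:
  fixes A :: "'g::topological_group_add atlas" and \<Gamma> :: "'g set"
  assumes "nilmanifold_cs A \<Gamma>"
    and "\<not> complex_torus (quot_top \<Gamma>) (quot_atlas \<Gamma> A)"
  defines "X \<equiv> quot_atlas \<Gamma> A"
  shows "(\<exists>\<omega>. hermitian_metric X \<omega> \<and> plurisigned X \<omega>) \<and>
    ((family_Np A \<Gamma> \<or> family_Nii A \<Gamma> \<or> family_Niii A \<Gamma>) \<or> family_Ni A \<Gamma>) \<and>
    (family_Np A \<Gamma> \<or> family_Nii A \<Gamma> \<or> family_Niii A \<Gamma> \<longrightarrow>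
      (\<forall>\<omega>. inv_hermitian_metric A \<Gamma> \<omega> \<longrightarrow> pluripositive X \<omega> \<and> \<not> pluriclosed X \<omega>)) \<and>
    (family_Ni A \<Gamma> \<longrightarrow>
      (\<forall>\<omega>. inv_hermitian_metric A \<Gamma> \<omega> \<longrightarrow> pluriclosed X \<omega>) \<or>
      (\<forall>\<omega>. inv_hermitian_metric A \<Gamma> \<omega> \<longrightarrow> pluripositive X \<omega> \<and> \<not> pluriclosed X \<omega>) \<or>
      (\<forall>\<omega>. inv_hermitian_metric A \<Gamma> \<omega> \<longrightarrow> plurinegative X \<omega> \<and> \<not> pluriclosed X \<omega>))"
proof -
  interpret nilmanifold A \<Gamma>
    using assms(1) by unfold_locales (simp_all add: nilmanifold_cs_def)
  show ?thesis
    unfolding X_def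
    using plurisigned_exists[OF assms(2)] family_cases Np_Nii_Niii_sign[OF assms(2)] Ni_sign by blast
qed

end
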